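(* Let $p$ be a prime and $G$ a transitive permutation group of degree $p^2$ whose point stabilizers are dihedral groups $D_{2n}$ of order $2n$ ($n\ge 2$). Then $G$ is isomorphic to one of the following groups (all subgroups of $AGL(2,p)$, $T$ the translation group): (1) $p=2$, $n=3$, $G_1=T\rtimes\langle x,y\rangle\cong S_4$ with $x=\|1,1;1,0\|$, $y=\|0,1;1,0\|$; (2) $p\ge3$, $n\mid(p+1)$, $n\ge3$, $G_2=T\rtimes\langle x,y\rangle$ with $x=\|e,f\theta;f,e\|$ of order $n$, where $e,f\in\mathbb{F}_p$, $e^2-f^2\theta=1$, and $y=\|1,0;0,-1\|$; (3) $p\ge3$, $n\mid(p-1)$, $n\ge3$, $G_3=T\rtimes\langle x,y\rangle$ with $x=\|t,0;0,t^{-1}\|$, $t\in\mathbb{F}_p^*$ of order $n$, and $y=\|0,1;1,0\|$; (4) $p\ge3$, $n=2$, $G_4=T\rtimes\langle x,y\rangle$ with $x=\|-1,0;0,-1\|$, $y=\|1,0;0,-1\|$; (5) $p\ge3$, $n=p$, $G_5=T\rtimes\langle x,y\rangle$ with $x=\|1,1;0,1\|$, $y=\|-1,0;0,1\|$; (6) $p\ge3$, $n=2p$, $G_6=T\rtimes\langle x_1,x_2,y\rangle$ with $x_1=\|1,1;0,1\|$, $x_2=\|-1,0;0,-1\|$, $y=\|1,0;0,-1\|$; (7) $p\ge3$, $n=p$, $G_7=T\rtimes\langle x,y\rangle$ with $x=\|1,1;0,1\|$, $y=\|-1,0;0,-1\|$.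
   Context: $D_{2n}$ denotes the dihedral group of order $2n$ (so $D_4\cong\mathbb{Z}_2^2$). $\mathbb{F}_p^*=\langle\theta\rangle$ (a fixed generator). $\|a,b;c,d\|$ denotes the $2\times2$ matrix over $\mathbb{F}_p$ with rows $(a,b)$ and $(c,d)$. $V=\mathbb{F}_p^2$ consists of row vectors, $GL(2,p)$ acts on $V$ on the right, $t_a$ ($a\in V$) is the translation $v\mapsto v+a$, $T=\{t_a: a\in V\}\cong\mathbb{Z}_p^2$, and $AGL(2,p)=T\rtimes GL(2,p)$ with $g^{-1}t_ag=t_{ag}$. For $L\le GL(2,p)$, $T\rtimes L$ is the subgroup of $AGL(2,p)$ generated by $T$ and $L$, acting on $V$ (degree $p^2$). *)

theory Defs
  imports "HOL-Number_Theory.Number_Theory" "HOL-Algebra.Algebra"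
begin

text \<open>Dihedral group of order 2n: elements (k,b) standing for r^k s^b, k in 0..n-1.\<close>
definition dihedral :: "nat \<Rightarrow> (int \<times> bool) monoid" where
  "dihedral n = \<lparr> carrier = {0..<int n} \<times> (UNIV :: bool set),
     mult = (\<lambda>(k1,b1) (k2,b2). ((k1 + (if b1 then - k2 else k2)) mod int n, b1 \<noteq> b2)),
     one = (0, False) \<rparr>"

text \<open>F_p as {0..p-1}, V = F_p^2 as row vectors.\<close>
definition Vp :: "nat \<Rightarrow> (int \<times> int) set" where
  "Vp p = {0..<int p} \<times> {0..<int p}"

text \<open>Matrix ||a,b;c,d|| as (a,b,c,d), acting on row vectors on the right: (v1,v2) \<mapsto> (v1 a + v2 c, v1 b + v2 d).\<close>
definition mat_act :: "nat \<Rightarrow> int \<times> int \<times> int \<times> int \<Rightarrow> int \<times> int \<Rightarrow> int \<times> int" where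
  "mat_act p M v = (case M of (m11,m12,m21,m22) \<Rightarrow> case v of (v1,v2) \<Rightarrow>
      ((v1*m11 + v2*m21) mod int p, (v1*m12 + v2*m22) mod int p))"

definition transl :: "nat \<Rightarrow> int \<times> int \<Rightarrow> int \<times> int \<Rightarrow> int \<times> int" where
  "transl p a v = ((fst v + fst a) mod int p, (snd v + snd a) mod int p)"

definition permV :: "nat \<Rightarrow> (int \<times> int \<Rightarrow> int \<times> int) \<Rightarrow> (int \<times> int \<Rightarrow> int \<times> int)" where
  "permV p f = restrict f (Vp p)"

text \<open>T \<rtimes> \<langle>gens\<rangle> as the subgroup of Sym(V) generated by all translations and the given matrices.\<close>
definition affine_group :: "nat \<Rightarrow> (int \<times> int \<times> int \<times> int) set \<Rightarrow> (int \<times> int \<Rightarrow> int \<times> int) monoid" where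
  "affine_group p gens = (BijGroup (Vp p))\<lparr> carrier :=
      generate (BijGroup (Vp p)) ((\<lambda>a. permV p (transl p a)) ` Vp p \<union> (\<lambda>M. permV p (mat_act p M)) ` gens) \<rparr>"

text \<open>Order of a matrix as an element of GL(2,p) (faithfully represented in Sym(V)).\<close>
definition mat_ord :: "nat \<Rightarrow> int \<times> int \<times> int \<times> int \<Rightarrow> nat" where
  "mat_ord p M = group.ord (BijGroup (Vp p)) (permV p (mat_act p M))"

definition transitive_on :: "'a set \<Rightarrow> ('a \<Rightarrow> 'a) set \<Rightarrow> bool" where
  "transitive_on \<Omega> G \<longleftrightarrow> (\<forall>x\<in>\<Omega>. \<forall>y\<in>\<Omega>. \<exists>g\<in>G. g x = y)"

definition stabilizer :: "'a set \<Rightarrow> ('a \<Rightarrow> 'a) set \<Rightarrow> 'a \<Rightarrow> ('a \<Rightarrow> 'a) monoid" where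
  "stabilizer \<Omega> G \<omega> = (BijGroup \<Omega>)\<lparr> carrier := {g \<in> G. g \<omega> = \<omega>} \<rparr>"

end

(* Let H = D_{2n} be a point stabilizer, so that H is core-free of index p^2. For p = 2 the order 8n
   divides 24, so G = Sym(4). For odd p the main point is that H has a normal complement W of order p^2.
   If H is maximal, the cyclic parts of distinct point stabilizers meet trivially, and the transfer to such a
   cyclic part, or the sign of an involution, splits off W unless all involutions lie in cyclic parts; then
   counting products of two involutions gives p^2 - 1 = n(n - 1), which is impossible. If H lies in
   a proper intermediate subgroup M,
   the block system of M and the core of M reduce to prime degree. H acts faithfully on W, which forces W to be
   elementary abelian, and the classification becomes linear algebra over F_p: in an eigenbasis of a
   reflection y, the matrix x inverted by y has equal diagonal entries, and its off-diagonal entries b, c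
   are both nonzero (split or nonsplit torus according to whether b/c is a square) or exactly one of them
   vanishes (unipotent up to sign). *)
theory Submission
  imports Defs
begin

section \<open>Finite groups, subgroups and actions\<close>

text \<open>The main obstacle is that p may divide the order of H (n = p or n = 2p). Then W is not a
  Hall subgroup and coprimality does not produce it: a Sylow p-subgroup of G has order p^3, and W
  must be chosen inside it, normalized by H and meeting H trivially. This occurs only when H is not
  maximal. The permutation action enters the structure theory only through core-freeness of H.
  Dihedral groups are replaced by the weaker notion \<open>dihedral_like\<close>, because the
  arguments keep passing to subgroups and quotients, where a dihedral group may degenerate to a
  cyclic one. The isomorphisms in the conclusion are between abstract groups, and this freedom is
  needed. The two matrices of the seventh group commute, so they generate a cyclic group of order
  2p. This group arises from a genuinely dihedral linear part (unipotent x, y = diag(1,-1)) by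
  splitting G over a different normal subgroup of order p^2.\<close>

lemma (in group) inv_cancel1: "\<lbrakk>x \<in> carrier G; y \<in> carrier G\<rbrakk> \<Longrightarrow> inv x \<otimes> (x \<otimes> y) = y"
  by (simp add: m_assoc[symmetric])

lemma (in group) inv_cancel2: "\<lbrakk>x \<in> carrier G; y \<in> carrier G\<rbrakk> \<Longrightarrow> x \<otimes> (inv x \<otimes> y) = y"
  by (simp add: m_assoc[symmetric])

lemma (in group) sub_mem: "\<lbrakk>subgroup H G; x \<in> H\<rbrakk> \<Longrightarrow> x \<in> carrier G"
  by (rule subgroup.mem_carrier)

lemma (in group) sub_one: "subgroup H G \<Longrightarrow> \<one> \<in> H"
  by (rule subgroup.one_closed)

lemma (in group) sub_mult: "\<lbrakk>subgroup H G; x \<in> H; y \<in> H\<rbrakk> \<Longrightarrow> x \<otimes> y \<in> H"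
  by (rule subgroup.m_closed)

lemma (in group) sub_inv: "\<lbrakk>subgroup H G; x \<in> H\<rbrakk> \<Longrightarrow> inv x \<in> H"
  by (rule subgroup.m_inv_closed)

text \<open>Normal form for words: right association, inverses moved onto single letters, and
  adjacent inverse pairs cancelled even when a tail follows. Most identities between conjugates are
  decided by it.\<close>

lemmas (in group) word_simps = m_assoc inv_mult_group inv_cancel1 inv_cancel2

locale fin_group = group +
  assumes fin: "finite (carrier G)"
begin

lemma fin_sub: "subgroup H G \<Longrightarrow> finite H"
  using fin finite_subset subgroup.subset by blast

lemma card_sub_pos: "subgroup H G \<Longrightarrow> card H > 0"
  using fin_sub card_gt_0_iff sub_one by blast

lemma fin_group_sub: "subgroup H G \<Longrightarrow> fin_group (G\<lparr>carrier := H\<rparr>)"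
  unfolding fin_group_def fin_group_axioms_def
  by (auto simp: fin_sub subgroup_imp_group)

text \<open>In a finite group the inverse of \<open>a\<close> is the power with exponent
  \<open>ord a - 1\<close>, so closure under products already gives closure under inverses.\<close>

lemma subgroup_finI:
  assumes "H \<subseteq> carrier G" "\<one> \<in> H" "\<And>x y. \<lbrakk>x \<in> H; y \<in> H\<rbrakk> \<Longrightarrow> x \<otimes> y \<in> H"
  shows "subgroup H G"
proof (rule subgroupI)
  fix a assume a: "a \<in> H"
  have pw: "a [^] (n::nat) \<in> H" for n
    by (induction n) (use assms a in auto)
  have aG: "a \<in> carrier G" using a assms by blast
  have o: "ord a > 0" using ord_ge_1[OF fin aG] by simp
  then have "a [^] (ord a - 1) \<otimes> a = \<one>"
    using pow_ord_eq_1[OF aG] by (metis Suc_pred' nat_pow_Suc)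
  then have "inv a = a [^] (ord a - 1)"
    using aG by (metis inv_equality nat_pow_closed)
  then show "inv a \<in> H" using pw by simp
qed (use assms in auto)

lemma card_dvd: "\<lbrakk>subgroup A G; subgroup B G; A \<subseteq> B\<rbrakk> \<Longrightarrow> card A dvd card B"
proof -
  assume a: "subgroup A G" "subgroup B G" "A \<subseteq> B"
  interpret B: group "G\<lparr>carrier := B\<rparr>" using a(2) subgroup_imp_group by blast
  have "subgroup A (G\<lparr>carrier := B\<rparr>)" using a subgroup_incl by blast
  then show ?thesis using B.lagrange by (metis dvd_triv_right order_def partial_object.select_convs(1) partial_object.surjective partial_object.update_convs(1))
qed

lemma card_dvd_carrier: "subgroup A G \<Longrightarrow> card A dvd card (carrier G)"
  using card_dvd subgroup_self subgroup.subset by blast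

lemma pow_card_sub: "\<lbrakk>subgroup A G; x \<in> A\<rbrakk> \<Longrightarrow> x [^] card A = \<one>"
proof -
  assume a: "subgroup A G" "x \<in> A"
  interpret A: fin_group "G\<lparr>carrier := A\<rparr>" using a(1) fin_group_sub by blast
  have "x [^]\<^bsub>G\<lparr>carrier := A\<rparr>\<^esub> order (G\<lparr>carrier := A\<rparr>) = \<one>\<^bsub>G\<lparr>carrier := A\<rparr>\<^esub>"
    using a(2) by (intro A.pow_order_eq_1) simp
  then show ?thesis by (simp add: order_def nat_pow_consistent[symmetric])
qed

lemma ord_dvd_sub: "\<lbrakk>subgroup A G; x \<in> A\<rbrakk> \<Longrightarrow> ord x dvd card A"
  using pow_card_sub pow_eq_id sub_mem by metis

lemma pow_sub: "\<lbrakk>subgroup A G; x \<in> A\<rbrakk> \<Longrightarrow> x [^] (n::nat) \<in> A"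
  by (induction n) (auto simp: sub_one sub_mult)

lemma pow_coprime_one:
  assumes "x \<in> carrier G" "x [^] (a::nat) = \<one>" "x [^] (b::nat) = \<one>" "coprime a b"
  shows "x = \<one>"
proof -
  have "ord x dvd a" "ord x dvd b" using assms(1-3) pow_eq_id by auto
  then have "ord x = 1" using assms(4) coprime_common_divisor_nat by blast
  then show ?thesis using assms(1) ord_eq_1 by auto
qed

text \<open>Sylow's existence theorem with exponent 1, applied inside \<open>A\<close>: any
  nontrivial element of a subgroup of order p will do.\<close>

lemma cauchy:
  assumes "Factorial_Ring.prime p" "subgroup A G" "p dvd card A"
  obtains x where "x \<in> A" "x \<noteq> \<one>" "x [^] p = \<one>"
proof -
  interpret A: fin_group "G\<lparr>carrier := A\<rparr>" using assms(2) fin_group_sub by blast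
  obtain m where m: "card A = p^1 * m" using assms by auto
  have "\<exists>H. subgroup H (G\<lparr>carrier := A\<rparr>) \<and> card H = p^1"
    by (rule sylow_thm[OF _ A.is_group]) (use assms m A.fin in \<open>auto simp: order_def\<close>)
  then obtain H where H: "subgroup H (G\<lparr>carrier := A\<rparr>)" "card H = p" by auto
  then have HG: "subgroup H G" using assms(2) incl_subgroup by blast
  have "card H > 1" using H(2) prime_gt_1_nat[OF assms(1)] by simp
  then obtain x where "x \<in> H" "x \<noteq> \<one>"
    by (metis One_nat_def card.empty card_Suc_eq card_mono empty_iff fin_sub[OF HG] finite.intros(1) finite_insert insertCI less_one linorder_not_le nat_neq_iff subsetI)
  then show ?thesis using that pow_card_sub[OF HG] H subgroup.subset[OF H(1)] by auto
qed

lemma sylow_sub: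
  assumes "Factorial_Ring.prime p" "p ^ a dvd card (carrier G)"
  obtains P where "subgroup P G" "card P = p ^ a"
proof -
  obtain m where m: "order G = p^a * m" using assms by (auto simp: order_def)
  show ?thesis using sylow_thm[OF assms(1) is_group m fin] that by blast
qed

lemma cyclic_prime_card:
  assumes "Factorial_Ring.prime p" "subgroup A G" "card A = p" "x \<in> A" "x \<noteq> \<one>" "y \<in> A"
  shows "\<exists>k::nat. k < p \<and> y = x [^] k"
proof -
  have xG: "x \<in> carrier G" using assms sub_mem by blast
  have "ord x dvd p" using ord_dvd_sub[OF assms(2,4)] assms(3) by simp
  moreover have "ord x \<noteq> 1" using assms(5) xG ord_eq_1 by simp
  ultimately have o: "ord x = p" using assms(1) by (metis prime_nat_iff)
  have inj: "inj_on (\<lambda>k. x [^] k) {0..ord x - 1}" using ord_inj[OF xG] by simp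
  have e: "{0..ord x - 1} = {..<p}" using o prime_gt_0_nat[OF assms(1)] by auto
  have sub: "(\<lambda>k. x [^] k) ` {..<p} \<subseteq> A" using pow_sub assms by blast
  have "(\<lambda>k. x [^] k) ` {..<p} = A"
    by (rule card_subset_eq[OF fin_sub[OF assms(2)] sub]) (use inj e assms(3) card_image in fastforce)
  then show ?thesis using assms(6) by auto
qed

lemma comm_prime_card:
  assumes "Factorial_Ring.prime p" "subgroup A G" "card A = p" "x \<in> A" "y \<in> A"
  shows "x \<otimes> y = y \<otimes> x"
proof (cases "x = \<one>")
  case False
  then obtain k where "y = x [^] (k::nat)" using cyclic_prime_card assms by blast
  then show ?thesis using sub_mem[OF assms(2,4)] nat_pow_comm[of x 1 k] by simp
qed (use sub_mem[OF assms(2,5)] in simp)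

lemma conj_pow:
  assumes "g \<in> carrier G" "x \<in> carrier G"
  shows "(g \<otimes> x \<otimes> inv g) [^] (n::nat) = g \<otimes> x [^] n \<otimes> inv g"
  by (induction n) (use assms in \<open>auto simp: word_simps\<close>)

lemma conj_one_iff:
  assumes "g \<in> carrier G" "x \<in> carrier G"
  shows "g \<otimes> x \<otimes> inv g = \<one> \<longleftrightarrow> x = \<one>"
proof
  assume a: "g \<otimes> x \<otimes> inv g = \<one>"
  have "x = inv g \<otimes> (g \<otimes> x \<otimes> inv g) \<otimes> g" using assms by (simp add: word_simps)
  then show "x = \<one>" using a assms by simp
qed (use assms in simp)

lemma conj_sub:
  assumes "subgroup H G" "g \<in> carrier G"
  shows "subgroup ((\<lambda>h. g \<otimes> h \<otimes> inv g) ` H) G" "card ((\<lambda>h. g \<otimes> h \<otimes> inv g) ` H) = card H"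
proof -
  have sub: "H \<subseteq> carrier G" using assms subgroup.subset by blast
  show "subgroup ((\<lambda>h. g \<otimes> h \<otimes> inv g) ` H) G"
  proof (rule subgroup_finI)
    show "\<one> \<in> (\<lambda>h. g \<otimes> h \<otimes> inv g) ` H"
      by (rule image_eqI[of _ _ \<one>]) (use assms(2) sub_one[OF assms(1)] in auto)
    fix x y assume "x \<in> (\<lambda>h. g \<otimes> h \<otimes> inv g) ` H" "y \<in> (\<lambda>h. g \<otimes> h \<otimes> inv g) ` H"
    then obtain a b where ab: "a \<in> H" "b \<in> H" "x = g \<otimes> a \<otimes> inv g" "y = g \<otimes> b \<otimes> inv g" by blast
    then have "x \<otimes> y = g \<otimes> (a \<otimes> b) \<otimes> inv g" using sub assms by (simp add: word_simps subset_iff)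
    then show "x \<otimes> y \<in> (\<lambda>h. g \<otimes> h \<otimes> inv g) ` H" using sub_mult[OF assms(1) ab(1,2)] by blast
  qed (use sub assms(2) in auto)
  have "inj_on (\<lambda>h. g \<otimes> h \<otimes> inv g) H"
  proof (intro inj_onI)
    fix x y assume xy: "x \<in> H" "y \<in> H" "g \<otimes> x \<otimes> inv g = g \<otimes> y \<otimes> inv g"
    then have "x \<in> carrier G" "y \<in> carrier G" using sub by auto
    then show "x = y" using xy(3) assms(2) by (metis inv_closed l_cancel m_closed r_cancel)
  qed
  then show "card ((\<lambda>h. g \<otimes> h \<otimes> inv g) ` H) = card H" by (rule card_image)
qed

lemma normalI':
  assumes "subgroup N G" "\<And>g x. \<lbrakk>g \<in> carrier G; x \<in> N\<rbrakk> \<Longrightarrow> g \<otimes> x \<otimes> inv g \<in> N"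
  shows "N \<lhd> G"
  using assms normal_inv_iff by blast

text \<open>The one-sided inclusion g D g^-1 \<subseteq> D suffices to describe a normalizer here:
  inverses are positive powers in a finite group, so closure under products settles the
  matter.\<close>

lemma normalizer_sub:
  assumes "D \<subseteq> carrier G" "finite D"
  shows "subgroup {g \<in> carrier G. \<forall>d\<in>D. g \<otimes> d \<otimes> inv g \<in> D} G"
proof (rule subgroup_finI)
  fix x y assume "x \<in> {g \<in> carrier G. \<forall>d\<in>D. g \<otimes> d \<otimes> inv g \<in> D}" "y \<in> {g \<in> carrier G. \<forall>d\<in>D. g \<otimes> d \<otimes> inv g \<in> D}"
  then have x: "x \<in> carrier G" "\<And>d. d \<in> D \<Longrightarrow> x \<otimes> d \<otimes> inv x \<in> D" and y: "y \<in> carrier G" "\<And>d. d \<in> D \<Longrightarrow> y \<otimes> d \<otimes> inv y \<in> D" by auto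
  have "x \<otimes> y \<otimes> d \<otimes> inv (x \<otimes> y) = x \<otimes> (y \<otimes> d \<otimes> inv y) \<otimes> inv x" if "d \<in> D" for d
    using that assms x(1) y(1) by (simp add: word_simps subset_iff)
  then show "x \<otimes> y \<in> {g \<in> carrier G. \<forall>d\<in>D. g \<otimes> d \<otimes> inv g \<in> D}" using x y by auto
qed (use assms in auto)

lemma centralizer_sub:
  assumes "D \<subseteq> carrier G"
  shows "subgroup {g \<in> carrier G. \<forall>d\<in>D. g \<otimes> d = d \<otimes> g} G"
proof (rule subgroup_finI)
  fix x y assume "x \<in> {g \<in> carrier G. \<forall>d\<in>D. g \<otimes> d = d \<otimes> g}" "y \<in> {g \<in> carrier G. \<forall>d\<in>D. g \<otimes> d = d \<otimes> g}"
  then have x: "x \<in> carrier G" "\<And>d. d \<in> D \<Longrightarrow> x \<otimes> d = d \<otimes> x" and y: "y \<in> carrier G" "\<And>d. d \<in> D \<Longrightarrow> y \<otimes> d = d \<otimes> y" by auto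
  have "x \<otimes> y \<otimes> d = d \<otimes> (x \<otimes> y)" if "d \<in> D" for d
  proof -
    have d: "d \<in> carrier G" using that assms by blast
    show ?thesis using x(1) y(1) d x(2)[OF that] y(2)[OF that] by (metis m_assoc)
  qed
  then show "x \<otimes> y \<in> {g \<in> carrier G. \<forall>d\<in>D. g \<otimes> d = d \<otimes> g}" using x y by auto
qed (use assms in auto)

text \<open>The indices of H in A and of A in M multiply to the prime p, so one of them is 1. In
  this form a subgroup of prime index is used as a maximal one.\<close>

lemma mem_by_index:
  assumes "subgroup H G" "subgroup M G" "H \<subseteq> M" "card M = p * card H" "Factorial_Ring.prime p"
    "subgroup A G" "H \<subseteq> A" "A \<subseteq> M"
  shows "A = H \<or> A = M"
proof -
  obtain k where k: "card A = card H * k" using card_dvd assms by (meson dvdE)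
  obtain l where l: "card M = card A * l" using card_dvd assms by (meson dvdE)
  have "card H * (k * l) = card H * p" using k l assms(4) by (metis mult.assoc mult.commute)
  then have "k * l = p" using card_sub_pos[OF assms(1)] by (metis mult_cancel1 less_irrefl)
  then have "k = 1 \<or> l = 1" using assms(5) prime_product by metis
  then show ?thesis using k l assms card_subset_eq fin_sub by (metis mult.right_neutral)
qed

end

section \<open>Actions of finite groups on finite sets\<close>

locale fin_action = fin_group G for G (structure) +
  fixes E :: "'x set" and act :: "'a \<Rightarrow> 'x \<Rightarrow> 'x"
  assumes finX: "finite E"
    and act_closed: "\<lbrakk>g \<in> carrier G; x \<in> E\<rbrakk> \<Longrightarrow> act g x \<in> E"
    and act_one: "x \<in> E \<Longrightarrow> act \<one> x = x"
    and act_mult: "\<lbrakk>g \<in> carrier G; h \<in> carrier G; x \<in> E\<rbrakk> \<Longrightarrow> act (g \<otimes> h) x = act g (act h x)"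
begin

definition stab :: "'x \<Rightarrow> 'a set" where
  "stab x = {g \<in> carrier G. act g x = x}"

definition orbit :: "'x \<Rightarrow> 'x set" where
  "orbit x = (\<lambda>g. act g x) ` carrier G"

lemma act_inv: "\<lbrakk>g \<in> carrier G; x \<in> E\<rbrakk> \<Longrightarrow> act (inv g) (act g x) = x"
  by (metis act_mult act_one inv_closed l_inv)

lemma act_inv': "\<lbrakk>g \<in> carrier G; x \<in> E\<rbrakk> \<Longrightarrow> act g (act (inv g) x) = x"
  by (metis act_mult act_one inv_closed r_inv)

lemma act_bij: "g \<in> carrier G \<Longrightarrow> bij_betw (act g) E E"
  by (rule bij_betwI[where g = "act (inv g)"]) (auto simp: act_closed act_inv act_inv')

lemma stab_sub: "x \<in> E \<Longrightarrow> subgroup (stab x) G"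
  by (rule subgroup_finI) (auto simp: stab_def act_one act_mult)

lemma stab_conj:
  assumes "x \<in> E" "g \<in> carrier G"
  shows "stab (act g x) = (\<lambda>h. g \<otimes> h \<otimes> inv g) ` stab x"
proof (intro equalityI subsetI)
  fix h assume h: "h \<in> stab (act g x)"
  have "inv g \<otimes> h \<otimes> g \<in> stab x" using h assms by (auto simp: stab_def act_mult act_inv act_closed)
  moreover have "h = g \<otimes> (inv g \<otimes> h \<otimes> g) \<otimes> inv g" using h assms by (simp add: stab_def word_simps)
  ultimately show "h \<in> (\<lambda>h. g \<otimes> h \<otimes> inv g) ` stab x" by blast
qed (use assms in \<open>auto simp: stab_def act_mult act_inv act_closed\<close>)

lemma stab_conj_mem:
  "\<lbrakk>x \<in> E; g \<in> carrier G; h \<in> stab x\<rbrakk> \<Longrightarrow> g \<otimes> h \<otimes> inv g \<in> stab (act g x)"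
  using stab_conj by blast

text \<open>The fibres of g \<mapsto> g x over the orbit are left cosets of the stabilizer, hence
  all of the same size.\<close>

lemma orbit_stab:
  assumes x: "x \<in> E"
  shows "card (orbit x) * card (stab x) = card (carrier G)"
proof -
  have f: "card {g \<in> carrier G. act g x = y} = card (stab x)" if "y \<in> orbit x" for y
  proof -
    from that obtain g0 where g0: "g0 \<in> carrier G" "y = act g0 x" unfolding orbit_def by blast
    have "bij_betw (\<lambda>s. g0 \<otimes> s) (stab x) {g \<in> carrier G. act g x = y}"
      by (rule bij_betwI[where g = "\<lambda>g. inv g0 \<otimes> g"])
        (use g0 x in \<open>auto simp: stab_def act_mult act_inv inv_cancel1 inv_cancel2\<close>)
    then show ?thesis by (metis bij_betw_same_card)
  qed
  have "carrier G = (\<Union>y\<in>orbit x. {g \<in> carrier G. act g x = y})"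
    unfolding orbit_def by blast
  then have "card (carrier G) = card (\<Union>y\<in>orbit x. {g \<in> carrier G. act g x = y})" by simp
  also have "\<dots> = (\<Sum>y\<in>orbit x. card {g \<in> carrier G. act g x = y})"
    by (rule card_UN_disjoint) (use fin in \<open>auto simp: orbit_def\<close>)
  also have "\<dots> = card (orbit x) * card (stab x)" using f by simp
  finally show ?thesis by simp
qed

lemma orbit_self: "x \<in> E \<Longrightarrow> x \<in> orbit x"
  unfolding orbit_def by (metis act_one image_eqI one_closed)

lemma orbit_eq:
  assumes "x \<in> E" "y \<in> orbit x" shows "orbit y = orbit x"
proof -
  obtain g where g: "g \<in> carrier G" "y = act g x" using assms by (auto simp: orbit_def)
  have "act h x \<in> (\<lambda>k. act k y) ` carrier G" if "h \<in> carrier G" for h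
    by (rule image_eqI[of _ _ "h \<otimes> inv g"]) (use that g assms in \<open>auto simp: act_mult act_inv act_closed\<close>)
  moreover have "act h y \<in> (\<lambda>k. act k x) ` carrier G" if "h \<in> carrier G" for h
    by (rule image_eqI[of _ _ "h \<otimes> g"]) (use that g assms in \<open>auto simp: act_mult\<close>)
  ultimately show ?thesis unfolding orbit_def by blast
qed

text \<open>Orbit lengths divide p^k, so an orbit that is not a single point has length divisible by
  p. This congruence drives the Sylow-type conjugacy arguments, the centre argument for groups of
  order p^2, and (with p = 2) the fact that an involution fixes a point of a set of odd
  size.\<close>

lemma p_group_fixed_points:
  assumes "Factorial_Ring.prime p" "card (carrier G) = p ^ k"
  shows "[card E = card {x \<in> E. \<forall>g\<in>carrier G. act g x = x}] (mod p)"
proof -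
  define F where "F = {x \<in> E. \<forall>g\<in>carrier G. act g x = x}"
  have sub: "orbit x \<subseteq> E" if "x \<in> E" for x using that act_closed by (auto simp: orbit_def)
  have U: "\<Union> (orbit ` (E - F)) = E - F"
  proof (intro equalityI subsetI)
    fix y assume "y \<in> \<Union> (orbit ` (E - F))"
    then obtain x where x: "x \<in> E - F" "y \<in> orbit x" by blast
    then have "y \<in> E" using sub by blast
    moreover have "y \<notin> F"
    proof
      assume "y \<in> F"
      then have "orbit y = {y}" by (auto simp: F_def orbit_def)
      moreover have "orbit y = orbit x" using x orbit_eq by blast
      ultimately have "orbit x = {x}" using orbit_self[of x] x by auto
      then show False using x by (auto simp: F_def orbit_def)
    qed
    ultimately show "y \<in> E - F" by simp
  qed (use orbit_self in auto)
  have "p dvd card (\<Union> (orbit ` (E - F)))"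
  proof (rule dvd_partition)
    show "finite (\<Union> (orbit ` (E - F)))" using U finX by simp
    show "\<forall>c\<in>orbit ` (E - F). p dvd card c"
    proof
      fix c assume "c \<in> orbit ` (E - F)"
      then obtain x where x: "x \<in> E - F" "c = orbit x" by blast
      have "card c dvd p ^ k" using orbit_stab[of x] x assms(2) by (metis DiffD1 dvd_triv_left)
      then obtain j where j: "card c = p ^ j" using assms(1) divides_primepow_nat by blast
      have "card c \<noteq> 1"
      proof
        assume "card c = 1"
        then have "orbit x = {x}" using orbit_self[of x] x by (metis DiffD1 card_1_singletonE singletonD)
        then have "x \<in> F" using x by (auto simp: F_def orbit_def)
        then show False using x by simp
      qed
      then show "p dvd card c" using j by (cases j) auto
    qed
    show "\<forall>c1\<in>orbit ` (E - F). \<forall>c2\<in>orbit ` (E - F). c1 \<noteq> c2 \<longrightarrow> c1 \<inter> c2 = {}"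
      using orbit_eq by blast
  qed
  then have "p dvd card (E - F)" using U by simp
  moreover have "card E = card (E - F) + card F"
    using finX by (metis (no_types, lifting) F_def card_Un_disjnt card_Diff_subset finite_subset le_add_diff_inverse2 card_mono mem_Collect_eq subsetI)
  ultimately show ?thesis unfolding F_def[symmetric] cong_def by (metis mod_add_self1 dvd_imp_mod_0 add_0 mod_add_left_eq)
qed

lemma restrict_action:
  assumes "subgroup U G"
  shows "fin_action (G\<lparr>carrier := U\<rparr>) E act"
proof -
  interpret U: fin_group "G\<lparr>carrier := U\<rparr>" using assms fin_group_sub by blast
  show ?thesis
    by unfold_locales (use assms sub_mem[OF assms] in \<open>auto simp: finX act_closed act_one act_mult\<close>)
qed

end

section \<open>Dihedral-like subgroups\<close>

text \<open>\<open>C\<close> is the cyclic part; every element of \<open>H\<close> outside it is a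
  reflection. \<open>H = C\<close> is allowed, so cyclic and trivial groups are covered and the
  notion survives restriction to subgroups and homomorphic images.\<close>

definition dihedral_like :: "('a, 'b) monoid_scheme \<Rightarrow> 'a set \<Rightarrow> 'a set \<Rightarrow> bool" where
  "dihedral_like G H C \<longleftrightarrow> subgroup H G \<and> subgroup C G \<and> C \<subseteq> H \<and>
     (\<exists>c\<in>C. \<forall>x\<in>C. \<exists>k::nat. x = c [^]\<^bsub>G\<^esub> k) \<and>
     (\<forall>h\<in>H - C. h \<otimes>\<^bsub>G\<^esub> h = \<one>\<^bsub>G\<^esub>) \<and>
     (\<forall>h\<in>H - C. \<forall>k\<in>H - C. h \<otimes>\<^bsub>G\<^esub> k \<in> C)"

context fin_group
begin

lemma pow_mod_exp:
  assumes "c \<in> carrier G" "c [^] (m::nat) = \<one>"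
  shows "c [^] (n::nat) = c [^] (n mod m)"
proof -
  have "c [^] n = c [^] (m * (n div m) + n mod m)" by simp
  also have "\<dots> = (c [^] m) [^] (n div m) \<otimes> c [^] (n mod m)"
    using assms(1) by (simp only: nat_pow_mult[symmetric] nat_pow_pow[symmetric])
  finally show ?thesis using assms by simp
qed

text \<open>Division with remainder by the least positive exponent m with c^m in D; the remainder
  vanishes by minimality, so c^m generates D.\<close>

lemma cyclic_sub:
  assumes c: "c \<in> carrier G" and D: "subgroup D G" "\<And>x. x \<in> D \<Longrightarrow> \<exists>k::nat. x = c [^] k"
  shows "\<exists>d\<in>D. \<forall>x\<in>D. \<exists>k::nat. x = d [^] k"
proof -
  define m where "m = (LEAST k. k > 0 \<and> c [^] (k::nat) \<in> D)"
  have "ord c > 0 \<and> c [^] ord c \<in> D"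
    using ord_ge_1[OF fin c] pow_ord_eq_1[OF c] D(1) sub_one by fastforce
  then have m: "m > 0" "c [^] m \<in> D" unfolding m_def by (metis (mono_tags, lifting) LeastI)+
  have least: "\<not> (k > 0 \<and> c [^] k \<in> D)" if "k < m" for k
    using that not_less_Least unfolding m_def by blast
  have "\<exists>k::nat. x = (c [^] m) [^] k" if x: "x \<in> D" for x
  proof -
    obtain i where i: "x = c [^] (i::nat)" using D(2) x by blast
    have e: "x = (c [^] m) [^] (i div m) \<otimes> c [^] (i mod m)"
      using c i by (metis div_mult_mod_eq mult.commute nat_pow_mult nat_pow_pow)
    then have "c [^] (i mod m) = inv ((c [^] m) [^] (i div m)) \<otimes> x"
      using c by (simp add: inv_cancel1)
    also have "\<dots> \<in> D" using m(2) x D(1) by (metis pow_sub sub_mult sub_inv)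
    finally have "i mod m = 0" using least[of "i mod m"] m(1) by auto
    then have "x = (c [^] m) [^] (i div m)" using e c by simp
    then show ?thesis by blast
  qed
  then show ?thesis using m(2) by blast
qed

text \<open>Let c have order m = q m'. Exponents of elements killed by q are multiples of m', and
  for x \<noteq> \<one> the quotient i / m' is invertible modulo q. Multiplying by its inverse turns
  x into any other such element.\<close>

lemma cyclic_unique_subgroup:
  assumes c: "c \<in> carrier G" and q: "Factorial_Ring.prime (q::nat)"
    and x: "x = c [^] (i::nat)" "x [^] q = \<one>" "x \<noteq> \<one>" and y: "y = c [^] (j::nat)" "y [^] q = \<one>"
  shows "\<exists>k::nat. y = x [^] k"
proof -
  define m where "m = ord c"
  have d: "m dvd i * q" "m dvd j * q" "\<not> m dvd i"
    using assms by (auto simp: m_def pow_eq_id nat_pow_pow)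
  have "m > 0" using ord_ge_1[OF fin c] by (simp add: m_def)
  have "q dvd m"
  proof (rule ccontr)
    assume "\<not> q dvd m"
    then have "coprime q m" using q prime_imp_coprime by blast
    then have "coprime m q" by (simp add: coprime_commute)
    then show False using d(1,3) coprime_dvd_mult_left_iff by blast
  qed
  then obtain m' where m': "m = q * m'" by blast
  have q0: "q > 0" using q prime_gt_0_nat by blast
  have "m' > 0" using \<open>m > 0\<close> m' by simp
  have "m' dvd i" "m' dvd j" using d(1,2) m' q0 by (simp_all add: mult.commute)
  then obtain i' j' where ij: "i = m' * i'" "j = m' * j'" unfolding dvd_def by blast
  have "\<not> q dvd i'" using d(3) m' ij by auto
  then have "coprime q i'" using q prime_imp_coprime by blast
  then have "coprime i' q" by (simp add: coprime_commute)
  then obtain k where k: "[i' * k = 1] (mod q)" using cong_solve_coprime_nat[of i' q] by auto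
  have "[i' * k * j' = 1 * j'] (mod q)" by (rule cong_scalar_right[OF k])
  then have "[m' * (i' * k * j') = m' * j'] (mod (m' * q))"
    unfolding cong_def by (metis mult_1 mult_mod_right)
  moreover have "m' * (i' * k * j') = i * (k * j')" "m' * q = m" using ij m' by simp_all
  ultimately have "[i * (k * j') = j] (mod m)" using ij(2) by simp
  then have "c [^] (i * (k * j')) = c [^] j"
    using pow_mod_exp[OF c pow_ord_eq_1[OF c]] unfolding cong_def m_def by metis
  then have "y = x [^] (k * j')" using x(1) y(1) c by (simp add: nat_pow_pow)
  then show ?thesis by blast
qed

context
  fixes H C
  assumes dl: "dihedral_like G H C"
begin

lemma dl_sub: "subgroup H G" "subgroup C G" "C \<subseteq> H"
  using dl by (auto simp: dihedral_like_def)

lemma dl_carrier: "h \<in> H \<Longrightarrow> h \<in> carrier G" "c \<in> C \<Longrightarrow> c \<in> carrier G"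
  using dl_sub sub_mem by blast+

lemma dl_comm: "\<lbrakk>x \<in> C; y \<in> C\<rbrakk> \<Longrightarrow> x \<otimes> y = y \<otimes> x"
  using dl dl_carrier nat_pow_comm unfolding dihedral_like_def by metis

lemma dl_sq: "\<lbrakk>r \<in> H; r \<notin> C\<rbrakk> \<Longrightarrow> r \<otimes> r = \<one>"
  using dl by (auto simp: dihedral_like_def)

lemma dl_inv_self: "\<lbrakk>r \<in> H; r \<notin> C\<rbrakk> \<Longrightarrow> inv r = r"
  using dl_sq dl_carrier inv_equality by metis

lemma dl_coset: "\<lbrakk>r \<in> H; r \<notin> C; c \<in> C\<rbrakk> \<Longrightarrow> r \<otimes> c \<in> H \<and> r \<otimes> c \<notin> C"
proof -
  assume a: "r \<in> H" "r \<notin> C" "c \<in> C"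
  have "r = (r \<otimes> c) \<otimes> inv c" using a dl_carrier by (simp add: word_simps)
  then show ?thesis using a dl_sub by (metis sub_mult sub_inv subsetD)
qed

text \<open>The product \<open>r\<close> \<open>c\<close> lies outside \<open>C\<close> again, so it
  is an involution; expanding its square gives the relation.\<close>

lemma dl_inverts:
  assumes "r \<in> H" "r \<notin> C" "c \<in> C"
  shows "r \<otimes> c \<otimes> inv r = inv c"
proof -
  have "(r \<otimes> c) \<otimes> (r \<otimes> c) = \<one>" using dl_coset[OF assms] dl_sq by blast
  then have "r \<otimes> c \<otimes> r \<otimes> c = \<one>" using assms dl_carrier by (simp add: word_simps)
  then have "r \<otimes> c \<otimes> r = inv c" using assms dl_carrier by (metis inv_equality m_closed)
  then show ?thesis using dl_inv_self assms by simp
qed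

lemma dl_prod: "\<lbrakk>r \<in> H; r \<notin> C; s \<in> H; s \<notin> C\<rbrakk> \<Longrightarrow> r \<otimes> s \<in> C"
  using dl by (auto simp: dihedral_like_def)

lemma dl_card:
  assumes "r \<in> H" "r \<notin> C"
  shows "card (H - C) = card C" "card H = 2 * card C"
proof -
  have "bij_betw (\<lambda>c. r \<otimes> c) C (H - C)"
    by (rule bij_betwI[where g = "\<lambda>h. r \<otimes> h"])
      (use assms dl_coset dl_prod dl_sq dl_carrier in \<open>auto simp: m_assoc[symmetric]\<close>)
  then show 1: "card (H - C) = card C" by (metis bij_betw_same_card)
  show "card H = 2 * card C" using 1 dl_sub fin_sub
    by (metis Diff_partition Diff_disjoint card_Un_disjoint finite_Diff mult_2)
qed

lemma dl_card_le: "card H \<le> 2 * card C"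
  using dl_card dl_sub by (metis le_add1 mult_2 subset_antisym subsetI order_refl)

text \<open>An element of \<open>H\<close> either centralizes \<open>C\<close> or inverts it, and
  both preserve every subgroup of \<open>C\<close>.\<close>

lemma dl_normal:
  assumes "subgroup D G" "D \<subseteq> C" "h \<in> H" "d \<in> D"
  shows "h \<otimes> d \<otimes> inv h \<in> D"
proof (cases "h \<in> C")
  case True
  then have "h \<otimes> d \<otimes> inv h = d" using dl_comm[of h d] assms dl_carrier by (simp add: word_simps subsetD)
  then show ?thesis using assms by simp
next
  case False
  then show ?thesis using dl_inverts[of h d] assms sub_inv by fastforce
qed

lemma dl_prime_order:
  assumes "Factorial_Ring.prime (q::nat)" "x \<in> C" "y \<in> C" "x [^] q = \<one>" "y [^] q = \<one>" "x \<noteq> \<one>"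
  shows "\<exists>k::nat. y = x [^] k"
proof -
  obtain c where c: "c \<in> C" "\<forall>x\<in>C. \<exists>k::nat. x = c [^] k" using dl by (auto simp: dihedral_like_def)
  obtain i j where "x = c [^] (i::nat)" "y = c [^] (j::nat)" using c assms by meson
  then show ?thesis using cyclic_unique_subgroup[of c q x i y j] assms c dl_carrier by blast
qed

lemma dl_unique_involution:
  assumes "x \<in> C" "y \<in> C" "x \<otimes> x = \<one>" "y \<otimes> y = \<one>" "x \<noteq> \<one>" "y \<noteq> \<one>"
  shows "x = y"
proof -
  have xG: "x \<in> carrier G" "y \<in> carrier G" using assms dl_carrier by auto
  have sq: "x [^] (2::nat) = \<one>" "y [^] (2::nat) = \<one>" using assms xG by (auto simp: numeral_2_eq_2)
  obtain k where k: "y = x [^] (k::nat)" using dl_prime_order[OF two_is_prime_nat assms(1,2) sq assms(5)] by blast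
  have "y = x [^] (k mod 2)"
    using xG k sq by (metis div_mult_mod_eq l_one mult.commute nat_pow_closed nat_pow_mult nat_pow_one nat_pow_pow)
  then show ?thesis using assms(6) xG by (cases "k mod 2 = 0") (auto simp: not_mod_2_eq_0_eq_1)
qed

lemma dl_restrict:
  assumes K: "subgroup K G"
  shows "dihedral_like (G\<lparr>carrier := K\<rparr>) (H \<inter> K) (C \<inter> K)"
proof -
  obtain c where c: "c \<in> C" "\<forall>x\<in>C. \<exists>k::nat. x = c [^] k" using dl by (auto simp: dihedral_like_def)
  have "subgroup (H \<inter> K) G" "subgroup (C \<inter> K) G" using K dl_sub subgroups_Inter_pair by blast+
  moreover from this have "\<exists>d\<in>C \<inter> K. \<forall>x\<in>C \<inter> K. \<exists>k::nat. x = d [^] k"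
    using cyclic_sub[of c "C \<inter> K"] c dl_carrier by blast
  ultimately show ?thesis
    using K dl_sub dl_sq dl_prod unfolding dihedral_like_def
    by (auto simp: nat_pow_consistent[symmetric] subgroup_incl sub_mult)
qed

end

lemma dl_hom:
  assumes dl: "dihedral_like G H C" and h: "group_hom G K h"
  shows "dihedral_like K (h ` H) (h ` C)"
proof -
  interpret h: group_hom G K h by fact
  obtain c where c: "c \<in> C" "\<forall>x\<in>C. \<exists>k::nat. x = c [^] k" using dl by (auto simp: dihedral_like_def)
  have cG: "c \<in> carrier G" using c dl_carrier[OF dl] by blast
  show ?thesis unfolding dihedral_like_def
  proof (intro conjI)
    show "subgroup (h ` H) K" "subgroup (h ` C) K"
      using h.subgroup_img_is_subgroup dl_sub[OF dl] by blast+
    show "h ` C \<subseteq> h ` H" using dl_sub[OF dl] by blast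
    show "\<exists>c\<in>h ` C. \<forall>x\<in>h ` C. \<exists>k::nat. x = c [^]\<^bsub>K\<^esub> k"
    proof (intro bexI[of _ "h c"] ballI)
      fix x assume "x \<in> h ` C"
      then obtain y where y: "y \<in> C" "x = h y" by blast
      then obtain k where "y = c [^] (k::nat)" using c by blast
      then have "x = h c [^]\<^bsub>K\<^esub> k" using y cG by (simp add: h.hom_nat_pow)
      then show "\<exists>k::nat. x = h c [^]\<^bsub>K\<^esub> k" by blast
    qed (use c in blast)
    show "\<forall>x\<in>h ` H - h ` C. x \<otimes>\<^bsub>K\<^esub> x = \<one>\<^bsub>K\<^esub>"
    proof
      fix x assume "x \<in> h ` H - h ` C"
      then obtain y where y: "y \<in> H" "y \<notin> C" "x = h y" by blast
      then show "x \<otimes>\<^bsub>K\<^esub> x = \<one>\<^bsub>K\<^esub>" using dl_sq[OF dl] dl_carrier[OF dl] by (metis h.hom_mult h.hom_one)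
    qed
    show "\<forall>x\<in>h ` H - h ` C. \<forall>y\<in>h ` H - h ` C. x \<otimes>\<^bsub>K\<^esub> y \<in> h ` C"
    proof (intro ballI)
      fix x y assume "x \<in> h ` H - h ` C" "y \<in> h ` H - h ` C"
      then obtain u v where "u \<in> H" "u \<notin> C" "x = h u" "v \<in> H" "v \<notin> C" "y = h v" by blast
      then show "x \<otimes>\<^bsub>K\<^esub> y \<in> h ` C"
        using dl_prod[OF dl] dl_carrier[OF dl] by (metis h.hom_mult image_eqI)
    qed
  qed
qed

subsection \<open>Actions on cosets and Sylow-type consequences\<close>

text \<open>Multiplying right cosets on the right by the inverse gives a left action, as
  \<open>fin_action\<close> demands. The stabilizer of Hx is the conjugate x^-1 H x.\<close>

lemma rcosets_action:
  assumes H: "subgroup H G"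
  shows "fin_action G (rcosets H) (\<lambda>g S. S #> inv g)"
proof
  have HG: "H \<subseteq> carrier G" using H subgroup.subset by blast
  have S: "S \<subseteq> carrier G" if "S \<in> rcosets H" for S using that H subgroup.rcosets_carrier is_group by blast
  show "finite (rcosets H)" using fin by (auto simp: RCOSETS_def)
  show "S #> inv g \<in> rcosets H" if "g \<in> carrier G" "S \<in> rcosets H" for g S
    using that HG by (auto simp: RCOSETS_def coset_mult_assoc)
  show "S #> inv \<one> = S" if "S \<in> rcosets H" for S using S[OF that] by simp
  show "S #> inv (g \<otimes> h) = S #> inv h #> inv g" if "g \<in> carrier G" "h \<in> carrier G" "S \<in> rcosets H" for g h S
    using that S[OF that(3)] by (simp add: inv_mult_group coset_mult_assoc)
qed

lemma rcoset_fixed_iff: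
  assumes H: "subgroup H G" and "x \<in> carrier G" "g \<in> carrier G"
  shows "H #> x #> inv g = H #> x \<longleftrightarrow> x \<otimes> g \<otimes> inv x \<in> H"
proof -
  have HG: "H \<subseteq> carrier G" using H subgroup.subset by blast
  have "H #> x #> inv g = H #> x \<longleftrightarrow> H #> (x \<otimes> inv g) = H #> x" using assms HG by (simp add: coset_mult_assoc)
  also have "\<dots> \<longleftrightarrow> x \<in> H #> (x \<otimes> inv g)"
    using assms HG by (metis inv_closed m_closed rcos_self repr_independence)
  also have "\<dots> \<longleftrightarrow> x \<otimes> inv (x \<otimes> inv g) \<in> H"
    using assms subgroup.rcos_module[OF H is_group, of "x \<otimes> inv g" x] by auto
  finally show ?thesis using assms by (simp add: word_simps)
qed

lemma rcosets_transitive: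
  assumes H: "subgroup H G" and "S \<in> rcosets H" "T \<in> rcosets H"
  shows "\<exists>g\<in>carrier G. S #> inv g = T"
proof -
  have HG: "H \<subseteq> carrier G" using H subgroup.subset by blast
  obtain x y where xy: "x \<in> carrier G" "S = H #> x" "y \<in> carrier G" "T = H #> y"
    using assms by (auto simp: RCOSETS_def)
  have "S #> inv (inv y \<otimes> x) = T" using xy HG by (simp add: word_simps coset_mult_assoc)
  then show ?thesis using xy by blast
qed

lemma card_rcosets:
  assumes "subgroup H G" "card (carrier G) = m * card H"
  shows "card (rcosets H) = m"
  using lagrange[OF assms(1)] assms card_sub_pos[OF assms(1)] by (simp add: order_def)

text \<open>The number of cosets of \<open>M\<close> is prime to p, so the p-group \<open>U\<close>
  fixes one of them. With \<open>M\<close> a Sylow subgroup this is the conjugacy part of Sylow's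
  theorem; with \<open>M\<close> of index prime to p it moves p-subgroups into
  \<open>M\<close>.\<close>

lemma p_subgroup_fixes_coset:
  assumes p: "Factorial_Ring.prime p" and U: "subgroup U G" "card U = p ^ k"
    and M: "subgroup M G" "card (carrier G) = m * card M" "\<not> p dvd m"
  obtains x where "x \<in> carrier G" "\<And>u. u \<in> U \<Longrightarrow> x \<otimes> u \<otimes> inv x \<in> M"
proof -
  interpret A: fin_action G "rcosets M" "\<lambda>g S. S #> inv g" by (rule rcosets_action[OF M(1)])
  interpret B: fin_action "G\<lparr>carrier := U\<rparr>" "rcosets M" "\<lambda>g S. S #> inv g" by (rule A.restrict_action[OF U(1)])
  have "[card (rcosets M) = card {S \<in> rcosets M. \<forall>g\<in>U. S #> inv g = S}] (mod p)"
    using B.p_group_fixed_points[OF p, of k] U by simp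
  then have "card {S \<in> rcosets M. \<forall>g\<in>U. S #> inv g = S} \<noteq> 0"
    using card_rcosets[OF M(1,2)] M(3) by (metis cong_def dvd_eq_mod_eq_0 mod_0)
  then have "{S \<in> rcosets M. \<forall>g\<in>U. S #> inv g = S} \<noteq> {}" by (metis card.empty)
  then obtain S where S: "S \<in> rcosets M" "\<forall>g\<in>U. S #> inv g = S" by blast
  then obtain x where x: "x \<in> carrier G" "S = M #> x" by (auto simp: RCOSETS_def)
  have "x \<otimes> u \<otimes> inv x \<in> M" if "u \<in> U" for u
    using rcoset_fixed_iff[OF M(1) x(1) sub_mem[OF U(1) that]] S(2) that x(2) by blast
  then show ?thesis using that[OF x(1)] by blast
qed

text \<open>\<open>U\<close> fixes the coset \<open>M\<close> itself, and the number of fixed cosets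
  is divisible by p. Being positive and at most p, it equals p: \<open>U\<close> fixes every coset
  and lies in the core of \<open>M\<close>.\<close>

lemma p_subgroup_in_core:
  assumes p: "Factorial_Ring.prime p" and U: "subgroup U G" "card U = p ^ k"
    and M: "subgroup M G" "card (carrier G) = p * card M" and UM: "U \<subseteq> M"
    and "x \<in> carrier G" "u \<in> U"
  shows "x \<otimes> u \<otimes> inv x \<in> M"
proof -
  interpret A: fin_action G "rcosets M" "\<lambda>g S. S #> inv g" by (rule rcosets_action[OF M(1)])
  interpret B: fin_action "G\<lparr>carrier := U\<rparr>" "rcosets M" "\<lambda>g S. S #> inv g" by (rule A.restrict_action[OF U(1)])
  define F where "F = {S \<in> rcosets M. \<forall>g\<in>U. S #> inv g = S}"
  have "[card (rcosets M) = card F] (mod p)"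
    using B.p_group_fixed_points[OF p, of k] U by (simp add: F_def)
  then have "p dvd card F" using card_rcosets[OF M(1,2)] by (simp add: cong_def dvd_eq_mod_eq_0)
  moreover have "M #> \<one> #> inv g = M #> \<one>" if "g \<in> U" for g
    using that UM U M sub_mem[OF U(1)] rcoset_fixed_iff[OF M(1) one_closed, of g] by auto
  then have "M #> \<one> \<in> F" using M by (auto simp: F_def intro!: rcosetsI subgroup.subset)
  then have "card F > 0" using A.finX by (auto simp: F_def card_gt_0_iff)
  ultimately have "card F \<ge> card (rcosets M)" using card_rcosets[OF M(1,2)] by (simp add: dvd_imp_le)
  then have "F = rcosets M" using A.finX by (metis (no_types, lifting) F_def card_seteq mem_Collect_eq subsetI)
  moreover have "M #> x \<in> rcosets M" using assms M by (intro rcosetsI subgroup.subset) auto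
  ultimately have "M #> x #> inv u = M #> x" using assms by (auto simp: F_def)
  then show ?thesis using rcoset_fixed_iff[OF M(1)] assms sub_mem by metis
qed

lemma p_element_subgroup:
  assumes "Factorial_Ring.prime p" "x \<in> carrier G" "x [^] (p ^ j) = \<one>"
  obtains k where "subgroup (generate G {x}) G" "card (generate G {x}) = p ^ k" "x \<in> generate G {x}"
proof -
  have "ord x dvd p ^ j" using assms pow_eq_id by simp
  then obtain k where "ord x = p ^ k" using assms divides_primepow_nat by blast
  then show ?thesis using that assms generate_pow_card generate_is_subgroup
    by (metis empty_subsetI generate.incl insert_subset singletonI)
qed

lemma p_element_in_core:
  assumes p: "Factorial_Ring.prime p" and M: "subgroup M G" "card (carrier G) = p * card M"
    and "u \<in> M" "u [^] (p ^ j) = \<one>" "x \<in> carrier G"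
  shows "x \<otimes> u \<otimes> inv x \<in> M"
proof -
  have "u \<in> carrier G" using assms sub_mem by blast
  then obtain k where "subgroup (generate G {u}) G" "card (generate G {u}) = p ^ k" "u \<in> generate G {u}"
    using p_element_subgroup assms by blast
  moreover have "generate G {u} \<subseteq> M" using assms generate_subgroup_incl by blast
  ultimately show ?thesis using p_subgroup_in_core assms by blast
qed

text \<open>Class equation argument: the centre has order at least p, and the centralizer of a
  noncentral \<open>x\<close> is strictly larger than the centre, so it is all of \<open>W\<close>,
  a contradiction.\<close>

lemma comm_prime_square_card:
  assumes p: "Factorial_Ring.prime p" and W: "subgroup W G" "card W = p\<^sup>2" and xy: "x \<in> W" "y \<in> W"
  shows "x \<otimes> y = y \<otimes> x"
proof (rule ccontr)
  assume nc: "x \<otimes> y \<noteq> y \<otimes> x"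
  interpret W: fin_group "G\<lparr>carrier := W\<rparr>" using W fin_group_sub by blast
  interpret A: fin_action "G\<lparr>carrier := W\<rparr>" W "\<lambda>g x. g \<otimes> x \<otimes> inv g"
    by unfold_locales
      (use W fin_sub sub_mem[OF W(1)] in \<open>auto simp: word_simps sub_mult sub_inv\<close>)
  have WG: "w \<in> W \<Longrightarrow> w \<in> carrier G" for w using W sub_mem by blast
  define Z where "Z = {z \<in> W. \<forall>g\<in>W. g \<otimes> z \<otimes> inv g = z}"
  have comm_iff: "g \<otimes> z \<otimes> inv g = z \<longleftrightarrow> g \<otimes> z = z \<otimes> g" if "g \<in> W" "z \<in> W" for g z
    using that WG by (metis inv_closed inv_solve_right m_closed)
  have "[card W = card Z] (mod p)"
    using A.p_group_fixed_points[OF p, of 2] W by (simp add: Z_def)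
  moreover have "p dvd card W" using W(2) by simp
  ultimately have "p dvd card Z" using cong_dvd_iff by blast
  have "\<one> \<in> Z" using W WG sub_one by (auto simp: Z_def)
  then have Z0: "card Z > 0" using W fin_sub by (auto simp: Z_def card_gt_0_iff)
  define C where "C = W \<inter> {g \<in> carrier G. \<forall>d\<in>{x}. g \<otimes> d = d \<otimes> g}"
  have C: "subgroup C G" unfolding C_def
    by (intro subgroups_Inter_pair W centralizer_sub) (use WG xy in auto)
  have ZC: "Z \<subseteq> C"
    using xy WG comm_iff by (auto simp: Z_def C_def)
  have "x \<in> C" "x \<notin> Z" using xy nc WG comm_iff[of y x] by (auto simp: C_def Z_def)
  then have "card Z < card C" using ZC C fin_sub by (metis psubsetI psubset_card_mono)
  have "card C dvd p\<^sup>2" using card_dvd[OF C W(1)] W by (auto simp: C_def)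
  then obtain k where k: "k \<le> 2" "card C = p ^ k" using p divides_primepow_nat by blast
  have "p \<le> card Z" using \<open>p dvd card Z\<close> Z0 by (simp add: dvd_imp_le)
  then have "p ^ 1 < p ^ k" using \<open>card Z < card C\<close> k by simp
  then have "k > 1" using prime_gt_1_nat[OF p] power_less_imp_less_exp by blast
  then have "k = 2" using k(1) by simp
  then have "card C = card W" using k W by simp
  then have "C = W" by (intro card_subset_eq[OF fin_sub[OF W(1)]]) (simp_all add: C_def)
  then have "y \<in> C" using xy by blast
  then show False using nc by (simp add: C_def)
qed

end

section \<open>Transfer\<close>

context fin_action
begin

text \<open>The transfer, written for a transitive action with base point e0: \<open>r x\<close>
  carries e0 to x and replaces a coset representative. The factor at x for a product gh splits as
  the factor of g at hx times the factor of h at x.\<close>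

lemma transfer_hom:
  assumes A: "comm_group A" and e0: "e0 \<in> E"
    and f: "f \<in> hom (G\<lparr>carrier := stab e0\<rparr>) A"
    and r: "\<And>x. x \<in> E \<Longrightarrow> r x \<in> carrier G \<and> act (r x) e0 = x"
  shows "(\<lambda>g. finprod A (\<lambda>x. f (inv (r (act g x)) \<otimes> g \<otimes> r x)) E) \<in> hom G A"
proof -
  interpret A: comm_group A by fact
  have st: "inv (r (act g x)) \<otimes> g \<otimes> r x \<in> stab e0" if "g \<in> carrier G" "x \<in> E" for g x
  proof -
    have "act (inv (r (act g x))) (act g x) = e0"
      using r[OF act_closed[OF that]] e0 act_inv[of "r (act g x)" e0] by simp
    then show ?thesis
      using that r[OF that(2)] r[OF act_closed[OF that]] e0 by (simp add: stab_def act_mult act_closed)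
  qed
  have fc: "f h \<in> carrier A" if "h \<in> stab e0" for h using f that by (auto simp: hom_def)
  show ?thesis
  proof (rule homI)
    show "finprod A (\<lambda>x. f (inv (r (act g x)) \<otimes> g \<otimes> r x)) E \<in> carrier A" if "g \<in> carrier G" for g
      using st fc that by (intro A.finprod_closed) auto
    fix g h assume g: "g \<in> carrier G" and h: "h \<in> carrier G"
    have spl: "f (inv (r (act (g \<otimes> h) x)) \<otimes> (g \<otimes> h) \<otimes> r x) =
        f (inv (r (act g (act h x))) \<otimes> g \<otimes> r (act h x)) \<otimes>\<^bsub>A\<^esub> f (inv (r (act h x)) \<otimes> h \<otimes> r x)" if x: "x \<in> E" for x
    proof -
      have hx: "act h x \<in> E" "act g (act h x) \<in> E" using act_closed g h x by auto
      have "inv (r (act (g \<otimes> h) x)) \<otimes> (g \<otimes> h) \<otimes> r x =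
        (inv (r (act g (act h x))) \<otimes> g \<otimes> r (act h x)) \<otimes> (inv (r (act h x)) \<otimes> h \<otimes> r x)"
        using g h x r[OF hx(1)] r[OF hx(2)] r[OF x] by (simp add: word_simps act_mult)
      then show ?thesis using f st[OF h x] st[OF g hx(1)] by (auto simp: hom_def)
    qed
    have "finprod A (\<lambda>x. f (inv (r (act (g \<otimes> h) x)) \<otimes> (g \<otimes> h) \<otimes> r x)) E =
      finprod A (\<lambda>x. f (inv (r (act g (act h x))) \<otimes> g \<otimes> r (act h x)) \<otimes>\<^bsub>A\<^esub> f (inv (r (act h x)) \<otimes> h \<otimes> r x)) E"
      by (rule A.finprod_cong') (use spl st fc g h act_closed in auto)
    also have "\<dots> = finprod A (\<lambda>x. f (inv (r (act g (act h x))) \<otimes> g \<otimes> r (act h x))) E \<otimes>\<^bsub>A\<^esub>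
        finprod A (\<lambda>x. f (inv (r (act h x)) \<otimes> h \<otimes> r x)) E"
      by (rule A.finprod_multf) (use st fc g h act_closed in auto)
    \<comment> \<open>Reindexing by the permutation x \<mapsto> hx turns the first product into the
      transfer of g.\<close>
    also have "finprod A (\<lambda>x. f (inv (r (act g (act h x))) \<otimes> g \<otimes> r (act h x))) E =
        finprod A (\<lambda>x. f (inv (r (act g x)) \<otimes> g \<otimes> r x)) (act h ` E)"
      by (rule A.finprod_reindex[symmetric])
        (use st fc g h act_closed act_bij[OF h] in \<open>auto simp: bij_betw_def\<close>)
    also have "act h ` E = E" using act_bij[OF h] by (simp add: bij_betw_def)
    finally show "finprod A (\<lambda>x. f (inv (r (act (g \<otimes> h) x)) \<otimes> (g \<otimes> h) \<otimes> r x)) E =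
      finprod A (\<lambda>x. f (inv (r (act g x)) \<otimes> g \<otimes> r x)) E \<otimes>\<^bsub>A\<^esub> finprod A (\<lambda>x. f (inv (r (act h x)) \<otimes> h \<otimes> r x)) E" .
  qed
qed

text \<open>By \<open>semi\<close>, each orbit of \<open>U\<close> is either a fixed point or
  regular. On a regular orbit the element of \<open>U\<close> leading from a chosen representative
  to x is unique, so the transversal can be made to commute with \<open>U\<close>.\<close>

lemma equivariant_transversal:
  assumes e0: "e0 \<in> E" and tr: "\<forall>x\<in>E. \<exists>g\<in>carrier G. act g e0 = x"
    and U: "subgroup U G"
    and semi: "\<forall>x\<in>E. \<forall>u\<in>U. u \<noteq> \<one> \<longrightarrow> act u x = x \<longrightarrow> (\<forall>v\<in>U. act v x = x)"
  obtains r where "\<And>x. x \<in> E \<Longrightarrow> r x \<in> carrier G \<and> act (r x) e0 = x"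
    "\<And>x u. \<lbrakk>x \<in> E; \<not> (\<forall>v\<in>U. act v x = x); u \<in> U\<rbrakk> \<Longrightarrow> r (act u x) = u \<otimes> r x"
proof -
  obtain r0 where r0: "\<And>x. x \<in> E \<Longrightarrow> r0 x \<in> carrier G \<and> act (r0 x) e0 = x" using tr by metis
  define orb where "orb x = (\<lambda>u. act u x) ` U" for x
  \<comment> \<open>The choice depends only on the set \<open>orb x\<close>, so all points of one
    orbit get the same representative.\<close>
  define rep where "rep x = (SOME y. y \<in> orb x)" for x
  define cc where "cc x = (SOME u. u \<in> U \<and> act u (rep x) = x)" for x
  have UG: "u \<in> carrier G" if "u \<in> U" for u using that sub_mem[OF U] by blast
  have rep: "rep x \<in> orb x" if "x \<in> E" for x
  proof -
    have "x \<in> orb x" using that act_one[OF that] sub_one[OF U] unfolding orb_def by force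
    then show ?thesis unfolding rep_def by (rule someI)
  qed
  have repE: "rep x \<in> E" if "x \<in> E" for x using rep[OF that] that UG act_closed by (auto simp: orb_def)
  have cc: "cc x \<in> U \<and> act (cc x) (rep x) = x" if x: "x \<in> E" for x
  proof -
    obtain u where u: "u \<in> U" "rep x = act u x" using rep[OF x] by (auto simp: orb_def)
    then have "inv u \<in> U \<and> act (inv u) (rep x) = x" using x UG sub_inv[OF U] act_inv by simp
    then show ?thesis unfolding cc_def by (rule someI)
  qed
  have orb_eq: "orb (act u x) = orb x" if x: "x \<in> E" and u: "u \<in> U" for x u
  proof -
    have "act v (act u x) \<in> orb x" if "v \<in> U" for v
      unfolding orb_def by (rule image_eqI[of _ _ "v \<otimes> u"]) (use that u x UG act_mult sub_mult[OF U] in auto)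
    moreover have "act v x \<in> orb (act u x)" if "v \<in> U" for v
      unfolding orb_def
      by (rule image_eqI[of _ _ "v \<otimes> inv u"])
        (use that u x UG act_mult act_inv act_closed sub_mult[OF U] sub_inv[OF U] in auto)
    ultimately show ?thesis by (auto simp: orb_def)
  qed
  define r where "r x = cc x \<otimes> r0 (rep x)" for x
  have r1: "r x \<in> carrier G \<and> act (r x) e0 = x" if "x \<in> E" for x
    using cc[OF that] repE[OF that] r0[OF repE[OF that]] UG e0 by (simp add: r_def act_mult)
  have r2: "r (act u x) = u \<otimes> r x" if x: "x \<in> E" and nf: "\<not> (\<forall>v\<in>U. act v x = x)" and u: "u \<in> U" for x u
  proof -
    have ux: "act u x \<in> E" using x u UG act_closed by blast
    have rr: "rep (act u x) = rep x" using orb_eq[OF x u] by (simp add: rep_def)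
    define y where "y = rep x"
    have y: "y \<in> E" using repE x by (simp add: y_def)
    have c: "cc x \<in> U" "act (cc x) y = x" and c': "cc (act u x) \<in> U" "act (cc (act u x)) y = act u x"
      using cc[OF x] cc[OF ux] rr by (auto simp: y_def)
    define w where "w = inv (u \<otimes> cc x) \<otimes> cc (act u x)"
    have w: "w \<in> U" using c c' u sub_mult[OF U] sub_inv[OF U] by (simp add: w_def)
    have uc: "u \<otimes> cc x \<in> U" "act (u \<otimes> cc x) y = act u x"
      using c u y UG act_mult sub_mult[OF U] by auto
    have "act w y = act (inv (u \<otimes> cc x)) (act (u \<otimes> cc x) y)"
      unfolding w_def using y c' uc UG by (simp add: act_mult)
    then have "act w y = y" using act_inv[of "u \<otimes> cc x" y] UG[OF uc(1)] y by simp
    have "w = \<one>"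
    proof (rule ccontr)
      assume "w \<noteq> \<one>"
      then have fy: "\<forall>v\<in>U. act v y = y" using semi y w \<open>act w y = y\<close> by blast
      then have "x = y" using c by auto
      then show False using fy nf by simp
    qed
    then have "cc (act u x) = u \<otimes> cc x"
      using w_def c' uc UG by (metis inv_cancel2 r_one UG)
    then show ?thesis using c c' u UG r0[OF y] rr by (simp add: r_def y_def[symmetric] m_assoc)
  qed
  show ?thesis by (rule that[OF r1 r2])
qed

text \<open>For the equivariant transversal a point not fixed by \<open>U\<close> contributes
  f(\<one>), which is neutral. Only the points fixed by \<open>U\<close> remain in the
  product.\<close>

lemma transfer_eval:
  assumes e0: "e0 \<in> E" and tr: "\<forall>x\<in>E. \<exists>g\<in>carrier G. act g e0 = x"
    and A: "comm_group A" and f: "f \<in> hom (G\<lparr>carrier := stab e0\<rparr>) A"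
    and U: "subgroup U G"
    and semi: "\<forall>x\<in>E. \<forall>u\<in>U. u \<noteq> \<one> \<longrightarrow> act u x = x \<longrightarrow> (\<forall>v\<in>U. act v x = x)"
  obtains V r where "V \<in> hom G A" "\<And>x. x \<in> E \<Longrightarrow> r x \<in> carrier G \<and> act (r x) e0 = x"
    "\<And>u. u \<in> U \<Longrightarrow> V u = finprod A (\<lambda>x. f (inv (r x) \<otimes> u \<otimes> r x)) {x \<in> E. \<forall>v\<in>U. act v x = x}"
proof -
  interpret A: comm_group A by fact
  obtain r where r: "\<And>x. x \<in> E \<Longrightarrow> r x \<in> carrier G \<and> act (r x) e0 = x"
    and eq: "\<And>x u. \<lbrakk>x \<in> E; \<not> (\<forall>v\<in>U. act v x = x); u \<in> U\<rbrakk> \<Longrightarrow> r (act u x) = u \<otimes> r x"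
    by (rule equivariant_transversal[OF e0 tr U semi]) blast
  define V where "V g = finprod A (\<lambda>x. f (inv (r (act g x)) \<otimes> g \<otimes> r x)) E" for g
  have UG: "u \<in> carrier G" if "u \<in> U" for u using that sub_mem[OF U] by blast
  have f1: "f \<one> = \<one>\<^bsub>A\<^esub>"
    using hom_one[OF f subgroup_imp_group[OF stab_sub[OF e0]] A.is_group] by simp
  have st: "inv (r (act g x)) \<otimes> g \<otimes> r x \<in> stab e0" if "g \<in> carrier G" "x \<in> E" for g x
  proof -
    have "act (inv (r (act g x))) (act g x) = e0"
      using r[OF act_closed[OF that]] e0 act_inv[of "r (act g x)" e0] by simp
    then show ?thesis
      using that r[OF that(2)] r[OF act_closed[OF that]] e0 by (simp add: stab_def act_mult act_closed)
  qed
  have fc: "f h \<in> carrier A" if "h \<in> stab e0" for h using f that by (auto simp: hom_def)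
  have "V u = finprod A (\<lambda>x. f (inv (r x) \<otimes> u \<otimes> r x)) {x \<in> E. \<forall>v\<in>U. act v x = x}" if u: "u \<in> U" for u
    unfolding V_def
  proof (rule A.finprod_mono_neutral_cong_right)
    fix x assume x: "x \<in> E - {x \<in> E. \<forall>v\<in>U. act v x = x}"
    then have "r (act u x) = u \<otimes> r x" using eq u by blast
    then have "inv (r (act u x)) \<otimes> u \<otimes> r x = \<one>" using r x u UG by (simp add: word_simps)
    then show "f (inv (r (act u x)) \<otimes> u \<otimes> r x) = \<one>\<^bsub>A\<^esub>" using f1 by simp
  qed (use finX st fc UG u in auto)
  moreover have "V \<in> hom G A" unfolding V_def by (rule transfer_hom[OF A e0 f r])
  ultimately show ?thesis using that r by blast
qed

end

section \<open>Dihedral-like stabilizers with trivially intersecting cyclic parts\<close>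

definition sign_group :: "int monoid" where
  "sign_group = \<lparr>carrier = {1, -1}, mult = (*), one = 1\<rparr>"

lemma comm_group_sign_group: "comm_group sign_group"
  by (rule comm_groupI) (auto simp: sign_group_def)

lemma sign_group_pow: "(-1) [^]\<^bsub>sign_group\<^esub> (n::nat) = (-1::int) ^ n"
  by (induction n) (simp_all add: sign_group_def nat_pow_def)

context fin_action
begin

lemma semiregular_card_dvd:
  assumes "\<And>x g. \<lbrakk>x \<in> E; g \<in> carrier G; act g x = x\<rbrakk> \<Longrightarrow> g = \<one>"
  shows "card (carrier G) dvd card E"
proof -
  have st: "stab x = {\<one>}" if "x \<in> E" for x
    using that assms act_one by (auto simp: stab_def)
  have U: "\<Union> (orbit ` E) = E" using orbit_self act_closed by (fastforce simp: orbit_def)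
  have "card (carrier G) dvd card (\<Union> (orbit ` E))"
  proof (rule dvd_partition)
    show "\<forall>c\<in>orbit ` E. card (carrier G) dvd card c" using orbit_stab st by fastforce
    show "\<forall>c1\<in>orbit ` E. \<forall>c2\<in>orbit ` E. c1 \<noteq> c2 \<longrightarrow> c1 \<inter> c2 = {}" using orbit_eq by blast
  qed (use U finX in simp)
  then show ?thesis using U by simp
qed

text \<open>The number of fixed points of a p-group on p^2 points is divisible by p, so it cannot be
  1.\<close>

lemma fixes_only_base_imp_not_dvd:
  assumes p: "Factorial_Ring.prime p" "card E = p\<^sup>2" and c: "c \<in> carrier G" "c [^] p = \<one>"
    and fixed: "e0 \<in> E" "\<And>x. x \<in> E \<Longrightarrow> act c x = x \<longleftrightarrow> x = e0"
  shows False
proof -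
  obtain k where U: "subgroup (generate G {c}) G" "card (generate G {c}) = p ^ k" "c \<in> generate G {c}"
    using p_element_subgroup[OF p(1) c(1), of 1] c(2) by auto
  interpret B: fin_action "G\<lparr>carrier := generate G {c}\<rparr>" E act by (rule restrict_action[OF U(1)])
  have "generate G {c} \<subseteq> stab e0"
    by (rule generate_subgroup_incl) (use fixed c stab_sub in \<open>auto simp: stab_def\<close>)
  then have "{x \<in> E. \<forall>g\<in>generate G {c}. act g x = x} = {e0}"
    using fixed U(3) by (auto simp: stab_def)
  then have "[card E = 1] (mod p)" using B.p_group_fixed_points[OF p(1), of k] U(2) by simp
  moreover have "p dvd card E" using p by simp
  ultimately have "p dvd 1" using cong_dvd_iff by blast
  then show False using p(1) by simp
qed

text \<open>Take the transfer into the abelian stabilizer C along the identity map. A nontrivial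
  element of C fixes e0 only, so the transfer restricts to the identity on C and G splits as kernel
  times C. The kernel has order p^2, and coprimality with |C| identifies it with the solutions of
  g^(p^2) = \<one>.\<close>

lemma abelian_stabilizer_complement:
  assumes p: "Factorial_Ring.prime p" "card E = p\<^sup>2" and e0: "e0 \<in> E"
    and tr: "\<forall>x\<in>E. \<exists>g\<in>carrier G. act g e0 = x"
    and comm: "\<And>x y. \<lbrakk>x \<in> stab e0; y \<in> stab e0\<rbrakk> \<Longrightarrow> x \<otimes> y = y \<otimes> x"
    and TI: "\<And>x u. \<lbrakk>x \<in> E; u \<in> stab e0; u \<noteq> \<one>; act u x = x\<rbrakk> \<Longrightarrow> x = e0"
    and cop: "\<not> p dvd card (stab e0)"
  shows "subgroup {g \<in> carrier G. g [^] p\<^sup>2 = \<one>} G \<and> card {g \<in> carrier G. g [^] p\<^sup>2 = \<one>} = p\<^sup>2"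
proof -
  define C where "C = stab e0"
  have C: "subgroup C G" using stab_sub[OF e0] by (simp add: C_def)
  have CG: "c \<in> carrier G" if "c \<in> C" for c using that sub_mem[OF C] by blast
  let ?A = "G\<lparr>carrier := C\<rparr>"
  interpret CA: fin_group ?A using fin_group_sub[OF C] .
  have A: "comm_group ?A"
    by (rule CA.group_comm_groupI) (use comm in \<open>auto simp: C_def\<close>)
  have f: "(\<lambda>x. x) \<in> hom (G\<lparr>carrier := stab e0\<rparr>) ?A" by (auto simp: hom_def C_def)
  have semi: "\<forall>x\<in>E. \<forall>u\<in>C. u \<noteq> \<one> \<longrightarrow> act u x = x \<longrightarrow> (\<forall>v\<in>C. act v x = x)"
  proof (intro ballI impI)
    fix x u v assume a: "x \<in> E" "u \<in> C" "u \<noteq> \<one>" "act u x = x" "v \<in> C"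
    then have "x = e0" using TI by (simp add: C_def)
    then show "act v x = x" using a(5) by (simp add: C_def stab_def)
  qed
  obtain V r where V: "V \<in> hom G ?A" and r: "\<And>x. x \<in> E \<Longrightarrow> r x \<in> carrier G \<and> act (r x) e0 = x"
    and ev: "\<And>u. u \<in> C \<Longrightarrow> V u = finprod ?A (\<lambda>x. inv (r x) \<otimes> u \<otimes> r x) {x \<in> E. \<forall>v\<in>C. act v x = x}"
    by (rule transfer_eval[OF e0 tr A f C semi]) blast
  interpret V: group_hom G ?A V using V CA.is_group is_group by (simp add: group_hom_def group_hom_axioms_def)
  have Vc: "V c = c" if c: "c \<in> C" for c
  proof (cases "c = \<one>")
    case True then show ?thesis using V.hom_one by simp
  next
    case False
    have "{x \<in> E. \<forall>v\<in>C. act v x = x} = {e0}"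
    proof (intro equalityI subsetI)
      fix x assume "x \<in> {x \<in> E. \<forall>v\<in>C. act v x = x}"
      then show "x \<in> {e0}" using TI[of x c] False c by (simp add: C_def)
    qed (use e0 in \<open>simp add: C_def stab_def\<close>)
    then have "V c = finprod ?A (\<lambda>x. inv (r x) \<otimes> c \<otimes> r x) {e0}" using ev[OF c] by simp
    moreover have re: "r e0 \<in> C" using r[OF e0] by (simp add: C_def stab_def)
    then have "inv (r e0) \<otimes> c \<otimes> r e0 = c"
      using comm[of c "r e0"] c CG by (simp add: C_def m_assoc inv_cancel1)
    ultimately show ?thesis using c CG comm_group.axioms(1)[OF A] by (simp add: comm_monoid.finprod_insert comm_monoid.finprod_empty)
  qed
  have VC: "V g \<in> C" if "g \<in> carrier G" for g using V.hom_closed[OF that] by simp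
  define K where "K = kernel G ?A V"
  have K: "subgroup K G" unfolding K_def by (rule V.subgroup_kernel)
  have Kiff: "g \<in> K \<longleftrightarrow> g \<in> carrier G \<and> V g = \<one>" for g by (simp add: K_def kernel_def)
  have Vm: "V (g \<otimes> h) = V g \<otimes> V h" if "g \<in> carrier G" "h \<in> carrier G" for g h using V.hom_mult[OF that] by simp
  have Vi: "V (inv g) = inv (V g)" if "g \<in> carrier G" for g
    using V.hom_inv[OF that] VC[OF that] C m_inv_consistent by simp
  \<comment> \<open>The factorization g = (g V(g)^-1) V(g), with the first factor in the kernel
    because V is the identity on C.\<close>
  have "bij_betw (\<lambda>g. (g \<otimes> inv (V g), V g)) (carrier G) (K \<times> C)"
    by (rule bij_betwI[where g = "\<lambda>(k, c). k \<otimes> c"])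
      (use Kiff VC CG Vm Vi Vc in \<open>auto simp: word_simps sub_inv[OF C]\<close>)
  then have "card (carrier G) = card K * card C" by (metis bij_betw_same_card card_cartesian_product)
  moreover have "card (carrier G) = p\<^sup>2 * card C"
  proof -
    have "orbit e0 = E" using tr act_closed e0 by (auto simp: orbit_def)
    then show ?thesis using orbit_stab[OF e0] p(2) by (simp add: C_def)
  qed
  ultimately have cK: "card K = p\<^sup>2" using card_sub_pos[OF C] by simp
  have cop2: "coprime (p\<^sup>2) (card C)" using cop p(1) by (simp add: C_def prime_imp_coprime)
  have "K = {g \<in> carrier G. g [^] p\<^sup>2 = \<one>}"
  proof (intro equalityI subsetI)
    fix g assume "g \<in> K" then show "g \<in> {g \<in> carrier G. g [^] p\<^sup>2 = \<one>}"
      using pow_card_sub[OF K] cK Kiff by auto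
  next
    fix g assume "g \<in> {g \<in> carrier G. g [^] p\<^sup>2 = \<one>}"
    then have g: "g \<in> carrier G" "g [^] p\<^sup>2 = \<one>" by auto
    have "V g [^]\<^bsub>?A\<^esub> p\<^sup>2 = \<one>" using V.hom_nat_pow[OF g(1), of "p\<^sup>2"] g(2) V.hom_one by simp
    then have "V g [^] p\<^sup>2 = \<one>" by (simp add: nat_pow_consistent[symmetric])
    moreover have "V g [^] card C = \<one>" using pow_card_sub[OF C] VC g by blast
    ultimately have "V g = \<one>" using pow_coprime_one cop2 CG VC g by blast
    then show "g \<in> K" using g Kiff by blast
  qed
  then show ?thesis using K cK by simp
qed

text \<open>Transfer of the sign character of the stabilizer: 1 on the cyclic part, -1 on
  reflections. The involution \<open>u\<close> fixes an odd number of points, and at each of them it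
  acts as a reflection, since it lies in no cyclic part. Hence its transfer is -1, and the kernel
  has index two.\<close>

lemma index_two_subgroup:
  assumes oddE: "odd (card E)" and e0: "e0 \<in> E"
    and tr: "\<forall>x\<in>E. \<exists>g\<in>carrier G. act g e0 = x"
    and dl: "dihedral_like G (stab e0) (C e0)"
    and eqv: "\<And>g x. \<lbrakk>g \<in> carrier G; x \<in> E\<rbrakk> \<Longrightarrow> C (act g x) = (\<lambda>c. g \<otimes> c \<otimes> inv g) ` C x"
    and u: "u \<in> carrier G" "u \<noteq> \<one>" "u \<otimes> u = \<one>" "\<And>x. x \<in> E \<Longrightarrow> u \<notin> C x"
  obtains G0 where "subgroup G0 G" "u \<notin> G0" "\<And>g h. \<lbrakk>g \<in> carrier G; h \<in> carrier G; g \<notin> G0; h \<notin> G0\<rbrakk> \<Longrightarrow> g \<otimes> h \<in> G0"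
proof -
  define f :: "'a \<Rightarrow> int" where "f h = (if h \<in> C e0 then 1 else -1)" for h
  have f: "f \<in> hom (G\<lparr>carrier := stab e0\<rparr>) sign_group"
  proof (rule homI)
    fix x y assume "x \<in> carrier (G\<lparr>carrier := stab e0\<rparr>)" "y \<in> carrier (G\<lparr>carrier := stab e0\<rparr>)"
    then have xy: "x \<in> stab e0" "y \<in> stab e0" by auto
    have "x \<otimes> y \<in> C e0 \<longleftrightarrow> (x \<in> C e0 \<longleftrightarrow> y \<in> C e0)"
    proof (cases "x \<in> C e0")
      case True
      have xG: "x \<in> carrier G" "y \<in> carrier G" using xy by (auto simp: stab_def)
      have "y = inv x \<otimes> (x \<otimes> y)" using xG by (simp add: inv_cancel1)
      then show ?thesis using True sub_mult[OF dl_sub(2)[OF dl]] sub_inv[OF dl_sub(2)[OF dl]] by metis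
    next
      case False
      then show ?thesis using dl_coset[OF dl xy(1) False] dl_prod[OF dl xy(1) False xy(2)] by blast
    qed
    then show "f (x \<otimes>\<^bsub>G\<lparr>carrier := stab e0\<rparr>\<^esub> y) = f x \<otimes>\<^bsub>sign_group\<^esub> f y"
      by (auto simp: f_def sign_group_def)
  qed (auto simp: f_def sign_group_def)
  define U where "U = {\<one>, u}"
  have U: "subgroup U G" by (rule subgroup_finI) (use u in \<open>auto simp: U_def\<close>)
  have Ufix: "(\<forall>v\<in>U. act v x = x) \<longleftrightarrow> act u x = x" if "x \<in> E" for x using that act_one by (auto simp: U_def)
  have semi: "\<forall>x\<in>E. \<forall>v\<in>U. v \<noteq> \<one> \<longrightarrow> act v x = x \<longrightarrow> (\<forall>w\<in>U. act w x = x)"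
    using Ufix by (auto simp: U_def)
  define F where "F = {x \<in> E. \<forall>v\<in>U. act v x = x}"
  obtain V r where V: "V \<in> hom G sign_group" and r: "\<And>x. x \<in> E \<Longrightarrow> r x \<in> carrier G \<and> act (r x) e0 = x"
    and ev: "\<And>v. v \<in> U \<Longrightarrow> V v = finprod sign_group (\<lambda>x. f (inv (r x) \<otimes> v \<otimes> r x)) F"
    unfolding F_def by (rule transfer_eval[OF e0 tr comm_group_sign_group f U semi]) blast
  interpret S: comm_group sign_group by (rule comm_group_sign_group)
  interpret B: fin_action "G\<lparr>carrier := U\<rparr>" E act by (rule restrict_action[OF U])
  have "card U = 2 ^ 1" using u by (simp add: U_def)
  then have "[card E = card F] (mod 2)"
    using B.p_group_fixed_points[OF two_is_prime_nat, of 1] by (simp add: F_def)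
  then have oF: "odd (card F)" using oddE by (metis cong_dvd_iff)
  have fx: "f (inv (r x) \<otimes> u \<otimes> r x) = -1" if x: "x \<in> F" for x
  proof -
    have xE: "x \<in> E" using x by (simp add: F_def)
    have "inv (r x) \<otimes> u \<otimes> r x \<notin> C e0"
    proof
      assume a: "inv (r x) \<otimes> u \<otimes> r x \<in> C e0"
      have "u = r x \<otimes> (inv (r x) \<otimes> u \<otimes> r x) \<otimes> inv (r x)" using r[OF xE] u by (simp add: word_simps)
      then have "u \<in> C (act (r x) e0)" using a eqv[of "r x" e0] r[OF xE] e0 by blast
      then show False using u(4) xE r by auto
    qed
    then show ?thesis by (simp add: f_def)
  qed
  have "V u = finprod sign_group (\<lambda>x. -1) F"
    using ev[of u] by (simp add: U_def) (rule S.finprod_cong', auto simp: fx sign_group_def)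
  also have "\<dots> = (-1) [^]\<^bsub>sign_group\<^esub> card F" by (rule S.finprod_const) (simp add: sign_group_def)
  also have "\<dots> = -1" using oF by (simp add: sign_group_pow)
  finally have Vu: "V u = -1" .
  interpret V: group_hom G sign_group V using V S.is_group is_group by (simp add: group_hom_def group_hom_axioms_def)
  show ?thesis
  proof (rule that[of "kernel G sign_group V"])
    show "subgroup (kernel G sign_group V) G" by (rule V.subgroup_kernel)
    show "u \<notin> kernel G sign_group V" using Vu by (simp add: kernel_def sign_group_def)
    fix g h assume gh: "g \<in> carrier G" "h \<in> carrier G" "g \<notin> kernel G sign_group V" "h \<notin> kernel G sign_group V"
    then have "V g = -1" "V h = -1" using V.hom_closed by (auto simp: kernel_def sign_group_def)
    then show "g \<otimes> h \<in> kernel G sign_group V" using gh V.hom_mult[OF gh(1,2)] by (simp add: kernel_def sign_group_def)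
  qed
qed

end

text \<open>For n \<le> p the right side is at most p^2 - p + 1, for n > p it is at least p^2 + p +
  1; neither can equal p^2.\<close>

lemma nat_square_ne_consecutive_product:
  assumes "(p::nat) > 1" "p\<^sup>2 = n * (n - 1) + 1"
  shows False
proof (cases "n \<le> p")
  case True
  then have "n * (n - 1) \<le> p * (p - 1)" by (intro mult_mono) auto
  moreover have "p * (p - 1) + p = p\<^sup>2" using assms(1) by (cases p) (auto simp: power2_eq_square)
  ultimately show False using assms by linarith
next
  case False
  then have "(p + 1) * p \<le> n * (n - 1)" by (intro mult_mono) auto
  then show False using assms by (simp add: power2_eq_square)
qed

text \<open>\<open>C\<close> assigns to each point the cyclic part of its stabilizer, compatibly
  with conjugation; \<open>TI\<close> says that these parts meet trivially. Unlike maximality of the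
  stabilizer, these conditions are inherited by the transitive index-two subgroups met in the
  induction.\<close>

locale ti_action = fin_action G E act for G (structure) and E :: "'x set" and act +
  fixes C :: "'x \<Rightarrow> 'a set" and p :: nat
  assumes p: "Factorial_Ring.prime p" "odd p" and cardE: "card E = p\<^sup>2"
    and tr: "\<lbrakk>x \<in> E; y \<in> E\<rbrakk> \<Longrightarrow> \<exists>g\<in>carrier G. act g x = y"
    and dl: "x \<in> E \<Longrightarrow> dihedral_like G (stab x) (C x)"
    and eqv: "\<lbrakk>g \<in> carrier G; x \<in> E\<rbrakk> \<Longrightarrow> C (act g x) = (\<lambda>c. g \<otimes> c \<otimes> inv g) ` C x"
    and TI: "\<lbrakk>x \<in> E; y \<in> E; c \<in> C x; c \<in> C y; c \<noteq> \<one>\<rbrakk> \<Longrightarrow> x = y"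
begin

lemma C_stab: "\<lbrakk>x \<in> E; c \<in> C x\<rbrakk> \<Longrightarrow> c \<in> stab x"
  using dl_sub(3)[OF dl] by blast

lemma C_carrier: "\<lbrakk>x \<in> E; c \<in> C x\<rbrakk> \<Longrightarrow> c \<in> carrier G"
  using C_stab by (auto simp: stab_def)

text \<open>An element with nontrivial square that fixes \<open>y\<close> cannot be a reflection
  there, so it lies in the cyclic part at \<open>y\<close> as well.\<close>

lemma C_fixed_unique:
  assumes "x \<in> E" "y \<in> E" "c \<in> C x" "act c y = y" "c \<otimes> c \<noteq> \<one>"
  shows "x = y"
proof -
  have "c \<in> stab y" using assms C_carrier by (auto simp: stab_def)
  then have "c \<in> C y" using dl_sq[OF dl] assms by blast
  moreover have "c \<noteq> \<one>" using assms(5) by auto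
  ultimately show ?thesis using TI assms by blast
qed

text \<open>An element of odd prime order p in the stabilizer is no reflection, so it lies in the
  cyclic part and fixes one point only. That contradicts the congruence for fixed points on p^2
  points.\<close>

lemma p_not_dvd_stab:
  assumes x: "x \<in> E"
  shows "\<not> p dvd card (stab x)"
proof
  assume "p dvd card (stab x)"
  then obtain c where c: "c \<in> stab x" "c \<noteq> \<one>" "c [^] p = \<one>" using cauchy[OF p(1) stab_sub[OF x]] by blast
  have cG: "c \<in> carrier G" using c by (simp add: stab_def)
  have sq: "c \<otimes> c \<noteq> \<one>"
  proof
    assume "c \<otimes> c = \<one>"
    then have "c [^] (2::nat) = \<one>" using cG by (simp add: numeral_2_eq_2)
    moreover have "coprime 2 p" using p(2) by simp
    ultimately show False using pow_coprime_one[OF cG] c by blast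
  qed
  then have "c \<in> C x" using dl_sq[OF dl[OF x]] c by blast
  then have "act c y = y \<longleftrightarrow> y = x" if "y \<in> E" for y
    using C_fixed_unique[OF x that] sq c(1) by (auto simp: stab_def)
  then show False using fixes_only_base_imp_not_dvd[OF p(1) cardE cG c(3) x] by blast
qed

lemma E_nonempty: "E \<noteq> {}" using cardE p(1) by auto

lemma card_G: "x \<in> E \<Longrightarrow> card (carrier G) = p\<^sup>2 * card (stab x)"
proof -
  assume x: "x \<in> E"
  have "orbit x = E" using tr[OF x] act_closed x by (auto simp: orbit_def)
  then show ?thesis using orbit_stab[OF x] cardE by simp
qed

text \<open>Each \<open>C x\<close> contains exactly one involution \<open>z x\<close>, and x
  \<mapsto> z x is a bijection from the p^2 points onto the involutions. Fix t0 = z e0. Every other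
  involution t is a reflection at exactly one point y \<noteq> e0 fixed by t0, namely the point
  whose cyclic part contains t0 t. There are n such points, each with n - 1 reflections other than
  t0.\<close>

lemma all_involutions_conjugate_contradiction:
  assumes e0: "e0 \<in> E" and u0: "u0 \<in> stab e0" "u0 \<notin> C e0"
    and all: "\<And>u. \<lbrakk>u \<in> carrier G; u \<noteq> \<one>; u \<otimes> u = \<one>\<rbrakk> \<Longrightarrow> \<exists>x\<in>E. u \<in> C x"
  shows False
proof -
  define I where "I = {u \<in> carrier G. u \<noteq> \<one> \<and> u \<otimes> u = \<one>}"
  have IG: "u \<in> carrier G" if "u \<in> I" for u using that by (simp add: I_def)
  have CE: "subgroup (C x) G" if "x \<in> E" for x using dl_sub(2)[OF dl[OF that]] .
  have u0I: "u0 \<in> I"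
    using u0 dl_sq[OF dl[OF e0] u0] sub_one[OF CE[OF e0]] by (auto simp: I_def stab_def)
  obtain y0 where y0: "y0 \<in> E" "u0 \<in> C y0" using all u0I by (auto simp: I_def)
  have inv_ex: "\<exists>v. v \<in> C x \<and> v \<in> I" if x: "x \<in> E" for x
  proof -
    obtain g where g: "g \<in> carrier G" "act g y0 = x" using tr[OF y0(1) x] by blast
    have "g \<otimes> u0 \<otimes> inv g \<in> C x" using eqv[OF g(1) y0(1)] g(2) y0(2) by auto
    moreover have "g \<otimes> u0 \<otimes> inv g \<in> I"
    proof -
      have "(g \<otimes> u0 \<otimes> inv g) \<otimes> (g \<otimes> u0 \<otimes> inv g) = g \<otimes> (u0 \<otimes> u0) \<otimes> inv g"
        using g IG[OF u0I] by (simp add: word_simps)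
      then show ?thesis using u0I g conj_one_iff[OF g(1) IG[OF u0I]] by (simp add: I_def)
    qed
    ultimately show ?thesis by blast
  qed
  define z where "z x = (SOME v. v \<in> C x \<and> v \<in> I)" for x
  have z: "z x \<in> C x" "z x \<in> I" if "x \<in> E" for x
    using someI_ex[OF inv_ex[OF that]] unfolding z_def by auto
  have z_unique: "v = z x" if "x \<in> E" "v \<in> C x" "v \<in> I" for v x
    using dl_unique_involution[OF dl[OF that(1)] that(2) z(1)[OF that(1)]] z(2)[OF that(1)] that(3) by (simp add: I_def)
  have z_inj: "x = y" if "x \<in> E" "y \<in> E" "z x = z y" for x y
    using TI[OF that(1,2) z(1)[OF that(1)]] z[OF that(2)] that(3) by (simp add: I_def)
  have z_bij: "bij_betw z E I"
  proof (rule bij_betw_imageI)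
    show "inj_on z E" using z_inj by (auto intro: inj_onI)
    show "z ` E = I"
    proof (intro equalityI subsetI)
      fix u assume u: "u \<in> I"
      then obtain x where "x \<in> E" "u \<in> C x" using all by (auto simp: I_def)
      then show "u \<in> z ` E" using z_unique u by blast
    qed (use z in auto)
  qed
  have conj_in: "act g y = y" if "y \<in> E" "g \<in> carrier G" "h \<in> C y" "h \<noteq> \<one>" "g \<otimes> h \<otimes> inv g \<in> C y" for g h y
  proof -
    have "g \<otimes> h \<otimes> inv g \<in> C (act g y)" using eqv[OF that(2,1)] that(3) by blast
    moreover have "g \<otimes> h \<otimes> inv g \<noteq> \<one>" using conj_one_iff[OF that(2) C_carrier[OF that(1,3)]] that(4) by simp
    ultimately show ?thesis using TI[OF act_closed[OF that(2,1)] that(1) _ that(5)] by blast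
  qed
  have comm_conj: "g \<otimes> h \<otimes> inv g = h \<longleftrightarrow> g \<otimes> h = h \<otimes> g" if "g \<in> carrier G" "h \<in> carrier G" for g h
    using that by (metis inv_closed inv_solve_right m_closed)
  have comm_fix: "act g y = y" if "y \<in> E" "g \<in> carrier G" "h \<in> C y" "h \<noteq> \<one>" "g \<otimes> h = h \<otimes> g" for g h y
    using conj_in[OF that(1-4)] comm_conj[OF that(2) C_carrier[OF that(1,3)]] that(3,5) by simp
  \<comment> \<open>The involution of the cyclic part generates a normal subgroup of order two in
    the stabilizer, so it is central there.\<close>
  have stab_z: "g \<otimes> z y = z y \<otimes> g" if "y \<in> E" "g \<in> stab y" for g y
  proof -
    have gG: "g \<in> carrier G" using that by (simp add: stab_def)
    have sub: "subgroup {\<one>, z y} G"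
      by (rule subgroup_finI) (use z[OF that(1)] in \<open>auto simp: I_def\<close>)
    have "g \<otimes> z y \<otimes> inv g \<in> {\<one>, z y}"
      by (rule dl_normal[OF dl[OF that(1)] sub]) (use z[OF that(1)] sub_one[OF CE[OF that(1)]] that in auto)
    moreover have "g \<otimes> z y \<otimes> inv g \<noteq> \<one>"
      using conj_one_iff[OF gG IG[OF z(2)[OF that(1)]]] z(2)[OF that(1)] by (simp add: I_def)
    ultimately show ?thesis using comm_conj[OF gG IG[OF z(2)[OF that(1)]]] by blast
  qed
  have nonder: "\<exists>y\<in>E. g \<in> C y" if "x \<in> E" "g \<in> stab x" "g \<noteq> \<one>" for g x
  proof (cases "g \<in> C x")
    case False
    then have "g \<otimes> g = \<one>" using dl_sq[OF dl] that by blast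
    then show ?thesis using all that by (auto simp: stab_def)
  qed (use that in blast)
  define t0 where "t0 = z e0"
  have t0: "t0 \<in> C e0" "t0 \<in> I" "t0 \<in> carrier G" "t0 \<otimes> t0 = \<one>" "t0 \<noteq> \<one>"
    using z[OF e0] by (auto simp: t0_def I_def)
  have t0i: "inv t0 = t0" using t0 inv_equality by blast
  have t0c: "t0 \<otimes> (t0 \<otimes> y) = y" if "y \<in> carrier G" for y
    using t0(3,4) that by (simp add: m_assoc[symmetric])
  have t0_fix: "act t0 y = y \<longleftrightarrow> t0 \<otimes> z y = z y \<otimes> t0" if "y \<in> E" for y
    using comm_fix[OF that t0(3) z(1)[OF that]] z(2)[OF that] stab_z[OF that, of t0] t0(3)
    by (auto simp: stab_def I_def)
  \<comment> \<open>Otherwise x = t0 t fixes no point, because here every nontrivial element with a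
    fixed point lies in some cyclic part. Then the centralizer A of x acts semiregularly, so its
    order divides p^2. A Sylow p-subgroup containing A has order p^2 and is abelian, so it equals
    A.\<close>
  have derangement: "\<exists>y\<in>E. t0 \<otimes> t \<in> C y" if t: "t \<in> I" "t \<noteq> t0" for t
  proof (rule ccontr)
    assume no: "\<not> (\<exists>y\<in>E. t0 \<otimes> t \<in> C y)"
    have tG: "t \<in> carrier G" "t \<otimes> t = \<one>" "inv t = t" using t inv_equality by (auto simp: I_def)
    define x where "x = t0 \<otimes> t"
    have xG: "x \<in> carrier G" using t0 tG by (simp add: x_def)
    have x1: "x \<noteq> \<one>"
    proof
      assume "x = \<one>"
      then have "t = t0" using t0c[OF tG(1)] t0(3) by (simp add: x_def)
      then show False using t by simp
    qed
    have xinv: "inv x = t \<otimes> t0" using tG t0 t0i by (simp add: x_def inv_mult_group)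
    have x_conj: "t0 \<otimes> x \<otimes> t0 = inv x" using tG t0 xinv by (simp add: x_def m_assoc[symmetric])
    define A where "A = {g \<in> carrier G. \<forall>d\<in>{x}. g \<otimes> d = d \<otimes> g}"
    have A: "subgroup A G" unfolding A_def by (rule centralizer_sub) (use xG in auto)
    have AG: "a \<in> carrier G" if "a \<in> A" for a using that by (simp add: A_def)
    have xA: "x \<in> A" using xG by (simp add: A_def)
    have semi: "a = \<one>" if "a \<in> A" "y \<in> E" "act a y = y" for a y
    proof (rule ccontr)
      assume a1: "a \<noteq> \<one>"
      have "a \<in> stab y" using that AG by (simp add: stab_def)
      then obtain w where w: "w \<in> E" "a \<in> C w" using nonder[OF \<open>y \<in> E\<close> _ a1] by blast
      have "x \<otimes> a = a \<otimes> x" using that(1) by (simp add: A_def)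
      then have "act x w = w" using comm_fix[OF w(1) xG w(2) a1] by simp
      then have "x \<in> stab w" using xG by (simp add: stab_def)
      then show False using nonder[OF w(1) _ x1] no by (simp add: x_def)
    qed
    interpret AA: fin_action "G\<lparr>carrier := A\<rparr>" E act by (rule restrict_action[OF A])
    have "card A dvd p\<^sup>2" using AA.semiregular_card_dvd semi cardE by auto
    then obtain k where k: "card A = p ^ k" "k \<le> 2" using p(1) divides_primepow_nat by blast
    have "p\<^sup>2 dvd card (carrier G)" using card_G[OF e0] by simp
    then obtain P where P: "subgroup P G" "card P = p\<^sup>2" using sylow_sub[OF p(1)] by blast
    have cG: "card (carrier G) = card (stab e0) * card P" using card_G[OF e0] P by simp
    obtain y where y: "y \<in> carrier G" "\<And>a. a \<in> A \<Longrightarrow> y \<otimes> a \<otimes> inv y \<in> P"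
      using p_subgroup_fixes_coset[OF p(1) A k(1) P(1) cG p_not_dvd_stab[OF e0]] by blast
    define P' where "P' = (\<lambda>h. inv y \<otimes> h \<otimes> inv (inv y)) ` P"
    have P': "subgroup P' G" "card P' = p\<^sup>2" using conj_sub[OF P(1), of "inv y"] y P by (auto simp: P'_def)
    have AP': "A \<subseteq> P'"
    proof
      fix a assume a: "a \<in> A"
      have "a = inv y \<otimes> (y \<otimes> a \<otimes> inv y) \<otimes> inv (inv y)" using a AG y(1) by (simp add: word_simps)
      then show "a \<in> P'" unfolding P'_def using y(2)[OF a] by blast
    qed
    have Pcomm: "a \<otimes> b = b \<otimes> a" if "a \<in> P'" "b \<in> P'" for a b
      using comm_prime_square_card[OF p(1) P' that] .
    have "P' \<subseteq> A" using Pcomm xA AP' sub_mem[OF P'(1)] by (auto simp: A_def)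
    then have AeqP: "A = P'" using AP' by blast
    have cA: "card A = p\<^sup>2" using AeqP P' by simp
    have Acomm: "a \<otimes> b = b \<otimes> a" if "a \<in> A" "b \<in> A" for a b using Pcomm that AeqP by simp
    have nrm: "t0 \<otimes> a \<otimes> t0 \<in> A" if a: "a \<in> A" for a
    proof -
      have aG: "a \<in> carrier G" using a AG by blast
      have tx: "t0 \<otimes> x = inv x \<otimes> t0" using x_conj[symmetric] xG t0(3,4) by (simp add: m_assoc)
      have "t0 \<otimes> inv x = x \<otimes> t0" using x_conj[symmetric] xG t0(3) t0c by (simp add: m_assoc)
      then have xt: "x \<otimes> (t0 \<otimes> y) = t0 \<otimes> (inv x \<otimes> y)" if "y \<in> carrier G" for y
        using that xG t0(3) by (simp add: m_assoc[symmetric])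
      have "(t0 \<otimes> a \<otimes> t0) \<otimes> x = t0 \<otimes> (a \<otimes> inv x) \<otimes> t0"
        using aG xG t0(3) tx by (simp add: m_assoc)
      also have "a \<otimes> inv x = inv x \<otimes> a" using a xA Acomm sub_inv[OF A] by simp
      also have "t0 \<otimes> (inv x \<otimes> a) \<otimes> t0 = x \<otimes> (t0 \<otimes> a \<otimes> t0)"
        using aG xG t0(3) xt by (simp add: m_assoc)
      finally have "t0 \<otimes> a \<otimes> t0 \<otimes> x = x \<otimes> (t0 \<otimes> a \<otimes> t0)" .
      moreover have "t0 \<otimes> a \<otimes> t0 \<in> carrier G" using aG t0(3) by simp
      ultimately show ?thesis unfolding A_def by blast
    qed
    \<comment> \<open>Conjugation by t0 fixes only \<one> in A: an element commuting with t0 fixes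
      e0, and A is semiregular. So a \<mapsto> a^-1 (t0 a t0) is injective, hence onto, and t0
      visibly inverts elements of this form.\<close>
    have inj: "inj_on (\<lambda>a. inv a \<otimes> (t0 \<otimes> a \<otimes> t0)) A"
    proof (rule inj_onI)
      fix a b assume ab: "a \<in> A" "b \<in> A" "inv a \<otimes> (t0 \<otimes> a \<otimes> t0) = inv b \<otimes> (t0 \<otimes> b \<otimes> t0)"
      have aG: "a \<in> carrier G" "b \<in> carrier G" using ab AG by auto
      define sa where "sa = t0 \<otimes> a \<otimes> t0"
      define sb where "sb = t0 \<otimes> b \<otimes> t0"
      have s: "sa \<in> A" "sb \<in> A" "sa \<in> carrier G" "sb \<in> carrier G"
        using ab nrm AG by (auto simp: sa_def sb_def)
      define w where "w = b \<otimes> inv a"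
      have wA: "w \<in> A" using ab sub_mult[OF A] sub_inv[OF A] by (simp add: w_def)
      have "b \<otimes> inv a \<otimes> sa = sb"
      proof -
        have "b \<otimes> (inv a \<otimes> sa) = b \<otimes> (inv b \<otimes> sb)" using ab(3) by (simp add: sa_def sb_def)
        then show ?thesis using aG s by (simp add: m_assoc inv_cancel2)
      qed
      then have "w \<otimes> sa = sb" by (simp add: w_def)
      then have "w = sb \<otimes> inv sa" using s AG[OF wA] by (auto simp: m_assoc)
      also have "\<dots> = t0 \<otimes> w \<otimes> t0"
        using aG t0(3) t0i t0c by (simp add: sa_def sb_def w_def word_simps)
      finally have "t0 \<otimes> w = t0 \<otimes> (t0 \<otimes> w \<otimes> t0)" by simp
      then have "w \<otimes> t0 = t0 \<otimes> w" using t0c AG[OF wA] t0(3) by (simp add: m_assoc)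
      then have "act w e0 = e0" using comm_fix[OF e0 AG[OF wA] t0(1,5)] by simp
      then have "w = \<one>" using semi[OF wA e0] by simp
      then have "b \<otimes> inv a \<otimes> a = a" using aG by (simp add: w_def)
      then show "a = b" using aG by (simp add: m_assoc)
    qed
    have surj: "(\<lambda>a. inv a \<otimes> (t0 \<otimes> a \<otimes> t0)) ` A = A"
      by (rule endo_inj_surj[OF fin_sub[OF A] _ inj]) (use nrm sub_inv[OF A] sub_mult[OF A] in auto)
    have inverts: "t0 \<otimes> w \<otimes> t0 = inv w" if w: "w \<in> A" for w
    proof -
      obtain a where a: "a \<in> A" "w = inv a \<otimes> (t0 \<otimes> a \<otimes> t0)" using surj w by blast
      have aG: "a \<in> carrier G" using a AG by blast
      have "t0 \<otimes> w \<otimes> t0 = (t0 \<otimes> inv a \<otimes> t0) \<otimes> (t0 \<otimes> t0) \<otimes> a \<otimes> (t0 \<otimes> t0)"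
        using a aG t0(3,4) by (simp add: m_assoc inv_cancel1 inv_cancel2)
      also have "\<dots> = (t0 \<otimes> inv a \<otimes> t0) \<otimes> a" using aG t0(3,4) by simp
      also have "t0 \<otimes> inv a \<otimes> t0 = inv (t0 \<otimes> a \<otimes> t0)" using aG t0(3) t0i by (simp add: word_simps)
      also have "inv (t0 \<otimes> a \<otimes> t0) \<otimes> a = inv w" using a aG t0(3) t0i by (simp add: word_simps)
      finally show ?thesis .
    qed
    have t0A: "t0 \<notin> A" using semi[OF _ e0] t0 C_stab[OF e0 t0(1)] by (auto simp: stab_def)
    have tI: "t0 \<otimes> a \<in> I" if a: "a \<in> A" for a
    proof -
      have "t0 \<otimes> a \<noteq> \<one>"
        using t0A a AG[OF a] t0(3) t0c[OF AG[OF a]] by auto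
      moreover have "t0 \<otimes> a \<otimes> (t0 \<otimes> a) = \<one>"
        using inverts[OF a] AG[OF a] t0(3) by (simp add: m_assoc[symmetric])
      ultimately show ?thesis using AG[OF a] t0(3) by (simp add: I_def)
    qed
    \<comment> \<open>Since t0 inverts A, the coset t0 A consists of p^2 involutions, hence of all
      involutions.\<close>
    have "card ((\<lambda>a. t0 \<otimes> a) ` A) = card I"
    proof -
      have "inj_on (\<lambda>a. t0 \<otimes> a) A" using AG t0(3) by (intro inj_onI) simp
      then have "card ((\<lambda>a. t0 \<otimes> a) ` A) = p\<^sup>2" using cA by (simp add: card_image)
      also have "\<dots> = card I" using bij_betw_same_card[OF z_bij] cardE by simp
      finally show ?thesis .
    qed
    moreover have "finite I" using fin by (simp add: I_def)
    ultimately have "(\<lambda>a. t0 \<otimes> a) ` A = I" using tI by (intro card_subset_eq) auto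
    \<comment> \<open>The reflection u0 is in this coset too. It commutes with the central
      involution t0 of the stabilizer, so a commutes with t0, which forces a = \<one> and u0 =
      t0.\<close>
    then obtain a where a: "a \<in> A" "u0 = t0 \<otimes> a" using u0I by blast
    have "u0 \<otimes> t0 = t0 \<otimes> u0" using stab_z[OF e0 u0(1)] by (simp add: t0_def)
    then have "t0 \<otimes> (a \<otimes> t0) = a" using a(2) t0c AG[OF a(1)] t0(3) by (simp add: m_assoc)
    then have "t0 \<otimes> (t0 \<otimes> (a \<otimes> t0)) = t0 \<otimes> a" by simp
    then have "a \<otimes> t0 = t0 \<otimes> a" using t0c AG[OF a(1)] t0(3) by simp
    then have "act a e0 = e0" using comm_fix[OF e0 AG[OF a(1)] t0(1,5)] by simp
    then have "a = \<one>" using semi a e0 by blast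
    then show False using a t0 u0 by simp
  qed
  define n where "n = card (C e0)"
  have cardC: "card (C y) = n" if y: "y \<in> E" for y
  proof -
    obtain g where g: "g \<in> carrier G" "act g e0 = y" using tr[OF e0 y] by blast
    show ?thesis using conj_sub(2)[OF CE[OF e0] g(1)] eqv[OF g(1) e0] g(2) by (simp add: n_def)
  qed
  define F where "F = {y \<in> E. y \<noteq> e0 \<and> act t0 y = y}"
  have F: "t0 \<in> stab y" "t0 \<notin> C y" "y \<in> E" if "y \<in> F" for y
    using that t0 TI[OF e0, of y t0] by (auto simp: F_def stab_def)
  \<comment> \<open>The relation is symmetric: t0 fixes y iff t0 and z y commute iff z y fixes e0.
    So the other fixed points of t0 correspond to the reflections at e0.\<close>
  have "bij_betw z F (stab e0 - C e0)"
  proof (rule bij_betw_imageI)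
    show "inj_on z F" using z_inj F by (auto intro: inj_onI)
    show "z ` F = stab e0 - C e0"
    proof (intro equalityI subsetI)
      fix v assume "v \<in> z ` F"
      then obtain y where y: "y \<in> F" "v = z y" by blast
      have yE: "y \<in> E" using F y by blast
      have "t0 \<otimes> v = v \<otimes> t0" using t0_fix[OF yE] y by (simp add: F_def)
      then have "act v e0 = e0" using comm_fix[OF e0 IG[OF z(2)[OF yE]] t0(1,5)] y by simp
      then have "v \<in> stab e0" using IG z(2)[OF yE] y by (simp add: stab_def)
      moreover have "v \<notin> C e0" using TI[OF e0 yE, of v] z[OF yE] y by (auto simp: F_def I_def)
      ultimately show "v \<in> stab e0 - C e0" by simp
    next
      fix v assume v: "v \<in> stab e0 - C e0"
      have "v \<in> I" using v dl_sq[OF dl[OF e0]] sub_one[OF CE[OF e0]] by (auto simp: I_def stab_def)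
      then obtain y where y: "y \<in> E" "v = z y" using z_bij by (auto simp: bij_betw_def)
      have "v \<otimes> t0 = t0 \<otimes> v" using stab_z[OF e0, of v] v by (simp add: t0_def)
      then have "act t0 y = y" using t0_fix[OF y(1)] y by simp
      moreover have "y \<noteq> e0" using v y z(1)[OF e0] by auto
      ultimately show "v \<in> z ` F" using y by (auto simp: F_def)
    qed
  qed
  then have cF: "card F = n" using dl_card(1)[OF dl[OF e0] u0] bij_betw_same_card by (fastforce simp: n_def)
  \<comment> \<open>Pairs of a further fixed point y of t0 and a reflection t \<noteq> t0 at y. The
    nontrivial product t0 t lies in \<open>C y\<close>, so t determines y by
    \<open>TI\<close>.\<close>
  define S where "S = Sigma F (\<lambda>y. stab y - C y - {t0})"
  have "bij_betw snd S (I - {t0})"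
  proof (rule bij_betw_imageI)
    show "inj_on snd S"
    proof (rule inj_onI)
      fix a b assume ab: "a \<in> S" "b \<in> S" "snd a = snd b"
      obtain y t y' where yt: "a = (y, t)" "b = (y', t)" using ab(3) by (metis prod.collapse)
      have y: "y \<in> F" "t \<in> stab y" "t \<notin> C y" "t \<noteq> t0" "y' \<in> F" "t \<in> stab y'" "t \<notin> C y'"
        using ab yt by (auto simp: S_def)
      have "t0 \<otimes> t \<in> C y" "t0 \<otimes> t \<in> C y'" using dl_prod[OF dl] F y by blast+
      moreover have "t0 \<otimes> t \<noteq> \<one>"
        using y(2,4) t0(3) t0c[of t] by (auto simp: stab_def)
      ultimately have "y = y'" using TI F y by blast
      then show "a = b" using yt by simp
    qed
    show "snd ` S = I - {t0}"
    proof (intro equalityI subsetI)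
      fix t assume "t \<in> snd ` S"
      then obtain y where y: "y \<in> F" "t \<in> stab y" "t \<notin> C y" "t \<noteq> t0" unfolding S_def by force
      then show "t \<in> I - {t0}"
        using dl_sq[OF dl[OF F(3)[OF y(1)]]] sub_one[OF CE[OF F(3)[OF y(1)]]] by (auto simp: I_def stab_def)
    next
      fix t assume t: "t \<in> I - {t0}"
      then obtain y where y: "y \<in> E" "t0 \<otimes> t \<in> C y" using derangement by blast
      have tG: "t \<in> carrier G" "t \<otimes> t = \<one>" "inv t = t" using t inv_equality by (auto simp: I_def)
      define h where "h = t0 \<otimes> t"
      have hG: "h \<in> carrier G" using t0 tG by (simp add: h_def)
      have t_h: "t = t0 \<otimes> h" using tG t0(3,4) by (simp add: h_def m_assoc[symmetric])
      have h1: "h \<noteq> \<one>" using t t_h t0(3) by auto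
      have "t0 \<otimes> h \<otimes> inv t0 = inv h"
        using tG t0(3,4) t0i by (simp add: h_def inv_mult_group m_assoc[symmetric])
      then have "t0 \<otimes> h \<otimes> inv t0 \<in> C y" using y sub_inv[OF CE[OF y(1)]] by (simp add: h_def)
      then have fy: "act t0 y = y" using conj_in[OF y(1) t0(3) _ h1] y(2) by (simp add: h_def)
      have "y \<noteq> e0"
      proof
        assume "y = e0"
        then have "t0 \<otimes> h \<in> C e0" using y(2) t0(1) sub_mult[OF CE[OF e0]] by (simp add: h_def)
        then have "t \<in> C e0" using t_h by simp
        then have "t = z e0" using z_unique[OF e0] t by blast
        then show False using t by (simp add: t0_def)
      qed
      then have yF: "y \<in> F" using y fy by (simp add: F_def)
      have "t0 \<otimes> h \<in> stab y \<and> t0 \<otimes> h \<notin> C y"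
        using dl_coset[OF dl[OF y(1)] F(1,2)[OF yF] y(2)] by (simp add: h_def)
      then have "t \<in> stab y" "t \<notin> C y" unfolding t_h[symmetric] by auto
      then have "(y, t) \<in> S" using yF t by (simp add: S_def)
      then show "t \<in> snd ` S" by force
    qed
  qed
  then have "card S = card (I - {t0})" by (rule bij_betw_same_card)
  also have "card I = p\<^sup>2" using bij_betw_same_card[OF z_bij] cardE by simp
  then have "card (I - {t0}) = p\<^sup>2 - 1" using t0(2) by simp
  finally have "card S = p\<^sup>2 - 1" .
  moreover have "card S = (\<Sum>y\<in>F. card (stab y - C y - {t0}))"
    unfolding S_def by (rule card_SigmaI) (use finX fin in \<open>auto simp: F_def stab_def\<close>)
  moreover have "card (stab y - C y - {t0}) = n - 1" if "y \<in> F" for y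
    using dl_card(1)[OF dl[OF F(3)[OF that]] F(1,2)[OF that]] cardC[OF F(3)[OF that]] F(1,2)[OF that] by simp
  ultimately have "p\<^sup>2 - 1 = n * (n - 1)" using cF by simp
  moreover have "p > 1" using p(1) prime_gt_1_nat by blast
  ultimately have "p\<^sup>2 = n * (n - 1) + 1"
    by (metis Suc_eq_plus1 Suc_pred' one_less_power pos2 less_trans zero_less_one)
  then show False using nat_square_ne_consecutive_product \<open>p > 1\<close> by blast
qed

end

text \<open>Induction on the group order. If some involution avoids all cyclic parts, the sign
  transfer yields a subgroup of index two to which the induction hypothesis applies, and it contains
  every solution of g^(p^2) = \<one>. If every involution lies in a cyclic part, the counting
  argument rules out reflections in the stabilizers; they are cyclic, and the transfer into a
  stabilizer finishes.\<close>

theorem ti_action_normal_complement: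
  assumes "ti_action G E act C p"
  shows "subgroup {g \<in> carrier G. g [^]\<^bsub>G\<^esub> p\<^sup>2 = \<one>\<^bsub>G\<^esub>} G \<and> card {g \<in> carrier G. g [^]\<^bsub>G\<^esub> p\<^sup>2 = \<one>\<^bsub>G\<^esub>} = p\<^sup>2"
  using assms
proof (induction "card (carrier G)" arbitrary: G C rule: less_induct)
  case less
  interpret ti_action G E act C p by fact
  obtain e0 where e0: "e0 \<in> E" using E_nonempty by blast
  have tr0: "\<forall>x\<in>E. \<exists>g\<in>carrier G. act g e0 = x" using tr e0 by blast
  show ?case
  proof (cases "\<exists>u\<in>carrier G. u \<noteq> \<one>\<^bsub>G\<^esub> \<and> u \<otimes>\<^bsub>G\<^esub> u = \<one>\<^bsub>G\<^esub> \<and> (\<forall>x\<in>E. u \<notin> C x)")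
    case True
    then obtain u where u: "u \<in> carrier G" "u \<noteq> \<one>\<^bsub>G\<^esub>" "u \<otimes>\<^bsub>G\<^esub> u = \<one>\<^bsub>G\<^esub>" "\<And>x. x \<in> E \<Longrightarrow> u \<notin> C x" by blast
    have odd_card: "odd (card E)" using cardE p(2) by simp
    obtain G0 where G0: "subgroup G0 G" "u \<notin> G0"
      "\<And>g h. \<lbrakk>g \<in> carrier G; h \<in> carrier G; g \<notin> G0; h \<notin> G0\<rbrakk> \<Longrightarrow> g \<otimes>\<^bsub>G\<^esub> h \<in> G0"
      by (rule index_two_subgroup[of e0 C u]) (use odd_card e0 tr0 dl eqv u in auto)
    have G0G: "g \<in> carrier G" if "g \<in> G0" for g using that sub_mem[OF G0(1)] by blast
    have mult_notin: "g \<otimes>\<^bsub>G\<^esub> h \<notin> G0" if "g \<in> G0" "h \<in> carrier G" "h \<notin> G0" for g h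
    proof
      assume "g \<otimes>\<^bsub>G\<^esub> h \<in> G0"
      then have "inv\<^bsub>G\<^esub> g \<otimes>\<^bsub>G\<^esub> (g \<otimes>\<^bsub>G\<^esub> h) \<in> G0" using that sub_mult[OF G0(1)] sub_inv[OF G0(1)] by blast
      then show False using that G0G by (simp add: inv_cancel1)
    qed
    have conj_notin: "k \<otimes>\<^bsub>G\<^esub> u \<otimes>\<^bsub>G\<^esub> inv\<^bsub>G\<^esub> k \<notin> G0" if k: "k \<in> carrier G" for k
    proof
      assume a: "k \<otimes>\<^bsub>G\<^esub> u \<otimes>\<^bsub>G\<^esub> inv\<^bsub>G\<^esub> k \<in> G0"
      have ku: "k \<otimes>\<^bsub>G\<^esub> u = (k \<otimes>\<^bsub>G\<^esub> u \<otimes>\<^bsub>G\<^esub> inv\<^bsub>G\<^esub> k) \<otimes>\<^bsub>G\<^esub> k" using k u by (simp add: word_simps)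
      show False
      proof (cases "k \<in> G0")
        case True
        have "k \<otimes>\<^bsub>G\<^esub> u \<in> G0" by (subst ku) (rule sub_mult[OF G0(1) a True])
        then show False using mult_notin[OF True u(1) G0(2)] by blast
      next
        case False
        then have "k \<otimes>\<^bsub>G\<^esub> u \<in> G0" using G0(3)[OF k u(1)] G0(2) by blast
        then show False using mult_notin[OF a k False] ku[symmetric] by simp
      qed
    qed
    \<comment> \<open>The involution u fixes a point, since their number is odd. Hence every point
      is fixed by a conjugate of u, which lies outside G0, and an element moving x to y can be
      corrected by it to lie in G0.\<close>
    have reach: "\<exists>g\<in>G0. act g x = y" if xy: "x \<in> E" "y \<in> E" for x y
    proof -
      have U: "subgroup {\<one>\<^bsub>G\<^esub>, u} G" by (rule subgroup_finI) (use u in auto)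
      interpret B: fin_action "G\<lparr>carrier := {\<one>\<^bsub>G\<^esub>, u}\<rparr>" E act by (rule restrict_action[OF U])
      have c2: "card {\<one>\<^bsub>G\<^esub>, u} = 2 ^ 1" using u(2) by simp
      have "[card E = card {x \<in> E. \<forall>g\<in>{\<one>\<^bsub>G\<^esub>, u}. act g x = x}] (mod 2)"
        using B.p_group_fixed_points[OF two_is_prime_nat, of 1] c2 by simp
      then have "odd (card {x \<in> E. \<forall>g\<in>{\<one>\<^bsub>G\<^esub>, u}. act g x = x})" using odd_card cong_dvd_iff by blast
      then have "{x \<in> E. \<forall>g\<in>{\<one>\<^bsub>G\<^esub>, u}. act g x = x} \<noteq> {}" by (metis card.empty even_zero)
      then obtain w where "w \<in> {x \<in> E. \<forall>g\<in>{\<one>\<^bsub>G\<^esub>, u}. act g x = x}" by blast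
      then have w: "w \<in> E" "act u w = w" by auto
      obtain k where k: "k \<in> carrier G" "act k w = x" using tr[OF w(1) xy(1)] by blast
      define s where "s = k \<otimes>\<^bsub>G\<^esub> u \<otimes>\<^bsub>G\<^esub> inv\<^bsub>G\<^esub> k"
      have "u \<in> stab w" using u(1) w(2) by (simp add: stab_def)
      then have s: "s \<in> carrier G" "act s x = x" "s \<notin> G0"
        using stab_conj_mem[OF w(1) k(1)] k(2) conj_notin[OF k(1)] by (auto simp: s_def stab_def)
      obtain g where g: "g \<in> carrier G" "act g x = y" using tr[OF xy] by blast
      show ?thesis
      proof (cases "g \<in> G0")
        case False
        then have "g \<otimes>\<^bsub>G\<^esub> s \<in> G0" using G0(3) g s by blast
        moreover have "act (g \<otimes>\<^bsub>G\<^esub> s) x = y" using g s xy act_mult by simp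
        ultimately show ?thesis by blast
      qed (use g in blast)
    qed
    let ?H = "G\<lparr>carrier := G0\<rparr>"
    interpret R: fin_action ?H E act by (rule restrict_action[OF G0(1)])
    have Rstab: "R.stab x = stab x \<inter> G0" for x using G0G by (auto simp: R.stab_def stab_def)
    have "ti_action ?H E act (\<lambda>x. C x \<inter> G0) p"
    proof
      show "dihedral_like ?H (R.stab x) (C x \<inter> G0)" if "x \<in> E" for x
        unfolding Rstab by (rule dl_restrict[OF dl[OF that] G0(1)])
      show "C (act g x) \<inter> G0 = (\<lambda>c. g \<otimes>\<^bsub>?H\<^esub> c \<otimes>\<^bsub>?H\<^esub> inv\<^bsub>?H\<^esub> g) ` (C x \<inter> G0)"
        if "g \<in> carrier ?H" "x \<in> E" for g x
      proof -
        have g: "g \<in> G0" "g \<in> carrier G" using that G0G by auto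
        have i: "inv\<^bsub>?H\<^esub> g = inv\<^bsub>G\<^esub> g" using m_inv_consistent[OF G0(1)] g by simp
        have "g \<otimes>\<^bsub>G\<^esub> c \<otimes>\<^bsub>G\<^esub> inv\<^bsub>G\<^esub> g \<in> G0 \<longleftrightarrow> c \<in> G0" if "c \<in> C x" for c
        proof
          have cG: "c \<in> carrier G" using C_carrier[OF \<open>x \<in> E\<close> that] .
          assume "g \<otimes>\<^bsub>G\<^esub> c \<otimes>\<^bsub>G\<^esub> inv\<^bsub>G\<^esub> g \<in> G0"
          then have "inv\<^bsub>G\<^esub> g \<otimes>\<^bsub>G\<^esub> (g \<otimes>\<^bsub>G\<^esub> c \<otimes>\<^bsub>G\<^esub> inv\<^bsub>G\<^esub> g) \<otimes>\<^bsub>G\<^esub> g \<in> G0"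
            using g sub_mult[OF G0(1)] sub_inv[OF G0(1)] by blast
          then show "c \<in> G0" using g cG by (simp add: word_simps)
        qed (use g sub_mult[OF G0(1)] sub_inv[OF G0(1)] in blast)
        then show ?thesis using eqv[OF g(2) that(2)] i by auto
      qed
    qed (use p cardE reach TI in auto)
    moreover have "card (carrier ?H) < card (carrier G)"
      using G0 G0G u(1) fin by (auto intro!: psubset_card_mono)
    ultimately have ih: "subgroup {g \<in> carrier ?H. g [^]\<^bsub>?H\<^esub> p\<^sup>2 = \<one>\<^bsub>?H\<^esub>} ?H \<and> card {g \<in> carrier ?H. g [^]\<^bsub>?H\<^esub> p\<^sup>2 = \<one>\<^bsub>?H\<^esub>} = p\<^sup>2"
      using less.hyps by blast
    \<comment> \<open>Elements of odd order are generated by their squares, and squares lie in the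
      index-two subgroup.\<close>
    have "g \<in> G0" if g: "g \<in> carrier G" "g [^]\<^bsub>G\<^esub> p\<^sup>2 = \<one>\<^bsub>G\<^esub>" for g
    proof (rule ccontr)
      assume n: "g \<notin> G0"
      have "odd (p\<^sup>2)" using p(2) by simp
      then obtain j where j: "p\<^sup>2 = 2 * j + 1" by (rule oddE)
      have "(g \<otimes>\<^bsub>G\<^esub> g) [^]\<^bsub>G\<^esub> j \<in> G0" using pow_sub[OF G0(1) G0(3)[OF g(1) g(1) n n]] by blast
      then have "(g \<otimes>\<^bsub>G\<^esub> g) [^]\<^bsub>G\<^esub> j \<otimes>\<^bsub>G\<^esub> g \<notin> G0" using mult_notin g(1) n by blast
      moreover have "(g \<otimes>\<^bsub>G\<^esub> g) [^]\<^bsub>G\<^esub> j \<otimes>\<^bsub>G\<^esub> g = g [^]\<^bsub>G\<^esub> p\<^sup>2"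
      proof -
        have "g \<otimes>\<^bsub>G\<^esub> g = g [^]\<^bsub>G\<^esub> (2::nat)" using g(1) by (simp add: numeral_2_eq_2)
        then show ?thesis using g(1) j by (simp add: nat_pow_pow)
      qed
      ultimately show False using g(2) sub_one[OF G0(1)] by simp
    qed
    then have eq: "{g \<in> carrier ?H. g [^]\<^bsub>?H\<^esub> p\<^sup>2 = \<one>\<^bsub>?H\<^esub>} = {g \<in> carrier G. g [^]\<^bsub>G\<^esub> p\<^sup>2 = \<one>\<^bsub>G\<^esub>}"
      using G0G by (auto simp: nat_pow_consistent[symmetric])
    show ?thesis using ih incl_subgroup[OF G0(1)] unfolding eq by blast
  next
    case False
    have "stab e0 \<subseteq> C e0"
      using all_involutions_conjugate_contradiction[OF e0] False by blast
    then have eq0: "stab e0 = C e0" using C_stab[OF e0] by blast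
    have eq: "stab x = C x" if x: "x \<in> E" for x
    proof -
      obtain g where g: "g \<in> carrier G" "act g e0 = x" using tr[OF e0 x] by blast
      show ?thesis using stab_conj[OF e0 g(1)] eqv[OF g(1) e0] g(2) eq0 by simp
    qed
    show ?thesis
    proof (rule abelian_stabilizer_complement[OF p(1) cardE e0 tr0])
      show "x \<otimes>\<^bsub>G\<^esub> y = y \<otimes>\<^bsub>G\<^esub> x" if "x \<in> stab e0" "y \<in> stab e0" for x y
        using dl_comm[OF dl[OF e0]] that eq0 by simp
      show "x = e0" if "x \<in> E" "u \<in> stab e0" "u \<noteq> \<one>\<^bsub>G\<^esub>" "act u x = x" for x u
      proof -
        have "u \<in> stab x" using that by (simp add: stab_def)
        then show ?thesis using TI[OF that(1) e0 _ _ that(3)] eq[OF that(1)] that(2) eq0 by blast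
      qed
    qed (rule p_not_dvd_stab[OF e0])
  qed
qed

section \<open>Core-free dihedral-like subgroups of prime index\<close>

context fin_group
begin

lemma conj_subgroup_eq:
  assumes "subgroup P G" "subgroup Q G" "card P = card Q" "x \<in> carrier G"
    "\<And>u. u \<in> P \<Longrightarrow> x \<otimes> u \<otimes> inv x \<in> Q"
  shows "(\<lambda>h. x \<otimes> h \<otimes> inv x) ` P = Q"
  by (rule card_subset_eq) (use assms conj_sub(2)[OF assms(1,4)] fin_sub in auto)

text \<open>Inside the normalizer of \<open>P\<close> the subgroup \<open>P\<close> is a normal
  Sylow p-subgroup, so a subgroup of order p there is conjugate into \<open>P\<close>, hence equal
  to it.\<close>

lemma normalizing_prime_subgroups_eq:
  assumes p: "Factorial_Ring.prime p" and P: "subgroup P G" "card P = p" and R: "subgroup R G" "card R = p"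
    and cG: "card (carrier G) = p * m" "\<not> p dvd m"
    and nrm: "\<And>x y. \<lbrakk>x \<in> R; y \<in> P\<rbrakk> \<Longrightarrow> x \<otimes> y \<otimes> inv x \<in> P"
  shows "R = P"
proof -
  define N where "N = {g \<in> carrier G. \<forall>d\<in>P. g \<otimes> d \<otimes> inv g \<in> P}"
  have PG: "P \<subseteq> carrier G" using subgroup.subset[OF P(1)] .
  have N: "subgroup N G" unfolding N_def by (rule normalizer_sub[OF PG fin_sub[OF P(1)]])
  have PN: "P \<subseteq> N" using PG sub_mult[OF P(1)] sub_inv[OF P(1)] by (auto simp: N_def)
  have RN: "R \<subseteq> N" using nrm sub_mem[OF R(1)] by (auto simp: N_def)
  interpret N: fin_group "G\<lparr>carrier := N\<rparr>" by (rule fin_group_sub[OF N])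
  obtain k where k: "card N = card P * k" using card_dvd[OF P(1) N PN] by (auto elim: dvdE)
  have "card N dvd p * m" using card_dvd_carrier[OF N] cG by simp
  then have "p * k dvd p * m" using k P by simp
  then have "k dvd m" using p by (simp add: prime_gt_0_nat)
  then have nk: "\<not> p dvd k" using cG(2) dvd_trans by blast
  have sub: "subgroup R (G\<lparr>carrier := N\<rparr>)" "subgroup P (G\<lparr>carrier := N\<rparr>)"
    using subgroup_incl[OF R(1) N RN] subgroup_incl[OF P(1) N PN] by auto
  obtain x where x: "x \<in> N" "\<And>u. u \<in> R \<Longrightarrow> x \<otimes> u \<otimes> inv\<^bsub>G\<lparr>carrier := N\<rparr>\<^esub> x \<in> P"
    by (rule N.p_subgroup_fixes_coset[OF p sub(1) _ sub(2) _ nk, of 1]) (use R P k in auto)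
  have ix: "inv\<^bsub>G\<lparr>carrier := N\<rparr>\<^esub> x = inv x" using m_inv_consistent[OF N x(1)] .
  have xG: "x \<in> carrier G" using x sub_mem[OF N] by blast
  have "R \<subseteq> P"
  proof
    fix u assume u: "u \<in> R"
    have uG: "u \<in> carrier G" using u sub_mem[OF R(1)] by blast
    have "x \<otimes> u \<otimes> inv x \<in> P" using x(2)[OF u] ix by simp
    moreover have "\<forall>d\<in>P. inv x \<otimes> d \<otimes> inv (inv x) \<in> P" using sub_inv[OF N x(1)] by (simp add: N_def)
    ultimately have "inv x \<otimes> (x \<otimes> u \<otimes> inv x) \<otimes> inv (inv x) \<in> P" by blast
    then show "u \<in> P" using uG xG by (simp add: word_simps)
  qed
  then show ?thesis by (intro card_subset_eq fin_sub P(1)) (use R P in auto)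
qed

text \<open>Let D be the set of all c in C with g c g^-1 in C. It is normal in H, so by maximality
  its normalizer is H or G. If it is G, then D lies in the core and is trivial. If it is H, then g D
  g^-1 \<subseteq> C is normal in H too, so g^-1 H g normalizes D and lies in H; but H is
  self-normalizing and g lies outside it.\<close>

lemma maximal_core_free_TI:
  assumes dl: "dihedral_like G H C"
    and maxH: "\<And>N. \<lbrakk>subgroup N G; H \<subseteq> N\<rbrakk> \<Longrightarrow> N = H \<or> N = carrier G"
    and core: "\<And>h. \<lbrakk>h \<in> H; \<And>g. g \<in> carrier G \<Longrightarrow> g \<otimes> h \<otimes> inv g \<in> H\<rbrakk> \<Longrightarrow> h = \<one>"
    and gh0: "g0 \<in> carrier G" "h0 \<in> H" "g0 \<otimes> h0 \<otimes> inv g0 \<notin> H"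
    and g: "g \<in> carrier G" "g \<notin> H" and c: "c \<in> C" "g \<otimes> c \<otimes> inv g \<in> C"
  shows "c = \<one>"
proof -
  note H = dl_sub(1)[OF dl] and C = dl_sub(2)[OF dl] and CH = dl_sub(3)[OF dl]
  have HG: "H \<subseteq> carrier G" using subgroup.subset[OF H] .
  have CG: "c \<in> carrier G" if "c \<in> C" for c using that CH HG by blast
  have normalizerH: "g \<in> H" if g: "g \<in> carrier G" "\<And>h. h \<in> H \<Longrightarrow> g \<otimes> h \<otimes> inv g \<in> H" for g
  proof (rule ccontr)
    assume n: "g \<notin> H"
    define N where "N = {g \<in> carrier G. \<forall>d\<in>H. g \<otimes> d \<otimes> inv g \<in> H}"
    have N: "subgroup N G" unfolding N_def by (rule normalizer_sub[OF HG fin_sub[OF H]])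
    have "H \<subseteq> N" using HG sub_mult[OF H] sub_inv[OF H] by (auto simp: N_def)
    moreover have "g \<in> N" using g by (simp add: N_def)
    ultimately have "N = carrier G" using maxH[OF N] n by blast
    then show False using gh0 by (auto simp: N_def)
  qed
    define D where "D = {c \<in> C. g \<otimes> c \<otimes> inv g \<in> C}"
    have D: "subgroup D G"
    proof (rule subgroup_finI)
      fix x y assume "x \<in> D" "y \<in> D"
      then have xy: "x \<in> C" "y \<in> C" "g \<otimes> x \<otimes> inv g \<in> C" "g \<otimes> y \<otimes> inv g \<in> C" by (auto simp: D_def)
      have "g \<otimes> (x \<otimes> y) \<otimes> inv g = (g \<otimes> x \<otimes> inv g) \<otimes> (g \<otimes> y \<otimes> inv g)"
        using xy(1,2) CG g(1) by (simp add: word_simps)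
      then show "x \<otimes> y \<in> D" using xy sub_mult[OF C] by (simp add: D_def)
    qed (use g sub_one[OF C] CG in \<open>auto simp: D_def\<close>)
    have DC: "D \<subseteq> C" by (auto simp: D_def)
    have DG: "D \<subseteq> carrier G" using DC CG by blast
    define N where "N = {g \<in> carrier G. \<forall>d\<in>D. g \<otimes> d \<otimes> inv g \<in> D}"
    have N: "subgroup N G" unfolding N_def by (rule normalizer_sub[OF DG fin_sub[OF D]])
    have HN: "H \<subseteq> N" using dl_normal[OF dl D DC] HG by (auto simp: N_def)
    consider "N = H" | "N = carrier G" using maxH[OF N HN] by blast
    then show "c = \<one>"
    proof cases
      case 1
      have Dg: "subgroup ((\<lambda>d. g \<otimes> d \<otimes> inv g) ` D) G" "(\<lambda>d. g \<otimes> d \<otimes> inv g) ` D \<subseteq> C"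
        using conj_sub(1)[OF D g(1)] by (auto simp: D_def)
      have "inv g \<otimes> h \<otimes> inv (inv g) \<in> N" if h: "h \<in> H" for h
      proof -
        have hG: "h \<in> carrier G" using h HG by blast
        have "inv g \<otimes> h \<otimes> g \<otimes> d \<otimes> inv (inv g \<otimes> h \<otimes> g) \<in> D" if d: "d \<in> D" for d
        proof -
          have dG: "d \<in> carrier G" using d DG by blast
          have "h \<otimes> (g \<otimes> d \<otimes> inv g) \<otimes> inv h \<in> (\<lambda>d. g \<otimes> d \<otimes> inv g) ` D"
            using dl_normal[OF dl Dg h] d by blast
          then obtain d' where d': "d' \<in> D" "h \<otimes> (g \<otimes> d \<otimes> inv g) \<otimes> inv h = g \<otimes> d' \<otimes> inv g" by blast
          have d'G: "d' \<in> carrier G" using d' DG by blast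
          have "inv g \<otimes> h \<otimes> g \<otimes> d \<otimes> inv (inv g \<otimes> h \<otimes> g) = inv g \<otimes> (h \<otimes> (g \<otimes> d \<otimes> inv g) \<otimes> inv h) \<otimes> g"
            using g(1) hG dG by (simp add: word_simps)
          also have "\<dots> = d'" unfolding d'(2) using g(1) d'G by (simp add: word_simps)
          finally show ?thesis using d' by simp
        qed
        then show ?thesis using hG g(1) by (simp add: N_def)
      qed
      then have "inv g \<in> H" using normalizerH[of "inv g"] g(1) 1 by blast
      then have "inv (inv g) \<in> H" using sub_inv[OF H] by blast
      then show ?thesis using g by simp
    next
      case 2
      have cD: "c \<in> D" using c by (simp add: D_def)
      then have "g \<otimes> c \<otimes> inv g \<in> H" if "g \<in> carrier G" for g
        using 2 that DC CH unfolding N_def by blast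
      then show ?thesis using core c CH by blast
    qed
qed

text \<open>Prime degree. A conjugate of C meeting H trivially makes H and the cosets Hgc (c in C)
  distinct, so |C| < p and |H| \<le> 2(p - 1). The number of Sylow p-subgroups is 1 + pt and divides
  |H|, so t \<le> 1. If t = 1, then |H| = p + 1 and the elements outside H are exactly those of
  order p; H would be invariant under conjugation.\<close>

lemma prime_index_core_free:
  assumes p: "Factorial_Ring.prime p" "odd p" and cG: "card (carrier G) = p * card H"
    and dl: "dihedral_like G H C"
    and core: "\<And>h. \<lbrakk>h \<in> H; \<And>g. g \<in> carrier G \<Longrightarrow> g \<otimes> h \<otimes> inv g \<in> H\<rbrakk> \<Longrightarrow> h = \<one>"
  shows "subgroup {g \<in> carrier G. g [^] p = \<one>} G" "card {g \<in> carrier G. g [^] p = \<one>} = p" "\<not> p dvd card H"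
proof -
  note H = dl_sub(1)[OF dl] and C = dl_sub(2)[OF dl] and CH = dl_sub(3)[OF dl]
  have HG: "H \<subseteq> carrier G" using subgroup.subset[OF H] .
  have CG: "c \<in> carrier G" if "c \<in> C" for c using that CH HG by blast
  have p1: "p > 1" using prime_gt_1_nat[OF p(1)] .
  have maxH: "N = H \<or> N = carrier G" if "subgroup N G" "H \<subseteq> N" for N
    using mem_by_index[OF H subgroup_self HG cG p(1) that subgroup.subset[OF that(1)]] .
  have H_not_G: "H \<noteq> carrier G" using cG p1 card_sub_pos[OF H] by auto
  show "subgroup {g \<in> carrier G. g [^] p = \<one>} G" "card {g \<in> carrier G. g [^] p = \<one>} = p" "\<not> p dvd card H"
  proof -
    have "subgroup {g \<in> carrier G. g [^] p = \<one>} G \<and> card {g \<in> carrier G. g [^] p = \<one>} = p \<and> \<not> p dvd card H"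
    proof (cases "\<forall>g\<in>carrier G. \<forall>h\<in>H. g \<otimes> h \<otimes> inv g \<in> H")
      case True
      then have H1: "H = {\<one>}" using core sub_one[OF H] by blast
      then have "card (carrier G) = p" using cG by simp
      then have "{g \<in> carrier G. g [^] p = \<one>} = carrier G" using pow_card_sub[OF subgroup_self] by auto
      then show ?thesis using H1 \<open>card (carrier G) = p\<close> p1 subgroup_self by simp
    next
      case False
      then obtain g0 h0 where gh0: "g0 \<in> carrier G" "h0 \<in> H" "g0 \<otimes> h0 \<otimes> inv g0 \<notin> H" by blast
      have TI: "c = \<one>" if "g \<in> carrier G" "g \<notin> H" "c \<in> C" "g \<otimes> c \<otimes> inv g \<in> C" for g c
        by (rule maximal_core_free_TI[OF dl maxH core gh0 that])
      \<comment> \<open>If C contains an involution z, g is chosen to move z out of H. An element c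
        of C conjugated by g to a reflection in H would be an involution, hence equal to z. Without
        such a z any g outside H works.\<close>
      obtain g where g: "g \<in> carrier G" "g \<notin> H" "\<And>c. \<lbrakk>c \<in> C; g \<otimes> c \<otimes> inv g \<in> H\<rbrakk> \<Longrightarrow> c = \<one>"
      proof (cases "\<exists>z\<in>C. z \<noteq> \<one> \<and> z \<otimes> z = \<one>")
        case True
        then obtain z where z: "z \<in> C" "z \<noteq> \<one>" "z \<otimes> z = \<one>" by blast
        then obtain g where g: "g \<in> carrier G" "g \<otimes> z \<otimes> inv g \<notin> H" using core CH by blast
        have gH: "g \<notin> H" using g z CH sub_mult[OF H] sub_inv[OF H] by blast
        have "c = \<one>" if c: "c \<in> C" "g \<otimes> c \<otimes> inv g \<in> H" for c
        proof (cases "g \<otimes> c \<otimes> inv g \<in> C")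
          case True then show ?thesis using TI[OF g(1) gH c(1)] by blast
        next
          case False
          have cG: "c \<in> carrier G" using c CG by blast
          have "(g \<otimes> c \<otimes> inv g) \<otimes> (g \<otimes> c \<otimes> inv g) = \<one>" using dl_sq[OF dl c(2) False] .
          then have "g \<otimes> (c \<otimes> c) \<otimes> inv g = \<one>" using g(1) cG by (simp add: word_simps)
          then have "c \<otimes> c = \<one>" using conj_one_iff[OF g(1)] cG by simp
          then show ?thesis using dl_unique_involution[OF dl c(1) z(1)] z c g by blast
        qed
        then show thesis using that[OF g(1) gH] by blast
      next
        case noinv: False
        obtain g where g: "g \<in> carrier G" "g \<notin> H" using H_not_G HG by blast
        have "c = \<one>" if c: "c \<in> C" "g \<otimes> c \<otimes> inv g \<in> H" for c
        proof (cases "g \<otimes> c \<otimes> inv g \<in> C")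
          case True then show ?thesis using TI[OF g c(1)] by blast
        next
          case False
          have cG: "c \<in> carrier G" using c CG by blast
          have "(g \<otimes> c \<otimes> inv g) \<otimes> (g \<otimes> c \<otimes> inv g) = \<one>" using dl_sq[OF dl c(2) False] .
          then have "g \<otimes> (c \<otimes> c) \<otimes> inv g = \<one>" using g(1) cG by (simp add: word_simps)
          then have "c \<otimes> c = \<one>" using conj_one_iff[OF g(1)] cG by simp
          then show ?thesis using noinv c by blast
        qed
        then show thesis using that[OF g] by blast
      qed
      have "card C < p"
      proof -
        have inj: "inj_on (\<lambda>c. H #> (g \<otimes> c)) C"
        proof (rule inj_onI)
          fix c d assume cd: "c \<in> C" "d \<in> C" "H #> (g \<otimes> c) = H #> (g \<otimes> d)"
          have cdG: "c \<in> carrier G" "d \<in> carrier G" using cd CG by auto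
          have "g \<otimes> c \<in> H #> (g \<otimes> d)" using rcos_self[OF _ H, of "g \<otimes> c"] cd(3) g(1) cdG by simp
          then have "g \<otimes> c \<otimes> inv (g \<otimes> d) \<in> H"
            using subgroup.rcos_module[OF H is_group, of "g \<otimes> d" "g \<otimes> c"] g(1) cdG by simp
          then have "g \<otimes> (c \<otimes> inv d) \<otimes> inv g \<in> H" using g(1) cdG by (simp add: word_simps)
          then have "c \<otimes> inv d = \<one>" using g(3) sub_mult[OF C cd(1) sub_inv[OF C cd(2)]] by blast
          then have "c \<otimes> inv d \<otimes> d = d" using cdG by simp
          then show "c = d" using cdG by (simp add: m_assoc)
        qed
        have nH: "H \<notin> (\<lambda>c. H #> (g \<otimes> c)) ` C"
        proof
          assume "H \<in> (\<lambda>c. H #> (g \<otimes> c)) ` C"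
          then obtain c where c: "c \<in> C" "H = H #> (g \<otimes> c)" by blast
          have "g \<otimes> c \<in> H" using rcos_self[OF _ H, of "g \<otimes> c"] c(2) CG[OF c(1)] g(1) by simp
          then have "g \<otimes> c \<otimes> inv c \<in> H" using sub_mult[OF H] sub_inv[OF H] c CH by blast
          then show False using g CG[OF c(1)] by (simp add: m_assoc)
        qed
        have H1: "H #> \<one> \<in> rcosets H" by (rule rcosetsI[OF HG one_closed])
        have "insert H ((\<lambda>c. H #> (g \<otimes> c)) ` C) \<subseteq> rcosets H"
          using H1 HG g(1) CG rcosetsI[OF HG] by auto
        then have "card (insert H ((\<lambda>c. H #> (g \<otimes> c)) ` C)) \<le> card (rcosets H)"
          using card_mono fin_action.finX[OF rcosets_action[OF H]] by blast
        then show ?thesis using nH inj fin_sub[OF C] card_rcosets[OF H cG] by (simp add: card_image)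
      qed
      then have H_le: "card H \<le> 2 * (p - 1)" using dl_card_le[OF dl] by linarith
      have C0: "card C > 0" using card_sub_pos[OF C] .
      have ndvd: "\<not> p dvd card H"
      proof
        assume pd: "p dvd card H"
        have "card H = card C \<or> card H = 2 * card C" using dl_card(2)[OF dl] CH by (metis subset_antisym subsetI)
        moreover have "\<not> p dvd card C" using \<open>card C < p\<close> C0 by (simp add: nat_dvd_not_less)
        ultimately have "p dvd 2" using pd p(1) prime_dvd_mult_iff by metis
        then have "p \<le> 2" by (simp add: dvd_imp_le)
        then show False using p(2) p1 by (metis Suc_1 Suc_leI even_numeral le_antisym numeral_2_eq_2)
      qed
      define \<P> where "\<P> = {P. subgroup P G \<and> card P = p}"
      have "p ^ 1 dvd card (carrier G)" using cG by simp
      then obtain P0 where P0: "subgroup P0 G" "card P0 = p" using sylow_sub[OF p(1), of 1] by auto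
      interpret A: fin_action G \<P> "\<lambda>g P. (\<lambda>h. g \<otimes> h \<otimes> inv g) ` P"
      proof
        have "\<P> \<subseteq> Pow (carrier G)" using subgroup.subset by (auto simp: \<P>_def)
        then show "finite \<P>" using fin finite_subset by blast
        show "(\<lambda>h. g \<otimes> h \<otimes> inv g) ` P \<in> \<P>" if "g \<in> carrier G" "P \<in> \<P>" for g P
          using that conj_sub by (auto simp: \<P>_def)
        show "(\<lambda>h. \<one> \<otimes> h \<otimes> inv \<one>) ` P = P" if "P \<in> \<P>" for P
          using that sub_mem by (force simp: \<P>_def)
        show "(\<lambda>x. g \<otimes> h \<otimes> x \<otimes> inv (g \<otimes> h)) ` P = (\<lambda>h. g \<otimes> h \<otimes> inv g) ` (\<lambda>x. h \<otimes> x \<otimes> inv h) ` P"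
          if "g \<in> carrier G" "h \<in> carrier G" "P \<in> \<P>" for g h P
          unfolding image_image
          by (rule image_cong) (use that sub_mem in \<open>auto simp: \<P>_def word_simps\<close>)
      qed
      have P0P: "P0 \<in> \<P>" using P0 by (simp add: \<P>_def)
      interpret B: fin_action "G\<lparr>carrier := P0\<rparr>" \<P> "\<lambda>g P. (\<lambda>h. g \<otimes> h \<otimes> inv g) ` P"
        by (rule A.restrict_action[OF P0(1)])
      \<comment> \<open>Only P0 itself is normalized by P0, so the number of subgroups of order p is
        1 modulo p.\<close>
      have "{P \<in> \<P>. \<forall>g\<in>P0. (\<lambda>h. g \<otimes> h \<otimes> inv g) ` P = P} = {P0}"
      proof (intro equalityI subsetI)
        fix P assume P: "P \<in> {P \<in> \<P>. \<forall>g\<in>P0. (\<lambda>h. g \<otimes> h \<otimes> inv g) ` P = P}"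
        have "P0 = P"
          by (rule normalizing_prime_subgroups_eq[OF p(1) _ _ P0 cG ndvd]) (use P in \<open>auto simp: \<P>_def\<close>)
        then show "P \<in> {P0}" by simp
      next
        fix P assume "P \<in> {P0}"
        moreover have "(\<lambda>h. g \<otimes> h \<otimes> inv g) ` P0 = P0" if "g \<in> P0" for g
          by (rule conj_subgroup_eq[OF P0(1) P0(1) refl sub_mem[OF P0(1) that]])
            (use that sub_mult[OF P0(1)] sub_inv[OF P0(1)] in blast)
        ultimately show "P \<in> {P \<in> \<P>. \<forall>g\<in>P0. (\<lambda>h. g \<otimes> h \<otimes> inv g) ` P = P}" using P0P by blast
      qed
      then have s1: "[card \<P> = 1] (mod p)" using B.p_group_fixed_points[OF p(1), of 1] P0 by simp
      have orb: "A.orbit P0 = \<P>"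
      proof
        show "A.orbit P0 \<subseteq> \<P>" using A.act_closed P0P by (auto simp: A.orbit_def)
        show "\<P> \<subseteq> A.orbit P0"
        proof
          fix P assume "P \<in> \<P>"
          then have P: "subgroup P G" "card P = p" by (auto simp: \<P>_def)
          have "card (carrier G) = card H * card P0" using cG P0 by simp
          then obtain x where x: "x \<in> carrier G" "\<And>u. u \<in> P \<Longrightarrow> x \<otimes> u \<otimes> inv x \<in> P0"
            using p_subgroup_fixes_coset[OF p(1) P(1) _ P0(1) _ ndvd, of 1] P(2) by auto
          have "(\<lambda>h. x \<otimes> h \<otimes> inv x) ` P = P0"
            by (rule conj_subgroup_eq[OF P(1) P0(1) _ x(1)]) (use P P0 x in auto)
          then have "P0 \<in> A.orbit P" unfolding A.orbit_def using x(1) by blast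
          then have "A.orbit P0 = A.orbit P" using A.orbit_eq P by (simp add: \<P>_def)
          then show "P \<in> A.orbit P0" using A.orbit_self P by (simp add: \<P>_def)
        qed
      qed
      have P0st: "P0 \<subseteq> A.stab P0"
      proof
        fix g assume g: "g \<in> P0"
        have "(\<lambda>h. g \<otimes> h \<otimes> inv g) ` P0 = P0"
          by (rule conj_subgroup_eq[OF P0(1) P0(1) refl sub_mem[OF P0(1) g]])
            (use g sub_mult[OF P0(1)] sub_inv[OF P0(1)] in blast)
        then show "g \<in> A.stab P0" using sub_mem[OF P0(1) g] by (simp add: A.stab_def)
      qed
      obtain m where m: "card (A.stab P0) = p * m"
        using card_dvd[OF P0(1) A.stab_sub[OF P0P] P0st] P0(2) by (auto elim: dvdE)
      have "card \<P> * (p * m) = p * card H" using A.orbit_stab[OF P0P] orb m cG by simp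
      then have sm: "card \<P> * m = card H" using p1 by simp
      have H0: "card H > 0" using card_sub_pos[OF H] .
      have m0: "m > 0" using sm H0 by (metis mult_0_right less_irrefl neq0_conv)
      have "card \<P> \<le> 2 * (p - 1)" using sm m0 H_le H0 by (metis dvd_imp_le dvd_triv_left order_trans)
      have spos: "card \<P> > 0" using A.finX P0P by (auto simp: card_gt_0_iff)
      obtain t where t: "card \<P> = 1 + p * t"
        using s1 spos by (metis add.commute cong_to_1_nat cong_sym dvdE le_add_diff_inverse Suc_leI One_nat_def plus_1_eq_Suc Suc_eq_plus1)
      have "t < 2"
      proof (rule ccontr)
        assume "\<not> t < 2"
        then have "p * 2 \<le> p * t" by simp
        then show False using t \<open>card \<P> \<le> 2 * (p - 1)\<close> by linarith
      qed
      define U where "U = {x \<in> carrier G. x \<noteq> \<one> \<and> x [^] p = \<one>}"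
      have gen: "generate G {x} \<in> \<P> \<and> x \<in> generate G {x}" if x: "x \<in> U" for x
      proof -
        have xG: "x \<in> carrier G" using x by (simp add: U_def)
        have "ord x dvd p" "ord x \<noteq> 1" using x pow_eq_id[OF xG] ord_eq_1[OF xG] by (auto simp: U_def)
        then have "ord x = p" using p(1) by (metis prime_nat_iff)
        then show ?thesis using xG generate_is_subgroup[of "{x}"] generate_pow_card[OF xG]
          by (simp add: \<P>_def generate.incl)
      qed
      have PU: "P - {\<one>} \<subseteq> U" if "P \<in> \<P>" for P
        using that pow_card_sub sub_mem by (auto simp: \<P>_def U_def)
      show ?thesis
      proof (cases "t = 0")
        case True
        then have "card \<P> = 1" using t by simp
        then have P1: "\<P> = {P0}" using P0P by (metis card_1_singletonE singletonD)
        have "{g \<in> carrier G. g [^] p = \<one>} = P0"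
        proof (intro equalityI subsetI)
          fix x assume x: "x \<in> {g \<in> carrier G. g [^] p = \<one>}"
          show "x \<in> P0"
          proof (cases "x = \<one>")
            case True then show ?thesis using sub_one[OF P0(1)] by simp
          next
            case False
            then have "x \<in> U" using x by (simp add: U_def)
            then show ?thesis using gen P1 by blast
          qed
        next
          fix x assume "x \<in> P0"
          then show "x \<in> {g \<in> carrier G. g [^] p = \<one>}" using pow_card_sub[OF P0(1)] P0(2) sub_mem[OF P0(1)] by auto
        qed
        then show ?thesis using P0 ndvd by simp
      next
        case False
        then have "t = 1" using \<open>t < 2\<close> by simp
        then have sp: "card \<P> = p + 1" using t by simp
        have "m = 1"
        proof (rule ccontr)
          assume "m \<noteq> 1"
          then have "(p + 1) * 2 \<le> (p + 1) * m" using m0 by (intro mult_le_mono2) simp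
          moreover have "(p + 1) * m = card H" using sm unfolding sp .
          ultimately have "(p + 1) * 2 \<le> card H" by metis
          moreover have "2 * (p - 1) < (p + 1) * 2" by (cases p) auto
          ultimately show False using H_le by (metis le_trans linorder_not_le)
        qed
        then have cH: "card H = p + 1" using sm sp by simp
        have "card U = card (\<Union>P\<in>\<P>. P - {\<one>})"
          using gen PU by (intro arg_cong[of _ _ card]) (auto simp: U_def)
        \<comment> \<open>This route is only reached for \<open>t = 1\<close>; distinct subgroups of
          order p share only \<one>, which gives (p + 1)(p - 1) elements of order p.\<close>
        also have "\<dots> = (\<Sum>P\<in>\<P>. card (P - {\<one>}))"
        proof (rule card_UN_disjoint[OF A.finX])
          show "\<forall>P\<in>\<P>. finite (P - {\<one>})" using fin_sub by (auto simp: \<P>_def)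
          show "\<forall>P\<in>\<P>. \<forall>R\<in>\<P>. P \<noteq> R \<longrightarrow> (P - {\<one>}) \<inter> (R - {\<one>}) = {}"
          proof (intro ballI impI, rule ccontr)
            fix P R assume PR: "P \<in> \<P>" "R \<in> \<P>" "P \<noteq> R" "(P - {\<one>}) \<inter> (R - {\<one>}) \<noteq> {}"
            then obtain x where x: "x \<in> P" "x \<in> R" "x \<noteq> \<one>" by blast
            have "y \<in> R" if "y \<in> P" for y
              using cyclic_prime_card[OF p(1) _ _ x(1,3) that] PR(1,2) pow_sub x(2) by (auto simp: \<P>_def)
            then have "P = R" by (intro card_subset_eq) (use PR fin_sub in \<open>auto simp: \<P>_def\<close>)
            then show False using PR by simp
          qed
        qed
        also have "\<dots> = (\<Sum>P\<in>\<P>. p - 1)"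
          by (rule sum.cong) (auto simp: \<P>_def sub_one)
        finally have cU: "card U = (p + 1) * (p - 1)" using sp by simp
        have UG: "U \<subseteq> carrier G" by (auto simp: U_def)
        have "p + 1 \<le> 2 * (p - 1)" using cH H_le by simp
        have "card (carrier G - U) = card H"
        proof -
          have "card (carrier G - U) = p * (p + 1) - (p + 1) * (p - 1)"
            using card_Diff_subset[OF finite_subset[OF UG fin] UG] cG cH cU by simp
          also have "\<dots> = (p + 1) * (p - (p - 1))" by (metis diff_mult_distrib2 mult.commute)
          also have "\<dots> = p + 1" using p1 by simp
          finally show ?thesis using cH by simp
        qed
        moreover have "H \<subseteq> carrier G - U"
        proof
          fix h assume h: "h \<in> H"
          have "h = \<one>" if "h [^] p = \<one>"
            using pow_coprime_one[OF sub_mem[OF H h] that pow_card_sub[OF H h]] ndvd p(1) by (simp add: prime_imp_coprime)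
          then show "h \<in> carrier G - U" using h HG by (auto simp: U_def)
        qed
        ultimately have HU: "H = carrier G - U" by (intro card_subset_eq) (use fin in auto)
        have "g0 \<otimes> h0 \<otimes> inv g0 \<in> carrier G - U"
        proof -
          have h: "h0 \<in> carrier G" "h0 \<notin> U" using gh0 HU by auto
          then show ?thesis using gh0(1) conj_pow[OF gh0(1) h(1)] conj_one_iff[OF gh0(1)] by (auto simp: U_def)
        qed
        then show ?thesis using gh0 HU by blast
      qed
    qed
    then show "subgroup {g \<in> carrier G. g [^] p = \<one>} G" "card {g \<in> carrier G. g [^] p = \<one>} = p" "\<not> p dvd card H" by auto
  qed
qed

text \<open>The prime degree case for G/K, where H/K is the image of the dihedral-like
  \<open>H0\<close> because H = K H0. The conclusions are pulled back: the normal subgroup of order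
  p of G/K is commutative, and its preimage catches all p-elements modulo K since p^2 does not
  divide |G/K|.\<close>

lemma prime_index_mod_normal:
  assumes p: "Factorial_Ring.prime p" "odd p" and K: "K \<lhd> G" and H: "subgroup H G" "K \<subseteq> H"
    and cG: "card (carrier G) = p * card H"
    and dl: "dihedral_like G H0 C0" "H0 \<subseteq> H" and HK: "\<And>h. h \<in> H \<Longrightarrow> \<exists>k\<in>K. \<exists>h0\<in>H0. h = k \<otimes> h0"
    and core: "\<And>h. \<lbrakk>h \<in> H; \<And>g. g \<in> carrier G \<Longrightarrow> g \<otimes> h \<otimes> inv g \<in> H\<rbrakk> \<Longrightarrow> h \<in> K"
  shows "subgroup {g \<in> carrier G. g [^] p \<in> K} G" "card {g \<in> carrier G. g [^] p \<in> K} = p * card K"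
    "\<And>x y. \<lbrakk>x \<in> carrier G; y \<in> carrier G; x [^] p \<in> K; y [^] p \<in> K\<rbrakk> \<Longrightarrow> x \<otimes> y \<otimes> inv (y \<otimes> x) \<in> K"
    "\<And>g j. \<lbrakk>g \<in> carrier G; g [^] (p ^ j) \<in> K\<rbrakk> \<Longrightarrow> g [^] p \<in> K"
proof -
  note [simp del] = mult_FactGroup one_FactGroup
  interpret N: normal K G by fact
  have Ks: "subgroup K G" using normal_imp_subgroup[OF K] .
  have KG: "K \<subseteq> carrier G" using subgroup.subset[OF Ks] .
  let ?Q = "G Mod K"
  define \<pi> where "\<pi> = (\<lambda>g. K #> g)"
  have gQ: "group ?Q" by (rule N.factorgroup_is_group)
  have \<pi>: "group_hom G ?Q \<pi>"
    using N.r_coset_hom_Mod gQ is_group by (simp add: group_hom_def group_hom_axioms_def \<pi>_def)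
  interpret \<pi>: group_hom G ?Q \<pi> by (rule \<pi>)
  have surj: "carrier ?Q = \<pi> ` carrier G" by (auto simp: FactGroup_def RCOSETS_def \<pi>_def)
  interpret Q: fin_group ?Q
    using gQ surj fin by (simp add: fin_group_def fin_group_axioms_def)
  have one_iff: "\<pi> x = \<one>\<^bsub>?Q\<^esub> \<longleftrightarrow> x \<in> K" if "x \<in> carrier G" for x
  proof -
    have "\<pi> x = \<one>\<^bsub>?Q\<^esub> \<longleftrightarrow> K #> x = K" by (simp add: \<pi>_def one_FactGroup)
    also have "\<dots> \<longleftrightarrow> x \<in> K" using coset_join1[OF _ that Ks] coset_join2[OF that Ks] KG by blast
    finally show ?thesis .
  qed
  have pow: "\<pi> x [^]\<^bsub>?Q\<^esub> n = \<one>\<^bsub>?Q\<^esub> \<longleftrightarrow> x [^] n \<in> K" if "x \<in> carrier G" for x and n :: nat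
    using \<pi>.hom_nat_pow[OF that] one_iff[of "x [^] n"] that by simp
  have card_img: "card A = card (\<pi> ` A) * card K" if A: "subgroup A G" "K \<subseteq> A" for A
  proof -
    interpret A: fin_group "G\<lparr>carrier := A\<rparr>" by (rule fin_group_sub[OF A(1)])
    have "rcosets\<^bsub>G\<lparr>carrier := A\<rparr>\<^esub> K = \<pi> ` A" by (auto simp: RCOSETS_def \<pi>_def)
    then show ?thesis using A.lagrange[OF subgroup_incl[OF Ks A(1,2)]] by (simp add: order_def)
  qed
  have K0: "card K > 0" using card_sub_pos[OF Ks] .
  have "card (\<pi> ` carrier G) * card K = p * card (\<pi> ` H) * card K"
    using card_img[OF subgroup_self KG] card_img[OF H] cG by (metis mult.assoc)
  then have cQ: "card (carrier ?Q) = p * card (\<pi> ` H)" using K0 surj by simp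
  have imgH: "\<pi> ` H = \<pi> ` H0"
  proof
    show "\<pi> ` H \<subseteq> \<pi> ` H0"
    proof
      fix y assume "y \<in> \<pi> ` H"
      then obtain h where h: "h \<in> H" "y = \<pi> h" by blast
      then obtain k h0 where k: "k \<in> K" "h0 \<in> H0" "h = k \<otimes> h0" using HK by blast
      have kG: "k \<in> carrier G" "h0 \<in> carrier G" using k KG dl_carrier(1)[OF dl(1)] by auto
      have "\<pi> h = \<pi> k \<otimes>\<^bsub>?Q\<^esub> \<pi> h0" using k kG by simp
      also have "\<pi> k = \<one>\<^bsub>?Q\<^esub>" using one_iff kG k by blast
      finally have "\<pi> h = \<one>\<^bsub>?Q\<^esub> \<otimes>\<^bsub>?Q\<^esub> \<pi> h0" .
      also have "\<dots> = \<pi> h0" by (rule \<pi>.H.l_one[OF \<pi>.hom_closed[OF kG(2)]])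
      finally have "\<pi> h = \<pi> h0" .
      then show "y \<in> \<pi> ` H0" using h k by blast
    qed
  qed (use dl(2) in blast)
  have dlQ: "dihedral_like ?Q (\<pi> ` H) (\<pi> ` C0)" unfolding imgH by (rule dl_hom[OF dl(1) \<pi>])
  have memH: "x \<in> H" if "x \<in> carrier G" "\<pi> x \<in> \<pi> ` H" for x
  proof -
    from that(2) obtain h where h: "h \<in> H" "\<pi> x = \<pi> h" by blast
    have hG: "h \<in> carrier G" using h sub_mem[OF H(1)] by blast
    have "\<pi> (x \<otimes> inv h) = \<one>\<^bsub>?Q\<^esub>" using that hG h by simp
    then have "x \<otimes> inv h \<in> K" using iffD1[OF one_iff[of "x \<otimes> inv h"]] that(1) hG by simp
    then have "x \<otimes> inv h \<in> H" using H(2) by blast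
    then have "x \<otimes> inv h \<otimes> h \<in> H" using h sub_mult[OF H(1)] by blast
    then show ?thesis using that hG by (simp add: m_assoc)
  qed
  have coreQ: "h = \<one>\<^bsub>?Q\<^esub>"
    if h: "h \<in> \<pi> ` H" "\<And>g. g \<in> carrier ?Q \<Longrightarrow> g \<otimes>\<^bsub>?Q\<^esub> h \<otimes>\<^bsub>?Q\<^esub> inv\<^bsub>?Q\<^esub> g \<in> \<pi> ` H" for h
  proof -
    obtain x where x: "x \<in> H" "h = \<pi> x" using h by blast
    have xG: "x \<in> carrier G" using x sub_mem[OF H(1)] by blast
    have "g \<otimes> x \<otimes> inv g \<in> H" if g: "g \<in> carrier G" for g
    proof (rule memH)
      have "\<pi> g \<otimes>\<^bsub>?Q\<^esub> h \<otimes>\<^bsub>?Q\<^esub> inv\<^bsub>?Q\<^esub> \<pi> g \<in> \<pi> ` H" using h(2) g surj by blast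
      then show "\<pi> (g \<otimes> x \<otimes> inv g) \<in> \<pi> ` H" using g xG x by simp
    qed (use g xG in simp)
    then have "x \<in> K" using core x by blast
    then show ?thesis using one_iff xG x by blast
  qed
  note B = Q.prime_index_core_free[OF p cQ dlQ coreQ]
  define S where "S = {g \<in> carrier G. g [^] p \<in> K}"
  have Siff: "g \<in> S \<longleftrightarrow> g \<in> carrier G \<and> \<pi> g \<in> {g \<in> carrier ?Q. g [^]\<^bsub>?Q\<^esub> p = \<one>\<^bsub>?Q\<^esub>}" for g
    using pow surj by (auto simp: S_def)
  have S: "subgroup S G"
  proof (rule subgroup_finI)
    fix x y assume "x \<in> S" "y \<in> S"
    then have xy: "x \<in> carrier G" "y \<in> carrier G" and
      "\<pi> x \<in> {g \<in> carrier ?Q. g [^]\<^bsub>?Q\<^esub> p = \<one>\<^bsub>?Q\<^esub>}" "\<pi> y \<in> {g \<in> carrier ?Q. g [^]\<^bsub>?Q\<^esub> p = \<one>\<^bsub>?Q\<^esub>}"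
      using Siff by blast+
    then have "\<pi> x \<otimes>\<^bsub>?Q\<^esub> \<pi> y \<in> {g \<in> carrier ?Q. g [^]\<^bsub>?Q\<^esub> p = \<one>\<^bsub>?Q\<^esub>}"
      using \<pi>.H.sub_mult[OF B(1)] by blast
    then have "\<pi> (x \<otimes> y) \<in> {g \<in> carrier ?Q. g [^]\<^bsub>?Q\<^esub> p = \<one>\<^bsub>?Q\<^esub>}" using \<pi>.hom_mult[OF xy] by simp
    then show "x \<otimes> y \<in> S" using Siff xy by simp
  qed (use sub_one[OF Ks] in \<open>auto simp: S_def\<close>)
  have KS: "K \<subseteq> S" using KG pow_sub[OF Ks] by (auto simp: S_def)
  have "\<pi> ` S = {g \<in> carrier ?Q. g [^]\<^bsub>?Q\<^esub> p = \<one>\<^bsub>?Q\<^esub>}" proof (intro equalityI subsetI)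
    fix y assume y: "y \<in> {g \<in> carrier ?Q. g [^]\<^bsub>?Q\<^esub> p = \<one>\<^bsub>?Q\<^esub>}"
    then obtain g where "g \<in> carrier G" "y = \<pi> g" using surj by blast
    then show "y \<in> \<pi> ` S" using Siff y by blast
  qed (use Siff in blast)
  then show "card {g \<in> carrier G. g [^] p \<in> K} = p * card K"
    using card_img[OF S KS] B(2) by (simp add: S_def)
  show "subgroup {g \<in> carrier G. g [^] p \<in> K} G" using S by (simp add: S_def)
  show "x \<otimes> y \<otimes> inv (y \<otimes> x) \<in> K" if "x \<in> carrier G" "y \<in> carrier G" "x [^] p \<in> K" "y [^] p \<in> K" for x y
  proof -
    have "x \<in> S" "y \<in> S" using that by (auto simp: S_def)
    then have "\<pi> x \<otimes>\<^bsub>?Q\<^esub> \<pi> y = \<pi> y \<otimes>\<^bsub>?Q\<^esub> \<pi> x"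
      using Q.comm_prime_card[OF p(1) B(1,2)] Siff by blast
    then have "\<pi> (x \<otimes> y) = \<pi> (y \<otimes> x)" using that by simp
    moreover have "\<pi> (x \<otimes> y \<otimes> inv (y \<otimes> x)) = \<pi> (x \<otimes> y) \<otimes>\<^bsub>?Q\<^esub> inv\<^bsub>?Q\<^esub> \<pi> (y \<otimes> x)"
      using that by (simp del: \<pi>.hom_mult add: \<pi>.hom_mult[of "x \<otimes> y" "inv (y \<otimes> x)"])
    ultimately have "\<pi> (x \<otimes> y \<otimes> inv (y \<otimes> x)) = \<one>\<^bsub>?Q\<^esub>" using that by (metis \<pi>.H.r_inv \<pi>.hom_closed m_closed)
    then show ?thesis using one_iff[of "x \<otimes> y \<otimes> inv (y \<otimes> x)"] that by simp
  qed
  show "g [^] p \<in> K" if g: "g \<in> carrier G" "g [^] (p ^ j) \<in> K" for g j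
  proof -
    have gQ': "\<pi> g \<in> carrier ?Q" using g surj by blast
    have "\<pi>.H.ord (\<pi> g) dvd p ^ j" using pow[OF g(1)] g(2) \<pi>.H.pow_eq_id[OF gQ'] by simp
    then obtain i where i: "\<pi>.H.ord (\<pi> g) = p ^ i" using p(1) divides_primepow_nat by blast
    have "p ^ i dvd p * card (\<pi> ` H)"
      using \<pi>.H.ord_dvd_group_order[OF gQ'] i cQ by (simp add: order_def)
    moreover have "\<not> p * p dvd p * card (\<pi> ` H)" using B(3) prime_gt_0_nat[OF p(1)] by simp
    ultimately have "i < 2" by (metis dvd_trans le_imp_power_dvd linorder_not_le power2_eq_square)
    then have "p ^ i dvd p" by (cases i) (auto simp: less_Suc_eq)
    then show ?thesis using pow[OF g(1)] \<pi>.H.pow_eq_id[OF gQ'] i by simp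
  qed
qed

end

section \<open>The imprimitive case\<close>

context fin_group
begin

lemma core_normal:
  assumes A: "subgroup A G"
  shows "{a \<in> A. \<forall>g\<in>carrier G. g \<otimes> a \<otimes> inv g \<in> A} \<lhd> G"
proof (rule normalI')
  let ?K = "{a \<in> A. \<forall>g\<in>carrier G. g \<otimes> a \<otimes> inv g \<in> A}"
  have AG: "a \<in> carrier G" if "a \<in> A" for a using sub_mem[OF A that] .
  show "subgroup ?K G"
  proof (rule subgroup_finI)
    fix x y assume xy: "x \<in> ?K" "y \<in> ?K"
    then have xyA: "x \<in> A" "y \<in> A" by auto
    have "g \<otimes> (x \<otimes> y) \<otimes> inv g \<in> A" if g: "g \<in> carrier G" for g
    proof -
      have "g \<otimes> (x \<otimes> y) \<otimes> inv g = (g \<otimes> x \<otimes> inv g) \<otimes> (g \<otimes> y \<otimes> inv g)"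
        using xyA AG g by (simp add: word_simps)
      then show ?thesis using xy g sub_mult[OF A] by simp
    qed
    then show "x \<otimes> y \<in> ?K" using xyA sub_mult[OF A] by simp
  qed (use sub_one[OF A] AG in auto)
  show "g \<otimes> x \<otimes> inv g \<in> ?K" if g: "g \<in> carrier G" and x: "x \<in> ?K" for g x
  proof -
    have xG: "x \<in> carrier G" using x AG by blast
    have "h \<otimes> (g \<otimes> x \<otimes> inv g) \<otimes> inv h \<in> A" if h: "h \<in> carrier G" for h
    proof -
      have "h \<otimes> (g \<otimes> x \<otimes> inv g) \<otimes> inv h = (h \<otimes> g) \<otimes> x \<otimes> inv (h \<otimes> g)"
        using xG g h by (simp add: word_simps)
      then show ?thesis using x g h by simp
    qed
    then show ?thesis using x g by simp
  qed
qed

lemma normal_conj: "\<lbrakk>N \<lhd> G; g \<in> carrier G; x \<in> N\<rbrakk> \<Longrightarrow> g \<otimes> x \<otimes> inv g \<in> N"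
  using normal_inv_iff by blast

lemma quotient_hom:
  assumes N: "N \<lhd> G"
  shows "group_hom G (G Mod N) (\<lambda>g. N #> g)"
    "x \<in> carrier G \<Longrightarrow> N #> x = \<one>\<^bsub>G Mod N\<^esub> \<longleftrightarrow> x \<in> N"
proof -
  interpret N: normal N G by fact
  have Ns: "subgroup N G" using normal_imp_subgroup[OF N] .
  show "group_hom G (G Mod N) (\<lambda>g. N #> g)"
    using N.r_coset_hom_Mod N.factorgroup_is_group is_group by (simp add: group_hom_def group_hom_axioms_def)
  show "N #> x = \<one>\<^bsub>G Mod N\<^esub> \<longleftrightarrow> x \<in> N" if "x \<in> carrier G"
    using coset_join1[OF _ that Ns] coset_join2[OF that Ns] subgroup.subset[OF Ns] by (auto simp: FactGroup_def)
qed

text \<open>The extension of A by an element g of order p modulo A. Exponents run over all naturals,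
  which makes closure under products immediate; the representation is unique once i < p.\<close>

lemma prime_extension:
  assumes p: "Factorial_Ring.prime p" and A: "subgroup A G" and g: "g \<in> carrier G" "g \<notin> A" "g [^] p \<in> A"
    and nrm: "\<And>a. a \<in> A \<Longrightarrow> g \<otimes> a \<otimes> inv g \<in> A"
  shows "subgroup {a \<otimes> g [^] i |a i. a \<in> A \<and> i \<in> (UNIV :: nat set)} G"
    "card {a \<otimes> g [^] i |a i. a \<in> A \<and> i \<in> (UNIV :: nat set)} = p * card A"
    "\<And>i::nat. g [^] i \<in> A \<Longrightarrow> p dvd i"
proof -
  let ?T = "{a \<otimes> g [^] i |a i. a \<in> A \<and> i \<in> (UNIV :: nat set)}"
  have AG: "a \<in> carrier G" if "a \<in> A" for a using sub_mem[OF A that] .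
  have p0: "p > 0" using prime_gt_0_nat[OF p] .
  have nrmi: "g [^] (i::nat) \<otimes> a \<otimes> inv (g [^] i) \<in> A" if "a \<in> A" for a i
  proof (induction i)
    case 0 then show ?case using that AG by simp
  next
    case (Suc i)
    have "g [^] Suc i \<otimes> a \<otimes> inv (g [^] Suc i) = g \<otimes> (g [^] i \<otimes> a \<otimes> inv (g [^] i)) \<otimes> inv g"
      using g(1) AG[OF that] nat_pow_Suc2[OF g(1)] by (simp add: word_simps)
    then show ?case using nrm[OF Suc] by simp
  qed
  show T: "subgroup ?T G"
  proof (rule subgroup_finI)
    show "\<one> \<in> ?T" using sub_one[OF A] by (auto intro!: exI[of _ \<one>] exI[of _ 0])
    fix x y assume "x \<in> ?T" "y \<in> ?T"
    then obtain a i b j where x: "a \<in> A" "x = a \<otimes> g [^] (i::nat)" and y: "b \<in> A" "y = b \<otimes> g [^] (j::nat)" by blast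
    have aG: "a \<in> carrier G" "b \<in> carrier G" using x y AG by auto
    have "x \<otimes> y = (a \<otimes> (g [^] i \<otimes> b \<otimes> inv (g [^] i))) \<otimes> g [^] (i + j)"
      using aG g(1) x y by (simp add: word_simps nat_pow_mult[symmetric])
    moreover have "a \<otimes> (g [^] i \<otimes> b \<otimes> inv (g [^] i)) \<in> A" using sub_mult[OF A x(1) nrmi[OF y(1)]] .
    ultimately show "x \<otimes> y \<in> ?T" by blast
  qed (use AG g(1) in auto)
  show dvdi: "p dvd i" if i: "g [^] i \<in> A" for i :: nat
  proof (rule ccontr)
    assume "\<not> p dvd i"
    then have "coprime p i" using p prime_imp_coprime by blast
    then have "coprime i p" by (simp add: coprime_commute)
    \<comment> \<open>If i is prime to p, a multiple ik is 1 modulo p, and g itself would be in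
      A.\<close>
    then obtain k where k: "[i * k = 1] (mod p)" using cong_solve_coprime_nat[of i p] by auto
    have "1 mod p = 1" using prime_gt_1_nat[OF p] by simp
    then have "i * k mod p = 1" using k by (simp add: cong_def)
    then have "i * k = p * (i * k div p) + 1" by (metis mult_div_mod_eq)
    then have "(g [^] i) [^] k = (g [^] p) [^] (i * k div p) \<otimes> g"
      using g(1) by (metis nat_pow_Suc nat_pow_pow Suc_eq_plus1)
    then have "g = inv ((g [^] p) [^] (i * k div p)) \<otimes> (g [^] i) [^] k"
      using g(1) by (simp add: inv_cancel1)
    moreover have "inv ((g [^] p) [^] (i * k div p)) \<otimes> (g [^] i) [^] k \<in> A"
      by (intro sub_mult[OF A] sub_inv[OF A] pow_sub[OF A] g(3) i)
    ultimately show False using g(2) by simp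
  qed
  have "bij_betw (\<lambda>(a, i). a \<otimes> g [^] i) (A \<times> {..<p}) ?T"
  proof (rule bij_betw_imageI)
    show "inj_on (\<lambda>(a, i). a \<otimes> g [^] i) (A \<times> {..<p})"
    proof -
      have main: "i = j \<and> a = b" if "a \<in> A" "b \<in> A" "i \<le> j" "j < p" "a \<otimes> g [^] i = b \<otimes> g [^] j" for a b and i j :: nat
      proof -
        have abG: "a \<in> carrier G" "b \<in> carrier G" using that AG by auto
        have "g [^] j = g [^] (j - i) \<otimes> g [^] i" using g(1) that(3) by (simp add: nat_pow_mult)
        then have "a \<otimes> g [^] i = b \<otimes> g [^] (j - i) \<otimes> g [^] i" using that(5) abG g(1) by (simp add: m_assoc)
        then have e: "a = b \<otimes> g [^] (j - i)" using abG g(1) by simp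
        then have "g [^] (j - i) = inv b \<otimes> a" using abG g(1) by (simp add: inv_cancel1)
        then have "g [^] (j - i) \<in> A" using that(1,2) sub_mult[OF A] sub_inv[OF A] by simp
        then have "p dvd j - i" by (rule dvdi)
        moreover have "j - i < p" using that(4) by simp
        ultimately have "j - i = 0" using nat_dvd_not_less by blast
        then show ?thesis using e that(3) abG by simp
      qed
      show ?thesis
      proof (rule inj_onI)
        fix x y assume "x \<in> A \<times> {..<p}" "y \<in> A \<times> {..<p}" "(case x of (a, i) \<Rightarrow> a \<otimes> g [^] i) = (case y of (a, i) \<Rightarrow> a \<otimes> g [^] i)"
        moreover obtain a i where x: "x = (a, i)" by (cases x)
        moreover obtain b j where y: "y = (b, j)" by (cases y)
        ultimately have "a \<in> A" "b \<in> A" "i < p" "j < p" "a \<otimes> g [^] i = b \<otimes> g [^] j" by simp_all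
        then show "x = y" unfolding x y using main[of a b i j] main[of b a j i] by (metis nat_le_linear)
      qed
    qed
    show "(\<lambda>(a, i). a \<otimes> g [^] i) ` (A \<times> {..<p}) = ?T"
    proof (intro equalityI subsetI)
      fix x assume "x \<in> ?T"
      then obtain a i where x: "a \<in> A" "x = a \<otimes> g [^] (i::nat)" by blast
      have "g [^] i = (g [^] p) [^] (i div p) \<otimes> g [^] (i mod p)"
        using g(1) by (simp add: nat_pow_pow nat_pow_mult)
      then have "x = (a \<otimes> (g [^] p) [^] (i div p)) \<otimes> g [^] (i mod p)"
        using x AG g(1) by (simp add: m_assoc)
      moreover have "a \<otimes> (g [^] p) [^] (i div p) \<in> A" by (intro sub_mult[OF A] pow_sub[OF A] g(3) x(1))
      ultimately show "x \<in> (\<lambda>(a, i). a \<otimes> g [^] i) ` (A \<times> {..<p})" using p0 by force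
    qed auto
  qed
  then have "card (A \<times> {..<p}) = card ?T" by (rule bij_betw_same_card)
  then show "card ?T = p * card A" by (simp add: card_cartesian_product mult.commute)
qed

lemma prime_subgroups_meet:
  assumes p: "Factorial_Ring.prime p" and A: "subgroup A G" "card A = p" and B: "subgroup B G" "card B = p"
    and x: "x \<in> A" "x \<in> B" "x \<noteq> \<one>"
  shows "A = B"
proof -
  have "A \<subseteq> B" using cyclic_prime_card[OF p A x(1,3)] pow_sub[OF B(1) x(2)] by blast
  then show ?thesis by (intro card_subset_eq fin_sub B(1)) (use A B in auto)
qed

text \<open>Two different subgroups of order p meet trivially, so their product set already has p^2
  elements.\<close>

lemma prime_subgroups_product:
  assumes p: "Factorial_Ring.prime p" and Q: "subgroup Q G" "card Q = p\<^sup>2" and A: "subgroup A G" "card A = p" "A \<subseteq> Q"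
    and B: "subgroup B G" "card B = p" "B \<subseteq> Q" and AB: "A \<noteq> B" and q: "q \<in> Q"
  shows "\<exists>a\<in>A. \<exists>b\<in>B. q = a \<otimes> b"
proof -
  have AG: "a \<in> carrier G" if "a \<in> A" for a using sub_mem[OF A(1) that] .
  have BG: "a \<in> carrier G" if "a \<in> B" for a using sub_mem[OF B(1) that] .
  have inj: "inj_on (\<lambda>(a, b). a \<otimes> b) (A \<times> B)"
  proof (rule inj_onI)
    fix x y assume "x \<in> A \<times> B" "y \<in> A \<times> B" "(case x of (a, b) \<Rightarrow> a \<otimes> b) = (case y of (a, b) \<Rightarrow> a \<otimes> b)"
    then obtain a b c d where xy: "x = (a, b)" "y = (c, d)" and m: "a \<in> A" "b \<in> B" "c \<in> A" "d \<in> B" and e: "a \<otimes> b = c \<otimes> d" by auto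
    have G: "a \<in> carrier G" "b \<in> carrier G" "c \<in> carrier G" "d \<in> carrier G" using m AG BG by auto
    have "inv c \<otimes> a = d \<otimes> inv b"
    proof -
      have "inv c \<otimes> (a \<otimes> b) \<otimes> inv b = inv c \<otimes> (c \<otimes> d) \<otimes> inv b" using e by simp
      then show ?thesis using G by (simp add: word_simps)
    qed
    moreover have "inv c \<otimes> a \<in> A" "d \<otimes> inv b \<in> B"
      using m sub_mult[OF A(1)] sub_inv[OF A(1)] sub_mult[OF B(1)] sub_inv[OF B(1)] by auto
    ultimately have "inv c \<otimes> a = \<one>" "d \<otimes> inv b = \<one>"
      using prime_subgroups_meet[OF p A(1,2) B(1,2)] AB by metis+
    then have "c \<otimes> (inv c \<otimes> a) = c" "d \<otimes> inv b \<otimes> b = b" using G by auto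
    then show "x = y" using xy G by (simp add: inv_cancel2 m_assoc)
  qed
  have sub: "(\<lambda>(a, b). a \<otimes> b) ` (A \<times> B) \<subseteq> Q" using A B sub_mult[OF Q(1)] by auto
  have "card ((\<lambda>(a, b). a \<otimes> b) ` (A \<times> B)) = card Q"
    using card_image[OF inj] A B Q by (simp add: power2_eq_square card_cartesian_product)
  then have "(\<lambda>(a, b). a \<otimes> b) ` (A \<times> B) = Q" using card_subset_eq[OF fin_sub[OF Q(1)] sub] by blast
  then show ?thesis using q by auto
qed

end

section \<open>A chain H < M < G in which both indices equal p\<close>

locale imprimitive = fin_group G for G (structure) +
  fixes H C M :: "'a set" and p :: nat and r :: 'a
  assumes p: "Factorial_Ring.prime p" "odd p"
    and dl: "dihedral_like G H C" and r: "r \<in> H" "r \<notin> C"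
    and core: "\<lbrakk>h \<in> H; \<And>g. g \<in> carrier G \<Longrightarrow> g \<otimes> h \<otimes> inv g \<in> H\<rbrakk> \<Longrightarrow> h = \<one>"
    and M: "subgroup M G" "H \<subseteq> M" "card M = p * card H" "card (carrier G) = p * card M"
begin

lemmas H = dl_sub(1)[OF dl]
lemmas C = dl_sub(2)[OF dl]
lemmas CH = dl_sub(3)[OF dl]

lemma H_carrier: "h \<in> H \<Longrightarrow> h \<in> carrier G" using sub_mem[OF H] .
lemma M_carrier: "h \<in> M \<Longrightarrow> h \<in> carrier G" using sub_mem[OF M(1)] .
lemma C_carrier: "h \<in> C \<Longrightarrow> h \<in> carrier G" using sub_mem[OF C] .
lemma p1: "p > 1" using prime_gt_1_nat[OF p(1)] .

lemma M_max: "\<lbrakk>subgroup N G; M \<subseteq> N\<rbrakk> \<Longrightarrow> N = M \<or> N = carrier G"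
  using mem_by_index[OF M(1) subgroup_self subgroup.subset[OF M(1)] M(4) p(1)] subgroup.subset by blast

text \<open>N is the core of H in M, and K the core of M in G. M/N acts faithfully on the p cosets
  of H in M, and S/N is its normal subgroup of order p. Q is the largest normal subgroup of G inside
  S; it turns out to be elementary abelian and to contain every p-element of M.\<close>

definition N where "N = {h \<in> H. \<forall>m\<in>M. m \<otimes> h \<otimes> inv m \<in> H}"
definition S where "S = {g \<in> M. g [^] p \<in> N}"
definition K where "K = {m \<in> M. \<forall>g\<in>carrier G. g \<otimes> m \<otimes> inv g \<in> M}"
definition Q where "Q = {q \<in> S. \<forall>g\<in>carrier G. g \<otimes> q \<otimes> inv g \<in> S}"

lemma S_facts: "subgroup S G"
  "\<And>x y. \<lbrakk>x \<in> S; y \<in> S\<rbrakk> \<Longrightarrow> x \<otimes> y \<otimes> inv (y \<otimes> x) \<in> N"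
  "\<And>g j. \<lbrakk>g \<in> M; g [^] (p ^ j) \<in> N\<rbrakk> \<Longrightarrow> g \<in> S" "N \<subseteq> S"
proof -
  let ?M = "G\<lparr>carrier := M\<rparr>"
  interpret MM: fin_group ?M by (rule fin_group_sub[OF M(1)])
  have i: "inv\<^bsub>?M\<^esub> x = inv x" if "x \<in> M" for x using m_inv_consistent[OF M(1) that] .
  have HM: "subgroup H ?M" by (rule subgroup_incl[OF H M(1,2)])
  have N_eq: "N = {h \<in> H. \<forall>g\<in>carrier ?M. g \<otimes>\<^bsub>?M\<^esub> h \<otimes>\<^bsub>?M\<^esub> inv\<^bsub>?M\<^esub> g \<in> H}"
    using i by (auto simp: N_def)
  have NM: "N \<lhd> ?M" unfolding N_eq by (rule MM.core_normal[OF HM])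
  have NH: "N \<subseteq> H" by (auto simp: N_def)
  have cM: "card (carrier ?M) = p * card H" using M(3) by simp
  have dlM: "dihedral_like ?M H C"
    using dl_restrict[OF dl M(1)] M(2) CH by (metis inf.absorb1 order_trans)
  have c1: "h \<in> N" if "h \<in> H" "\<And>g. g \<in> carrier ?M \<Longrightarrow> g \<otimes>\<^bsub>?M\<^esub> h \<otimes>\<^bsub>?M\<^esub> inv\<^bsub>?M\<^esub> g \<in> H" for h
    using that unfolding N_eq by blast
  have c2: "\<exists>k\<in>N. \<exists>h0\<in>H. h = k \<otimes>\<^bsub>?M\<^esub> h0" if "h \<in> H" for h
    using that sub_one[OF H] H_carrier M_carrier by (intro bexI[of _ \<one>] bexI[of _ h]) (auto simp: N_def)
  note B = MM.prime_index_mod_normal[OF p NM HM NH cM dlM order_refl c2 c1]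
  have pw: "x [^]\<^bsub>?M\<^esub> (n::nat) = x [^] n" for x n by (simp add: nat_pow_consistent[symmetric])
  have S_eq: "S = {g \<in> carrier ?M. g [^]\<^bsub>?M\<^esub> p \<in> N}" by (simp add: S_def pw)
  show S: "subgroup S G" using incl_subgroup[OF M(1)] B(1) unfolding S_eq by blast
  show "x \<otimes> y \<otimes> inv (y \<otimes> x) \<in> N" if "x \<in> S" "y \<in> S" for x y
    using B(3)[of x y] that i[of "y \<otimes> x"] sub_mult[OF M(1)] by (simp add: S_def pw)
  show "g \<in> S" if "g \<in> M" "g [^] (p ^ j) \<in> N" for g j
    using B(4)[of g j] that by (simp add: S_def pw)
  have "subgroup N G" using incl_subgroup[OF M(1) normal_imp_subgroup[OF NM]] .
  then show "N \<subseteq> S" using pow_sub NH M(2) by (auto simp: S_def)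
qed

lemma K_normal: "K \<lhd> G" unfolding K_def by (rule core_normal[OF M(1)])
lemma Q_normal: "Q \<lhd> G" unfolding Q_def by (rule core_normal[OF S_facts(1)])
lemmas K = normal_imp_subgroup[OF K_normal]
lemmas Q = normal_imp_subgroup[OF Q_normal]
lemma K_carrier: "h \<in> K \<Longrightarrow> h \<in> carrier G" using sub_mem[OF K] .
lemma Q_carrier: "h \<in> Q \<Longrightarrow> h \<in> carrier G" using sub_mem[OF Q] .
lemma QM: "Q \<subseteq> M" by (auto simp: Q_def S_def)
lemma KM: "K \<subseteq> M" by (auto simp: K_def)
lemma QK: "Q \<subseteq> K" by (auto simp: Q_def K_def S_def)
lemma NH: "N \<subseteq> H" by (auto simp: N_def)

text \<open>S/N is commutative, so every conjugate of a commutator of elements of Q lies in N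
  \<subseteq> H. Core-freeness of H kills the commutator; the same argument kills p-th
  powers.\<close>

lemma Q_comm:
  assumes "x \<in> Q" "y \<in> Q" shows "x \<otimes> y = y \<otimes> x"
proof -
  have G: "x \<in> carrier G" "y \<in> carrier G" using assms Q_carrier by auto
  define w where "w = x \<otimes> y \<otimes> inv (y \<otimes> x)"
  have wH: "g \<otimes> w \<otimes> inv g \<in> H" if g: "g \<in> carrier G" for g
  proof -
    have "g \<otimes> w \<otimes> inv g = (g \<otimes> x \<otimes> inv g) \<otimes> (g \<otimes> y \<otimes> inv g) \<otimes> inv ((g \<otimes> y \<otimes> inv g) \<otimes> (g \<otimes> x \<otimes> inv g))"
      using G g by (simp add: w_def word_simps)
    then show ?thesis using S_facts(2)[of "g \<otimes> x \<otimes> inv g" "g \<otimes> y \<otimes> inv g"] assms g NH by (auto simp: Q_def)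
  qed
  have "w \<in> H" using wH[OF one_closed] G by (simp add: w_def)
  then have "w = \<one>" using core wH by blast
  then have "w \<otimes> (y \<otimes> x) = y \<otimes> x" using G by simp
  then show ?thesis using G by (simp add: w_def m_assoc)
qed

lemma Q_exponent:
  assumes "x \<in> Q" shows "x [^] p = \<one>"
proof (rule core)
  have G: "x \<in> carrier G" using assms Q_carrier by auto
  show "g \<otimes> x [^] p \<otimes> inv g \<in> H" if g: "g \<in> carrier G" for g
  proof -
    have "g \<otimes> x \<otimes> inv g \<in> S" using assms g by (simp add: Q_def)
    then show ?thesis using conj_pow[OF g G] NH by (auto simp: S_def)
  qed
  have "x \<in> S" using assms by (simp add: Q_def)
  then show "x [^] p \<in> H" using NH by (auto simp: S_def)
qed

text \<open>A p-element of M lies in the core of M, since the index is p. All its conjugates are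
  therefore p-elements of M, and these lie in S.\<close>

lemma p_element_in_Q:
  assumes "u \<in> M" "u [^] (p ^ j) = \<one>" shows "u \<in> Q"
proof -
  have uG: "u \<in> carrier G" using assms M_carrier by blast
  have N1: "\<one> \<in> N" using sub_one[OF H] M_carrier by (auto simp: N_def)
  have "g \<otimes> u \<otimes> inv g \<in> S" if g: "g \<in> carrier G" for g
  proof (rule S_facts(3))
    show "g \<otimes> u \<otimes> inv g \<in> M" by (rule p_element_in_core[OF p(1) M(1,4) assms g])
    show "(g \<otimes> u \<otimes> inv g) [^] p ^ j \<in> N" using conj_pow[OF g uG, of "p ^ j"] assms(2) N1 g by simp
  qed
  moreover have "u \<in> S" by (rule S_facts(3)[OF assms(1), of j]) (simp add: assms(2) N1)
  ultimately show ?thesis by (simp add: Q_def)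
qed

lemma Q_not_subset_H: "\<not> Q \<subseteq> H"
proof
  assume a: "Q \<subseteq> H"
  have "p dvd card M" using M(3) by simp
  then obtain u where u: "u \<in> M" "u \<noteq> \<one>" "u [^] p = \<one>" using cauchy[OF p(1) M(1)] by blast
  then have uQ: "u \<in> Q" using p_element_in_Q[of u 1] by simp
  have "u = \<one>" using core[of u] a uQ normal_conj[OF Q_normal] by blast
  then show False using u by simp
qed

text \<open>QH is a subgroup between H and M, larger than H, and the index of H in M is
  prime.\<close>

lemma M_eq_QH: assumes "m \<in> M" shows "\<exists>q\<in>Q. \<exists>h\<in>H. m = q \<otimes> h"
proof -
  define T where "T = {q \<otimes> h |q h. q \<in> Q \<and> h \<in> H}"
  have T: "subgroup T G"
  proof (rule subgroup_finI)
    show "\<one> \<in> T" unfolding T_def using sub_one[OF Q] sub_one[OF H] by force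
    fix x y assume "x \<in> T" "y \<in> T"
    then obtain a b c d where x: "a \<in> Q" "b \<in> H" "x = a \<otimes> b" and y: "c \<in> Q" "d \<in> H" "y = c \<otimes> d" unfolding T_def by blast
    have G: "a \<in> carrier G" "b \<in> carrier G" "c \<in> carrier G" "d \<in> carrier G" using x y Q_carrier H_carrier by auto
    have "x \<otimes> y = (a \<otimes> (b \<otimes> c \<otimes> inv b)) \<otimes> (b \<otimes> d)" using x y G by (simp add: word_simps)
    moreover have "a \<otimes> (b \<otimes> c \<otimes> inv b) \<in> Q" using sub_mult[OF Q x(1) normal_conj[OF Q_normal G(2) y(1)]] .
    moreover have "b \<otimes> d \<in> H" using sub_mult[OF H] x y by blast
    ultimately show "x \<otimes> y \<in> T" unfolding T_def by blast
  qed (use Q_carrier H_carrier in \<open>auto simp: T_def\<close>)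
  have HT: "H \<subseteq> T"
  proof
    fix h assume h: "h \<in> H"
    have "h = \<one> \<otimes> h" using H_carrier[OF h] by simp
    then show "h \<in> T" unfolding T_def using h sub_one[OF Q] by blast
  qed
  have QT: "Q \<subseteq> T"
  proof
    fix h assume h: "h \<in> Q"
    have "h = h \<otimes> \<one>" using Q_carrier[OF h] by simp
    then show "h \<in> T" unfolding T_def using h sub_one[OF H] by blast
  qed
  have TM: "T \<subseteq> M" using QM M(2) sub_mult[OF M(1)] by (auto simp: T_def)
  have "T = H \<or> T = M" by (rule mem_by_index[OF H M(1,2,3) p(1) T HT TM])
  then have "T = M" using QT Q_not_subset_H by blast
  then show ?thesis using assms unfolding T_def by blast
qed

text \<open>The point stabilizer in Q. It is trivial or of order p, and it decides between the two
  situations for the complement: p-subgroups of order p^2 or p^3.\<close>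

definition L where "L = Q \<inter> H"

lemma L: "subgroup L G" unfolding L_def by (rule subgroups_Inter_pair[OF Q H])

lemma LC: "L \<subseteq> C"
proof
  fix l assume l: "l \<in> L"
  show "l \<in> C"
  proof (rule ccontr)
    assume n: "l \<notin> C"
    have lG: "l \<in> carrier G" using l H_carrier by (simp add: L_def)
    have "l \<otimes> l = \<one>" using dl_sq[OF dl _ n] l by (simp add: L_def)
    then have "l [^] (2::nat) = \<one>" using lG by (simp add: numeral_2_eq_2)
    moreover have "l [^] p = \<one>" using Q_exponent l by (simp add: L_def)
    moreover have "coprime 2 p" using p(2) by simp
    ultimately have "l = \<one>" using pow_coprime_one[OF lG] by blast
    then show False using n sub_one[OF C] by simp
  qed
qed

lemma card_L: "L = {\<one>} \<or> card L = p"
proof (cases "L = {\<one>}")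
  case False
  then obtain u where u: "u \<in> L" "u \<noteq> \<one>" using sub_one[OF L] by blast
  have uG: "u \<in> carrier G" using u sub_mem[OF L] by blast
  have up: "u [^] p = \<one>" using u Q_exponent by (simp add: L_def)
  have "ord u dvd p" "ord u \<noteq> 1" using pow_eq_id[OF uG] up ord_eq_1[OF uG] u by auto
  then have o: "ord u = p" using p(1) by (metis prime_nat_iff)
  have "L = generate G {u}"
  proof
    show "generate G {u} \<subseteq> L" by (rule generate_subgroup_incl[OF _ L]) (use u in simp)
    show "L \<subseteq> generate G {u}"
    proof
      fix l assume l: "l \<in> L"
      then have "\<exists>k::nat. l = u [^] k"
        using dl_prime_order[OF dl p(1), of u l] LC u up Q_exponent by (auto simp: L_def)
      then show "l \<in> generate G {u}"
        using pow_sub[OF generate_is_subgroup[of "{u}"]] uG by (auto intro: generate.incl)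
    qed
  qed
  then have "card L = ord u" using generate_pow_card[OF uG] by simp
  then show ?thesis using o by simp
qed simp

text \<open>Since M = QH, the orbit of the coset H under Q is the whole block of p cosets in M; the
  stabilizer in Q is L.\<close>

lemma card_Q: "card Q = p * card L"
proof -
  interpret A: fin_action G "rcosets H" "\<lambda>g T. T #> inv g" by (rule rcosets_action[OF H])
  interpret B: fin_action "G\<lparr>carrier := Q\<rparr>" "rcosets H" "\<lambda>g T. T #> inv g" by (rule A.restrict_action[OF Q])
  interpret MM: fin_group "G\<lparr>carrier := M\<rparr>" by (rule fin_group_sub[OF M(1)])
  have HG: "H \<subseteq> carrier G" using H_carrier by blast
  have H1: "H #> \<one> = H" using HG by simp
  have HR: "H \<in> rcosets H" using rcosetsI[OF HG one_closed] H1 by simp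
  have "B.orbit H = rcosets\<^bsub>G\<lparr>carrier := M\<rparr>\<^esub> H"
  proof
    show "B.orbit H \<subseteq> rcosets\<^bsub>G\<lparr>carrier := M\<rparr>\<^esub> H"
      using QM sub_inv[OF Q] by (auto simp: B.orbit_def RCOSETS_def)
    show "rcosets\<^bsub>G\<lparr>carrier := M\<rparr>\<^esub> H \<subseteq> B.orbit H"
    proof
      fix T assume "T \<in> rcosets\<^bsub>G\<lparr>carrier := M\<rparr>\<^esub> H"
      then obtain m where m: "m \<in> M" "T = H #> m" by (auto simp: RCOSETS_def)
      obtain q h where qh: "q \<in> Q" "h \<in> H" "inv m = q \<otimes> h" using M_eq_QH[OF sub_inv[OF M(1) m(1)]] by blast
      have G: "q \<in> carrier G" "h \<in> carrier G" "m \<in> carrier G" using qh m Q_carrier H_carrier M_carrier by auto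
      have "m = inv (q \<otimes> h)" using qh(3) G inv_inv[of m] by simp
      then have "m = inv h \<otimes> inv q" using G by (simp add: inv_mult_group)
      then have "T = H #> inv h #> inv q" using m(2) G HG by (simp add: coset_mult_assoc)
      also have "H #> inv h = H" by (rule coset_join2) (use G sub_inv[OF H qh(2)] H in auto)
      finally show "T \<in> B.orbit H" using qh(1) by (auto simp: B.orbit_def)
    qed
  qed
  moreover have "card (rcosets\<^bsub>G\<lparr>carrier := M\<rparr>\<^esub> H) = p"
    by (rule MM.card_rcosets[OF subgroup_incl[OF H M(1,2)]]) (simp add: M(3))
  moreover have "B.stab H = L"
  proof -
    have "H #> inv g = H \<longleftrightarrow> g \<in> H" if "g \<in> carrier G" for g
      using rcoset_fixed_iff[OF H one_closed that] that H1 by simp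
    then show ?thesis using Q_carrier by (auto simp: B.stab_def L_def)
  qed
  ultimately show ?thesis using B.orbit_stab[OF HR] by simp
qed

end

section \<open>The action on Q: K acts by power maps\<close>

context imprimitive
begin

lemma conj_Q: "\<lbrakk>g \<in> carrier G; q \<in> Q\<rbrakk> \<Longrightarrow> g \<otimes> q \<otimes> inv g \<in> Q"
  using normal_conj[OF Q_normal] .

text \<open>Write m = qh. As Q is abelian, h centralizes Q, and so do its H-conjugates. Since M =
  QH, the M-conjugates of h are H-conjugates; they stay in H, so h lies in the core N.\<close>

lemma centralizer_Q_in_S:
  assumes m: "m \<in> M" and cent: "\<And>q. q \<in> Q \<Longrightarrow> m \<otimes> q = q \<otimes> m"
  shows "m \<in> S"
proof -
  obtain q h where qh: "q \<in> Q" "h \<in> H" "m = q \<otimes> h" using M_eq_QH[OF m] by blast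
  have G: "q \<in> carrier G" "h \<in> carrier G" "m \<in> carrier G" using qh m Q_carrier H_carrier M_carrier by auto
  have hc: "h \<otimes> y = y \<otimes> h" if y: "y \<in> Q" for y
  proof -
    have yG: "y \<in> carrier G" using Q_carrier[OF y] .
    have "q \<otimes> (h \<otimes> y) = y \<otimes> (q \<otimes> h)" using cent[OF y] qh G yG by (simp add: m_assoc)
    also have "\<dots> = q \<otimes> (y \<otimes> h)" using Q_comm[OF y qh(1)] G yG by (simp add: m_assoc[symmetric])
    finally show ?thesis using G yG by simp
  qed
  have "m' \<otimes> h \<otimes> inv m' \<in> H" if m': "m' \<in> M" for m'
  proof -
    obtain q' h' where qh': "q' \<in> Q" "h' \<in> H" "m' = q' \<otimes> h'" using M_eq_QH[OF m'] by blast
    have G': "q' \<in> carrier G" "h' \<in> carrier G" using qh' Q_carrier H_carrier by auto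
    define k where "k = h' \<otimes> h \<otimes> inv h'"
    have kG: "k \<in> carrier G" using G G' by (simp add: k_def)
    define y where "y = inv h' \<otimes> q' \<otimes> h'"
    have y: "y \<in> Q" using conj_Q[of "inv h'" q'] qh' G' by (simp add: y_def)
    have yG: "y \<in> carrier G" using Q_carrier[OF y] .
    have q'e: "q' = h' \<otimes> y \<otimes> inv h'" using G' by (simp add: y_def word_simps)
    have "q' \<otimes> k = h' \<otimes> (y \<otimes> h) \<otimes> inv h'" unfolding q'e k_def using G G' yG by (simp add: word_simps)
    also have "\<dots> = h' \<otimes> (h \<otimes> y) \<otimes> inv h'" using hc[OF y] by simp
    also have "\<dots> = k \<otimes> q'" unfolding q'e k_def using G G' yG by (simp add: word_simps)
    finally have qk: "q' \<otimes> k = k \<otimes> q'" .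
    have "m' \<otimes> h \<otimes> inv m' = (q' \<otimes> k) \<otimes> inv q'" using G G' qh'(3) by (simp add: k_def word_simps)
    also have "\<dots> = k" unfolding qk using G' kG by (simp add: word_simps)
    finally show ?thesis using qh(2) qh'(2) sub_mult[OF H] sub_inv[OF H] by (simp add: k_def)
  qed
  then have "h \<in> N" using qh(2) by (simp add: N_def)
  then have "h \<in> S" using S_facts(4) by blast
  moreover have "q \<in> S" using qh(1) by (simp add: Q_def)
  ultimately show ?thesis using sub_mult[OF S_facts(1)] qh(3) by simp
qed

text \<open>Conjugates of g centralize the normal subgroup Q as well, so all of them lie in S. Thus
  K/Q acts faithfully on Q.\<close>

lemma centralizer_K_Q:
  assumes g: "g \<in> K" and cent: "\<And>q. q \<in> Q \<Longrightarrow> g \<otimes> q = q \<otimes> g"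
  shows "g \<in> Q"
proof -
  have gG: "g \<in> carrier G" using K_carrier[OF g] .
  have "x \<otimes> g \<otimes> inv x \<in> S" if x: "x \<in> carrier G" for x
  proof (rule centralizer_Q_in_S)
    show "x \<otimes> g \<otimes> inv x \<in> M" using g x by (simp add: K_def)
    fix q assume q: "q \<in> Q"
    have qG: "q \<in> carrier G" using Q_carrier[OF q] .
    define y where "y = inv x \<otimes> q \<otimes> x"
    have y: "y \<in> Q" using conj_Q[of "inv x" q] q x by (simp add: y_def)
    have yG: "y \<in> carrier G" using Q_carrier[OF y] .
    have qe: "q = x \<otimes> y \<otimes> inv x" using x qG by (simp add: y_def word_simps)
    have "x \<otimes> g \<otimes> inv x \<otimes> q = x \<otimes> (g \<otimes> y) \<otimes> inv x" unfolding qe using x gG yG by (simp add: word_simps)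
    also have "\<dots> = x \<otimes> (y \<otimes> g) \<otimes> inv x" using cent[OF y] by simp
    also have "\<dots> = q \<otimes> (x \<otimes> g \<otimes> inv x)" unfolding qe using x gG yG by (simp add: word_simps)
    finally show "x \<otimes> g \<otimes> inv x \<otimes> q = q \<otimes> (x \<otimes> g \<otimes> inv x)" .
  qed
  moreover have "g \<in> S" by (rule centralizer_Q_in_S) (use g KM cent in auto)
  ultimately show ?thesis by (simp add: Q_def)
qed

text \<open>A p-subgroup of order p |Q| exists by Sylow. Inside M it would consist of p-elements and
  fit into Q, which is too small.\<close>

lemma p_element_outside_M: "\<exists>g j. g \<in> carrier G \<and> g \<notin> M \<and> g [^] (p ^ j) = \<one>"
proof -
  obtain k where k: "card L = p ^ k"
    using card_L by (metis power_0 power_one_right is_singletonI is_singleton_altdef)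
  have "card L dvd card H" by (rule card_dvd[OF L H]) (simp add: L_def)
  then have "p * (p * card L) dvd p * (p * card H)" by simp
  moreover have "p ^ (k + 2) = p * (p * card L)" using k by simp
  ultimately have "p ^ (k + 2) dvd p * (p * card H)" by (simp only:)
  then have "p ^ (k + 2) dvd card (carrier G)" using M(3,4) by simp
  then obtain P0 where P0: "subgroup P0 G" "card P0 = p ^ (k + 2)" using sylow_sub[OF p(1)] by blast
  have pw: "x \<in> carrier G \<and> x [^] (p ^ (k + 2)) = \<one>" if "x \<in> P0" for x
    using pow_card_sub[OF P0(1) that] P0(2) sub_mem[OF P0(1) that] by simp
  have "\<not> P0 \<subseteq> M"
  proof
    assume "P0 \<subseteq> M"
    then have "P0 \<subseteq> Q" using p_element_in_Q pw by blast
    then have "card P0 \<le> card Q" using card_mono[OF fin_sub[OF Q]] by blast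
    then have "p * card Q \<le> card Q" using card_Q P0(2) k by simp
    then show False using p1 card_sub_pos[OF Q] by simp
  qed
  then obtain g where "g \<in> P0" "g \<notin> M" by blast
  then show ?thesis using pw by blast
qed

lemma M_conj_L:
  assumes "m \<in> M"
  obtains h where "h \<in> H" "\<And>l. l \<in> L \<Longrightarrow> m \<otimes> l \<otimes> inv m = h \<otimes> l \<otimes> inv h"
proof -
  obtain q h where qh: "q \<in> Q" "h \<in> H" "m = q \<otimes> h" using M_eq_QH[OF assms] by blast
  have G: "q \<in> carrier G" "h \<in> carrier G" using qh Q_carrier H_carrier by auto
  have "m \<otimes> l \<otimes> inv m = h \<otimes> l \<otimes> inv h" if l: "l \<in> L" for l
  proof -
    have lG: "l \<in> carrier G" using l H_carrier by (simp add: L_def)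
    have hl: "h \<otimes> l \<otimes> inv h \<in> Q" using conj_Q[OF G(2)] l by (simp add: L_def)
    have "m \<otimes> l \<otimes> inv m = q \<otimes> (h \<otimes> l \<otimes> inv h) \<otimes> inv q" using G lG qh(3) by (simp add: word_simps)
    also have "\<dots> = (h \<otimes> l \<otimes> inv h) \<otimes> q \<otimes> inv q" using Q_comm[OF qh(1) hl] by simp
    also have "\<dots> = h \<otimes> l \<otimes> inv h" using G lG by (simp add: word_simps)
    finally show ?thesis .
  qed
  then show ?thesis using that qh(2) by blast
qed

text \<open>Q centralizes L, and H centralizes or inverts the cyclic part containing L; every
  element of M is a product of two such.\<close>

lemma M_sign_L:
  assumes "m \<in> M"
  shows "(\<forall>l\<in>L. m \<otimes> l \<otimes> inv m = l) \<or> (\<forall>l\<in>L. m \<otimes> l \<otimes> inv m = inv l)"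
proof -
  obtain h where h: "h \<in> H" "\<And>l. l \<in> L \<Longrightarrow> m \<otimes> l \<otimes> inv m = h \<otimes> l \<otimes> inv h" using M_conj_L[OF assms] by blast
  show ?thesis
  proof (cases "h \<in> C")
    case True
    have "h \<otimes> l \<otimes> inv h = l" if "l \<in> L" for l
    proof -
      have lC: "l \<in> C" using that LC by blast
      have "h \<otimes> l \<otimes> inv h = l \<otimes> h \<otimes> inv h" using dl_comm[OF dl True lC] by simp
      then show ?thesis using C_carrier[OF lC] C_carrier[OF True] by (simp add: m_assoc)
    qed
    then show ?thesis using h by simp
  next
    case False
    then show ?thesis using dl_inverts[OF dl h(1)] LC h by auto
  qed
qed

text \<open>M normalizes L and is maximal in G. If G normalized L, then L would lie in the trivial
  core of H.\<close>

lemma normalizer_L: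
  assumes L_p: "card L = p" and g: "g \<in> carrier G" "\<And>l. l \<in> L \<Longrightarrow> g \<otimes> l \<otimes> inv g \<in> L"
  shows "g \<in> M"
proof -
  define D where "D = {g \<in> carrier G. \<forall>l\<in>L. g \<otimes> l \<otimes> inv g \<in> L}"
  have LG: "L \<subseteq> carrier G" using subgroup.subset[OF L] .
  have D: "subgroup D G" unfolding D_def by (rule normalizer_sub[OF LG fin_sub[OF L]])
  have "M \<subseteq> D"
  proof
    fix m assume m: "m \<in> M"
    have "m \<otimes> l \<otimes> inv m \<in> L" if "l \<in> L" for l using M_sign_L[OF m] that sub_inv[OF L] by auto
    then show "m \<in> D" using M_carrier[OF m] by (simp add: D_def)
  qed
  then consider "D = M" | "D = carrier G" using M_max[OF D] by blast
  then show ?thesis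
  proof cases
    case 1 then show ?thesis using g by (auto simp: D_def)
  next
    case 2
    have "l = \<one>" if l: "l \<in> L" for l
    proof (rule core)
      show "l \<in> H" using l by (simp add: L_def)
      show "x \<otimes> l \<otimes> inv x \<in> H" if x: "x \<in> carrier G" for x
      proof -
        have "x \<in> D" using 2 x by simp
        then have "x \<otimes> l \<otimes> inv x \<in> L" using l by (simp add: D_def)
        then show ?thesis by (simp add: L_def)
      qed
    qed
    then have "L \<subseteq> {\<one>}" by blast
    then have "card L \<le> 1" using card_mono[of "{\<one>}" L] by simp
    then show ?thesis using L_p p1 by simp
  qed
qed

text \<open>If Q has order p, it is cyclic and nothing is to do. If it has order p^2, take the three
  lines L, gLg^-1, g^2 L g^-2 for a p-element g outside M. They are distinct, and k acts on each as
  1 or -1. Two of the signs agree, and two distinct lines generate Q.\<close>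

lemma power_action:
  assumes k: "k \<in> K"
  shows "\<exists>e::nat. \<forall>q\<in>Q. k \<otimes> q \<otimes> inv k = q [^] e"
proof -
  have kG: "k \<in> carrier G" using K_carrier[OF k] .
  show ?thesis
  proof (cases "L = {\<one>}")
    case True
    then have cQ: "card Q = p" using card_Q by simp
    obtain u where u: "u \<in> Q" "u \<noteq> \<one>" using Q_not_subset_H sub_one[OF H] by blast
    have uG: "u \<in> carrier G" using Q_carrier[OF u(1)] .
    obtain e where e: "k \<otimes> u \<otimes> inv k = u [^] (e::nat)"
      using cyclic_prime_card[OF p(1) Q cQ u conj_Q[OF kG u(1)]] by blast
    have "k \<otimes> q \<otimes> inv k = q [^] e" if q: "q \<in> Q" for q
    proof -
      obtain i where i: "q = u [^] (i::nat)" using cyclic_prime_card[OF p(1) Q cQ u q] by blast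
      have "k \<otimes> q \<otimes> inv k = (k \<otimes> u \<otimes> inv k) [^] i" using conj_pow[OF kG uG] i by simp
      also have "\<dots> = q [^] e" using e i uG by (simp add: nat_pow_pow mult.commute)
      finally show ?thesis .
    qed
    then show ?thesis by blast
  next
    case False
    then have cL: "card L = p" using card_L by blast
    then have cQ: "card Q = p\<^sup>2" using card_Q by (simp add: power2_eq_square)
    obtain g j where g: "g \<in> carrier G" "g \<notin> M" "g [^] (p ^ j) = \<one>" using p_element_outside_M by blast
    \<comment> \<open>As g has odd order, it is a power of its square; so the square is outside M
      too.\<close>
    have gg: "g \<otimes> g \<notin> M"
    proof
      assume a: "g \<otimes> g \<in> M"
      have "odd (p ^ j)" using p(2) by simp
      then obtain i where i: "p ^ j = 2 * i + 1" by (rule oddE)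
      have "g [^] (2::nat) = g \<otimes> g" using g(1) by (simp add: numeral_2_eq_2)
      then have "(g \<otimes> g) [^] i \<otimes> g = g [^] (p ^ j)" using g(1) i by (simp add: nat_pow_pow[symmetric])
      then have "(g \<otimes> g) [^] i \<otimes> g = \<one>" using g(3) by simp
      then have "g = inv ((g \<otimes> g) [^] i)" using g(1) by (metis inv_char inv_comm inv_equality m_closed nat_pow_closed)
      then show False using g(2) sub_inv[OF M(1) pow_sub[OF M(1) a, of i]] by simp
    qed
    define LL where "LL x = (\<lambda>l. x \<otimes> l \<otimes> inv x) ` L" for x
    have LG: "l \<in> carrier G" if "l \<in> L" for l using sub_mem[OF L that] .
    have LL: "subgroup (LL x) G" "card (LL x) = p" "LL x \<subseteq> Q" if "x \<in> carrier G" for x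
      using conj_sub[OF L that] cL conj_Q[OF that] by (auto simp: LL_def L_def)
    have LL_ne: "LL x \<noteq> LL (x \<otimes> y)" if xy: "x \<in> carrier G" "y \<in> carrier G" "y \<notin> M" for x y
    proof
      assume e: "LL x = LL (x \<otimes> y)"
      have "y \<otimes> l \<otimes> inv y \<in> L" if l: "l \<in> L" for l
      proof -
        have "x \<otimes> y \<otimes> l \<otimes> inv (x \<otimes> y) \<in> LL x" unfolding e using l by (simp add: LL_def)
        then obtain l' where l': "l' \<in> L" "x \<otimes> y \<otimes> l \<otimes> inv (x \<otimes> y) = x \<otimes> l' \<otimes> inv x" by (auto simp: LL_def)
        have "y \<otimes> l \<otimes> inv y = inv x \<otimes> (x \<otimes> y \<otimes> l \<otimes> inv (x \<otimes> y)) \<otimes> x"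
          using xy LG[OF l] by (simp add: word_simps)
        also have "\<dots> = l'" unfolding l'(2) using xy LG[OF l'(1)] by (simp add: word_simps)
        finally show ?thesis using l' by simp
      qed
      then show False using normalizer_L[OF cL xy(2)] xy(3) by blast
    qed
    have sgn: "(\<forall>q\<in>LL x. k \<otimes> q \<otimes> inv k = q) \<or> (\<forall>q\<in>LL x. k \<otimes> q \<otimes> inv k = inv q)" if x: "x \<in> carrier G" for x
    proof -
      define m where "m = inv x \<otimes> k \<otimes> x"
      have mM: "m \<in> M" using k x unfolding K_def m_def by (metis (no_types, lifting) inv_closed inv_inv mem_Collect_eq)
      have mG: "m \<in> carrier G" using M_carrier[OF mM] .
      have e: "k \<otimes> (x \<otimes> l \<otimes> inv x) \<otimes> inv k = x \<otimes> (m \<otimes> l \<otimes> inv m) \<otimes> inv x" if "l \<in> L" for l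
        using kG x LG[OF that] by (simp add: m_def word_simps)
      have i: "inv (x \<otimes> l \<otimes> inv x) = x \<otimes> inv l \<otimes> inv x" if "l \<in> L" for l
        using x LG[OF that] by (simp add: word_simps)
      show ?thesis using M_sign_L[OF mM] e i unfolding LL_def by auto
    qed
    have two: "\<exists>e::nat. \<forall>q\<in>Q. k \<otimes> q \<otimes> inv k = q [^] e"
      if xy: "x \<in> carrier G" "y \<in> carrier G" "LL x \<noteq> LL y"
        and s: "(\<forall>q\<in>LL x \<union> LL y. k \<otimes> q \<otimes> inv k = q) \<or> (\<forall>q\<in>LL x \<union> LL y. k \<otimes> q \<otimes> inv k = inv q)" for x y
    proof -
      have dec: "\<exists>a\<in>LL x. \<exists>b\<in>LL y. q = a \<otimes> b" if "q \<in> Q" for q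
        by (rule prime_subgroups_product[OF p(1) Q cQ LL[OF xy(1)] LL[OF xy(2)] xy(3) that])
      have conj_mult: "k \<otimes> (a \<otimes> b) \<otimes> inv k = (k \<otimes> a \<otimes> inv k) \<otimes> (k \<otimes> b \<otimes> inv k)"
        if "a \<in> Q" "b \<in> Q" for a b using Q_carrier that kG by (simp add: word_simps)
      from s show ?thesis
      proof
        assume a: "\<forall>q\<in>LL x \<union> LL y. k \<otimes> q \<otimes> inv k = q"
        have "k \<otimes> q \<otimes> inv k = q [^] (1::nat)" if q: "q \<in> Q" for q
        proof -
          obtain b c where bc: "b \<in> LL x" "c \<in> LL y" "q = b \<otimes> c" using dec[OF q] by blast
          have "b \<in> Q" "c \<in> Q" using bc LL(3) xy by auto
          then show ?thesis using conj_mult[of b c] a bc Q_carrier by simp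
        qed
        then show ?thesis by blast
      next
        assume a: "\<forall>q\<in>LL x \<union> LL y. k \<otimes> q \<otimes> inv k = inv q"
        have "k \<otimes> q \<otimes> inv k = q [^] (p - 1)" if q: "q \<in> Q" for q
        proof -
          obtain b c where bc: "b \<in> LL x" "c \<in> LL y" "q = b \<otimes> c" using dec[OF q] by blast
          have Qm: "b \<in> Q" "c \<in> Q" using bc LL(3) xy by auto
          have qG: "q \<in> carrier G" using Q_carrier[OF q] .
          have "k \<otimes> q \<otimes> inv k = inv b \<otimes> inv c" using conj_mult[OF Qm] a bc by simp
          also have "\<dots> = inv q" using Q_comm[OF Qm] bc(3) Q_carrier Qm by (simp add: inv_mult_group[symmetric])
          also have "\<dots> = q [^] (p - 1)"
          proof (rule inv_equality)
            have "q [^] (p - 1) \<otimes> q = q [^] Suc (p - 1)" by simp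
            also have "Suc (p - 1) = p" using p1 by simp
            finally show "q [^] (p - 1) \<otimes> q = \<one>" using Q_exponent[OF q] by simp
          qed (use qG in auto)
          finally show ?thesis .
        qed
        then show ?thesis by blast
      qed
    qed
    have n1: "LL \<one> \<noteq> LL g" using LL_ne[of \<one> g] g by simp
    have n2: "LL g \<noteq> LL (g \<otimes> g)" using LL_ne[of g g] g by simp
    have n3: "LL \<one> \<noteq> LL (g \<otimes> g)" using LL_ne[of \<one> "g \<otimes> g"] g gg by simp
    have ggG: "g \<otimes> g \<in> carrier G" using g by simp
    \<comment> \<open>Pigeonhole: three lines, two signs.\<close>
    show ?thesis
      using sgn[OF one_closed] sgn[OF g(1)] sgn[OF ggG] two[OF one_closed g(1) n1] two[OF g(1) ggG n2] two[OF one_closed ggG n3]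
      by (metis (no_types, lifting) UnE)
  qed
qed

text \<open>A power map of Q commutes with all automorphisms, so k and its conjugate act identically
  on Q; their quotient centralizes Q and lies in Q. Thus K/Q is central in G/Q.\<close>

lemma K_central_mod_Q:
  assumes k: "k \<in> K" and x: "x \<in> carrier G"
  shows "inv k \<otimes> (x \<otimes> k \<otimes> inv x) \<in> Q"
proof -
  have kG: "k \<in> carrier G" using K_carrier[OF k] .
  define k' where "k' = x \<otimes> k \<otimes> inv x"
  have k': "k' \<in> K" "k' \<in> carrier G" using normal_conj[OF K_normal x k] K_carrier by (auto simp: k'_def)
  obtain e where e: "\<And>q. q \<in> Q \<Longrightarrow> k \<otimes> q \<otimes> inv k = q [^] (e::nat)" using power_action[OF k] by blast
  have e': "k' \<otimes> q \<otimes> inv k' = k \<otimes> q \<otimes> inv k" if q: "q \<in> Q" for q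
  proof -
    have qG: "q \<in> carrier G" using Q_carrier[OF q] .
    define y where "y = inv x \<otimes> q \<otimes> x"
    have y: "y \<in> Q" using conj_Q[of "inv x" q] q x by (simp add: y_def)
    have yG: "y \<in> carrier G" using Q_carrier[OF y] .
    have qe: "q = x \<otimes> y \<otimes> inv x" using x qG by (simp add: y_def word_simps)
    have "k' \<otimes> q \<otimes> inv k' = x \<otimes> (k \<otimes> y \<otimes> inv k) \<otimes> inv x"
      unfolding qe k'_def using x kG yG by (simp add: word_simps)
    also have "\<dots> = x \<otimes> y [^] e \<otimes> inv x" using e[OF y] by simp
    also have "\<dots> = q [^] e" unfolding qe using conj_pow[OF x yG] by simp
    finally show ?thesis using e[OF q] by simp
  qed
  have "inv k \<otimes> k' \<in> Q"
  proof (rule centralizer_K_Q)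
    show "inv k \<otimes> k' \<in> K" using sub_mult[OF K sub_inv[OF K k] k'(1)] .
    fix q assume q: "q \<in> Q"
    have qG: "q \<in> carrier G" using Q_carrier[OF q] .
    have "inv k \<otimes> k' \<otimes> q = inv k \<otimes> (k' \<otimes> q \<otimes> inv k') \<otimes> k'" using kG k' qG by (simp add: word_simps)
    also have "\<dots> = inv k \<otimes> (k \<otimes> q \<otimes> inv k) \<otimes> k'" using e'[OF q] by simp
    also have "\<dots> = q \<otimes> (inv k \<otimes> k')" using kG k' qG by (simp add: word_simps)
    finally show "inv k \<otimes> k' \<otimes> q = q \<otimes> (inv k \<otimes> k')" .
  qed
  then show ?thesis by (simp add: k'_def)
qed

end

text \<open>The automorphisms y \<mapsto> y^d and y \<mapsto> y^e commute. Hence a acts on y as its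
  conjugate by s, that is as a^-1, and the square of a acts trivially.\<close>

lemma (in fin_group) dihedral_action_square:
  assumes G: "a \<in> carrier G" "s \<in> carrier G" "y \<in> carrier G"
    and a: "a \<otimes> y \<otimes> inv a = y [^] (d::nat)" and s: "s \<otimes> y \<otimes> inv s = y [^] (e::nat)"
    and sa: "s \<otimes> a \<otimes> inv s = inv a" and ss: "s \<otimes> s = \<one>"
  shows "a \<otimes> (a \<otimes> y \<otimes> inv a) \<otimes> inv a = y"
proof -
  have cp: "x \<otimes> z [^] (n::nat) \<otimes> inv x = (x \<otimes> z \<otimes> inv x) [^] n" if "x \<in> carrier G" "z \<in> carrier G" for x z n
    using conj_pow[OF that] by simp
  have si: "inv s = s" using ss G inv_equality by blast
  have "s \<otimes> (s \<otimes> y \<otimes> inv s) \<otimes> inv s = (s \<otimes> s) \<otimes> y \<otimes> inv (s \<otimes> s)" using G by (simp add: word_simps)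
  also have "\<dots> = y" using ss G by simp
  finally have "s \<otimes> (s \<otimes> y \<otimes> inv s) \<otimes> inv s = y" .
  then have "s \<otimes> y [^] e \<otimes> inv s = y" using s by simp
  then have ee: "(y [^] e) [^] e = y" using cp[OF G(2,3)] s by simp
  have "inv a \<otimes> y \<otimes> a = (s \<otimes> a \<otimes> inv s) \<otimes> y \<otimes> inv (s \<otimes> a \<otimes> inv s)" using sa G by simp
  also have "\<dots> = s \<otimes> (a \<otimes> (inv s \<otimes> y \<otimes> s) \<otimes> inv a) \<otimes> inv s" using G by (simp add: word_simps)
  also have "inv s \<otimes> y \<otimes> s = y [^] e" using s unfolding si by simp
  also have "a \<otimes> y [^] e \<otimes> inv a = (y [^] d) [^] e" using cp[OF G(1,3)] a by simp
  also have "s \<otimes> (y [^] d) [^] e \<otimes> inv s = ((y [^] e) [^] d) [^] e" using cp[OF G(2)] G s by simp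
  also have "\<dots> = ((y [^] e) [^] e) [^] d" using G by (simp add: nat_pow_pow ac_simps)
  also have "\<dots> = a \<otimes> y \<otimes> inv a" using ee a by simp
  finally have "inv a \<otimes> y \<otimes> a = a \<otimes> y \<otimes> inv a" .
  then have "a \<otimes> (a \<otimes> y \<otimes> inv a) \<otimes> inv a = a \<otimes> (inv a \<otimes> y \<otimes> a) \<otimes> inv a" by simp
  also have "\<dots> = y" using G by (simp add: word_simps)
  finally show ?thesis .
qed

lemma (in fin_group) normal_mult_subgroup:
  assumes N: "N \<lhd> G" and H: "subgroup H G"
  shows "subgroup {n \<otimes> h |n h. n \<in> N \<and> h \<in> H} G" (is "subgroup ?T G")
proof (rule subgroup_finI)
  have Ns: "subgroup N G" using normal_imp_subgroup[OF N] .
  show "\<one> \<in> ?T" using sub_one[OF Ns] sub_one[OF H] by force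
  show "?T \<subseteq> carrier G" using sub_mem[OF Ns] sub_mem[OF H] by auto
  fix x y assume "x \<in> ?T" "y \<in> ?T"
  then obtain a b c d where x: "a \<in> N" "b \<in> H" "x = a \<otimes> b" and y: "c \<in> N" "d \<in> H" "y = c \<otimes> d" by blast
  have G: "a \<in> carrier G" "b \<in> carrier G" "c \<in> carrier G" "d \<in> carrier G" using x y sub_mem[OF Ns] sub_mem[OF H] by auto
  have "x \<otimes> y = (a \<otimes> (b \<otimes> c \<otimes> inv b)) \<otimes> (b \<otimes> d)" using x y G by (simp add: word_simps)
  moreover have "a \<otimes> (b \<otimes> c \<otimes> inv b) \<in> N" using sub_mult[OF Ns x(1) normal_conj[OF N G(2) y(1)]] .
  moreover have "b \<otimes> d \<in> H" using sub_mult[OF H] x y by blast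
  ultimately show "x \<otimes> y \<in> ?T" by blast
qed

lemma (in fin_group) quotient_fin:
  assumes N: "N \<lhd> G"
  shows "fin_group (G Mod N)" "carrier (G Mod N) = (\<lambda>g. N #> g) ` carrier G"
proof -
  interpret N: normal N G by fact
  show c: "carrier (G Mod N) = (\<lambda>g. N #> g) ` carrier G" by (auto simp: FactGroup_def RCOSETS_def)
  show "fin_group (G Mod N)"
    using N.factorgroup_is_group c fin by (simp add: fin_group_def fin_group_axioms_def)
qed

lemma (in fin_group) quotient_eq_iff:
  assumes N: "N \<lhd> G" and xy: "x \<in> carrier G" "y \<in> carrier G"
  shows "N #> x = N #> y \<longleftrightarrow> x \<otimes> inv y \<in> N"
proof -
  define f where "f = (\<lambda>x. N #> x)"
  interpret f: group_hom G "G Mod N" f unfolding f_def by (rule quotient_hom[OF N])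
  note [simp del] = mult_FactGroup one_FactGroup
  have one: "f z = \<one>\<^bsub>G Mod N\<^esub> \<longleftrightarrow> z \<in> N" if "z \<in> carrier G" for z
    unfolding f_def by (rule quotient_hom(2)[OF N that])
  define z where "z = x \<otimes> inv y"
  have zG: "z \<in> carrier G" using xy by (simp add: z_def)
  have "f x = f y \<longleftrightarrow> z \<in> N"
  proof
    assume e: "f x = f y"
    have "f z = \<one>\<^bsub>G Mod N\<^esub>" unfolding z_def using xy e f.hom_mult[of x "inv y"] f.hom_inv[of y] by simp
    then show "z \<in> N" using one[OF zG] by simp
  next
    assume "z \<in> N"
    then have e: "f z = \<one>\<^bsub>G Mod N\<^esub>" using one[OF zG] by simp
    have "x = z \<otimes> y" using xy by (simp add: z_def m_assoc)
    then have "f x = f z \<otimes>\<^bsub>G Mod N\<^esub> f y" using f.hom_mult[OF zG xy(2)] by simp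
    then show "f x = f y" using e f.hom_closed[OF xy(2)] by simp
  qed
  then show ?thesis by (simp add: f_def z_def)
qed

section \<open>A normal p-subgroup transitive on the cosets of H, and the complement inside
  it\<close>

context imprimitive
begin

text \<open>Take a p-element g outside M and P = Q<g>. The elements whose p-th power lies in K form
  the normal subgroup K<g>, so a conjugate of g has the form k g^i. As K/Q is central in G/Q,
  comparing p-th powers modulo Q shows that k is a p-element of K, hence lies in Q.\<close>

lemma normal_p_subgroup:
  obtains g where "g \<in> carrier G" "g \<notin> M" "g [^] p \<in> Q"
    "{a \<otimes> g [^] i |a i. a \<in> Q \<and> i \<in> (UNIV :: nat set)} \<lhd> G"
proof -
  have HK: "\<exists>k\<in>K. \<exists>h0\<in>H. m = k \<otimes> h0" if "m \<in> M" for m using M_eq_QH[OF that] QK by blast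
  have cK: "m \<in> K" if "m \<in> M" "\<And>g. g \<in> carrier G \<Longrightarrow> g \<otimes> m \<otimes> inv g \<in> M" for m
    using that by (simp add: K_def)
  have B: "subgroup {x \<in> carrier G. x [^] p \<in> K} G" "card {x \<in> carrier G. x [^] p \<in> K} = p * card K"
  proof -
    have c: "\<And>h. \<lbrakk>h \<in> M; \<And>g. g \<in> carrier G \<Longrightarrow> g \<otimes> h \<otimes> inv g \<in> M\<rbrakk> \<Longrightarrow> h \<in> K" by (rule cK)
    show "subgroup {x \<in> carrier G. x [^] p \<in> K} G"
      by (rule prime_index_mod_normal(1)[OF p K_normal M(1) KM M(4) dl M(2)]) (erule HK, rule c)
    show "card {x \<in> carrier G. x [^] p \<in> K} = p * card K"
      by (rule prime_index_mod_normal(2)[OF p K_normal M(1) KM M(4) dl M(2)]) (erule HK, rule c)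
  qed
  have B4: "x [^] p \<in> K" if x: "x \<in> carrier G" "x [^] (p ^ j) \<in> K" for x j
  proof (rule prime_index_mod_normal(4)[OF p K_normal M(1) KM M(4) dl M(2) _ _ x])
    show "\<And>h. h \<in> M \<Longrightarrow> \<exists>k\<in>K. \<exists>h0\<in>H. h = k \<otimes> h0" by (rule HK)
    show "\<And>h. \<lbrakk>h \<in> M; \<And>g. g \<in> carrier G \<Longrightarrow> g \<otimes> h \<otimes> inv g \<in> M\<rbrakk> \<Longrightarrow> h \<in> K" by (rule cK)
  qed
  obtain g j where g: "g \<in> carrier G" "g \<notin> M" "g [^] (p ^ j) = \<one>" using p_element_outside_M by blast
  have gK: "g [^] p \<in> K" using B4[OF g(1), of j] g(3) sub_one[OF K] by simp
  have "(g [^] p) [^] (p ^ j) = (g [^] (p ^ j)) [^] p" using g(1) by (simp add: nat_pow_pow mult.commute)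
  then have "(g [^] p) [^] (p ^ j) = \<one>" using g(3) by simp
  then have gQ: "g [^] p \<in> Q" using p_element_in_Q gK KM by blast
  have nQ: "g \<notin> Q" and nK: "g \<notin> K" using g QM KM by auto
  note EQ = prime_extension[OF p(1) Q g(1) nQ gQ conj_Q[OF g(1)]]
  note EK = prime_extension[OF p(1) K g(1) nK gK normal_conj[OF K_normal g(1)]]
  define R where "R = {x \<in> carrier G. x [^] p \<in> K}"
  have R: "subgroup R G" "card R = p * card K" using B(1,2) by (auto simp: R_def)
  have KR: "K \<subseteq> R" using pow_sub[OF K] K_carrier by (auto simp: R_def)
  have gR: "g \<in> R" using g gK by (simp add: R_def)
  have "{a \<otimes> g [^] i |a i. a \<in> K \<and> i \<in> (UNIV :: nat set)} \<subseteq> R"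
    using KR sub_mult[OF R(1)] pow_sub[OF R(1) gR] by blast
  then have R_eq: "{a \<otimes> g [^] i |a i. a \<in> K \<and> i \<in> (UNIV :: nat set)} = R"
    using card_subset_eq[OF fin_sub[OF R(1)]] EK(2) R(2) by simp
  define P where "P = {a \<otimes> g [^] i |a i. a \<in> Q \<and> i \<in> (UNIV :: nat set)}"
  have P: "subgroup P G" using EQ(1) by (simp add: P_def)
  have QP: "Q \<subseteq> P"
  proof
    fix q assume q: "q \<in> Q"
    have "q = q \<otimes> g [^] (0::nat)" using Q_carrier[OF q] by simp
    then show "q \<in> P" using q unfolding P_def by blast
  qed
  have gP: "g \<in> P"
  proof -
    have "g = \<one> \<otimes> g [^] (1::nat)" using g(1) by simp
    then show ?thesis using sub_one[OF Q] unfolding P_def by blast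
  qed
  have conj_g: "x \<otimes> g \<otimes> inv x \<in> P" if x: "x \<in> carrier G" for x
  proof -
    define y where "y = x \<otimes> g \<otimes> inv x"
    have yG: "y \<in> carrier G" using x g by (simp add: y_def)
    have yp: "y [^] p = x \<otimes> g [^] p \<otimes> inv x" using conj_pow[OF x g(1)] by (simp add: y_def)
    then have ypQ: "y [^] p \<in> Q" using conj_Q[OF x gQ] by simp
    then have "y \<in> R" using yG QK by (auto simp: R_def)
    then obtain k i where ki: "k \<in> K" "y = k \<otimes> g [^] (i::nat)" unfolding R_eq[symmetric] by blast
    have kG: "k \<in> carrier G" using K_carrier[OF ki(1)] .
    define t where "t = g [^] i"
    have tG: "t \<in> carrier G" using g(1) by (simp add: t_def)
    let ?q = "\<lambda>g. Q #> g"
    interpret q: group_hom G "G Mod Q" ?q by (rule quotient_hom[OF Q_normal])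
    note [simp del] = mult_FactGroup one_FactGroup
    have one: "?q x = \<one>\<^bsub>G Mod Q\<^esub> \<longleftrightarrow> x \<in> Q" if "x \<in> carrier G" for x by (rule quotient_hom(2)[OF Q_normal that])
    have "inv k \<otimes> (t \<otimes> k \<otimes> inv t) \<in> Q" by (rule K_central_mod_Q[OF ki(1) tG])
    then have "k \<otimes> (inv k \<otimes> (t \<otimes> k \<otimes> inv t)) \<otimes> inv k \<in> Q" by (rule conj_Q[OF kG])
    then have "(t \<otimes> k) \<otimes> inv (k \<otimes> t) \<in> Q" using kG tG by (simp add: word_simps)
    then have "?q (t \<otimes> k) = ?q (k \<otimes> t)" using quotient_eq_iff[OF Q_normal, of "t \<otimes> k" "k \<otimes> t"] kG tG by blast
    then have cm: "?q k \<otimes>\<^bsub>G Mod Q\<^esub> ?q t = ?q t \<otimes>\<^bsub>G Mod Q\<^esub> ?q k" using kG tG by simp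
    have tp: "t [^] p \<in> Q"
    proof -
      have "t [^] p = (g [^] p) [^] i" using g(1) by (simp add: t_def nat_pow_pow mult.commute)
      then show ?thesis using pow_sub[OF Q gQ] by simp
    qed
    \<comment> \<open>Commutation modulo Q lets the p-th power be taken factorwise, which leaves
      only k^p.\<close>
    have "\<one>\<^bsub>G Mod Q\<^esub> = ?q (y [^] p)" using one[of "y [^] p"] ypQ yG by simp
    also have "\<dots> = (?q k \<otimes>\<^bsub>G Mod Q\<^esub> ?q t) [^]\<^bsub>G Mod Q\<^esub> p"
      using q.hom_nat_pow[OF yG] q.hom_mult[OF kG tG] ki(2) by (simp add: t_def)
    also have "\<dots> = ?q k [^]\<^bsub>G Mod Q\<^esub> p \<otimes>\<^bsub>G Mod Q\<^esub> ?q t [^]\<^bsub>G Mod Q\<^esub> p"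
      by (rule q.H.pow_mult_distrib[OF cm]) (use kG tG in auto)
    also have "?q t [^]\<^bsub>G Mod Q\<^esub> p = \<one>\<^bsub>G Mod Q\<^esub>" using q.hom_nat_pow[OF tG, of p] one[of "t [^] p"] tp tG by simp
    finally have "?q k [^]\<^bsub>G Mod Q\<^esub> p = \<one>\<^bsub>G Mod Q\<^esub>" using kG by simp
    then have "?q (k [^] p) = \<one>\<^bsub>G Mod Q\<^esub>" using q.hom_nat_pow[OF kG, of p] by simp
    then have "k [^] p \<in> Q" using one[of "k [^] p"] kG by simp
    then have "(k [^] p) [^] p = \<one>" by (rule Q_exponent)
    then have "k [^] (p ^ 2) = \<one>" using kG by (simp add: nat_pow_pow power2_eq_square)
    then have "k \<in> Q" using p_element_in_Q ki(1) KM by blast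
    then show ?thesis using ki(2) unfolding P_def y_def by blast
  qed
  have "P \<lhd> G"
  proof (rule normalI'[OF P])
    fix x y assume x: "x \<in> carrier G" and "y \<in> P"
    then obtain q i where y: "q \<in> Q" "y = q \<otimes> g [^] (i::nat)" unfolding P_def by blast
    have qG: "q \<in> carrier G" using Q_carrier[OF y(1)] .
    have "x \<otimes> y \<otimes> inv x = (x \<otimes> q \<otimes> inv x) \<otimes> (x \<otimes> g [^] i \<otimes> inv x)" using x qG g(1) y(2) by (simp add: word_simps)
    also have "x \<otimes> g [^] i \<otimes> inv x = (x \<otimes> g \<otimes> inv x) [^] i" using conj_pow[OF x g(1)] by simp
    finally show "x \<otimes> y \<otimes> inv x \<in> P"
      using sub_mult[OF P] pow_sub[OF P conj_g[OF x]] QP conj_Q[OF x y(1)] by auto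
  qed
  then show ?thesis using that g gQ by (simp add: P_def)
qed

text \<open>If L is trivial, W = P. Otherwise |P| = p^3; let Z be the centralizer of g in Q, a
  normal subgroup of order p. P/Z is abelian of exponent p, and W is the preimage of a line in P/Z
  that lies outside Q/Z and is invariant under H. Squares of elements of C lie in L \<subseteq> P
  and act trivially on P/Z, so H acts there through r and at most one further involution, and the
  line is found by averaging, as p is odd.\<close>

lemma normal_complement:
  "\<exists>W. W \<lhd> G \<and> card W = p\<^sup>2 \<and> W \<inter> H = {\<one>}"
proof -
  obtain g where g: "g \<in> carrier G" "g \<notin> M" "g [^] p \<in> Q"
    and Pn: "{a \<otimes> g [^] i |a i. a \<in> Q \<and> i \<in> (UNIV :: nat set)} \<lhd> G" by (rule normal_p_subgroup)
  define P where "P = {a \<otimes> g [^] i |a i. a \<in> Q \<and> i \<in> (UNIV :: nat set)}"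
  have P_normal: "P \<lhd> G" using Pn by (simp add: P_def)
  have P: "subgroup P G" using normal_imp_subgroup[OF P_normal] .
  have gQ: "g \<notin> Q" using g QM by blast
  note EQ = prime_extension[OF p(1) Q g(1) gQ g(3) conj_Q[OF g(1)]]
  have cP: "card P = p * card Q" using EQ(2) by (simp add: P_def)
  have P_carrier: "y \<in> carrier G" if "y \<in> P" for y using sub_mem[OF P that] .
  have QP: "Q \<subseteq> P"
  proof
    fix q assume q: "q \<in> Q"
    have "q = q \<otimes> g [^] (0::nat)" using Q_carrier[OF q] by simp
    then show "q \<in> P" using q unfolding P_def by blast
  qed
  have gP: "g \<in> P"
  proof -
    have "g = \<one> \<otimes> g [^] (1::nat)" using g(1) by simp
    then show ?thesis using sub_one[OF Q] unfolding P_def by blast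
  qed
  have PM: "y \<in> Q" if y: "y \<in> P" "y \<in> M" for y
  proof -
    obtain k where "card L = p ^ k"
      using card_L by (metis power_0 power_one_right is_singletonI is_singleton_altdef)
    then have "card P = p ^ (k + 2)" using cP card_Q by simp
    then have "y [^] (p ^ (k + 2)) = \<one>" using pow_card_sub[OF P y(1)] by simp
    then show ?thesis by (rule p_element_in_Q[OF y(2)])
  qed
  show ?thesis
  proof (cases "L = {\<one>}")
    case True
    have "card P = p\<^sup>2" using cP card_Q True by (simp add: power2_eq_square)
    moreover have "P \<inter> H = {\<one>}"
    proof
      show "P \<inter> H \<subseteq> {\<one>}" using PM M(2) True unfolding L_def by blast
      show "{\<one>} \<subseteq> P \<inter> H" using sub_one[OF P] sub_one[OF H] by blast
    qed
    ultimately show ?thesis using P_normal by blast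
  next
    case False
    then have cL: "card L = p" using card_L by blast
    then have cQ: "card Q = p\<^sup>2" using card_Q by (simp add: power2_eq_square)
    have L_carrier: "l \<in> carrier G" if "l \<in> L" for l using sub_mem[OF L that] .
    have LQ: "L \<subseteq> Q" by (auto simp: L_def)
    have "L \<noteq> {\<one>}" by (rule False)
    then obtain u where u: "u \<in> L" "u \<noteq> \<one>" using sub_one[OF L] by blast
    have uG: "u \<in> carrier G" using L_carrier[OF u(1)] .
    define Z where "Z = Q \<inter> {x \<in> carrier G. \<forall>d\<in>{g}. x \<otimes> d = d \<otimes> x}"
    have Z: "subgroup Z G" unfolding Z_def
      by (rule subgroups_Inter_pair[OF Q centralizer_sub]) (use g in auto)
    have Ziff: "z \<in> Z \<longleftrightarrow> z \<in> Q \<and> z \<otimes> g = g \<otimes> z" for z using Q_carrier by (auto simp: Z_def)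
    have ZQ: "Z \<subseteq> Q" using Ziff by blast
    have Z_carrier: "z \<in> carrier G" if "z \<in> Z" for z using sub_mem[OF Z that] .
    have Z_central: "y \<otimes> z = z \<otimes> y" if z: "z \<in> Z" and y: "y \<in> P" for z y
    proof -
      define D where "D = {x \<in> carrier G. \<forall>d\<in>{z}. x \<otimes> d = d \<otimes> x}"
      have D: "subgroup D G" unfolding D_def by (rule centralizer_sub) (use Z_carrier[OF z] in auto)
      have QD: "Q \<subseteq> D" using Q_comm ZQ z Q_carrier by (auto simp: D_def)
      have gD: "g \<in> D" using z g(1) by (auto simp: D_def Ziff)
      obtain q i where "q \<in> Q" "y = q \<otimes> g [^] (i::nat)" using y unfolding P_def by blast
      then have "y \<in> D" using sub_mult[OF D] pow_sub[OF D gD] QD by auto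
      then show ?thesis by (simp add: D_def)
    qed
    have conj_comm: "x \<otimes> y \<otimes> inv x = y \<longleftrightarrow> x \<otimes> y = y \<otimes> x" if "x \<in> carrier G" "y \<in> carrier G" for x y
      using that by (metis inv_closed inv_solve_right m_closed)
    have Z_normal: "Z \<lhd> G"
    proof (rule normalI'[OF Z])
      fix x z assume x: "x \<in> carrier G" and z: "z \<in> Z"
      have zG: "z \<in> carrier G" using Z_carrier[OF z] .
      define y where "y = inv x \<otimes> g \<otimes> x"
      have y: "y \<in> P" using normal_conj[OF P_normal, of "inv x" g] x gP by (simp add: y_def)
      have yG: "y \<in> carrier G" using P_carrier[OF y] .
      have ge: "g = x \<otimes> y \<otimes> inv x" using x g(1) by (simp add: y_def word_simps)
      have "x \<otimes> z \<otimes> inv x \<otimes> g = x \<otimes> (z \<otimes> y) \<otimes> inv x" unfolding ge using x zG yG by (simp add: word_simps)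
      also have "\<dots> = x \<otimes> (y \<otimes> z) \<otimes> inv x" using Z_central[OF z y] by simp
      also have "\<dots> = g \<otimes> (x \<otimes> z \<otimes> inv x)" unfolding ge using x zG yG by (simp add: word_simps)
      finally show "x \<otimes> z \<otimes> inv x \<in> Z" using Ziff conj_Q[OF x] z by blast
    qed
    \<comment> \<open>If g centralized a nontrivial element of L, it would centralize L and
      therefore lie in M.\<close>
    have LZ: "l = \<one>" if l: "l \<in> L" "l \<in> Z" for l
    proof (rule ccontr)
      assume l1: "l \<noteq> \<one>"
      have "g \<otimes> l' \<otimes> inv g \<in> L" if l': "l' \<in> L" for l'
      proof -
        obtain k where "l' = l [^] (k::nat)" using cyclic_prime_card[OF p(1) L cL l(1) l1 l'] by blast
        then have l'Z: "l' \<in> Z" using pow_sub[OF Z l(2)] by blast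
        then have "g \<otimes> l' \<otimes> inv g = l'" using conj_comm[OF g(1) L_carrier[OF l']] Ziff by simp
        then show ?thesis using l' by simp
      qed
      then show False using normalizer_L[OF cL g(1)] g(2) by blast
    qed
    \<comment> \<open>Z is the fixed point set of <g> on Q by conjugation, so p divides its order;
      it is proper in Q because it meets L trivially.\<close>
    have cZ: "card Z = p"
    proof -
      have "(g [^] p) [^] p = \<one>" using Q_exponent[OF g(3)] .
      then have "g [^] (p ^ 2) = \<one>" using g(1) by (simp add: nat_pow_pow power2_eq_square)
      then obtain k where U: "subgroup (generate G {g}) G" "card (generate G {g}) = p ^ k" "g \<in> generate G {g}"
        using p_element_subgroup[OF p(1) g(1)] by blast
      interpret A: fin_action G Q "\<lambda>x q. x \<otimes> q \<otimes> inv x"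
        by unfold_locales (use fin_sub[OF Q] conj_Q Q_carrier in \<open>auto simp: word_simps\<close>)
      interpret B: fin_action "G\<lparr>carrier := generate G {g}\<rparr>" Q "\<lambda>x q. x \<otimes> q \<otimes> inv x" by (rule A.restrict_action[OF U(1)])
      have "{q \<in> Q. \<forall>h\<in>generate G {g}. h \<otimes> q \<otimes> inv h = q} = Z"
      proof (intro equalityI subsetI)
        fix q assume q: "q \<in> {q \<in> Q. \<forall>h\<in>generate G {g}. h \<otimes> q \<otimes> inv h = q}"
        then have "g \<otimes> q \<otimes> inv g = q" "q \<in> Q" using U(3) by auto
        then show "q \<in> Z" using conj_comm[OF g(1) Q_carrier] Ziff by auto
      next
        fix q assume q: "q \<in> Z"
        have "h \<otimes> q \<otimes> inv h = q" if h: "h \<in> generate G {g}" for h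
        proof -
          have "generate G {g} \<subseteq> P" by (rule generate_subgroup_incl[OF _ P]) (use gP in simp)
          then have hP: "h \<in> P" using h by blast
          show ?thesis using conj_comm[OF P_carrier[OF hP] Z_carrier[OF q]] Z_central[OF q hP] by simp
        qed
        then show "q \<in> {q \<in> Q. \<forall>h\<in>generate G {g}. h \<otimes> q \<otimes> inv h = q}" using q ZQ by auto
      qed
      then have "[card Q = card Z] (mod p)" using B.p_group_fixed_points[OF p(1), of k] U(2) by simp
      moreover have "p dvd card Q" using cQ by simp
      ultimately have pZ: "p dvd card Z" using cong_dvd_iff by blast
      have "card Z dvd p ^ 2" using card_dvd[OF Z Q ZQ] cQ by simp
      then obtain i where i: "i \<le> 2" "card Z = p ^ i" using p(1) divides_primepow_nat by blast
      have "Z \<noteq> Q" using LZ[of u] u LQ by blast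
      then have "card Z < card Q" using ZQ psubset_card_mono[OF fin_sub[OF Q]] by blast
      then have "i \<noteq> 2" using i cQ by auto
      moreover have "i \<noteq> 0" using i pZ p1 by (metis power_0 nat_dvd_1_iff_1 less_irrefl)
      ultimately have "i = 1" using i(1) by linarith
      then show ?thesis using i by simp
    qed
    have gpZ: "g [^] p \<in> Z"
    proof -
      have "g [^] p \<otimes> g = g \<otimes> g [^] p" using nat_pow_comm[OF g(1), of p 1] g(1) by simp
      then show ?thesis using Ziff g(3) by blast
    qed
    have gZ: "g \<notin> Z" using gQ ZQ by blast
    \<comment> \<open>Z<g> has index p in P and is therefore invariant under P. The commutator of q
      and g lies in it and in Q, and Q meets Z<g> in Z.\<close>
    have comm_g: "q \<otimes> (g \<otimes> inv q \<otimes> inv g) \<in> Z" if q: "q \<in> Q" for q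
    proof -
      have qG: "q \<in> carrier G" using Q_carrier[OF q] .
      have nz: "g \<otimes> z \<otimes> inv g \<in> Z" if "z \<in> Z" for z using normal_conj[OF Z_normal g(1) that] .
      note EZ = prime_extension[OF p(1) Z g(1) gZ gpZ nz]
      define F where "F = {a \<otimes> g [^] i |a i. a \<in> Z \<and> i \<in> (UNIV :: nat set)}"
      have F: "subgroup F G" "card F = p * p" using EZ(1,2) cZ by (simp_all add: F_def)
      have FP: "F \<subseteq> P" using ZQ unfolding F_def P_def by blast
      have gF: "g \<in> F"
      proof -
        have "g = \<one> \<otimes> g [^] (1::nat)" using g(1) by simp
        then show ?thesis using sub_one[OF Z] unfolding F_def by blast
      qed
      interpret PP: fin_group "G\<lparr>carrier := P\<rparr>" by (rule fin_group_sub[OF P])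
      have qP: "q \<in> P" using q QP by blast
      have "q \<otimes>\<^bsub>G\<lparr>carrier := P\<rparr>\<^esub> g \<otimes>\<^bsub>G\<lparr>carrier := P\<rparr>\<^esub> inv\<^bsub>G\<lparr>carrier := P\<rparr>\<^esub> q \<in> F"
      proof (rule PP.p_subgroup_in_core[OF p(1)])
        show "subgroup F (G\<lparr>carrier := P\<rparr>)" "subgroup F (G\<lparr>carrier := P\<rparr>)" by (rule subgroup_incl[OF F(1) P FP])+
        show "card F = p ^ 2" using F by (simp add: power2_eq_square)
        show "card (carrier (G\<lparr>carrier := P\<rparr>)) = p * card F" using F cP cQ by (simp add: power2_eq_square)
      qed (use qP gF in auto)
      then have "q \<otimes> g \<otimes> inv q \<in> F" using m_inv_consistent[OF P qP] by simp
      then obtain z i where zi: "z \<in> Z" "q \<otimes> g \<otimes> inv q = z \<otimes> g [^] (i::nat)" unfolding F_def by blast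
      have zG: "z \<in> carrier G" using Z_carrier[OF zi(1)] .
      have "q \<otimes> (g \<otimes> inv q \<otimes> inv g) = z \<otimes> g [^] i \<otimes> inv g"
        unfolding zi(2)[symmetric] using qG g(1) by (simp add: word_simps)
      then have e: "q \<otimes> (g \<otimes> inv q \<otimes> inv g) = z \<otimes> (g [^] i \<otimes> inv g)" using zG g(1) by (simp add: m_assoc)
      have "q \<otimes> (g \<otimes> inv q \<otimes> inv g) \<in> Q" using sub_mult[OF Q q conj_Q[OF g(1) sub_inv[OF Q q]]] .
      then have "inv z \<otimes> (z \<otimes> (g [^] i \<otimes> inv g)) \<in> Q" unfolding e using sub_mult[OF Q] sub_inv[OF Q] zi(1) ZQ by blast
      then have giQ: "g [^] i \<otimes> inv g \<in> Q" using zG g(1) by (simp add: inv_cancel1)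
      have "g [^] i \<otimes> inv g \<in> Z"
      proof (cases i)
        case 0
        then have "inv (inv g) \<in> Q" using giQ sub_inv[OF Q, of "inv g"] g(1) by simp
        then show ?thesis using gQ g(1) by simp
      next
        case (Suc j)
        then have gj: "g [^] i \<otimes> inv g = g [^] j" using g(1) by (simp add: m_assoc)
        then have "p dvd j" using EQ(3)[of j] giQ by simp
        then obtain t where "j = p * t" by blast
        then have "g [^] j = (g [^] p) [^] t" using g(1) by (simp add: nat_pow_pow)
        then show ?thesis using gj pow_sub[OF Z gpZ] by simp
      qed
      then show ?thesis unfolding e using sub_mult[OF Z zi(1)] by blast
    qed
    let ?Z = "G Mod Z"
    define \<pi> where "\<pi> = (\<lambda>x. Z #> x)"
    interpret \<pi>: group_hom G ?Z \<pi> unfolding \<pi>_def by (rule quotient_hom[OF Z_normal])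
    interpret QZ: fin_group ?Z by (rule quotient_fin[OF Z_normal])
    note [simp del] = mult_FactGroup one_FactGroup
    have one: "\<pi> x = \<one>\<^bsub>?Z\<^esub> \<longleftrightarrow> x \<in> Z" if "x \<in> carrier G" for x
      unfolding \<pi>_def by (rule quotient_hom(2)[OF Z_normal that])
    have pi_eq: "\<pi> x = \<pi> y \<longleftrightarrow> x \<otimes> inv y \<in> Z" if xy: "x \<in> carrier G" "y \<in> carrier G" for x y
      unfolding \<pi>_def by (rule quotient_eq_iff[OF Z_normal xy])
    have pi_comm: "\<pi> x \<otimes>\<^bsub>?Z\<^esub> \<pi> y = \<pi> y \<otimes>\<^bsub>?Z\<^esub> \<pi> x" if xy: "x \<in> P" "y \<in> P" for x y
    proof -
      have qg: "\<pi> q \<otimes>\<^bsub>?Z\<^esub> \<pi> g = \<pi> g \<otimes>\<^bsub>?Z\<^esub> \<pi> q" if q: "q \<in> Q" for q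
      proof -
        have qG: "q \<in> carrier G" using Q_carrier[OF q] .
        have "(q \<otimes> g) \<otimes> inv (g \<otimes> q) \<in> Z" using comm_g[OF q] qG g(1) by (simp add: word_simps)
        then have "\<pi> (q \<otimes> g) = \<pi> (g \<otimes> q)" using pi_eq[of "q \<otimes> g" "g \<otimes> q"] qG g(1) by simp
        then show ?thesis using qG g(1) by simp
      qed
      have qq: "\<pi> a \<otimes>\<^bsub>?Z\<^esub> \<pi> b = \<pi> b \<otimes>\<^bsub>?Z\<^esub> \<pi> a" if "a \<in> Q" "b \<in> Q" for a b
        using \<pi>.hom_mult[OF Q_carrier[OF that(1)] Q_carrier[OF that(2)]] \<pi>.hom_mult[OF Q_carrier[OF that(2)] Q_carrier[OF that(1)]]
          Q_comm[OF that] by simp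
      define B where "B = insert (\<pi> g) (\<pi> ` Q)"
      have BG: "B \<subseteq> carrier ?Z" using g(1) Q_carrier by (auto simp: B_def)
      have gen: "\<pi> w \<in> D" if w: "w \<in> P" and D: "subgroup D ?Z" "B \<subseteq> D" for w D
      proof -
        obtain q i where qi: "q \<in> Q" "w = q \<otimes> g [^] (i::nat)" using w unfolding P_def by blast
        have "\<pi> w = \<pi> q \<otimes>\<^bsub>?Z\<^esub> \<pi> g [^]\<^bsub>?Z\<^esub> i" using qi Q_carrier g(1) by (simp add: \<pi>.hom_nat_pow)
        moreover have "\<pi> q \<in> D" "\<pi> g \<in> D" using D(2) qi(1) by (auto simp: B_def)
        ultimately show ?thesis using \<pi>.H.sub_mult[OF D(1)] QZ.pow_sub[OF D(1)] by simp
      qed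
      define D1 where "D1 = {x \<in> carrier ?Z. \<forall>d\<in>B. x \<otimes>\<^bsub>?Z\<^esub> d = d \<otimes>\<^bsub>?Z\<^esub> x}"
      have D1: "subgroup D1 ?Z" unfolding D1_def by (rule QZ.centralizer_sub[OF BG])
      have "B \<subseteq> D1" using BG qg qq by (auto simp: D1_def B_def)
      then have P1: "\<pi> w \<in> D1" if "w \<in> P" for w using gen[OF that D1] by blast
      define D2 where "D2 = {x \<in> carrier ?Z. \<forall>d\<in>\<pi> ` P. x \<otimes>\<^bsub>?Z\<^esub> d = d \<otimes>\<^bsub>?Z\<^esub> x}"
      have D2: "subgroup D2 ?Z" unfolding D2_def by (rule QZ.centralizer_sub) (use P_carrier in auto)
      have "b \<otimes>\<^bsub>?Z\<^esub> d = d \<otimes>\<^bsub>?Z\<^esub> b" if "b \<in> B" "d \<in> \<pi> ` P" for b d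
        using P1 that unfolding D1_def by fastforce
      then have "B \<subseteq> D2" using BG by (auto simp: D2_def)
      then have "\<pi> x \<in> D2" using gen[OF xy(1) D2] by blast
      then show ?thesis using xy(2) by (simp add: D2_def)
    qed
    have P_pow: "w [^] p \<in> Z" if w: "w \<in> P" for w
    proof -
      obtain q i where qi: "q \<in> Q" "w = q \<otimes> g [^] (i::nat)" using w unfolding P_def by blast
      have qG: "q \<in> carrier G" using Q_carrier[OF qi(1)] .
      have wG: "w \<in> carrier G" using P_carrier[OF w] .
      have c: "\<pi> q \<otimes>\<^bsub>?Z\<^esub> \<pi> (g [^] i) = \<pi> (g [^] i) \<otimes>\<^bsub>?Z\<^esub> \<pi> q"
        by (rule pi_comm) (use qi QP pow_sub[OF P gP] in auto)
      have "\<pi> (w [^] p) = (\<pi> q \<otimes>\<^bsub>?Z\<^esub> \<pi> (g [^] i)) [^]\<^bsub>?Z\<^esub> p"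
        using \<pi>.hom_nat_pow[OF wG, of p] \<pi>.hom_mult[OF qG, of "g [^] i"] qi(2) g(1) by simp
      also have "\<dots> = \<pi> q [^]\<^bsub>?Z\<^esub> p \<otimes>\<^bsub>?Z\<^esub> \<pi> (g [^] i) [^]\<^bsub>?Z\<^esub> p"
        by (rule \<pi>.H.pow_mult_distrib[OF c]) (use qG g(1) in auto)
      also have "\<pi> q [^]\<^bsub>?Z\<^esub> p = \<one>\<^bsub>?Z\<^esub>" using \<pi>.hom_nat_pow[OF qG, of p] Q_exponent[OF qi(1)] by simp
      also have "\<pi> (g [^] i) [^]\<^bsub>?Z\<^esub> p = \<one>\<^bsub>?Z\<^esub>"
      proof -
        have "(g [^] i) [^] p = (g [^] p) [^] i" using g(1) by (simp add: nat_pow_pow mult.commute)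
        then have "(g [^] i) [^] p \<in> Z" using pow_sub[OF Z gpZ] by simp
        then show ?thesis using \<pi>.hom_nat_pow[of "g [^] i" p] one[of "(g [^] i) [^] p"] g(1) by simp
      qed
      finally show ?thesis using one[of "w [^] p"] wG by simp
    qed
    have PH: "\<exists>y\<in>P. \<exists>h\<in>H. x = y \<otimes> h" if x: "x \<in> carrier G" for x
    proof -
      define T where "T = {y \<otimes> h |y h. y \<in> P \<and> h \<in> H}"
      have T: "subgroup T G" unfolding T_def by (rule normal_mult_subgroup[OF P_normal H])
      have "M \<subseteq> T" using M_eq_QH QP unfolding T_def by blast
      moreover have "g \<in> T"
      proof -
        have "g = g \<otimes> \<one>" using g(1) by simp
        then show ?thesis using gP sub_one[OF H] unfolding T_def by blast
      qed
      ultimately have "T = carrier G" using M_max[OF T] g(2) by blast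
      then show ?thesis using x unfolding T_def by blast
    qed
    \<comment> \<open>An element of H centralizing P has all its G-conjugates in H, since G = PH;
      core-freeness applies.\<close>
    have cent_P: "h = \<one>" if h: "h \<in> H" and hc: "\<And>y. y \<in> P \<Longrightarrow> h \<otimes> y = y \<otimes> h" for h
    proof (rule core[OF h])
      fix x assume "x \<in> carrier G"
      then obtain y k where yk: "y \<in> P" "k \<in> H" "x = y \<otimes> k" using PH by blast
      have G: "y \<in> carrier G" "k \<in> carrier G" "h \<in> carrier G" using yk h P_carrier H_carrier by auto
      define v where "v = inv k \<otimes> y \<otimes> k"
      have v: "v \<in> P" using normal_conj[OF P_normal, of "inv k" y] yk G by (simp add: v_def)
      have vG: "v \<in> carrier G" using P_carrier[OF v] .
      have xe: "x = k \<otimes> v" using yk(3) G by (simp add: v_def word_simps)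
      have "x \<otimes> h \<otimes> inv x = k \<otimes> (v \<otimes> h) \<otimes> inv v \<otimes> inv k" unfolding xe using G vG by (simp add: word_simps)
      also have "\<dots> = k \<otimes> (h \<otimes> v) \<otimes> inv v \<otimes> inv k" using hc[OF v] by simp
      also have "\<dots> = k \<otimes> h \<otimes> inv k" using G vG by (simp add: word_simps)
      finally show "x \<otimes> h \<otimes> inv x \<in> H" using yk h sub_mult[OF H] sub_inv[OF H] by simp
    qed
    \<comment> \<open>With b = c^2: b acts trivially on P/Q (order p) by the dihedral relation, and
      it centralizes L and Z, hence Q = LZ. So conjugation by b multiplies g by an element q0 of Q,
      and b^p centralizes P. By faithfulness b^p = \<one>, so b is a p-element of M and lies in Q
      and in H.\<close>
    have sq_L: "c \<otimes> c \<in> L" if c: "c \<in> C" for c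
    proof -
      have cG: "c \<in> carrier G" using C_carrier[OF c] .
      have rG: "r \<in> carrier G" using H_carrier[OF r(1)] .
      define b where "b = c \<otimes> c"
      have bC: "b \<in> C" using sub_mult[OF C c c] by (simp add: b_def)
      have bG: "b \<in> carrier G" using C_carrier[OF bC] .
      obtain q1 d where q1: "q1 \<in> Q" "c \<otimes> g \<otimes> inv c = q1 \<otimes> g [^] (d::nat)"
        using normal_conj[OF P_normal cG gP] unfolding P_def by blast
      obtain q2 e where q2: "q2 \<in> Q" "r \<otimes> g \<otimes> inv r = q2 \<otimes> g [^] (e::nat)"
        using normal_conj[OF P_normal rG gP] unfolding P_def by blast
      define q0 where "q0 = b \<otimes> g \<otimes> inv b \<otimes> inv g"
      have q0: "q0 \<in> Q"
      proof -
        define \<rho> where "\<rho> = (\<lambda>x. Q #> x)"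
        interpret \<rho>: group_hom G "G Mod Q" \<rho> unfolding \<rho>_def by (rule quotient_hom[OF Q_normal])
        interpret QQ: fin_group "G Mod Q" by (rule quotient_fin[OF Q_normal])
        have one: "\<rho> x = \<one>\<^bsub>G Mod Q\<^esub>" if "x \<in> Q" for x
          unfolding \<rho>_def using quotient_hom(2)[OF Q_normal Q_carrier[OF that]] that by blast
        have red: "\<rho> (x \<otimes> g \<otimes> inv x) = \<rho> g [^]\<^bsub>G Mod Q\<^esub> k" if "q \<in> Q" "x \<otimes> g \<otimes> inv x = q \<otimes> g [^] (k::nat)" for x q k
          using that one[OF that(1)] Q_carrier[OF that(1)] g(1) by (simp add: \<rho>.hom_nat_pow)
        have e1: "\<rho> c \<otimes>\<^bsub>G Mod Q\<^esub> \<rho> g \<otimes>\<^bsub>G Mod Q\<^esub> inv\<^bsub>G Mod Q\<^esub> \<rho> c = \<rho> g [^]\<^bsub>G Mod Q\<^esub> d"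
          using red[OF q1] cG g(1) by simp
        have e2: "\<rho> r \<otimes>\<^bsub>G Mod Q\<^esub> \<rho> g \<otimes>\<^bsub>G Mod Q\<^esub> inv\<^bsub>G Mod Q\<^esub> \<rho> r = \<rho> g [^]\<^bsub>G Mod Q\<^esub> e"
          using red[OF q2] rG g(1) by simp
        have e3: "\<rho> r \<otimes>\<^bsub>G Mod Q\<^esub> \<rho> c \<otimes>\<^bsub>G Mod Q\<^esub> inv\<^bsub>G Mod Q\<^esub> \<rho> r = inv\<^bsub>G Mod Q\<^esub> \<rho> c"
        proof -
          have "\<rho> (r \<otimes> c \<otimes> inv r) = \<rho> (inv c)" using dl_inverts[OF dl r c] by simp
          then show ?thesis using rG cG by simp
        qed
        have e4: "\<rho> r \<otimes>\<^bsub>G Mod Q\<^esub> \<rho> r = \<one>\<^bsub>G Mod Q\<^esub>"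
          using \<rho>.hom_mult[OF rG rG] dl_sq[OF dl r] \<rho>.hom_one by simp
        have "\<rho> c \<otimes>\<^bsub>G Mod Q\<^esub> (\<rho> c \<otimes>\<^bsub>G Mod Q\<^esub> \<rho> g \<otimes>\<^bsub>G Mod Q\<^esub> inv\<^bsub>G Mod Q\<^esub> \<rho> c) \<otimes>\<^bsub>G Mod Q\<^esub> inv\<^bsub>G Mod Q\<^esub> \<rho> c = \<rho> g"
          by (rule QQ.dihedral_action_square[OF _ _ _ e1 e2 e3 e4]) (use cG rG g(1) in auto)
        then have "\<rho> (c \<otimes> (c \<otimes> g \<otimes> inv c) \<otimes> inv c) = \<rho> g" using cG g(1) by simp
        moreover have "c \<otimes> (c \<otimes> g \<otimes> inv c) \<otimes> inv c = b \<otimes> g \<otimes> inv b" using cG g(1) by (simp add: b_def word_simps)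
        ultimately have "\<rho> (b \<otimes> g \<otimes> inv b) = \<rho> g" by simp
        then show ?thesis
          using quotient_eq_iff[OF Q_normal, of "b \<otimes> g \<otimes> inv b" g] bG g(1) by (simp add: \<rho>_def q0_def)
      qed
      have q0G: "q0 \<in> carrier G" using Q_carrier[OF q0] .
      have bg: "b \<otimes> g \<otimes> inv b = q0 \<otimes> g" using bG g(1) by (simp add: q0_def word_simps)
      have bL: "b \<otimes> l = l \<otimes> b" if "l \<in> L" for l using dl_comm[OF dl bC] LC that by blast
      \<comment> \<open>A commutator of L with g. It generates Z, and b fixes it because b fixes u
        and changes g only by an element of the abelian group Q.\<close>
      define v where "v = inv u \<otimes> (g \<otimes> u \<otimes> inv g)"
      have vZ: "v \<in> Z" using comm_g[of "inv u"] sub_inv[OF Q] u LQ uG by (auto simp: v_def)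
      have vG: "v \<in> carrier G" using Z_carrier[OF vZ] .
      have v1: "v \<noteq> \<one>"
      proof
        assume "v = \<one>"
        then have "u \<otimes> v = u" using uG by simp
        then have "g \<otimes> u \<otimes> inv g = u" using uG g(1) by (simp add: v_def inv_cancel2)
        then have "u \<in> Z" using conj_comm[OF g(1) uG] Ziff u LQ by auto
        then show False using LZ u by blast
      qed
      have bv: "b \<otimes> v \<otimes> inv b = v"
      proof -
        have bu: "b \<otimes> u \<otimes> inv b = u" using conj_comm[OF bG uG] bL[OF u(1)] by simp
        have gu: "g \<otimes> u \<otimes> inv g \<in> Q" using conj_Q[OF g(1)] u LQ by blast
        have guG: "g \<otimes> u \<otimes> inv g \<in> carrier G" using g(1) uG by simp
        have "b \<otimes> v \<otimes> inv b = inv (b \<otimes> u \<otimes> inv b) \<otimes> ((b \<otimes> g \<otimes> inv b) \<otimes> (b \<otimes> u \<otimes> inv b) \<otimes> inv (b \<otimes> g \<otimes> inv b))"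
          using bG uG g(1) by (simp add: v_def word_simps)
        also have "\<dots> = inv u \<otimes> (q0 \<otimes> (g \<otimes> u \<otimes> inv g) \<otimes> inv q0)"
          unfolding bu bg using uG g(1) q0G by (simp add: word_simps)
        also have "q0 \<otimes> (g \<otimes> u \<otimes> inv g) \<otimes> inv q0 = g \<otimes> u \<otimes> inv g"
          using conj_comm[OF q0G guG] Q_comm[OF q0 gu] by simp
        finally show ?thesis by (simp add: v_def)
      qed
      have bZ: "b \<otimes> z = z \<otimes> b" if z: "z \<in> Z" for z
      proof -
        obtain i where i: "z = v [^] (i::nat)" using cyclic_prime_card[OF p(1) Z cZ vZ v1 z] by blast
        have "b \<otimes> z \<otimes> inv b = z" using conj_pow[OF bG vG, of i] bv i by simp
        then show ?thesis using conj_comm[OF bG Z_carrier[OF z]] by simp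
      qed
      have bQ: "b \<otimes> q = q \<otimes> b" if q: "q \<in> Q" for q
      proof -
        have "L \<noteq> Z" using LZ u by blast
        then obtain l z where lz: "l \<in> L" "z \<in> Z" "q = l \<otimes> z"
          using prime_subgroups_product[OF p(1) Q cQ L cL LQ Z cZ ZQ _ q] by blast
        have "b \<otimes> (l \<otimes> z) = l \<otimes> (b \<otimes> z)" using bL[OF lz(1)] bG L_carrier[OF lz(1)] Z_carrier[OF lz(2)] by (simp add: m_assoc[symmetric])
        also have "\<dots> = (l \<otimes> z) \<otimes> b" using bZ[OF lz(2)] bG L_carrier[OF lz(1)] Z_carrier[OF lz(2)] by (simp add: m_assoc)
        finally show ?thesis using lz by simp
      qed
      have bn: "b [^] n \<otimes> g \<otimes> inv (b [^] n) = q0 [^] n \<otimes> g" for n :: nat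
      proof (induction n)
        case (Suc n)
        have "b [^] Suc n \<otimes> g \<otimes> inv (b [^] Suc n) = b \<otimes> (b [^] n \<otimes> g \<otimes> inv (b [^] n)) \<otimes> inv b"
          using bG g(1) nat_pow_Suc2[OF bG] by (simp add: word_simps)
        also have "\<dots> = (b \<otimes> q0 [^] n) \<otimes> g \<otimes> inv b" unfolding Suc using bG g(1) q0G by (simp add: m_assoc)
        also have "b \<otimes> q0 [^] n = q0 [^] n \<otimes> b" using bQ[OF pow_sub[OF Q q0]] .
        also have "q0 [^] n \<otimes> b \<otimes> g \<otimes> inv b = q0 [^] n \<otimes> (b \<otimes> g \<otimes> inv b)" using bG g(1) q0G by (simp add: m_assoc)
        also have "\<dots> = q0 [^] Suc n \<otimes> g" unfolding bg using g(1) q0G by (simp add: m_assoc)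
        finally show ?case .
      qed (use g(1) in simp)
      define h where "h = b [^] p"
      have hG: "h \<in> carrier G" using bG by (simp add: h_def)
      have hg: "h \<otimes> g \<otimes> inv h = g" using bn[of p] Q_exponent[OF q0] g(1) by (simp add: h_def)
      define D where "D = {x \<in> carrier G. \<forall>d\<in>{h}. x \<otimes> d = d \<otimes> x}"
      have D: "subgroup D G" unfolding D_def by (rule centralizer_sub) (use hG in auto)
      have QD: "Q \<subseteq> D"
      proof
        fix q assume q: "q \<in> Q"
        have qG: "q \<in> carrier G" using Q_carrier[OF q] .
        have "b \<otimes> q \<otimes> inv b = q" using conj_comm[OF bG qG] bQ[OF q] by simp
        then have "q \<otimes> b \<otimes> inv q = b" using bQ[OF q] bG qG by (simp add: m_assoc[symmetric] conj_comm)
        then have "q \<otimes> h \<otimes> inv q = h" using conj_pow[OF qG bG, of p] by (simp add: h_def)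
        then show "q \<in> D" using conj_comm[OF qG hG] qG by (simp add: D_def)
      qed
      have gD: "g \<in> D" using conj_comm[OF hG g(1)] hg g(1) by (simp add: D_def)
      have "h \<otimes> y = y \<otimes> h" if "y \<in> P" for y
      proof -
        from that obtain q i where "q \<in> Q" "y = q \<otimes> g [^] (i::nat)" unfolding P_def by blast
        then have "y \<in> D" using sub_mult[OF D] pow_sub[OF D gD] QD by auto
        then show ?thesis by (simp add: D_def)
      qed
      moreover have "h \<in> H" using pow_sub[OF C bC] CH by (auto simp: h_def)
      ultimately have "h = \<one>" using cent_P by blast
      then have "b [^] (p ^ 1) = \<one>" by (simp add: h_def)
      moreover have "b \<in> M" using bC CH M(2) by blast
      ultimately have "b \<in> Q" using p_element_in_Q by blast
      then show ?thesis using bC CH by (auto simp: L_def b_def)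
    qed
    have rG: "r \<in> carrier G" using H_carrier[OF r(1)] .
    \<comment> \<open>The only possible involution of C, with \<one> as a default when there is
      none.\<close>
    obtain c1 where c1: "c1 \<in> C" "c1 \<otimes> c1 = \<one>" "\<And>c. \<lbrakk>c \<in> C; c \<otimes> c = \<one>\<rbrakk> \<Longrightarrow> c = \<one> \<or> c = c1"
    proof (cases "\<exists>c\<in>C. c \<noteq> \<one> \<and> c \<otimes> c = \<one>")
      case True
      then obtain c where c: "c \<in> C" "c \<noteq> \<one>" "c \<otimes> c = \<one>" by blast
      have "d = \<one> \<or> d = c" if "d \<in> C" "d \<otimes> d = \<one>" for d
        using dl_unique_involution[OF dl that(1) c(1) that(2) c(3)] c(2) by blast
      then show thesis using that[of c] c by blast
    next
      case False
      then show thesis using that[of \<one>] sub_one[OF C] by auto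
    qed
    have c1G: "c1 \<in> carrier G" using C_carrier[OF c1(1)] .
    have rc1: "r \<otimes> c1 = c1 \<otimes> r"
    proof -
      have "inv c1 = c1" using c1 c1G inv_equality by blast
      then show ?thesis using dl_inverts[OF dl r c1(1)] conj_comm[OF rG c1G] by simp
    qed
    \<comment> \<open>Modulo Z, w is an eigenvector with eigenvalue 1 or -1.\<close>
    define Inv where "Inv \<tau> w \<longleftrightarrow> \<pi> (\<tau> \<otimes> w \<otimes> inv \<tau>) = \<pi> w \<or> \<pi> (\<tau> \<otimes> w \<otimes> inv \<tau>) = inv\<^bsub>?Z\<^esub> \<pi> w" for \<tau> w
    \<comment> \<open>With s the image of w under \<sigma>, the product w s is fixed by \<sigma>
      modulo Z, and w s^-1 is inverted. An eigenvector property for \<tau> survives because \<tau>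
      commutes with \<sigma>.\<close>
    have avg: "\<exists>w'. w' \<in> P \<and> w' \<notin> Q \<and> Inv \<sigma> w' \<and> Inv \<tau> w'"
      if \<sigma>: "\<sigma> \<in> carrier G" "\<sigma> \<otimes> \<sigma> = \<one>" and \<tau>: "\<tau> \<in> carrier G" "\<sigma> \<otimes> \<tau> = \<tau> \<otimes> \<sigma>" and w: "w \<in> P" "w \<notin> Q" "Inv \<tau> w"
      for \<sigma> \<tau> w
    proof -
      have wG: "w \<in> carrier G" using P_carrier[OF w(1)] .
      define s where "s = \<sigma> \<otimes> w \<otimes> inv \<sigma>"
      have s: "s \<in> P" using normal_conj[OF P_normal \<sigma>(1) w(1)] by (simp add: s_def)
      have sG: "s \<in> carrier G" using P_carrier[OF s] .
      have \<sigma>s: "\<sigma> \<otimes> s \<otimes> inv \<sigma> = w"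
      proof -
        have "\<sigma> \<otimes> s \<otimes> inv \<sigma> = (\<sigma> \<otimes> \<sigma>) \<otimes> w \<otimes> inv (\<sigma> \<otimes> \<sigma>)" using \<sigma>(1) wG by (simp add: s_def word_simps)
        then show ?thesis using \<sigma>(2) wG by simp
      qed
      define a b where "a = \<pi> w" and "b = \<pi> s"
      have ab: "a \<in> carrier ?Z" "b \<in> carrier ?Z" "a \<otimes>\<^bsub>?Z\<^esub> b = b \<otimes>\<^bsub>?Z\<^esub> a"
        using wG sG pi_comm[OF w(1) s] by (auto simp: a_def b_def)
      have aib: "a \<otimes>\<^bsub>?Z\<^esub> inv\<^bsub>?Z\<^esub> b = inv\<^bsub>?Z\<^esub> b \<otimes>\<^bsub>?Z\<^esub> a"
        using pi_comm[OF w(1) sub_inv[OF P s]] sG by (simp add: a_def b_def)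
      have \<tau>s: "\<tau> \<otimes> s \<otimes> inv \<tau> = \<sigma> \<otimes> (\<tau> \<otimes> w \<otimes> inv \<tau>) \<otimes> inv \<sigma>"
      proof -
        have "\<tau> \<otimes> s \<otimes> inv \<tau> = (\<tau> \<otimes> \<sigma>) \<otimes> w \<otimes> inv (\<tau> \<otimes> \<sigma>)" using \<sigma>(1) \<tau>(1) wG by (simp add: s_def word_simps)
        also have "\<dots> = (\<sigma> \<otimes> \<tau>) \<otimes> w \<otimes> inv (\<sigma> \<otimes> \<tau>)" using \<tau>(2) by simp
        finally show ?thesis using \<sigma>(1) \<tau>(1) wG by (simp add: word_simps)
      qed
      have bs: "b = \<pi> \<sigma> \<otimes>\<^bsub>?Z\<^esub> a \<otimes>\<^bsub>?Z\<^esub> inv\<^bsub>?Z\<^esub> \<pi> \<sigma>" using \<sigma>(1) wG by (simp add: a_def b_def s_def)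
      have pts: "\<pi> (\<tau> \<otimes> s \<otimes> inv \<tau>) = \<pi> \<sigma> \<otimes>\<^bsub>?Z\<^esub> \<pi> (\<tau> \<otimes> w \<otimes> inv \<tau>) \<otimes>\<^bsub>?Z\<^esub> inv\<^bsub>?Z\<^esub> \<pi> \<sigma>"
        unfolding \<tau>s using \<sigma>(1) \<tau>(1) wG by (simp del: \<pi>.hom_mult add: \<pi>.hom_mult[of "\<sigma> \<otimes> (\<tau> \<otimes> w \<otimes> inv \<tau>)" "inv \<sigma>"] \<pi>.hom_mult[of \<sigma> "\<tau> \<otimes> w \<otimes> inv \<tau>"])
      have alt: "(\<pi> (\<tau> \<otimes> w \<otimes> inv \<tau>) = a \<and> \<pi> (\<tau> \<otimes> s \<otimes> inv \<tau>) = b) \<or>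
        (\<pi> (\<tau> \<otimes> w \<otimes> inv \<tau>) = inv\<^bsub>?Z\<^esub> a \<and> \<pi> (\<tau> \<otimes> s \<otimes> inv \<tau>) = inv\<^bsub>?Z\<^esub> b)"
      proof -
        from w(3) consider "\<pi> (\<tau> \<otimes> w \<otimes> inv \<tau>) = a" | "\<pi> (\<tau> \<otimes> w \<otimes> inv \<tau>) = inv\<^bsub>?Z\<^esub> a"
          unfolding Inv_def a_def by blast
        then show ?thesis
        proof cases
          case 1 then show ?thesis using pts bs by simp
        next
          case 2
          have "\<pi> \<sigma> \<otimes>\<^bsub>?Z\<^esub> inv\<^bsub>?Z\<^esub> a \<otimes>\<^bsub>?Z\<^esub> inv\<^bsub>?Z\<^esub> \<pi> \<sigma> = inv\<^bsub>?Z\<^esub> b"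
            unfolding bs using \<sigma>(1) ab(1) by (simp add: \<pi>.H.word_simps)
          then show ?thesis using pts 2 by simp
        qed
      qed
      have \<tau>conj: "\<pi> (\<tau> \<otimes> (y \<otimes> y') \<otimes> inv \<tau>) = \<pi> (\<tau> \<otimes> y \<otimes> inv \<tau>) \<otimes>\<^bsub>?Z\<^esub> \<pi> (\<tau> \<otimes> y' \<otimes> inv \<tau>)"
        if "y \<in> carrier G" "y' \<in> carrier G" for y y'
      proof -
        have "\<tau> \<otimes> (y \<otimes> y') \<otimes> inv \<tau> = (\<tau> \<otimes> y \<otimes> inv \<tau>) \<otimes> (\<tau> \<otimes> y' \<otimes> inv \<tau>)" using that \<tau>(1) by (simp add: word_simps)
        then show ?thesis using \<pi>.hom_mult[of "\<tau> \<otimes> y \<otimes> inv \<tau>" "\<tau> \<otimes> y' \<otimes> inv \<tau>"] that \<tau>(1) by simp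
      qed
      have \<tau>inv: "\<pi> (\<tau> \<otimes> inv s \<otimes> inv \<tau>) = inv\<^bsub>?Z\<^esub> \<pi> (\<tau> \<otimes> s \<otimes> inv \<tau>)"
      proof -
        have "\<tau> \<otimes> inv s \<otimes> inv \<tau> = inv (\<tau> \<otimes> s \<otimes> inv \<tau>)" using sG \<tau>(1) by (simp add: word_simps)
        then show ?thesis using \<pi>.hom_inv[of "\<tau> \<otimes> s \<otimes> inv \<tau>"] sG \<tau>(1) by simp
      qed
      \<comment> \<open>If both candidates were in Q, so would be w^2. But w^p is in Z and p is odd,
        so w itself would be in Q.\<close>
      consider "w \<otimes> s \<notin> Q" | "w \<otimes> inv s \<notin> Q"
      proof -
        have "w \<otimes> s \<notin> Q \<or> w \<otimes> inv s \<notin> Q"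
        proof (rule ccontr)
          assume "\<not> ?thesis"
          then have q: "w \<otimes> s \<in> Q" "w \<otimes> inv s \<in> Q" by auto
          have "inv w \<otimes> (w \<otimes> s) \<otimes> inv (inv w) \<in> Q" using conj_Q[of "inv w", OF _ q(1)] wG by simp
          then have "s \<otimes> w \<in> Q" using wG sG by (simp add: inv_cancel1)
          then have "(w \<otimes> inv s) \<otimes> (s \<otimes> w) \<in> Q" using sub_mult[OF Q q(2)] by blast
          then have ww: "w \<otimes> w \<in> Q" using wG sG by (simp add: m_assoc inv_cancel1)
          obtain i where i: "p = 2 * i + 1" using p(2) by (rule oddE)
          have "w [^] (2::nat) = w \<otimes> w" using wG by (simp add: numeral_2_eq_2)
          then have "w [^] p = (w \<otimes> w) [^] i \<otimes> w" using wG i by (simp add: nat_pow_pow[symmetric])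
          then have "w = inv ((w \<otimes> w) [^] i) \<otimes> w [^] p" using wG by (simp add: inv_cancel1)
          moreover have "inv ((w \<otimes> w) [^] i) \<otimes> w [^] p \<in> Q"
            using P_pow[OF w(1)] ZQ by (intro sub_mult[OF Q] sub_inv[OF Q] pow_sub[OF Q ww]) blast
          ultimately show False using w(2) by simp
        qed
        then show thesis using that by blast
      qed
      then show ?thesis
      proof cases
        case 1
        have "\<sigma> \<otimes> (w \<otimes> s) \<otimes> inv \<sigma> = s \<otimes> w"
        proof -
          have "\<sigma> \<otimes> (w \<otimes> s) \<otimes> inv \<sigma> = s \<otimes> (\<sigma> \<otimes> s \<otimes> inv \<sigma>)" unfolding s_def using \<sigma>(1) wG by (simp add: word_simps)
          then show ?thesis using \<sigma>s by simp
        qed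
        then have "Inv \<sigma> (w \<otimes> s)" using ab wG sG by (simp add: Inv_def a_def b_def)
        moreover have "Inv \<tau> (w \<otimes> s)"
          using alt
        proof
          assume "\<pi> (\<tau> \<otimes> w \<otimes> inv \<tau>) = a \<and> \<pi> (\<tau> \<otimes> s \<otimes> inv \<tau>) = b"
          then show ?thesis using \<tau>conj[OF wG sG] \<pi>.hom_mult[OF wG sG] unfolding Inv_def a_def b_def by simp
        next
          assume "\<pi> (\<tau> \<otimes> w \<otimes> inv \<tau>) = inv\<^bsub>?Z\<^esub> a \<and> \<pi> (\<tau> \<otimes> s \<otimes> inv \<tau>) = inv\<^bsub>?Z\<^esub> b"
          then have "\<pi> (\<tau> \<otimes> (w \<otimes> s) \<otimes> inv \<tau>) = inv\<^bsub>?Z\<^esub> a \<otimes>\<^bsub>?Z\<^esub> inv\<^bsub>?Z\<^esub> b" using \<tau>conj[OF wG sG] by simp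
          also have "\<dots> = inv\<^bsub>?Z\<^esub> (b \<otimes>\<^bsub>?Z\<^esub> a)" using ab by (simp add: \<pi>.H.inv_mult_group)
          also have "\<dots> = inv\<^bsub>?Z\<^esub> \<pi> (w \<otimes> s)" using ab(3) \<pi>.hom_mult[OF wG sG] by (simp add: a_def b_def)
          finally show ?thesis unfolding Inv_def by blast
        qed
        ultimately show ?thesis using 1 sub_mult[OF P w(1) s] by blast
      next
        case 2
        have isG: "inv s \<in> carrier G" using sG by simp
        have "\<sigma> \<otimes> (w \<otimes> inv s) \<otimes> inv \<sigma> = inv (w \<otimes> inv s)"
        proof -
          have "\<sigma> \<otimes> (w \<otimes> inv s) \<otimes> inv \<sigma> = s \<otimes> inv (\<sigma> \<otimes> s \<otimes> inv \<sigma>)" unfolding s_def using \<sigma>(1) wG by (simp add: word_simps)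
          then show ?thesis using \<sigma>s wG sG by (simp add: inv_mult_group)
        qed
        then have "Inv \<sigma> (w \<otimes> inv s)" using wG sG \<pi>.hom_inv[of "w \<otimes> inv s"] unfolding Inv_def by simp
        moreover have "Inv \<tau> (w \<otimes> inv s)"
          using alt
        proof
          assume "\<pi> (\<tau> \<otimes> w \<otimes> inv \<tau>) = a \<and> \<pi> (\<tau> \<otimes> s \<otimes> inv \<tau>) = b"
          then show ?thesis using \<tau>conj[OF wG isG] \<tau>inv \<pi>.hom_mult[OF wG isG] \<pi>.hom_inv[OF sG] unfolding Inv_def a_def b_def by simp
        next
          assume "\<pi> (\<tau> \<otimes> w \<otimes> inv \<tau>) = inv\<^bsub>?Z\<^esub> a \<and> \<pi> (\<tau> \<otimes> s \<otimes> inv \<tau>) = inv\<^bsub>?Z\<^esub> b"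
          then have "\<pi> (\<tau> \<otimes> (w \<otimes> inv s) \<otimes> inv \<tau>) = inv\<^bsub>?Z\<^esub> a \<otimes>\<^bsub>?Z\<^esub> inv\<^bsub>?Z\<^esub> (inv\<^bsub>?Z\<^esub> b)" using \<tau>conj[OF wG isG] \<tau>inv by simp
          also have "\<dots> = inv\<^bsub>?Z\<^esub> (inv\<^bsub>?Z\<^esub> b \<otimes>\<^bsub>?Z\<^esub> a)" using ab by (simp add: \<pi>.H.inv_mult_group)
          also have "\<dots> = inv\<^bsub>?Z\<^esub> \<pi> (w \<otimes> inv s)" using aib \<pi>.hom_mult[OF wG isG] \<pi>.hom_inv[OF sG] by (simp add: a_def b_def)
          finally show ?thesis unfolding Inv_def by blast
        qed
        ultimately show ?thesis using 2 sub_mult[OF P w(1) sub_inv[OF P s]] by blast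
      qed
    qed
    \<comment> \<open>Averaging twice: over r starting from g, then over c1, which commutes with
      r.\<close>
    have "Inv \<one> g" using g(1) by (simp add: Inv_def)
    then obtain w1 where w1: "w1 \<in> P" "w1 \<notin> Q" "Inv r w1"
      using avg[of r \<one> g] rG dl_sq[OF dl r] gP gQ by auto
    obtain w where w: "w \<in> P" "w \<notin> Q" "Inv c1 w" "Inv r w"
      using avg[of c1 r w1] c1G c1(2) rG rc1 w1 by auto
    have wG: "w \<in> carrier G" using P_carrier[OF w(1)] .
    have wZ: "w \<notin> Z" using w(2) ZQ by blast
    have nz: "w \<otimes> z \<otimes> inv w \<in> Z" if "z \<in> Z" for z using normal_conj[OF Z_normal wG that] .
    define W where "W = {a \<otimes> w [^] i |a i. a \<in> Z \<and> i \<in> (UNIV :: nat set)}"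
    have W: "subgroup W G" "card W = p\<^sup>2"
      using prime_extension(1,2)[OF p(1) Z wG wZ P_pow[OF w(1)] nz] cZ by (simp_all add: W_def power2_eq_square)
    have ZW: "Z \<subseteq> W"
    proof
      fix z assume z: "z \<in> Z"
      have "z = z \<otimes> w [^] (0::nat)" using Z_carrier[OF z] by simp
      then show "z \<in> W" using z unfolding W_def by blast
    qed
    have wW: "w \<in> W"
    proof -
      have "w = \<one> \<otimes> w [^] (1::nat)" using wG by simp
      then show ?thesis using sub_one[OF Z] unfolding W_def by blast
    qed
    define D where "D = {x \<in> carrier G. \<forall>y\<in>W. x \<otimes> y \<otimes> inv x \<in> W}"
    have D: "subgroup D G" unfolding D_def by (rule normalizer_sub[OF subgroup.subset[OF W(1)] fin_sub[OF W(1)]])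
    have in_D: "x \<in> D" if x: "x \<in> carrier G" "Inv x w" for x
    proof -
      define y where "y = x \<otimes> w \<otimes> inv x"
      have yG: "y \<in> carrier G" using x wG by (simp add: y_def)
      have "y \<in> W"
      proof -
        from x(2) consider "\<pi> y = \<pi> w" | "\<pi> y = \<pi> (inv w)" using \<pi>.hom_inv[OF wG] unfolding Inv_def y_def by auto
        then show ?thesis
        proof cases
          case 1
          then have "y \<otimes> inv w \<in> W" using pi_eq[OF yG wG] ZW by blast
          then have "y \<otimes> inv w \<otimes> w \<in> W" using sub_mult[OF W(1) _ wW] by blast
          then show ?thesis using yG wG by (simp add: m_assoc)
        next
          case 2
          then have "y \<otimes> inv (inv w) \<in> W" using pi_eq[OF yG, of "inv w"] wG ZW by auto
          then have "y \<otimes> w \<otimes> inv w \<in> W" using sub_mult[OF W(1) _ sub_inv[OF W(1) wW]] wG by simp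
          then show ?thesis using yG wG by (simp add: m_assoc)
        qed
      qed
      have "x \<otimes> v \<otimes> inv x \<in> W" if "v \<in> W" for v
      proof -
        obtain z i where zi: "z \<in> Z" "v = z \<otimes> w [^] (i::nat)" using \<open>v \<in> W\<close> unfolding W_def by blast
        have "x \<otimes> v \<otimes> inv x = (x \<otimes> z \<otimes> inv x) \<otimes> (x \<otimes> w [^] i \<otimes> inv x)"
          using zi x Z_carrier[OF zi(1)] wG by (simp add: word_simps)
        also have "x \<otimes> w [^] i \<otimes> inv x = y [^] i" using conj_pow[OF x(1) wG] by (simp add: y_def)
        finally show ?thesis
          using sub_mult[OF W(1)] pow_sub[OF W(1) \<open>y \<in> W\<close>] normal_conj[OF Z_normal x(1) zi(1)] ZW by auto
      qed
      then show ?thesis using x(1) by (simp add: D_def)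
    qed
    have PD: "P \<subseteq> D"
    proof
      fix y assume y: "y \<in> P"
      have yG: "y \<in> carrier G" using P_carrier[OF y] .
      have "\<pi> (y \<otimes> w \<otimes> inv y) = \<pi> w"
        using pi_comm[OF y w(1)] yG wG by (simp add: \<pi>.H.m_assoc)
      then show "y \<in> D" using in_D[OF yG] by (simp add: Inv_def)
    qed
    have rD: "r \<in> D" and c1D: "c1 \<in> D" using in_D rG c1G w by auto
    \<comment> \<open>Writing p = 2i + 1, c is a product of powers of c^2, which lies in L, and of
      c^p, which is \<one> or c1.\<close>
    have CD: "c \<in> D" if c: "c \<in> C" for c
    proof -
      have cG: "c \<in> carrier G" using C_carrier[OF c] .
      have ccD: "c \<otimes> c \<in> D" using sq_L[OF c] LQ QP PD by blast
      obtain i where i: "p = 2 * i + 1" using p(2) by (rule oddE)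
      have c2: "c [^] (2::nat) = c \<otimes> c" using cG by (simp add: numeral_2_eq_2)
      then have cp: "c [^] p = (c \<otimes> c) [^] i \<otimes> c" using cG i by (simp add: nat_pow_pow[symmetric])
      have "c [^] p \<otimes> c [^] p = (c [^] (2::nat)) [^] p" using cG by (simp add: nat_pow_pow nat_pow_mult mult_2)
      also have "\<dots> = \<one>" unfolding c2 using Q_exponent sq_L[OF c] LQ by blast
      finally have "c [^] p = \<one> \<or> c [^] p = c1" using c1(3)[OF pow_sub[OF C c]] by blast
      then have "c [^] p \<in> D" using c1D sub_one[OF D] by auto
      moreover have "c = inv ((c \<otimes> c) [^] i) \<otimes> c [^] p" using cp cG by (simp add: inv_cancel1)
      ultimately show ?thesis using sub_mult[OF D sub_inv[OF D pow_sub[OF D ccD]]] by metis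
    qed
    have HD: "h \<in> D" if h: "h \<in> H" for h
    proof (cases "h \<in> C")
      case False
      have "r \<otimes> h \<in> C" using dl_prod[OF dl r h False] .
      then have "r \<otimes> (r \<otimes> h) \<in> D" using sub_mult[OF D rD] CD by blast
      moreover have "r \<otimes> (r \<otimes> h) = h" using dl_sq[OF dl r] rG H_carrier[OF h] by (simp add: m_assoc[symmetric])
      ultimately show ?thesis by simp
    qed (rule CD)
    have "x \<in> D" if "x \<in> carrier G" for x using PH[OF that] PD HD sub_mult[OF D] by auto
    then have "W \<lhd> G" by (intro normalI' W(1)) (simp add: D_def)
    \<comment> \<open>W \<inter> H lies in P \<inter> M = Q, and W meets Q only in Z because w has
      order p modulo Q; finally L and Z meet trivially.\<close>
    moreover have "W \<inter> H = {\<one>}"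
    proof
      show "{\<one>} \<subseteq> W \<inter> H" using sub_one[OF W(1)] sub_one[OF H] by blast
      show "W \<inter> H \<subseteq> {\<one>}"
      proof
        fix y assume y: "y \<in> W \<inter> H"
        then obtain z i where zi: "z \<in> Z" "y = z \<otimes> w [^] (i::nat)" unfolding W_def by blast
        have WP: "W \<subseteq> P" using ZQ QP sub_mult[OF P] pow_sub[OF P w(1)] unfolding W_def by blast
        have yQ: "y \<in> Q" using PM[of y] y WP M(2) by blast
        have "inv z \<otimes> y \<in> Q" using sub_mult[OF Q sub_inv[OF Q] yQ] zi(1) ZQ by blast
        then have "w [^] i \<in> Q" using zi Z_carrier[OF zi(1)] wG by (simp add: inv_cancel1)
        moreover have wpQ: "w [^] p \<in> Q" using P_pow[OF w(1)] ZQ by blast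
        ultimately have "p dvd i" using prime_extension(3)[OF p(1) Q wG w(2) wpQ conj_Q[OF wG]] by blast
        then obtain t where "i = p * t" by blast
        then have "w [^] i = (w [^] p) [^] t" using wG by (simp add: nat_pow_pow)
        then have "w [^] i \<in> Z" using pow_sub[OF Z P_pow[OF w(1)]] by simp
        then have "y \<in> Z" using sub_mult[OF Z zi(1)] zi(2) by simp
        moreover have "y \<in> L" using yQ y by (simp add: L_def)
        ultimately show "y \<in> {\<one>}" using LZ by blast
      qed
    qed
    ultimately show ?thesis using W(2) by blast
  qed
qed

end

section \<open>A normal complement of order p squared\<close>

text \<open>An intermediate subgroup must have index p on both sides, which gives the imprimitive
  setting. Otherwise H is maximal, the action on its cosets satisfies the trivial intersection
  property, and W is the set of solutions of g^(p^2) = \<one>.\<close>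

lemma (in fin_group) normal_complement_exists:
  assumes p: "Factorial_Ring.prime p" "odd p" and dl: "dihedral_like G H C" and r: "r \<in> H" "r \<notin> C"
    and core: "\<And>h. \<lbrakk>h \<in> H; \<And>g. g \<in> carrier G \<Longrightarrow> g \<otimes> h \<otimes> inv g \<in> H\<rbrakk> \<Longrightarrow> h = \<one>"
    and cG: "card (carrier G) = p\<^sup>2 * card H"
  shows "\<exists>W. W \<lhd> G \<and> card W = p\<^sup>2 \<and> W \<inter> H = {\<one>}"
proof (cases "\<exists>M. subgroup M G \<and> H \<subset> M \<and> M \<subset> carrier G")
  case True
  then obtain M where M: "subgroup M G" "H \<subseteq> M" "H \<noteq> M" "M \<noteq> carrier G" by blast
  note H = dl_sub(1)[OF dl]
  obtain k where k: "card M = card H * k" using card_dvd[OF H M(1,2)] by (auto elim: dvdE)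
  obtain l where l: "card (carrier G) = card M * l" using card_dvd_carrier[OF M(1)] by (auto elim: dvdE)
  have "card H * (k * l) = card H * p\<^sup>2" using k l cG by (metis mult.assoc mult.commute)
  then have kl: "k * l = p\<^sup>2" using card_sub_pos[OF H] by (metis mult_cancel1 less_irrefl)
  have "k \<noteq> 1" using k M(3) card_subset_eq[OF fin_sub[OF M(1)] M(2)] by auto
  have "l \<noteq> 1" using l M(4) card_subset_eq[OF fin subgroup.subset[OF M(1)]] by auto
  have "k dvd p ^ 2" using kl by (metis dvd_triv_left)
  then obtain i where i: "i \<le> 2" "k = p ^ i" using p(1) divides_primepow_nat by blast
  have p0: "p > 0" using prime_gt_0_nat[OF p(1)] .
  have "i \<noteq> 0" using i(2) \<open>k \<noteq> 1\<close> by auto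
  moreover have "i \<noteq> 2"
  proof
    assume "i = 2"
    then have "p\<^sup>2 * l = p\<^sup>2 * 1" using kl i(2) by simp
    then have "l = 1" using p0 by (metis mult_cancel1 power_not_zero less_irrefl)
    then show False using \<open>l \<noteq> 1\<close> by simp
  qed
  ultimately have "i = 1" using i(1) by linarith
  then have kp: "k = p" using i(2) by simp
  then have lp: "l = p" using kl p0 by (metis mult_cancel1 power2_eq_square less_irrefl)
  then have "imprimitive G H C M p r"
    using p dl r core M(1,2) k l unfolding kp lp 
    by unfold_locales (simp_all add: mult.commute subgroup.subset[OF M(1)] sub_mult[OF M(1)] sub_one[OF M(1)] sub_inv[OF M(1)])
  then show ?thesis by (rule imprimitive.normal_complement)
next
  case False
  note H = dl_sub(1)[OF dl] and C = dl_sub(2)[OF dl] and CH = dl_sub(3)[OF dl]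
  have HG: "H \<subseteq> carrier G" using subgroup.subset[OF H] .
  have CG: "c \<in> carrier G" if "c \<in> C" for c using that CH HG by blast
  have maxH: "N = H \<or> N = carrier G" if "subgroup N G" "H \<subseteq> N" for N
    using False that subgroup.subset[OF that(1)] by blast
  have r1: "r \<noteq> \<one>" using r sub_one[OF C] by blast
  obtain g0 where g0: "g0 \<in> carrier G" "g0 \<otimes> r \<otimes> inv g0 \<notin> H" using core r r1 by blast
  have TI0: "c = \<one>" if "g \<in> carrier G" "g \<notin> H" "c \<in> C" "g \<otimes> c \<otimes> inv g \<in> C" for g c
    by (rule maximal_core_free_TI[OF dl maxH core g0(1) r(1) g0(2) that])
  interpret A: fin_action G "rcosets H" "\<lambda>g S. S #> inv g" by (rule rcosets_action[OF H])
  define f where "f x h = inv x \<otimes> h \<otimes> x" for x h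
  \<comment> \<open>The cyclic part at the coset Hx is x^-1 C x. Taking all x of the coset avoids
    choosing a representative; the union is a single conjugate because C is normal in H.\<close>
  define CC where "CC S = {f x c |x c. x \<in> S \<and> c \<in> C}" for S
  have CC_base: "CC (H #> x) = f x ` C" if x: "x \<in> carrier G" for x
  proof
    show "CC (H #> x) \<subseteq> f x ` C"
    proof
      fix v assume "v \<in> CC (H #> x)"
      then obtain y c where yc: "y \<in> H #> x" "c \<in> C" "v = f y c" by (auto simp: CC_def)
      then obtain h where h: "h \<in> H" "y = h \<otimes> x" by (auto simp: r_coset_def)
      have "v = f x (inv h \<otimes> c \<otimes> inv (inv h))"
        using yc h x CG HG by (simp add: f_def word_simps subsetD)
      moreover have "inv h \<otimes> c \<otimes> inv (inv h) \<in> C"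
        by (rule dl_normal[OF dl C order_refl sub_inv[OF H h(1)] yc(2)])
      ultimately show "v \<in> f x ` C" by blast
    qed
    show "f x ` C \<subseteq> CC (H #> x)" using rcos_self[OF x H] by (auto simp: CC_def)
  qed
  have stab_base: "A.stab (H #> x) = f x ` H" if x: "x \<in> carrier G" for x
  proof (intro equalityI subsetI)
    fix g assume "g \<in> A.stab (H #> x)"
    then have g: "g \<in> carrier G" "x \<otimes> g \<otimes> inv x \<in> H" using rcoset_fixed_iff[OF H x] by (auto simp: A.stab_def)
    have "g = f x (x \<otimes> g \<otimes> inv x)" using g x by (simp add: f_def word_simps)
    then show "g \<in> f x ` H" using g by blast
  next
    fix g assume "g \<in> f x ` H"
    then obtain h where h: "h \<in> H" "g = f x h" by blast
    have hG: "h \<in> carrier G" using h HG by blast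
    have "x \<otimes> g \<otimes> inv x = h" using h hG x by (simp add: f_def word_simps)
    then show "g \<in> A.stab (H #> x)" using rcoset_fixed_iff[OF H x, of g] h hG x by (simp add: A.stab_def f_def)
  qed
  have "ti_action G (rcosets H) (\<lambda>g S. S #> inv g) CC p"
  proof
    show "card (rcosets H) = p\<^sup>2" by (rule card_rcosets[OF H cG])
    show "\<exists>g\<in>carrier G. S #> inv g = T" if "S \<in> rcosets H" "T \<in> rcosets H" for S T
      by (rule rcosets_transitive[OF H that])
    show "dihedral_like G (A.stab S) (CC S)" if "S \<in> rcosets H" for S
    proof -
      obtain x where x: "x \<in> carrier G" "S = H #> x" using \<open>S \<in> rcosets H\<close> by (auto simp: RCOSETS_def)
      have "group_hom G G (f x)"
        using x(1) by unfold_locales (auto simp: hom_def f_def word_simps)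
      then show ?thesis unfolding x(2) stab_base[OF x(1)] CC_base[OF x(1)] by (rule dl_hom[OF dl])
    qed
    show "CC (S #> inv g) = (\<lambda>c. g \<otimes> c \<otimes> inv g) ` CC S" if g: "g \<in> carrier G" and S: "S \<in> rcosets H" for g S
    proof -
      obtain x where x: "x \<in> carrier G" "S = H #> x" using S by (auto simp: RCOSETS_def)
      have e: "S #> inv g = H #> (x \<otimes> inv g)" using x g HG by (simp add: coset_mult_assoc)
      have "CC (S #> inv g) = f (x \<otimes> inv g) ` C" unfolding e by (rule CC_base) (use x g in simp)
      also have "\<dots> = (\<lambda>c. g \<otimes> c \<otimes> inv g) ` f x ` C"
        unfolding image_image by (rule image_cong) (use x g CG in \<open>auto simp: f_def word_simps\<close>)
      finally show ?thesis using CC_base[OF x(1)] x(2) by simp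
    qed
    show "S = T" if S: "S \<in> rcosets H" and T: "T \<in> rcosets H" and v: "v \<in> CC S" "v \<in> CC T" "v \<noteq> \<one>" for S T v
    proof -
      obtain x where x: "x \<in> carrier G" "S = H #> x" using S by (auto simp: RCOSETS_def)
      obtain y where y: "y \<in> carrier G" "T = H #> y" using T by (auto simp: RCOSETS_def)
      obtain c where c: "c \<in> C" "v = f x c" using v(1) CC_base[OF x(1)] x(2) by blast
      obtain d where d: "d \<in> C" "v = f y d" using v(2) CC_base[OF y(1)] y(2) by blast
      define g where "g = y \<otimes> inv x"
      have gG: "g \<in> carrier G" using x y by (simp add: g_def)
      have "g \<otimes> c \<otimes> inv g = y \<otimes> f x c \<otimes> inv y" using x y CG[OF c(1)] by (simp add: g_def f_def word_simps)
      also have "\<dots> = y \<otimes> f y d \<otimes> inv y" using c d by simp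
      also have "\<dots> = d" using y CG[OF d(1)] by (simp add: f_def word_simps)
      finally have gc: "g \<otimes> c \<otimes> inv g \<in> C" using d by simp
      have "c \<noteq> \<one>" using v(3) c x by (auto simp: f_def)
      then have "g \<in> H" using TI0[OF gG _ c(1) gc] by blast
      then have "y \<in> H #> x" using subgroup.rcos_module[OF H is_group x(1) y(1)] by (simp add: g_def)
      then show ?thesis using repr_independence[OF _ x(1) H] x y by simp
    qed
  qed (use p in auto)
  then interpret T: ti_action G "rcosets H" "\<lambda>g S. S #> inv g" CC p .
  define W where "W = {g \<in> carrier G. g [^] p\<^sup>2 = \<one>}"
  have W: "subgroup W G" "card W = p\<^sup>2"
    using ti_action_normal_complement[OF T.ti_action_axioms] by (auto simp: W_def)
  have "W \<lhd> G" by (rule normalI'[OF W(1)]) (auto simp: W_def conj_pow)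
  moreover have "W \<inter> H = {\<one>}"
  proof
    have H1: "H #> \<one> = H" using HG by simp
    have "H \<in> rcosets H" using rcosetsI[OF HG one_closed] H1 by simp
    moreover have "A.stab H = H"
    proof -
      have "f \<one> ` H = (\<lambda>h. h) ` H" by (rule image_cong) (use HG in \<open>auto simp: f_def\<close>)
      then show ?thesis using stab_base[OF one_closed] H1 by simp
    qed
    ultimately have nd: "\<not> p dvd card H" using T.p_not_dvd_stab by metis
    have "coprime (p\<^sup>2) (card H)" using nd p(1) by (simp add: prime_imp_coprime)
    show "W \<inter> H \<subseteq> {\<one>}"
    proof
      fix x assume x: "x \<in> W \<inter> H"
      then have "x [^] p\<^sup>2 = \<one>" "x [^] card H = \<one>" "x \<in> carrier G"
        using pow_card_sub[OF H] HG by (auto simp: W_def)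
      then show "x \<in> {\<one>}" using pow_coprime_one \<open>coprime (p\<^sup>2) (card H)\<close> by blast
    qed
    show "{\<one>} \<subseteq> W \<inter> H" using sub_one[OF W(1)] sub_one[OF H] by blast
  qed
  ultimately show ?thesis using W(2) by blast
qed

section \<open>The action of a complement on the normal subgroup of order p^2\<close>

context fin_group
begin

context
  fixes W H p
  assumes W: "W \<lhd> G" "card W = p\<^sup>2" and H: "subgroup H G" and WH: "W \<inter> H = {\<one>}"
    and cG: "card (carrier G) = p\<^sup>2 * card H"
begin

lemma complement_factorization:
  assumes "g \<in> carrier G"
  shows "\<exists>w\<in>W. \<exists>h\<in>H. g = w \<otimes> h"
proof -
  have Ws: "subgroup W G" using normal_imp_subgroup[OF W(1)] .
  have WG: "w \<in> carrier G" if "w \<in> W" for w using sub_mem[OF Ws that] .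
  have HG: "h \<in> carrier G" if "h \<in> H" for h using sub_mem[OF H that] .
  have inj: "inj_on (\<lambda>(w, h). w \<otimes> h) (W \<times> H)"
  proof (rule inj_onI)
    fix x y assume "x \<in> W \<times> H" "y \<in> W \<times> H" "(case x of (w, h) \<Rightarrow> w \<otimes> h) = (case y of (w, h) \<Rightarrow> w \<otimes> h)"
    then obtain a b c d where xy: "x = (a, b)" "y = (c, d)" and m: "a \<in> W" "b \<in> H" "c \<in> W" "d \<in> H" and e: "a \<otimes> b = c \<otimes> d" by auto
    have G: "a \<in> carrier G" "b \<in> carrier G" "c \<in> carrier G" "d \<in> carrier G" using m WG HG by auto
    have "inv c \<otimes> (a \<otimes> b) \<otimes> inv b = inv c \<otimes> (c \<otimes> d) \<otimes> inv b" using e by simp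
    then have e2: "inv c \<otimes> a = d \<otimes> inv b" using G by (simp add: word_simps)
    have "inv c \<otimes> a \<in> W" "d \<otimes> inv b \<in> H"
      using m sub_mult[OF Ws] sub_inv[OF Ws] sub_mult[OF H] sub_inv[OF H] by auto
    then have "inv c \<otimes> a = \<one>" using e2 WH by auto
    then have "c \<otimes> (inv c \<otimes> a) = c" "d \<otimes> inv b \<otimes> b = b" using G e2 by auto
    then show "x = y" using xy G by (simp add: inv_cancel2 m_assoc)
  qed
  have "(\<lambda>(w, h). w \<otimes> h) ` (W \<times> H) = carrier G"
    by (rule card_subset_eq[OF fin])
      (use WG HG card_image[OF inj] W(2) cG in \<open>auto simp: card_cartesian_product\<close>)
  then have "g \<in> (\<lambda>(w, h). w \<otimes> h) ` (W \<times> H)" using assms by simp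
  then show ?thesis by auto
qed

text \<open>If h centralizes W, its conjugates under G = WH are its conjugates under H, so they
  remain in H.\<close>

lemma complement_faithful:
  assumes core: "\<And>h. \<lbrakk>h \<in> H; \<And>g. g \<in> carrier G \<Longrightarrow> g \<otimes> h \<otimes> inv g \<in> H\<rbrakk> \<Longrightarrow> h = \<one>"
    and h: "h \<in> H" "\<And>w. w \<in> W \<Longrightarrow> h \<otimes> w = w \<otimes> h"
  shows "h = \<one>"
proof (rule core[OF h(1)])
  have Ws: "subgroup W G" using normal_imp_subgroup[OF W(1)] .
  fix g assume "g \<in> carrier G"
  then obtain y k where yk: "y \<in> W" "k \<in> H" "g = y \<otimes> k" using complement_factorization by blast
  have G: "y \<in> carrier G" "k \<in> carrier G" "h \<in> carrier G" using yk h sub_mem[OF Ws] sub_mem[OF H] by auto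
  define v where "v = inv k \<otimes> y \<otimes> k"
  have v: "v \<in> W" using normal_conj[OF W(1), of "inv k" y] yk G by (simp add: v_def)
  have vG: "v \<in> carrier G" using sub_mem[OF Ws v] .
  have xe: "g = k \<otimes> v" using yk(3) G by (simp add: v_def word_simps)
  have "g \<otimes> h \<otimes> inv g = k \<otimes> (v \<otimes> h) \<otimes> inv v \<otimes> inv k" unfolding xe using G vG by (simp add: word_simps)
  also have "\<dots> = k \<otimes> (h \<otimes> v) \<otimes> inv v \<otimes> inv k" using h(2)[OF v] by simp
  also have "\<dots> = k \<otimes> h \<otimes> inv k" using G vG by (simp add: word_simps)
  finally show "g \<otimes> h \<otimes> inv g \<in> H" using yk h sub_mult[OF H] sub_inv[OF H] by simp
qed

text \<open>Otherwise W is cyclic of order p^2 and has an abelian automorphism group. Then H is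
  abelian, so c, being inverted by the reflection r, is an involution. Inversion is the only
  involution among the automorphisms of W, so r and c act alike and rc = \<one>, although rc lies
  outside C.\<close>

lemma complement_exponent:
  assumes p: "Factorial_Ring.prime p" "odd p"
    and core: "\<And>h. \<lbrakk>h \<in> H; \<And>g. g \<in> carrier G \<Longrightarrow> g \<otimes> h \<otimes> inv g \<in> H\<rbrakk> \<Longrightarrow> h = \<one>"
    and dl: "dihedral_like G H C" and r: "r \<in> H" "r \<notin> C" and c: "c \<in> C" "c \<noteq> \<one>" and w: "w \<in> W"
  shows "w [^] p = \<one>"
proof (rule ccontr)
  assume wp: "w [^] p \<noteq> \<one>"
  have Ws: "subgroup W G" using normal_imp_subgroup[OF W(1)] .
  have wG: "w \<in> carrier G" using sub_mem[OF Ws w] .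
  have HG: "h \<in> carrier G" if "h \<in> H" for h using sub_mem[OF H that] .
  have "ord w dvd p ^ 2" using ord_dvd_sub[OF Ws w] W(2) by simp
  then obtain i where i: "i \<le> 2" "ord w = p ^ i" using p(1) divides_primepow_nat by blast
  have "\<not> i \<le> 1"
  proof
    assume "i \<le> 1"
    then have "ord w dvd p" using i by (metis le_imp_power_dvd power_one_right)
    then show False using wp pow_eq_id[OF wG] by simp
  qed
  then have "i = 2" using i(1) by simp
  then have o: "ord w = p\<^sup>2" using i(2) by simp
  have gen: "\<exists>k::nat. v = w [^] k" if v: "v \<in> W" for v
  proof -
    have "inj_on (\<lambda>k. w [^] k) {0..ord w - 1}" using ord_inj[OF wG] by simp
    then have "card ((\<lambda>k. w [^] k) ` {0..ord w - 1}) = p\<^sup>2" using o prime_gt_0_nat[OF p(1)] by (simp add: card_image)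
    moreover have "(\<lambda>k. w [^] k) ` {0..ord w - 1} \<subseteq> W" using pow_sub[OF Ws w] by blast
    ultimately have "(\<lambda>k. w [^] k) ` {0..ord w - 1} = W" using card_subset_eq[OF fin_sub[OF Ws]] W(2) by simp
    then show ?thesis using v by blast
  qed
  have faith: "h = \<one>" if h: "h \<in> H" "h \<otimes> w \<otimes> inv h = w" for h
  proof (rule complement_faithful[OF core h(1)])
    fix v assume "v \<in> W"
    then obtain k where k: "v = w [^] (k::nat)" using gen by blast
    have "h \<otimes> v \<otimes> inv h = v" using conj_pow[OF HG[OF h(1)] wG] h(2) k by simp
    then have "h \<otimes> v \<otimes> inv h \<otimes> h = v \<otimes> h" by simp
    then show "h \<otimes> v = v \<otimes> h" using HG[OF h(1)] wG k by (simp add: m_assoc)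
  qed
  have act: "\<exists>k::nat. h \<otimes> w \<otimes> inv h = w [^] k" if "h \<in> H" for h
    by (rule gen) (rule normal_conj[OF W(1) HG[OF that] w])
  have conj_conj: "h \<otimes> k \<otimes> w \<otimes> inv (h \<otimes> k) = (w [^] a) [^] b"
    if hk: "h \<in> H" "k \<in> H" "h \<otimes> w \<otimes> inv h = w [^] (a::nat)" "k \<otimes> w \<otimes> inv k = w [^] (b::nat)" for h k a b
  proof -
    have "h \<otimes> k \<otimes> w \<otimes> inv (h \<otimes> k) = h \<otimes> (k \<otimes> w \<otimes> inv k) \<otimes> inv h" using HG hk(1,2) wG by (simp add: word_simps)
    also have "\<dots> = (h \<otimes> w \<otimes> inv h) [^] b" unfolding hk(4) using conj_pow[OF HG[OF hk(1)] wG] by simp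
    finally show ?thesis using hk(3) by simp
  qed
  have comm: "h \<otimes> k = k \<otimes> h" if hk: "h \<in> H" "k \<in> H" for h k
  proof -
    obtain a b where ab: "h \<otimes> w \<otimes> inv h = w [^] (a::nat)" "k \<otimes> w \<otimes> inv k = w [^] (b::nat)" using act hk by meson
    have e: "h \<otimes> k \<otimes> w \<otimes> inv (h \<otimes> k) = k \<otimes> h \<otimes> w \<otimes> inv (k \<otimes> h)"
      using conj_conj[OF hk ab] conj_conj[OF hk(2,1) ab(2,1)] wG by (simp add: nat_pow_pow mult.commute)
    have G: "h \<in> carrier G" "k \<in> carrier G" using HG hk by auto
    define m where "m = inv (k \<otimes> h) \<otimes> (h \<otimes> k)"
    have "m \<otimes> w \<otimes> inv m = inv (k \<otimes> h) \<otimes> (h \<otimes> k \<otimes> w \<otimes> inv (h \<otimes> k)) \<otimes> (k \<otimes> h)"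
      using G wG by (simp add: m_def word_simps)
    also have "\<dots> = w" unfolding e using G wG by (simp add: word_simps)
    finally have "m = \<one>" using faith hk sub_mult[OF H] sub_inv[OF H] by (simp add: m_def)
    then have "(k \<otimes> h) \<otimes> m = k \<otimes> h" using G by simp
    then show ?thesis using G by (simp add: m_def inv_cancel2)
  qed
  have inv_w: "h \<otimes> w \<otimes> inv h = inv w" if h: "h \<in> H" "h \<otimes> h = \<one>" "h \<noteq> \<one>" for h
  proof -
    obtain a where a: "h \<otimes> w \<otimes> inv h = w [^] (a::nat)" using act h by blast
    have "(w [^] a) [^] a = w" using conj_conj[OF h(1) h(1) a a] h(2) wG by simp
    then have "w [^] (a * a) = w" using wG by (simp add: nat_pow_pow)
    then have "w [^] int (a * a) = w" by (simp only: int_pow_int)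
    then have "w [^] (int (a * a) - 1) = w \<otimes> inv w" using int_pow_diff[OF wG, of "int (a * a)" 1] wG by simp
    then have "w [^] (int (a * a) - 1) = \<one>" using wG by simp
    then have "int (p\<^sup>2) dvd int (a * a) - 1" using int_pow_eq_id[OF wG] o by simp
    then have d: "int p * int p dvd (int a - 1) * (int a + 1)" by (simp add: power2_eq_square algebra_simps)
    have ip: "Factorial_Ring.prime (int p)" using p(1) by simp
    \<comment> \<open>For odd p only one of a - 1, a + 1 is divisible by p; that one absorbs the
      whole factor p^2 of a^2 - 1.\<close>
    have nb: "\<not> (int p dvd int a - 1 \<and> int p dvd int a + 1)"
    proof
      assume "int p dvd int a - 1 \<and> int p dvd int a + 1"
      then have "int p dvd (int a + 1) - (int a - 1)" using dvd_diff by blast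
      then have "int p dvd 2" by simp
      then have "p dvd 2" by (metis int_dvd_int_iff of_nat_numeral)
      then have "p \<le> 2" by (simp add: dvd_imp_le)
      then show False using p prime_ge_2_nat[OF p(1)] by (metis even_numeral le_antisym)
    qed
    have "int p * int p dvd int a - 1 \<or> int p * int p dvd int a + 1"
    proof (cases "int p dvd int a - 1")
      case True
      then have "coprime (int p * int p) (int a + 1)" using nb ip by (simp add: prime_imp_coprime)
      then show ?thesis using d coprime_dvd_mult_left_iff by blast
    next
      case False
      then have "coprime (int p * int p) (int a - 1)" using ip by (simp add: prime_imp_coprime)
      then show ?thesis using d coprime_dvd_mult_right_iff by blast
    qed
    then have "w [^] (int a - 1) = \<one> \<or> w [^] (int a + 1) = \<one>"
      using int_pow_eq_id[OF wG] o by (simp add: power2_eq_square)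
    then have "w [^] a = w \<or> w [^] a = inv w"
    proof
      assume "w [^] (int a - 1) = \<one>"
      moreover have "w [^] ((int a - 1) + 1) = w [^] (int a - 1) \<otimes> w [^] (1::int)" by (rule int_pow_mult[OF wG])
      ultimately have "w [^] (int a) = w" using wG by simp
      then show ?thesis by (simp add: int_pow_int)
    next
      assume "w [^] (int a + 1) = \<one>"
      then have "w [^] (int a) \<otimes> w = \<one>" using wG by (simp add: int_pow_mult)
      then show ?thesis using wG inv_equality by (simp add: int_pow_int)
    qed
    moreover have "w [^] a \<noteq> w" using faith h a by metis
    ultimately show ?thesis using a by simp
  qed
  have CH: "C \<subseteq> H" and Cs: "subgroup C G" using dl_sub[OF dl] by auto
  have cH: "c \<in> H" using c CH by blast
  have G: "c \<in> carrier G" "r \<in> carrier G" using HG cH r by auto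
  have "r \<otimes> c \<otimes> inv r = c" using comm[OF r(1) cH] G by (simp add: m_assoc)
  then have "c = inv c" using dl_inverts[OF dl r c(1)] by simp
  then have "c \<otimes> c = \<one>" using G by (metis r_inv)
  then have c_inv: "c \<otimes> w \<otimes> inv c = inv w" using inv_w cH c by blast
  have r_inv: "r \<otimes> w \<otimes> inv r = inv w" using inv_w[OF r(1) dl_sq[OF dl r]] r sub_one[OF Cs] by blast
  have "(r \<otimes> c) \<otimes> w \<otimes> inv (r \<otimes> c) = r \<otimes> (c \<otimes> w \<otimes> inv c) \<otimes> inv r" using G wG by (simp add: word_simps)
  also have "\<dots> = inv (r \<otimes> w \<otimes> inv r)" unfolding c_inv using G wG by (simp add: word_simps)
  also have "\<dots> = w" unfolding r_inv using wG by simp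
  finally have "r \<otimes> c = \<one>" using faith sub_mult[OF H r(1) cH] by blast
  then show False using dl_coset[OF dl r c(1)] sub_one[OF Cs] by simp
qed

end
end

section \<open>Recognizing affine groups\<close>

lemma (in group) int_pow_mod_prime:
  assumes "x \<in> carrier G" "x [^] (p::nat) = \<one>"
  shows "x [^] (i mod int p) = x [^] (i::int)"
proof -
  have "x [^] i = x [^] (int p * (i div int p)) \<otimes> x [^] (i mod int p)"
    using int_pow_mult[OF assms(1), of "int p * (i div int p)" "i mod int p"] by simp
  also have "x [^] (int p * (i div int p)) = (x [^] int p) [^] (i div int p)"
    using assms(1) by (simp add: int_pow_pow)
  also have "x [^] int p = \<one>" using assms by (simp add: int_pow_int)
  finally show ?thesis using assms(1) by simp
qed

text \<open>A basis of an elementary abelian subgroup of order p^2 inside a possibly noncommutative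
  group. Coordinates are integers, meaningful only modulo p; independence is stated for integer
  exponents accordingly.\<close>

locale plane_basis = fin_group G for G (structure) +
  fixes p :: nat and w1 w2 :: 'a
  assumes prime_p: "Factorial_Ring.prime p"
    and basis_carrier: "w1 \<in> carrier G" "w2 \<in> carrier G"
    and basis_comm: "w1 \<otimes> w2 = w2 \<otimes> w1"
    and basis_exponent: "w1 [^] p = \<one>" "w2 [^] p = \<one>"
    and basis_indep: "w1 [^] (i::int) \<otimes> w2 [^] (j::int) = \<one> \<Longrightarrow> int p dvd i \<and> int p dvd j"
begin

definition vec :: "int \<times> int \<Rightarrow> 'a" where
  "vec v = w1 [^] fst v \<otimes> w2 [^] snd v"

lemma vec_carrier [simp]: "vec v \<in> carrier G"
  using basis_carrier by (simp add: vec_def)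

lemma pow_commute: "w1 [^] (i::int) \<otimes> w2 [^] (j::int) = w2 [^] j \<otimes> w1 [^] i"
proof -
  have sw: "y [^] (j::int) \<otimes> x = x \<otimes> y [^] j" if "x \<in> carrier G" "y \<in> carrier G" "x \<otimes> y = y \<otimes> x" for x y j
  proof -
    interpret h: group_hom G G "\<lambda>z. inv x \<otimes> z \<otimes> x"
      using that by unfold_locales (auto simp: hom_def word_simps)
    have "inv x \<otimes> y \<otimes> x = y" using that by (simp add: m_assoc inv_cancel1 flip: that(3))
    then have "inv x \<otimes> y [^] j \<otimes> x = y [^] j" using h.hom_int_pow[OF that(2), of j] by simp
    then have "x \<otimes> (inv x \<otimes> y [^] j \<otimes> x) = x \<otimes> y [^] j" by simp
    then show ?thesis using that by (simp add: m_assoc inv_cancel2)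
  qed
  have "w2 [^] j \<otimes> w1 = w1 \<otimes> w2 [^] j" by (rule sw[OF basis_carrier basis_comm])
  then show ?thesis using sw[of "w2 [^] j" w1 i] basis_carrier by simp
qed

lemma vec_add: "vec v \<otimes> vec w = vec (fst v + fst w, snd v + snd w)"
proof -
  have "vec v \<otimes> vec w = w1 [^] fst v \<otimes> (w2 [^] snd v \<otimes> w1 [^] fst w) \<otimes> w2 [^] snd w"
    using basis_carrier by (simp add: vec_def m_assoc)
  also have "\<dots> = w1 [^] fst v \<otimes> (w1 [^] fst w \<otimes> w2 [^] snd v) \<otimes> w2 [^] snd w" by (simp add: pow_commute)
  also have "\<dots> = vec (fst v + fst w, snd v + snd w)"
    using basis_carrier by (simp add: vec_def m_assoc int_pow_mult)
  finally show ?thesis .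
qed

lemma vec_comm: "vec v \<otimes> vec w = vec w \<otimes> vec v"
  by (simp add: vec_add add.commute)

lemma vec_one: "vec (0, 0) = \<one>" by (simp add: vec_def)

lemma vec_basis: "vec (1, 0) = w1" "vec (0, 1) = w2"
  using basis_carrier by (simp_all add: vec_def)

lemma vec_int_pow: "vec v [^] (i::int) = vec (i * fst v, i * snd v)"
proof -
  have "vec v [^] i = (w1 [^] fst v) [^] i \<otimes> (w2 [^] snd v) [^] i"
    unfolding vec_def by (rule int_pow_mult_distrib[OF pow_commute]) (use basis_carrier in auto)
  then show ?thesis using basis_carrier by (simp add: vec_def int_pow_pow mult.commute)
qed

lemma vec_inv: "inv (vec v) = vec (- fst v, - snd v)"
  by (rule inv_equality) (simp_all add: vec_add vec_one)

lemma vec_mod: "vec (i mod int p, j mod int p) = vec (i, j)"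
  using basis_carrier basis_exponent by (simp add: vec_def int_pow_mod_prime)

lemma vec_eq_iff: "vec v = vec w \<longleftrightarrow> fst v mod int p = fst w mod int p \<and> snd v mod int p = snd w mod int p"
proof
  assume e: "vec v = vec w"
  have "vec (fst v - fst w, snd v - snd w) = vec v \<otimes> inv (vec w)" by (simp add: vec_inv vec_add)
  also have "\<dots> = \<one>" using e by simp
  finally have "int p dvd fst v - fst w \<and> int p dvd snd v - snd w" using basis_indep by (simp add: vec_def)
  then show "fst v mod int p = fst w mod int p \<and> snd v mod int p = snd w mod int p" by (simp add: mod_eq_dvd_iff)
next
  assume "fst v mod int p = fst w mod int p \<and> snd v mod int p = snd w mod int p"
  then show "vec v = vec w" using vec_mod by (metis prod.collapse)
qed

definition plane :: "'a set" where "plane = range vec"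

lemma plane_subgroup: "subgroup plane G"
  by (rule subgroup_finI) (auto simp: plane_def vec_add vec_one[symmetric])

text \<open>The inverse of \<open>vec\<close> with values in the standard residues, which are the
  points of V.\<close>

definition coord :: "'a \<Rightarrow> int \<times> int" where
  "coord a = (SOME v. v \<in> Vp p \<and> vec v = a)"

lemma coord_vec: "coord (vec v) = (fst v mod int p, snd v mod int p)"
proof -
  have p0: "int p > 0" using prime_gt_0_nat[OF prime_p] by simp
  have ex: "(fst v mod int p, snd v mod int p) \<in> Vp p \<and> vec (fst v mod int p, snd v mod int p) = vec v"
    using p0 by (simp add: Vp_def vec_mod)
  have "coord (vec v) \<in> Vp p \<and> vec (coord (vec v)) = vec v" unfolding coord_def by (rule someI) (rule ex)
  then show ?thesis using vec_eq_iff[of "coord (vec v)" v] by (auto simp: Vp_def mem_Times_iff prod_eq_iff)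
qed

lemma card_plane: "card plane = p\<^sup>2"
proof -
  have p0: "int p > 0" using prime_gt_0_nat[OF prime_p] by simp
  have "bij_betw vec (Vp p) plane"
  proof (rule bij_betw_imageI)
    show "inj_on vec (Vp p)" by (rule inj_onI) (auto simp: vec_eq_iff Vp_def)
    show "vec ` Vp p = plane"
    proof
      show "plane \<subseteq> vec ` Vp p"
      proof
        fix a assume "a \<in> plane"
        then obtain v where "a = vec (fst v mod int p, snd v mod int p)" using vec_mod by (metis plane_def prod.collapse rangeE)
        then show "a \<in> vec ` Vp p" using p0 by (auto simp: Vp_def)
      qed
    qed (auto simp: plane_def)
  qed
  then have "card (Vp p) = card plane" by (rule bij_betw_same_card)
  then show ?thesis by (simp add: Vp_def card_cartesian_product power2_eq_square)
qed

text \<open>The images of w1 and w2 are the rows of the matrix, so conjugation by l is the right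
  action of that matrix on row vectors.\<close>

lemma conj_vec:
  assumes l: "l \<in> carrier G" and "l \<otimes> w1 \<otimes> inv l = vec (a, b)" "l \<otimes> w2 \<otimes> inv l = vec (c, d)"
  shows "l \<otimes> vec v \<otimes> inv l = vec (mat_act p (a, b, c, d) v)"
proof -
  interpret h: group_hom G G "\<lambda>z. l \<otimes> z \<otimes> inv l"
    using l by unfold_locales (auto simp: hom_def word_simps)
  have "l \<otimes> vec v \<otimes> inv l = (l \<otimes> w1 [^] fst v \<otimes> inv l) \<otimes> (l \<otimes> w2 [^] snd v \<otimes> inv l)"
    unfolding vec_def by (rule h.hom_mult) (use basis_carrier in auto)
  also have "\<dots> = vec (a, b) [^] fst v \<otimes> vec (c, d) [^] snd v"
    using h.hom_int_pow[OF basis_carrier(1)] h.hom_int_pow[OF basis_carrier(2)] assms by simp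
  also have "\<dots> = vec (fst v * a + snd v * c, fst v * b + snd v * d)" by (simp add: vec_int_pow vec_add)
  also have "\<dots> = vec (mat_act p (a, b, c, d) v)" by (simp add: mat_act_def vec_mod split: prod.split)
  finally show ?thesis .
qed

text \<open>G acts on the plane as on the cosets of K: elements of the plane by translation,
  elements of K by conjugation. The action is faithful because K acts faithfully on the plane, and
  it carries generators of G to the prescribed translations and matrices. Orders of the generators
  are preserved, which gives the claim on \<open>mat_ord\<close>.\<close>

lemma affine_group_recognition:
  assumes normal: "plane \<lhd> G" and K: "subgroup K G" "plane \<inter> K = {\<one>}"
    and factor: "\<And>g. g \<in> carrier G \<Longrightarrow> \<exists>a\<in>plane. \<exists>k\<in>K. g = a \<otimes> k"
    and faithful: "\<And>k. \<lbrakk>k \<in> K; k \<otimes> w1 = w1 \<otimes> k; k \<otimes> w2 = w2 \<otimes> k\<rbrakk> \<Longrightarrow> k = \<one>"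
    and gens: "K = generate G (lm ` gens)" "lm ` gens \<subseteq> K"
    and conj: "\<And>a b c d. (a, b, c, d) \<in> gens \<Longrightarrow> lm (a, b, c, d) \<otimes> w1 \<otimes> inv (lm (a, b, c, d)) = vec (a, b) \<and>
      lm (a, b, c, d) \<otimes> w2 \<otimes> inv (lm (a, b, c, d)) = vec (c, d)"
  shows "G \<cong> affine_group p gens" "\<And>M. M \<in> gens \<Longrightarrow> mat_ord p M = ord (lm M)"
proof -
  have KG: "k \<in> carrier G" if "k \<in> K" for k using sub_mem[OF K(1) that] .
  have PG: "a \<in> carrier G" if "a \<in> plane" for a using sub_mem[OF plane_subgroup that] .
  \<comment> \<open>The plane component of g in the factorization g = ak.\<close>
  define apart where "apart g = (SOME a. a \<in> plane \<and> inv a \<otimes> g \<in> K)" for g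
  have uniq: "a = b" if "a \<in> plane" "b \<in> plane" "inv a \<otimes> g \<in> K" "inv b \<otimes> g \<in> K" "g \<in> carrier G" for a b g
  proof -
    have G: "a \<in> carrier G" "b \<in> carrier G" using that PG by auto
    have "(inv a \<otimes> g) \<otimes> inv (inv b \<otimes> g) \<in> K" using that sub_mult[OF K(1)] sub_inv[OF K(1)] by blast
    then have "inv a \<otimes> b \<in> K" using G that(5) by (simp add: word_simps)
    moreover have "inv a \<otimes> b \<in> plane" using that sub_mult[OF plane_subgroup] sub_inv[OF plane_subgroup] by blast
    ultimately have "inv a \<otimes> b = \<one>" using K(2) by blast
    then have "a \<otimes> (inv a \<otimes> b) = a" using G by simp
    then show ?thesis using G by (simp add: inv_cancel2)
  qed
  have apart: "apart g \<in> plane \<and> inv (apart g) \<otimes> g \<in> K" if g: "g \<in> carrier G" for g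
  proof -
    obtain a k where ak: "a \<in> plane" "k \<in> K" "g = a \<otimes> k" using factor[OF g] by blast
    then have "a \<in> plane \<and> inv a \<otimes> g \<in> K" using PG KG by (simp add: inv_cancel1)
    then show ?thesis unfolding apart_def by (rule someI)
  qed
  have apart_eq: "apart g = a" if "g \<in> carrier G" "a \<in> plane" "inv a \<otimes> g \<in> K" for g a
    using uniq[of "apart g" a g] apart that by blast
  have apart_mult: "apart (g \<otimes> apart h) = apart (g \<otimes> h)" if gh: "g \<in> carrier G" "h \<in> carrier G" for g h
  proof (rule apart_eq)
    have aG: "apart h \<in> carrier G" "apart (g \<otimes> h) \<in> carrier G" using apart PG gh by auto
    show "g \<otimes> apart h \<in> carrier G" "apart (g \<otimes> h) \<in> plane" using gh aG apart by auto
    have "(inv (apart (g \<otimes> h)) \<otimes> (g \<otimes> h)) \<otimes> inv (inv (apart h) \<otimes> h) \<in> K"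
      using apart gh sub_mult[OF K(1)] sub_inv[OF K(1)] by simp
    then show "inv (apart (g \<otimes> h)) \<otimes> (g \<otimes> apart h) \<in> K" using gh aG by (simp add: word_simps)
  qed
  \<comment> \<open>The point v stands for the coset vec(v) K; multiplying by g and taking the plane
    component gives its image.\<close>
  define act where "act g v = coord (apart (g \<otimes> vec v))" for g v
  have p0: "int p > 0" using prime_gt_0_nat[OF prime_p] by simp
  have coord: "coord a \<in> Vp p" "vec (coord a) = a" if "a \<in> plane" for a
    using that coord_vec p0 by (auto simp: plane_def Vp_def vec_mod)
  have vec_plane: "vec v \<in> plane" for v by (simp add: plane_def)
  have act_plane: "act g v = coord a" if "g \<in> carrier G" "a \<in> plane" "inv a \<otimes> (g \<otimes> vec v) \<in> K" for g v a
    unfolding act_def using apart_eq[of "g \<otimes> vec v" a] that by simp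
  have act_vec: "act (vec w) v = transl p w v" for v w
  proof -
    have "act (vec w) v = coord (vec w \<otimes> vec v)"
      by (rule act_plane) (use sub_one[OF K(1)] sub_mult[OF plane_subgroup] vec_plane in auto)
    then show ?thesis by (simp add: vec_add coord_vec transl_def add.commute)
  qed
  have act_K: "act k v = coord (k \<otimes> vec v \<otimes> inv k)" if k: "k \<in> K" for k v
  proof (rule act_plane)
    have kG: "k \<in> carrier G" using KG[OF k] .
    show "k \<otimes> vec v \<otimes> inv k \<in> plane" by (rule normal_conj[OF normal kG vec_plane])
    show "inv (k \<otimes> vec v \<otimes> inv k) \<otimes> (k \<otimes> vec v) \<in> K" using k kG by (simp add: word_simps)
  qed (use KG k in simp)
  interpret A: fin_action G "Vp p" act
  proof
    show "finite (Vp p)" by (simp add: Vp_def)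
    show "act g v \<in> Vp p" if "g \<in> carrier G" for g v
      unfolding act_def using coord(1) apart[of "g \<otimes> vec v"] that by simp
    show "act \<one> v = v" if "v \<in> Vp p" for v
      using act_vec[of "(0, 0)" v] that by (auto simp: vec_one transl_def Vp_def)
    show "act (g \<otimes> h) v = act g (act h v)" if gh: "g \<in> carrier G" "h \<in> carrier G" for g h v
    proof -
      have "vec (act h v) = apart (h \<otimes> vec v)" unfolding act_def using coord(2) apart[of "h \<otimes> vec v"] gh by simp
      then show ?thesis using apart_mult[of g "h \<otimes> vec v"] gh by (simp add: act_def m_assoc)
    qed
  qed
  define \<Phi> where "\<Phi> g = restrict (act g) (Vp p)" for g
  have Bij: "\<Phi> g \<in> Bij (Vp p)" if "g \<in> carrier G" for g
    using A.act_bij[OF that] by (simp add: \<Phi>_def Bij_def bij_betw_restrict_eq)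
  have "\<Phi> \<in> hom G (BijGroup (Vp p))"
  proof (rule homI)
    show "\<Phi> g \<in> carrier (BijGroup (Vp p))" if "g \<in> carrier G" for g using Bij[OF that] by (simp add: BijGroup_def)
    show "\<Phi> (g \<otimes> h) = \<Phi> g \<otimes>\<^bsub>BijGroup (Vp p)\<^esub> \<Phi> h" if gh: "g \<in> carrier G" "h \<in> carrier G" for g h
      using Bij gh A.act_mult[OF gh] A.act_closed[OF gh(2)]
      by (auto simp: BijGroup_def \<Phi>_def compose_def fun_eq_iff restrict_def)
  qed
  then interpret \<Phi>: group_hom G "BijGroup (Vp p)" \<Phi>
    by (simp add: group_hom_def group_hom_axioms_def group_BijGroup is_group)
  have inj: "inj_on \<Phi> (carrier G)"
  proof (rule \<Phi>.inj_on_one_iff[THEN iffD2], intro allI impI)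
    fix g assume g: "g \<in> carrier G" "\<Phi> g = \<one>\<^bsub>BijGroup (Vp p)\<^esub>"
    have fixed: "act g v = v" if "v \<in> Vp p" for v
      using fun_cong[OF g(2), of v] that by (simp add: BijGroup_def \<Phi>_def)
    obtain a k where ak: "a \<in> plane" "k \<in> K" "g = a \<otimes> k" using factor[OF g(1)] by blast
    have "inv a \<otimes> (g \<otimes> vec (0, 0)) \<in> K" using ak PG KG g(1) by (simp add: vec_one inv_cancel1)
    then have "act g (0, 0) = coord a" using act_plane g(1) ak(1) by blast
    then have "coord a = (0, 0)" using fixed[of "(0, 0)"] p0 by (simp add: Vp_def)
    then have "a = \<one>" using coord(2)[OF ak(1)] vec_one by simp
    then have gK: "g \<in> K" using ak KG by simp
    have gc: "g \<otimes> vec v = vec v \<otimes> g" if "v \<in> Vp p" for v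
    proof -
      have "coord (g \<otimes> vec v \<otimes> inv g) = v" using fixed[OF that] act_K[OF gK] by simp
      then have "g \<otimes> vec v \<otimes> inv g = vec v" using coord(2)[OF normal_conj[OF normal g(1) vec_plane]] by metis
      then have "g \<otimes> vec v \<otimes> inv g \<otimes> g = vec v \<otimes> g" by simp
      then show ?thesis using g(1) by (simp add: m_assoc)
    qed
    have "(1, 0) \<in> Vp p" "(0, 1) \<in> Vp p" using prime_gt_1_nat[OF prime_p] by (auto simp: Vp_def)
    then show "g = \<one>" using faithful[OF gK] gc[of "(1, 0)"] gc[of "(0, 1)"] vec_basis by simp
  qed
  have \<Phi>_vec: "\<Phi> (vec w) = permV p (transl p w)" for w
    by (simp add: \<Phi>_def permV_def act_vec[abs_def] fun_eq_iff restrict_def)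
  have \<Phi>_gen: "\<Phi> (lm M) = permV p (mat_act p M)" if M: "M \<in> gens" for M
  proof -
    obtain a b c d where abcd: "M = (a, b, c, d)" by (cases M)
    have lK: "lm M \<in> K" using gens(2) M by blast
    have "act (lm M) v = mat_act p M v" if "v \<in> Vp p" for v
    proof -
      have "act (lm M) v = coord (vec (mat_act p M v))"
        using act_K[OF lK] conj_vec[OF KG[OF lK], of a b c d v] conj[of a b c d] M abcd by simp
      also have "\<dots> = mat_act p M v" by (simp add: coord_vec mat_act_def abcd split: prod.split)
      finally show ?thesis .
    qed
    then show ?thesis by (simp add: \<Phi>_def permV_def fun_eq_iff restrict_def)
  qed
  define S where "S = vec ` Vp p \<union> lm ` gens"
  have SG: "S \<subseteq> carrier G" using gens(2) KG by (auto simp: S_def)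
  have "generate G S = carrier G"
  proof
    show "generate G S \<subseteq> carrier G" using generate_incl[OF SG] .
    have gS: "subgroup (generate G S) G" using generate_is_subgroup[OF SG] .
    have "plane \<subseteq> generate G S"
    proof
      fix a assume "a \<in> plane"
      then have "a \<in> S" using coord by (metis S_def UnI1 image_eqI)
      then show "a \<in> generate G S" by (rule generate.incl)
    qed
    moreover have "K \<subseteq> generate G S" unfolding gens(1) by (rule mono_generate) (auto simp: S_def)
    ultimately show "carrier G \<subseteq> generate G S" using factor sub_mult[OF gS] by blast
  qed
  then have "\<Phi> ` carrier G = generate (BijGroup (Vp p)) (\<Phi> ` S)" using \<Phi>.generate_img[OF SG] by simp
  also have "\<Phi> ` S = (\<lambda>a. permV p (transl p a)) ` Vp p \<union> (\<lambda>M. permV p (mat_act p M)) ` gens"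
  proof -
    have "\<Phi> ` S = (\<lambda>w. \<Phi> (vec w)) ` Vp p \<union> (\<lambda>M. \<Phi> (lm M)) ` gens" by (auto simp: S_def image_iff)
    then show ?thesis using \<Phi>_vec \<Phi>_gen by (simp cong: image_cong)
  qed
  finally have img: "\<Phi> ` carrier G = carrier (affine_group p gens)" by (simp add: affine_group_def)
  have "\<Phi> \<in> iso G (affine_group p gens)"
  proof (rule isoI)
    show "\<Phi> \<in> hom G (affine_group p gens)"
      using \<Phi>.hom_mult img by (intro homI) (auto simp: affine_group_def)
    show "bij_betw \<Phi> (carrier G) (carrier (affine_group p gens))"
      using inj img by (simp add: bij_betw_def)
  qed
  then show "G \<cong> affine_group p gens" by (auto simp: is_iso_def)
  show "mat_ord p M = ord (lm M)" if M: "M \<in> gens" for M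
  proof -
    have lG: "lm M \<in> carrier G" using gens(2) M KG by blast
    have "\<Phi> (lm M) [^]\<^bsub>BijGroup (Vp p)\<^esub> n = \<one>\<^bsub>BijGroup (Vp p)\<^esub> \<longleftrightarrow> ord (lm M) dvd n" for n :: nat
    proof -
      have e: "\<Phi> (lm M) [^]\<^bsub>BijGroup (Vp p)\<^esub> n = \<Phi> (lm M [^] n)" using \<Phi>.hom_nat_pow[OF lG] by simp
      have "\<Phi> (lm M [^] n) = \<Phi> \<one> \<longleftrightarrow> lm M [^] n = \<one>"
        by (rule inj_on_eq_iff[OF inj]) (use lG in auto)
      then show ?thesis using e \<Phi>.hom_one pow_eq_id[OF lG] by simp
    qed
    then have "group.ord (BijGroup (Vp p)) (\<Phi> (lm M)) = ord (lm M)"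
      using group.ord_unique[OF group_BijGroup \<Phi>.hom_closed[OF lG]] by blast
    then show ?thesis using \<Phi>_gen[OF M] by (simp add: mat_ord_def)
  qed
qed

end

section \<open>Change of basis, and matrices of group elements\<close>

context plane_basis
begin

lemma change_basis:
  assumes det: "\<not> int p dvd a * d - b * c"
  shows "plane_basis G p (vec (a, b)) (vec (c, d))"
    "plane_basis.plane G (vec (a, b)) (vec (c, d)) = plane"
proof -
  have ip: "Factorial_Ring.prime (int p)" using prime_p by simp
  have comb: "vec (a, b) [^] i \<otimes> vec (c, d) [^] j = vec (i * a + j * c, i * b + j * d)" for i j :: int
    by (simp add: vec_int_pow vec_add)
  have ex: "vec v [^] p = \<one>" for v
  proof -
    have "vec v [^] p = vec v [^] int p" by (simp add: int_pow_int)
    also have "\<dots> = vec (0, 0)" by (simp add: vec_int_pow vec_eq_iff)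
    finally show ?thesis by (simp add: vec_one)
  qed
  show B: "plane_basis G p (vec (a, b)) (vec (c, d))"
  proof
    fix i j :: int assume "vec (a, b) [^] i \<otimes> vec (c, d) [^] j = \<one>"
    then have "vec (i * a + j * c, i * b + j * d) = vec (0, 0)" using comb vec_one by simp
    then have "int p dvd i * a + j * c" "int p dvd i * b + j * d" by (auto simp: vec_eq_iff)
    \<comment> \<open>Cramer's rule: the two equations are combined by the adjugate, leaving i and j
      multiplied by the determinant.\<close>
    then have "int p dvd (i * a + j * c) * d - (i * b + j * d) * c" "int p dvd (i * b + j * d) * a - (i * a + j * c) * b"
      by (auto intro: dvd_diff dvd_mult2)
    then have "int p dvd i * (a * d - b * c)" "int p dvd j * (a * d - b * c)" by (auto simp: algebra_simps)
    then show "int p dvd i \<and> int p dvd j" using det ip prime_dvd_mult_iff by blast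
  qed (use prime_p vec_comm ex in auto)
  interpret B: plane_basis G p "vec (a, b)" "vec (c, d)" by (rule B)
  have "B.plane \<subseteq> plane" by (auto simp: B.plane_def B.vec_def comb plane_def)
  then show "B.plane = plane"
    using card_subset_eq[OF fin_sub[OF plane_subgroup]] card_plane B.card_plane by simp
qed

lemma commutes_plane: "\<lbrakk>k \<in> carrier G; k \<otimes> w1 = w1 \<otimes> k; k \<otimes> w2 = w2 \<otimes> k; a \<in> plane\<rbrakk> \<Longrightarrow> k \<otimes> a = a \<otimes> k"
proof -
  assume a: "k \<in> carrier G" "k \<otimes> w1 = w1 \<otimes> k" "k \<otimes> w2 = w2 \<otimes> k" "a \<in> plane"
  have "k \<otimes> w1 \<otimes> inv k = vec (1, 0)" "k \<otimes> w2 \<otimes> inv k = vec (0, 1)"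
    using a basis_carrier by (simp_all add: vec_basis m_assoc)
  moreover obtain v where v: "a = vec v" using a(4) by (auto simp: plane_def)
  ultimately have "k \<otimes> a \<otimes> inv k = vec (mat_act p (1, 0, 0, 1) v)" using conj_vec[OF a(1)] by blast
  also have "\<dots> = a" by (simp add: mat_act_def v vec_mod split: prod.split)
  finally have "k \<otimes> a \<otimes> inv k \<otimes> k = a \<otimes> k" by simp
  then show ?thesis using a(1) v by (simp add: m_assoc)
qed

end

text \<open>A split extension of the plane by a faithfully acting complement H. The fields mention
  the basis only through the plane it spans, so they carry over under a change of basis.\<close>

locale affine_setting = plane_basis G p w1 w2 for G (structure) and p w1 w2 +
  fixes H :: "'a set"
  assumes normal: "plane \<lhd> G" and H: "subgroup H G" "plane \<inter> H = {\<one>}"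
    and factor: "g \<in> carrier G \<Longrightarrow> \<exists>a\<in>plane. \<exists>k\<in>H. g = a \<otimes> k"
    and faithful: "\<lbrakk>k \<in> H; \<And>a. a \<in> plane \<Longrightarrow> k \<otimes> a = a \<otimes> k\<rbrakk> \<Longrightarrow> k = \<one>"
begin

lemma H_carrier: "h \<in> H \<Longrightarrow> h \<in> carrier G" using sub_mem[OF H(1)] .

lemma change_setting:
  assumes "\<not> int p dvd a * d - b * c"
  shows "affine_setting G p (vec (a, b)) (vec (c, d)) H"
  by (rule affine_setting.intro[OF change_basis(1)[OF assms]],
      unfold affine_setting_axioms_def change_basis(2)[OF assms], use normal H factor faithful in blast)

text \<open>k acts on the plane by the matrix ||a,b;c,d||. A relation rather than a function, since
  the integer entries are determined only modulo p.\<close>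

definition acts :: "'a \<Rightarrow> int \<Rightarrow> int \<Rightarrow> int \<Rightarrow> int \<Rightarrow> bool" where
  "acts k a b c d \<longleftrightarrow> k \<otimes> w1 \<otimes> inv k = vec (a, b) \<and> k \<otimes> w2 \<otimes> inv k = vec (c, d)"

lemma acts_vec:
  assumes "k \<in> carrier G" "acts k a b c d"
  shows "k \<otimes> vec (i, j) \<otimes> inv k = vec (i * a + j * c, i * b + j * d)"
  using conj_vec[OF assms(1), of a b c d "(i, j)"] assms(2) by (simp add: acts_def mat_act_def vec_mod)

text \<open>With row vectors the matrices multiply in reverse order: the matrix of a product kl is
  the matrix of l times the matrix of k.\<close>

lemma acts_mult:
  assumes "k \<in> carrier G" "l \<in> carrier G" "acts k a b c d" "acts l a' b' c' d'"
  shows "acts (k \<otimes> l) (a' * a + b' * c) (a' * b + b' * d) (c' * a + d' * c) (c' * b + d' * d)"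
proof -
  have e: "k \<otimes> l \<otimes> w \<otimes> inv (k \<otimes> l) = k \<otimes> (l \<otimes> w \<otimes> inv l) \<otimes> inv k" if "w \<in> carrier G" for w
    using that assms(1,2) by (simp add: word_simps)
  show ?thesis using assms(4) e[OF basis_carrier(1)] e[OF basis_carrier(2)] acts_vec[OF assms(1,3)] by (simp add: acts_def)
qed

lemma acts_cong:
  assumes "acts k a b c d" "[a = a'] (mod int p)" "[b = b'] (mod int p)" "[c = c'] (mod int p)" "[d = d'] (mod int p)"
  shows "acts k a' b' c' d'"
  using assms by (simp add: acts_def vec_eq_iff cong_def)

lemma acts_exists: "k \<in> carrier G \<Longrightarrow> \<exists>a b c d. acts k a b c d"
proof -
  assume k: "k \<in> carrier G"
  have "vec (1, 0) \<in> plane" "vec (0, 1) \<in> plane" by (auto simp: plane_def)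
  then have "k \<otimes> w1 \<otimes> inv k \<in> plane" "k \<otimes> w2 \<otimes> inv k \<in> plane"
    using normal_conj[OF normal k] vec_basis by auto
  then show ?thesis unfolding plane_def acts_def by (metis prod.collapse rangeE)
qed

lemma acts_one: "acts \<one> 1 0 0 1"
  using basis_carrier by (simp add: acts_def vec_basis)

lemma acts_unique:
  "\<lbrakk>acts k a b c d; acts k a' b' c' d'\<rbrakk> \<Longrightarrow>
    [a = a'] (mod int p) \<and> [b = b'] (mod int p) \<and> [c = c'] (mod int p) \<and> [d = d'] (mod int p)"
  by (auto simp: acts_def vec_eq_iff cong_def)

lemma acts_identity_iff:
  assumes "k \<in> H" "acts k a b c d"
  shows "k = \<one> \<longleftrightarrow> [a = 1] (mod int p) \<and> [b = 0] (mod int p) \<and> [c = 0] (mod int p) \<and> [d = 1] (mod int p)"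
proof
  assume "k = \<one>"
  then show "[a = 1] (mod int p) \<and> [b = 0] (mod int p) \<and> [c = 0] (mod int p) \<and> [d = 1] (mod int p)"
    using acts_unique[OF _ acts_one] assms by blast
next
  assume "[a = 1] (mod int p) \<and> [b = 0] (mod int p) \<and> [c = 0] (mod int p) \<and> [d = 1] (mod int p)"
  then have "acts k 1 0 0 1" using acts_cong[OF assms(2)] by blast
  then have "k \<otimes> w1 \<otimes> inv k = w1" "k \<otimes> w2 \<otimes> inv k = w2" by (simp_all add: acts_def vec_basis)
  then have "k \<otimes> w1 \<otimes> inv k \<otimes> k = w1 \<otimes> k" "k \<otimes> w2 \<otimes> inv k \<otimes> k = w2 \<otimes> k" by simp_all
  then have "k \<otimes> w1 = w1 \<otimes> k" "k \<otimes> w2 = w2 \<otimes> k" using H_carrier[OF assms(1)] basis_carrier by (simp_all add: m_assoc)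
  then show "k = \<one>" using faithful[OF assms(1)] commutes_plane[OF H_carrier[OF assms(1)]] by blast
qed

lemma acts_eq:
  assumes "k \<in> H" "l \<in> H" "acts k a b c d" "acts l a b c d"
  shows "k = l"
proof -
  have G: "k \<in> carrier G" "l \<in> carrier G" using assms H_carrier by auto
  obtain a' b' c' d' where i: "acts (inv l) a' b' c' d'" using acts_exists[of "inv l"] G by auto
  have "acts (inv l \<otimes> k) (a * a' + b * c') (a * b' + b * d') (c * a' + d * c') (c * b' + d * d')"
    by (rule acts_mult[OF _ G(1) i assms(3)]) (use G in simp)
  moreover have "acts (inv l \<otimes> l) (a * a' + b * c') (a * b' + b * d') (c * a' + d * c') (c * b' + d * d')"
    by (rule acts_mult[OF _ G(2) i assms(4)]) (use G in simp)
  then have "acts \<one> (a * a' + b * c') (a * b' + b * d') (c * a' + d * c') (c * b' + d * d')" using G by simp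
  ultimately have "inv l \<otimes> k = \<one>"
    using acts_identity_iff[of "inv l \<otimes> k"] acts_unique[OF _ acts_one] assms sub_mult[OF H(1)] sub_inv[OF H(1)] by blast
  then have "l \<otimes> (inv l \<otimes> k) = l" using G by simp
  then show ?thesis using G by (simp add: inv_cancel2)
qed

lemma recognize:
  assumes "H = generate G (lm ` gens)" "lm ` gens \<subseteq> H"
    and "\<And>a b c d. (a, b, c, d) \<in> gens \<Longrightarrow> acts (lm (a, b, c, d)) a b c d"
  shows "G \<cong> affine_group p gens" "\<And>M. M \<in> gens \<Longrightarrow> mat_ord p M = ord (lm M)"
proof -
  have f: "k = \<one>" if "k \<in> H" "k \<otimes> w1 = w1 \<otimes> k" "k \<otimes> w2 = w2 \<otimes> k" for k
    using faithful[OF that(1)] commutes_plane[OF H_carrier[OF that(1)] that(2,3)] by blast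
  have c: "lm (a, b, c, d) \<otimes> w1 \<otimes> inv (lm (a, b, c, d)) = vec (a, b) \<and>
      lm (a, b, c, d) \<otimes> w2 \<otimes> inv (lm (a, b, c, d)) = vec (c, d)" if "(a, b, c, d) \<in> gens" for a b c d
    using assms(3)[OF that] by (simp add: acts_def)
  show "G \<cong> affine_group p gens" by (rule affine_group_recognition(1)[OF normal H]) (use factor f assms(1,2) c in blast)+
  show "mat_ord p M = ord (lm M)" if "M \<in> gens" for M
    by (rule affine_group_recognition(2)[OF normal H]) (use factor f assms(1,2) c that in blast)+
qed

lemma recognize2:
  assumes k: "k \<in> H" "acts k a b c d" and l: "l \<in> H" "acts l a' b' c' d'"
    and H_gen: "H = generate G {k, l}"
  shows "G \<cong> affine_group p {(a, b, c, d), (a', b', c', d')}" "mat_ord p (a, b, c, d) = ord k"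
proof -
  define lm where "lm M = (if M = (a, b, c, d) then k else l)" for M
  \<comment> \<open>The map from matrices back to elements is well defined: if both matrices
    coincide, faithfulness makes the elements equal.\<close>
  have kl: "k = l" if "(a, b, c, d) = (a', b', c', d')" using acts_eq[OF k(1) l(1) k(2)] l(2) that by simp
  have lm: "lm ` {(a, b, c, d), (a', b', c', d')} = {k, l}" using kl by (auto simp: lm_def)
  have R: "H = generate G (lm ` {(a, b, c, d), (a', b', c', d')})" "lm ` {(a, b, c, d), (a', b', c', d')} \<subseteq> H"
    unfolding lm using H_gen k(1) l(1) by auto
  have A: "acts (lm (i, j, m, n)) i j m n" if "(i, j, m, n) \<in> {(a, b, c, d), (a', b', c', d')}" for i j m n
    using that k(2) l(2) by (auto simp: lm_def)
  show "G \<cong> affine_group p {(a, b, c, d), (a', b', c', d')}" using recognize(1)[OF R A] by blast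
  show "mat_ord p (a, b, c, d) = ord k" using recognize(2)[OF R A, of "(a, b, c, d)"] by (simp add: lm_def)
qed

lemma recognize3:
  assumes k: "k \<in> H" "acts k a b c d" and l: "l \<in> H" "acts l a' b' c' d'" and m: "m \<in> H" "acts m a'' b'' c'' d''"
    and H_gen: "H = generate G {k, l, m}"
  shows "G \<cong> affine_group p {(a, b, c, d), (a', b', c', d'), (a'', b'', c'', d'')}"
proof -
  let ?g = "{(a, b, c, d), (a', b', c', d'), (a'', b'', c'', d'')}"
  define lm where "lm M = (if M = (a, b, c, d) then k else if M = (a', b', c', d') then l else m)" for M
  have e: "(a, b, c, d) = (a', b', c', d') \<Longrightarrow> k = l" "(a, b, c, d) = (a'', b'', c'', d'') \<Longrightarrow> k = m"
    "(a', b', c', d') = (a'', b'', c'', d'') \<Longrightarrow> l = m"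
    using acts_eq k l m by auto
  have lm: "lm ` ?g = {k, l, m}" using e by (auto simp: lm_def)
  have R: "H = generate G (lm ` ?g)" "lm ` ?g \<subseteq> H" unfolding lm using H_gen k(1) l(1) m(1) by auto
  have A: "acts (lm (i, j, s, n)) i j s n" if "(i, j, s, n) \<in> ?g" for i j s n
    using that k(2) l(2) m(2) by (auto simp: lm_def)
  show ?thesis using recognize(1)[OF R A] by blast
qed

end

section \<open>Classification of the linear parts\<close>

lemma (in fin_group) generate_eqI:
  assumes "H = generate G {x, y}" "S \<subseteq> H" "H \<subseteq> carrier G" "x \<in> generate G S" "y \<in> generate G S"
  shows "H = generate G S"
proof
  have xy: "{x, y} \<subseteq> carrier G" using assms(1,3) generate.incl[of _ "{x, y}" G] by blast
  have S: "S \<subseteq> carrier G" using assms(2,3) by blast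
  have "subgroup H G" unfolding assms(1) by (rule generate_is_subgroup[OF xy])
  then show "generate G S \<subseteq> H" using generate_subgroup_incl assms(2) by blast
  show "H \<subseteq> generate G S"
    unfolding assms(1) by (rule generate_subgroup_incl[OF _ generate_is_subgroup[OF S]]) (use assms in simp)
qed

context affine_setting
begin

lemma p_not_dvd_two: "odd p \<Longrightarrow> \<not> int p dvd 2"
proof
  assume o: "odd p" and "int p dvd 2"
  then have "p dvd 2" by (metis int_dvd_int_iff of_nat_numeral)
  then have "p \<le> 2" by (simp add: dvd_imp_le)
  then show False using o prime_ge_2_nat[OF prime_p] by (metis even_numeral le_antisym)
qed

text \<open>The matrix is a(1 + N) with N^2 = 0, so its m-th power is a^m (1 + mN).\<close>

lemma unipotent_pow:
  assumes "k \<in> carrier G" "acts k a a 0 a"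
  shows "acts (k [^] m) (a ^ m) (int m * a ^ m) 0 (a ^ m)"
proof (induction m)
  case 0 then show ?case using acts_one by simp
next
  case (Suc m)
  have "acts (k [^] m \<otimes> k) (a * a ^ m + a * 0) (a * (int m * a ^ m) + a * a ^ m) (0 * a ^ m + a * 0) (0 * (int m * a ^ m) + a * a ^ m)"
    by (rule acts_mult[OF _ assms(1) Suc assms(2)]) (use assms(1) in simp)
  then show ?case by (simp add: algebra_simps)
qed

lemma diagonal_pow:
  assumes "k \<in> carrier G" "acts k a 0 0 d"
  shows "acts (k [^] m) (a ^ m) 0 0 (d ^ m)"
proof (induction m)
  case 0 then show ?case using acts_one by simp
next
  case (Suc m)
  have "acts (k [^] m \<otimes> k) (a * a ^ m + 0 * 0) (a * 0 + 0 * d ^ m) (0 * a ^ m + d * 0) (0 * 0 + d * d ^ m)"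
    by (rule acts_mult[OF _ assms(1) Suc assms(2)]) (use assms(1) in simp)
  then show ?case by simp
qed

text \<open>For odd p the p-th power removes the unipotent factor and leaves the scalar -1. This
  lets an element of order 2p be split into a unipotent matrix and -1.\<close>

lemma negative_unipotent_pow:
  assumes "k \<in> carrier G" "acts k (-1) (-1) 0 (-1)" "odd p"
  shows "acts (k [^] p) (-1) 0 0 (-1)"
proof -
  have "(-1::int) ^ p = -1" using assms(3) by simp
  then have "acts (k [^] p) (-1) (- int p) 0 (-1)" using unipotent_pow[OF assms(1,2), of p] by simp
  then show ?thesis by (rule acts_cong) (simp_all add: cong_def)
qed

lemma unipotent_ord:
  assumes k: "k \<in> H" and o: "odd p"
  shows "acts k 1 1 0 1 \<Longrightarrow> ord k = p" "acts k (-1) (-1) 0 (-1) \<Longrightarrow> ord k = 2 * p"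
proof -
  have kG: "k \<in> carrier G" using H_carrier[OF k] .
  have iff: "k [^] m = \<one> \<longleftrightarrow> [a ^ m = 1] (mod int p) \<and> int p dvd int m * a ^ m" if "acts k a a 0 a" for a and m :: nat
    using acts_identity_iff[OF pow_sub[OF H(1) k] unipotent_pow[OF kG that]] by (auto simp: cong_0_iff)
  show "ord k = p" if "acts k 1 1 0 1"
    using ord_unique[OF kG] iff[OF that] by simp
  show "ord k = 2 * p" if a: "acts k (-1) (-1) 0 (-1)"
  proof -
    have "k [^] m = \<one> \<longleftrightarrow> 2 * p dvd m" for m :: nat
    proof -
      have "[(-1) ^ m = (1::int)] (mod int p) \<longleftrightarrow> even m"
        using p_not_dvd_two[OF o] by (cases "even m") (auto simp: cong_iff_dvd_diff)
      moreover have "int p dvd int m * (-1) ^ m \<longleftrightarrow> p dvd m" by (cases "even m") auto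
      moreover have "coprime 2 p" using o by simp
      then have "2 * p dvd m \<longleftrightarrow> even m \<and> p dvd m"
        by (metis divides_mult dvd_mult_left dvd_mult_right)
      ultimately show ?thesis using iff[OF a] by simp
    qed
    then show ?thesis using ord_unique[OF kG] by simp
  qed
qed

context
  fixes x y
  assumes oddp: "odd p" and xH: "x \<in> H" and yH: "y \<in> H" and H_gen: "H = generate G {x, y}"
    and yy: "y \<otimes> y = \<one>" and yx: "y \<otimes> x \<otimes> inv y = inv x"
begin

lemma xG: "x \<in> carrier G" and yG: "y \<in> carrier G"
  using xH yH H_carrier by auto

lemma H_genI: "\<lbrakk>S \<subseteq> H; x \<in> generate G S; y \<in> generate G S\<rbrakk> \<Longrightarrow> H = generate G S"
  using generate_eqI[OF H_gen _ subgroup.subset[OF H(1)]] by blast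

text \<open>The planar translations spanned by w2 and the unipotent x form another
  complemented normal plane, on which y acts as -1.\<close>
lemma swapped_plane:
  assumes x: "acts x 1 1 0 1" and y: "acts y 1 0 0 (-1)"
  shows "G \<cong> affine_group p {(1,1,0,1), (-1,0,0,-1)}"
proof -
  have bG: "w1 \<in> carrier G" "w2 \<in> carrier G" using basis_carrier by auto
  have ox: "ord x = p" using unipotent_ord(1)[OF xH oddp x] .
  have xw1: "x \<otimes> w1 \<otimes> inv x = w1 \<otimes> w2" and xw2: "x \<otimes> w2 \<otimes> inv x = w2"
    using x bG by (simp_all add: acts_def vec_def)
  have yw1: "y \<otimes> w1 \<otimes> inv y = w1" and yw2: "y \<otimes> w2 \<otimes> inv y = inv w2"
    using y bG by (simp_all add: acts_def vec_def int_pow_neg)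
  have cm: "a \<otimes> b = b \<otimes> a" if "a \<in> carrier G" "b \<in> carrier G" "a \<otimes> b \<otimes> inv a = b" for a b
  proof -
    have "a \<otimes> b \<otimes> inv a \<otimes> a = b \<otimes> a" using that(3) by simp
    then show ?thesis using that(1,2) by (simp add: m_assoc)
  qed
  have xw2c: "x \<otimes> w2 = w2 \<otimes> x" using cm[OF xG bG(2) xw2] .
  have yw1c: "y \<otimes> w1 = w1 \<otimes> y" using cm[OF yG bG(1) yw1] .
  have pl: "vec v \<in> plane" for v by (simp add: plane_def)
  have w2pl: "w2 [^] (j::int) \<in> plane" "w1 [^] (j::int) \<in> plane" for j
    using pl[of "(0, j)"] pl[of "(j, 0)"] bG by (simp_all add: vec_def)
  have xiH: "x [^] (i::int) \<in> H" for i using subgroup_int_pow_closed[OF H(1) xH] .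
  interpret B: plane_basis G p x w2
  proof
    show "x [^] p = \<one>" using ox pow_ord_eq_1[OF xG] by simp
    fix i j :: int assume e: "x [^] i \<otimes> w2 [^] j = \<one>"
    then have xe: "x [^] i = inv (w2 [^] j)" using xG bG inv_equality[of "x [^] i" "w2 [^] j"] by simp
    have "inv (w2 [^] j) \<in> plane" using sub_inv[OF plane_subgroup w2pl(1)] .
    then have "x [^] i = \<one>" using xe xiH[of i] H(2) by auto
    then have "int p dvd i" using int_pow_eq_id[OF xG] ox by simp
    moreover have "w2 [^] j = \<one>" using e \<open>x [^] i = \<one>\<close> bG by simp
    then have "int p dvd j" using basis_indep[of 0 j] bG by simp
    ultimately show "int p dvd i \<and> int p dvd j" by simp
  qed (use prime_p xG bG xw2c basis_exponent in auto)
  have B_xw2: "x \<in> B.plane" "w2 \<in> B.plane"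
    using B.vec_basis rangeI[of B.vec "(1, 0)"] rangeI[of B.vec "(0, 1)"] by (auto simp: B.plane_def)
  have conj_B: "k \<otimes> v \<otimes> inv k \<in> B.plane" if k: "k \<in> carrier G" "k \<otimes> x \<otimes> inv k \<in> B.plane" "k \<otimes> w2 \<otimes> inv k \<in> B.plane" "v \<in> B.plane" for k v
  proof -
    obtain a b c d where "k \<otimes> x \<otimes> inv k = B.vec (a, b)" "k \<otimes> w2 \<otimes> inv k = B.vec (c, d)"
      using k(2,3) unfolding B.plane_def by (metis prod.collapse rangeE)
    then show ?thesis using B.conj_vec[OF k(1)] k(4) by (auto simp: B.plane_def)
  qed
  \<comment> \<open>The inverse of w1 rather than w1 itself, so that conjugation sends x to x w2 and
    the matrix in the basis x, w2 is exactly ||1,1;0,1||.\<close>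
  define u where "u = inv w1"
  have uG: "u \<in> carrier G" using bG by (simp add: u_def)
  have ux: "u \<otimes> x \<otimes> inv u = x \<otimes> w2"
  proof -
    have "u \<otimes> x \<otimes> inv u = inv w1 \<otimes> (x \<otimes> w1 \<otimes> inv x) \<otimes> x" using bG xG by (simp add: u_def word_simps)
    also have "\<dots> = w2 \<otimes> x" unfolding xw1 using bG xG by (simp add: word_simps)
    finally show ?thesis using xw2c by simp
  qed
  have uw2: "u \<otimes> w2 \<otimes> inv u = w2"
  proof -
    have "u \<otimes> w2 \<otimes> inv u = inv w1 \<otimes> (w2 \<otimes> w1)" using bG by (simp add: u_def m_assoc)
    also have "\<dots> = w2" using bG basis_comm by (simp add: inv_cancel1 flip: basis_comm)
    finally show ?thesis .
  qed
  have all_G: "D = carrier G" if D: "subgroup D G" "x \<in> D" "y \<in> D" "u \<in> D" "w2 \<in> D" for D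
  proof -
    have "H \<subseteq> D" unfolding H_gen by (rule generate_subgroup_incl[OF _ D(1)]) (use D in simp)
    moreover have "plane \<subseteq> D"
    proof
      fix a assume "a \<in> plane"
      then obtain i j where "a = w1 [^] (i::int) \<otimes> w2 [^] (j::int)" by (auto simp: plane_def vec_def)
      moreover have "w1 \<in> D" using sub_inv[OF D(1,4)] bG by (simp add: u_def)
      ultimately show "a \<in> D" using sub_mult[OF D(1)] subgroup_int_pow_closed[OF D(1)] D(5) by simp
    qed
    ultimately have "carrier G \<subseteq> D" using factor sub_mult[OF D(1)] by blast
    then show ?thesis using subgroup.subset[OF D(1)] by blast
  qed
  define D where "D = {k \<in> carrier G. \<forall>v\<in>B.plane. k \<otimes> v \<otimes> inv k \<in> B.plane}"
  have Dsub: "subgroup D G"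
    unfolding D_def by (rule normalizer_sub[OF subgroup.subset[OF B.plane_subgroup] fin_sub[OF B.plane_subgroup]])
  have in_D: "k \<in> D" if "k \<in> carrier G" "k \<otimes> x \<otimes> inv k \<in> B.plane" "k \<otimes> w2 \<otimes> inv k \<in> B.plane" for k
    using conj_B[OF that] that(1) by (simp add: D_def)
  have conj_y: "y \<otimes> x \<otimes> inv y \<in> B.plane" "y \<otimes> w2 \<otimes> inv y \<in> B.plane"
    unfolding yx yw2 by (rule sub_inv[OF B.plane_subgroup B_xw2(1)], rule sub_inv[OF B.plane_subgroup B_xw2(2)])
  have conj_u: "u \<otimes> x \<otimes> inv u \<in> B.plane" "u \<otimes> w2 \<otimes> inv u \<in> B.plane"
    unfolding ux uw2 by (rule sub_mult[OF B.plane_subgroup B_xw2], rule B_xw2(2))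
  have self: "k \<in> D" if "k \<in> B.plane" for k
    using that sub_mem[OF B.plane_subgroup that] sub_mult[OF B.plane_subgroup] sub_inv[OF B.plane_subgroup] by (simp add: D_def)
  have "D = carrier G"
    using all_G[OF Dsub] in_D[OF yG conj_y] in_D[OF uG conj_u] self B_xw2 by blast
  then have B_normal: "B.plane \<lhd> G"
    by (intro normalI' B.plane_subgroup) (auto simp: D_def)
  \<comment> \<open>The new complement. Since y fixes w1, it is abelian, and every element has the
    form w1^i or w1^i y.\<close>
  define K where "K = generate G {u, y}"
  have uyG: "{u, y} \<subseteq> carrier G" using uG yG by simp
  have K: "subgroup K G" unfolding K_def by (rule generate_is_subgroup[OF uyG])
  have uyK: "u \<in> K" "y \<in> K" unfolding K_def by (auto intro: generate.incl)
  have uy: "y \<otimes> u = u \<otimes> y"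
  proof -
    have "u \<otimes> (w1 \<otimes> y) \<otimes> u = u \<otimes> (y \<otimes> w1) \<otimes> u" using yw1c by simp
    then show ?thesis using bG yG by (simp add: u_def m_assoc inv_cancel1)
  qed
  have Kform: "\<exists>i::int. k = w1 [^] i \<or> k = w1 [^] i \<otimes> y" if "k \<in> K" for k
  proof -
    define T where "T = {k. \<exists>i::int. k = w1 [^] i \<or> k = w1 [^] i \<otimes> y}"
    have yi: "y \<otimes> w1 [^] (i::int) = w1 [^] i \<otimes> y" for i
    proof -
      interpret h: group_hom G G "\<lambda>z. y \<otimes> z \<otimes> inv y"
        using yG by unfold_locales (auto simp: hom_def word_simps)
      have "y \<otimes> w1 [^] i \<otimes> inv y = w1 [^] i" using h.hom_int_pow[OF bG(1), of i] yw1 by simp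
      then show ?thesis using cm[OF yG, of "w1 [^] i"] bG by simp
    qed
    have T: "subgroup T G"
    proof (rule subgroup_finI)
      show "T \<subseteq> carrier G" using bG yG by (auto simp: T_def)
      show "\<one> \<in> T" by (auto simp: T_def intro: exI[of _ 0])
      have m1: "w1 [^] (i::int) \<otimes> w1 [^] (j::int) = w1 [^] (i + j)" for i j using int_pow_mult[OF bG(1)] by simp
      fix a b assume "a \<in> T" "b \<in> T"
      then obtain i j where ij: "a = w1 [^] (i::int) \<or> a = w1 [^] i \<otimes> y" "b = w1 [^] (j::int) \<or> b = w1 [^] j \<otimes> y" by (auto simp: T_def)
      have c1: "w1 [^] i \<otimes> (w1 [^] j \<otimes> y) = w1 [^] (i + j) \<otimes> y" using bG yG by (simp add: m1 m_assoc[symmetric])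
      have c2: "w1 [^] i \<otimes> y \<otimes> w1 [^] j = w1 [^] (i + j) \<otimes> y"
      proof -
        have "w1 [^] i \<otimes> y \<otimes> w1 [^] j = w1 [^] i \<otimes> (w1 [^] j \<otimes> y)" using bG yG yi[of j] by (simp add: m_assoc)
        then show ?thesis using c1 by simp
      qed
      have c3: "w1 [^] i \<otimes> y \<otimes> (w1 [^] j \<otimes> y) = w1 [^] (i + j)"
      proof -
        have "w1 [^] i \<otimes> y \<otimes> (w1 [^] j \<otimes> y) = (w1 [^] i \<otimes> y \<otimes> w1 [^] j) \<otimes> y" using bG yG by (simp add: m_assoc)
        also have "\<dots> = w1 [^] (i + j) \<otimes> (y \<otimes> y)" unfolding c2 using bG yG by (simp add: m_assoc)
        finally show ?thesis using yy bG by simp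
      qed
      show "a \<otimes> b \<in> T" using ij c1 c2 c3 m1 unfolding T_def by auto
    qed
    have "u = w1 [^] (-1::int)" using bG by (simp add: u_def int_pow_neg)
    moreover have "y = w1 [^] (0::int) \<otimes> y" using yG by simp
    ultimately have "{u, y} \<subseteq> T" unfolding T_def by blast
    then have "K \<subseteq> T" unfolding K_def by (rule generate_subgroup_incl[OF _ T])
    then show ?thesis using that by (auto simp: T_def)
  qed
  have x_sq: "x \<otimes> x \<noteq> \<one>"
  proof
    assume "x \<otimes> x = \<one>"
    then have "x [^] (2::nat) = \<one>" using xG by (simp add: numeral_2_eq_2)
    then have "p dvd 2" using pow_eq_id[OF xG] ox by simp
    then show False using p_not_dvd_two[OF oddp] by (metis int_dvd_int_iff of_nat_numeral)
  qed
  \<comment> \<open>A power of x would commute with x, whereas y inverts x and x is not an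
    involution.\<close>
  have y_not_x: "y \<noteq> x [^] (i::int)" for i
  proof
    assume e: "y = x [^] i"
    have "x [^] i \<otimes> x = x \<otimes> x [^] i" using int_pow_mult[OF xG, of i 1] int_pow_mult[OF xG, of 1 i] xG by (simp add: add.commute)
    then have "y \<otimes> x \<otimes> inv y = x" unfolding e using xG by (simp add: m_assoc)
    then have "x = inv x" using yx by simp
    then have "x \<otimes> x = \<one>" using xG r_inv by metis
    then show False using x_sq by simp
  qed
  \<comment> \<open>Separating the old plane from H in the equation shows that the y-part is a power
    of x, hence \<one>, and then that the exponent of w1 is divisible by p.\<close>
  have KB: "B.plane \<inter> K = {\<one>}"
  proof
    show "{\<one>} \<subseteq> B.plane \<inter> K" using sub_one[OF K] sub_one[OF B.plane_subgroup] by blast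
    show "B.plane \<inter> K \<subseteq> {\<one>}"
    proof
      fix k assume k: "k \<in> B.plane \<inter> K"
      then obtain m l where ml: "k = x [^] (m::int) \<otimes> w2 [^] (l::int)" by (auto simp: B.plane_def B.vec_def)
      have kx: "k = w2 [^] l \<otimes> x [^] m" unfolding ml by (rule B.pow_commute)
      obtain i where i: "k = w1 [^] (i::int) \<or> k = w1 [^] i \<otimes> y" using Kform k by blast
      then obtain e where e: "k = w1 [^] i \<otimes> e" "e = \<one> \<or> e = y" using bG by (metis int_pow_closed r_one)
      have eG: "e \<in> carrier G" "e \<in> H" using e(2) yG yH sub_one[OF H(1)] by auto
      have "inv (w2 [^] l) \<otimes> w1 [^] i = x [^] m \<otimes> inv e"
      proof -
        have "inv (w2 [^] l) \<otimes> (w1 [^] i \<otimes> e) \<otimes> inv e = inv (w2 [^] l) \<otimes> (w2 [^] l \<otimes> x [^] m) \<otimes> inv e" using e(1) kx by simp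
        then show ?thesis using bG xG eG by (simp add: word_simps)
      qed
      moreover have "inv (w2 [^] l) \<otimes> w1 [^] i \<in> plane" using sub_mult[OF plane_subgroup] sub_inv[OF plane_subgroup] w2pl by blast
      moreover have "x [^] m \<otimes> inv e \<in> H" using sub_mult[OF H(1) xiH sub_inv[OF H(1) eG(2)]] .
      ultimately have z: "inv (w2 [^] l) \<otimes> w1 [^] i = \<one>" "x [^] m \<otimes> inv e = \<one>" using H(2) by auto
      have "x [^] m \<otimes> inv e \<otimes> e = e" using z(2) eG by simp
      then have "e = x [^] m" using xG eG by (simp add: m_assoc)
      then have e1: "e = \<one>" using e(2) y_not_x by blast
      have "w1 [^] i \<otimes> w2 [^] (- l) = \<one>" using z(1) pow_commute[of i "- l"] bG by (simp add: int_pow_neg)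
      then have "int p dvd i" using basis_indep by blast
      then have "w1 [^] i = \<one>" using vec_eq_iff[of "(i, 0)" "(0, 0)"] bG by (auto simp: vec_def)
      then show "k \<in> {\<one>}" using e(1) e1 by simp
    qed
  qed
  have Bset: "affine_setting G p x w2 K"
  proof (rule affine_setting.intro[OF B.plane_basis_axioms], unfold affine_setting_axioms_def, intro conjI allI impI)
    show "B.plane \<lhd> G" by (rule B_normal)
    show "subgroup K G" by (rule K)
    show "B.plane \<inter> K = {\<one>}" by (rule KB)
    show "\<exists>a\<in>B.plane. \<exists>k\<in>K. g = a \<otimes> k" if "g \<in> carrier G" for g
    proof -
      define T where "T = {a \<otimes> k |a k. a \<in> B.plane \<and> k \<in> K}"
      have T: "subgroup T G" unfolding T_def by (rule normal_mult_subgroup[OF B_normal K])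
      have BT: "B.plane \<subseteq> T"
      proof
        fix a assume a: "a \<in> B.plane"
        have "a = a \<otimes> \<one>" using sub_mem[OF B.plane_subgroup a] by simp
        then show "a \<in> T" unfolding T_def using a sub_one[OF K] by blast
      qed
      have KT: "K \<subseteq> T"
      proof
        fix a assume a: "a \<in> K"
        have "a = \<one> \<otimes> a" using sub_mem[OF K a] by simp
        then show "a \<in> T" unfolding T_def using a sub_one[OF B.plane_subgroup] by blast
      qed
      have "T = carrier G" by (rule all_G[OF T]) (use BT KT B_xw2 uyK in auto)
      then show ?thesis using that unfolding T_def by blast
    qed
    show "k = \<one>" if k: "k \<in> K" "\<forall>a. a \<in> B.plane \<longrightarrow> k \<otimes> a = a \<otimes> k" for k
    proof -
      obtain i where i: "k = w1 [^] (i::int) \<or> k = w1 [^] i \<otimes> y" using Kform k(1) by blast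
      have kx: "k \<otimes> x = x \<otimes> k" and kw: "k \<otimes> w2 = w2 \<otimes> k" using k(2) B_xw2 by auto
      have w1w2: "w1 [^] i \<otimes> w2 = w2 \<otimes> w1 [^] i" using pow_commute[of i 1] bG by simp
      show ?thesis
      proof (rule disjE[OF i])
        assume e: "k = w1 [^] i"
        have "x \<otimes> vec (i, 0) \<otimes> inv x = vec (i, i)" using acts_vec[OF xG x, of i 0] by simp
        moreover have "vec (i, 0) = k" using bG e by (simp add: vec_def)
        moreover have "x \<otimes> k \<otimes> inv x = k" using kx[symmetric] xG e bG by (simp add: m_assoc)
        ultimately have "vec (i, i) = vec (i, 0)" by simp
        then have "i mod int p = 0" by (simp add: vec_eq_iff)
        then have "vec (i, 0) = vec (0, 0)" by (simp add: vec_eq_iff)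
        then show ?thesis using \<open>vec (i, 0) = k\<close> vec_one by simp
      next
        assume e: "k = w1 [^] i \<otimes> y"
        have "w1 [^] i \<otimes> (y \<otimes> w2) = w1 [^] i \<otimes> (w2 \<otimes> y)"
          using kw w1w2 bG yG unfolding e by (simp add: m_assoc[symmetric])
        then have "y \<otimes> w2 = w2 \<otimes> y" using bG yG by simp
        then have "y \<otimes> w2 \<otimes> inv y = w2" using bG yG by (simp add: m_assoc)
        then have "inv w2 = w2" using yw2 by simp
        then have "vec (0, -1) = vec (0, 1)" using bG by (simp add: vec_def int_pow_neg)
        then have "snd (0::int, -1::int) mod int p = snd (0::int, 1::int) mod int p" unfolding vec_eq_iff by blast
        then have "int p dvd -1 - 1" unfolding snd_conv by (rule mod_eq_dvd_iff[THEN iffD1])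
        then show ?thesis using p_not_dvd_two[OF oddp] by simp
      qed
    qed
  qed
  interpret S: affine_setting G p x w2 K by (rule Bset)
  show ?thesis
  proof (rule S.recognize2(1)[OF uyK(1) _ uyK(2)])
    show "S.acts u 1 1 0 1" unfolding S.acts_def ux uw2 using xG bG by (simp add: B.vec_def)
    show "S.acts y (-1) 0 0 (-1)" unfolding S.acts_def yx yw2 using xG bG by (simp add: B.vec_def int_pow_neg)
  qed (rule K_def)
qed

text \<open>For a = 1 the linear part is not one of the displayed matrix groups, and the other
  normal plane must be used. For a = -1 the scalar z = -1 is the p-th power of x; then xz is the
  standard unipotent matrix and H is generated by xz, z and y.\<close>

lemma unipotent_case_plus:
  assumes x: "acts x a a 0 a" and a: "a = 1 \<or> a = -1" and y: "acts y 1 0 0 (-1)"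
  shows "(ord x = p \<and> G \<cong> affine_group p {(1,1,0,1), (-1,0,0,-1)}) \<or>
    (ord x = 2 * p \<and> G \<cong> affine_group p {(1,1,0,1), (-1,0,0,-1), (1,0,0,-1)})"
  using a
proof
  assume "a = 1"
  then show ?thesis using unipotent_ord(1)[OF xH oddp] swapped_plane x y by simp
next
  assume "a = -1"
  then have x': "acts x (-1) (-1) 0 (-1)" using x by simp
  define z where "z = x [^] p"
  have zH: "z \<in> H" unfolding z_def by (rule pow_sub[OF H(1) xH])
  have zG: "z \<in> carrier G" using H_carrier[OF zH] .
  have z: "acts z (-1) 0 0 (-1)"
    unfolding z_def by (rule negative_unipotent_pow[OF xG x' oddp])
  have xz: "acts (x \<otimes> z) 1 1 0 1" using acts_mult[OF xG zG x' z] by simp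
  have xzH: "x \<otimes> z \<in> H" using sub_mult[OF H(1) xH zH] .
  have zz: "z \<otimes> z = \<one>"
  proof -
    have "acts (z \<otimes> z) 1 0 0 1" using acts_mult[OF zG zG z z] by simp
    then show ?thesis using acts_identity_iff[OF sub_mult[OF H(1) zH zH]] by simp
  qed
  have g: "H = generate G {x \<otimes> z, z, y}"
  proof (rule H_genI)
    have S: "{x \<otimes> z, z, y} \<subseteq> carrier G" using xG zG yG by simp
    have "(x \<otimes> z) \<otimes> z \<in> generate G {x \<otimes> z, z, y}"
      by (rule sub_mult[OF generate_is_subgroup[OF S]]) (auto intro: generate.incl)
    moreover have "(x \<otimes> z) \<otimes> z = x" using zz xG zG by (simp add: m_assoc)
    ultimately show "x \<in> generate G {x \<otimes> z, z, y}" by simp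
  qed (use xzH zH yH in \<open>auto intro: generate.incl\<close>)
  have "G \<cong> affine_group p {(1,1,0,1), (-1,0,0,-1), (1,0,0,-1)}"
    by (rule recognize3[OF xzH xz zH z yH y g])
  then show ?thesis using unipotent_ord(2)[OF xH oddp x'] by simp
qed

end

text \<open>For a = 1 the matrices are already the displayed ones. For a = -1 the scalar -1 belongs
  to H, and replacing the reflection y by its negative, which still inverts x, reduces to the
  opposite sign of y.\<close>

lemma unipotent_case_minus:
  assumes oddp: "odd p" and xH: "x \<in> H" and yH: "y \<in> H" and H_gen: "H = generate G {x, y}"
    and yy: "y \<otimes> y = \<one>" and yx: "y \<otimes> x \<otimes> inv y = inv x"
    and x: "acts x a a 0 a" and a: "a = 1 \<or> a = -1" and y: "acts y (-1) 0 0 1"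
  shows "(ord x = p \<and> G \<cong> affine_group p {(1,1,0,1), (-1,0,0,1)}) \<or>
    (ord x = 2 * p \<and> G \<cong> affine_group p {(1,1,0,1), (-1,0,0,-1), (1,0,0,-1)})"
  using a
proof
  have xG: "x \<in> carrier G" and yG: "y \<in> carrier G" using xH yH H_carrier by auto
  assume "a = -1"
  then have x': "acts x (-1) (-1) 0 (-1)" using x by simp
  define z where "z = x [^] p"
  have zH: "z \<in> H" unfolding z_def by (rule pow_sub[OF H(1) xH])
  have zG: "z \<in> carrier G" using H_carrier[OF zH] .
  have z: "acts z (-1) 0 0 (-1)"
    unfolding z_def by (rule negative_unipotent_pow[OF xG x' oddp])
  define y' where "y' = z \<otimes> y"
  have y'H: "y' \<in> H" unfolding y'_def by (rule sub_mult[OF H(1) zH yH])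
  have y'G: "y' \<in> carrier G" using H_carrier[OF y'H] .
  have y': "acts y' 1 0 0 (-1)" unfolding y'_def using acts_mult[OF zG yG z y] by simp
  have y'y': "y' \<otimes> y' = \<one>"
  proof -
    have "acts (y' \<otimes> y') 1 0 0 1" using acts_mult[OF y'G y'G y' y'] by simp
    then show ?thesis using acts_identity_iff[OF sub_mult[OF H(1) y'H y'H]] by simp
  qed
  have zx: "z \<otimes> v = v \<otimes> z" if "v = x" for v
    unfolding that z_def using nat_pow_comm[OF xG, of p 1] xG by simp
  have y'x: "y' \<otimes> x \<otimes> inv y' = inv x"
  proof -
    have "y' \<otimes> x \<otimes> inv y' = z \<otimes> (y \<otimes> x \<otimes> inv y) \<otimes> inv z" using xG yG zG by (simp add: y'_def word_simps)
    also have "\<dots> = inv (z \<otimes> x \<otimes> inv z)" unfolding yx using xG zG by (simp add: word_simps)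
    also have "z \<otimes> x \<otimes> inv z = x" using zx[OF refl] xG zG by (simp add: m_assoc)
    finally show ?thesis .
  qed
  have g: "H = generate G {x, y'}"
  proof (rule generate_eqI[OF H_gen _ subgroup.subset[OF H(1)]])
    have S: "{x, y'} \<subseteq> carrier G" using xG y'G by simp
    have xg: "x \<in> generate G {x, y'}" "y' \<in> generate G {x, y'}" by (auto intro: generate.incl)
    then have "inv z \<otimes> y' \<in> generate G {x, y'}" unfolding z_def
      by (intro sub_mult[OF generate_is_subgroup[OF S]] sub_inv[OF generate_is_subgroup[OF S]] pow_sub[OF generate_is_subgroup[OF S]])
    then show "y \<in> generate G {x, y'}" using yG zG by (simp add: y'_def inv_cancel1)
    show "x \<in> generate G {x, y'}" by (rule xg(1))
  qed (use xH y'H in auto)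
  have "ord x = 2 * p" using unipotent_ord(2)[OF xH oddp x'] .
  moreover have "ord x \<noteq> p" using calculation prime_gt_0_nat[OF prime_p] by simp
  ultimately show ?thesis
    using unipotent_case_plus[OF oddp xH y'H g y'y' y'x x' _ y'] by simp
next
  assume "a = 1"
  then have x': "acts x 1 1 0 1" using x by simp
  then show ?thesis using unipotent_ord(1)[OF xH oddp x'] recognize2(1)[OF xH x' yH y H_gen] by simp
qed

end

text \<open>The p-th power of e + f s modulo p: the inner binomial coefficients are divisible by p,
  and s^p = \<theta>^m s. The extension field is not constructed; the computation takes place in the
  reals, and u, v do not depend on which square root s of \<theta> is used.\<close>

lemma real_quadratic_freshman:
  fixes e f \<theta> :: int
  assumes p: "Factorial_Ring.prime p" "p = 2 * m + 1"
  obtains u v :: int where "\<And>s :: real. s * s = of_int \<theta> \<Longrightarrow>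
    (of_int e + of_int f * s) ^ p = of_int (e ^ p + int p * u) + of_int (f ^ p * \<theta> ^ m + int p * v) * s"
proof -
  define c where "c k = int ((p choose k) div p)" for k
  have c: "real (p choose k) = real p * of_int (c k)" if "k \<in> {1..<p}" for k
  proof -
    have "p dvd (p choose k)" using that p(1) by (intro dvd_choose_prime) auto
    then have "real (p choose k) = real (p * ((p choose k) div p))" by simp
    then show ?thesis by (simp add: c_def)
  qed
  \<comment> \<open>The inner term divided by p, with s^k already reduced to a power of \<theta>
    times 1 or s; parity of k decides between u and v.\<close>
  define t where "t k = c k * f ^ k * \<theta> ^ (k div 2) * e ^ (p - k)" for k
  define u where "u = (\<Sum>k\<in>{1..<p}. if even k then t k else 0)"
  define v where "v = (\<Sum>k\<in>{1..<p}. if even k then 0 else t k)"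
  show ?thesis
  proof (rule that[of u v])
    fix s :: real assume s: "s * s = of_int \<theta>"
    have sp: "s ^ k = of_int (\<theta> ^ (k div 2)) * (if even k then 1 else s)" for k
    proof -
      have "s ^ k = s ^ (2 * (k div 2) + k mod 2)" by simp
      also have "\<dots> = (s * s) ^ (k div 2) * s ^ (k mod 2)"
        by (simp only: power_add power_mult power2_eq_square)
      finally show ?thesis unfolding s by (cases "even k") (auto simp: even_iff_mod_2_eq_zero odd_iff_mod_2_eq_one)
    qed
    define T where "T k = real (p choose k) * (of_int f * s) ^ k * of_int e ^ (p - k)" for k
    have p1: "p \<ge> 1" using p(2) by simp
    have "(of_int e + of_int f * s) ^ p = (\<Sum>k\<le>p. T k)"
      using binomial_ring[of "of_int f * s" "of_int e :: real" p] by (simp add: T_def add.commute)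
    also have "{..p} = insert 0 (insert p {1..<p})" using p1 by auto
    also have "sum T (insert 0 (insert p {1..<p})) = T 0 + (T p + (\<Sum>k\<in>{1..<p}. T k))"
      using p1 by simp
    also have "T 0 = of_int (e ^ p)" by (simp add: T_def)
    also have "T p = of_int (f ^ p * \<theta> ^ m) * s"
    proof -
      have "s ^ p = of_int (\<theta> ^ m) * s" using sp[of p] p(2) by (simp del: power_Suc)
      then show ?thesis unfolding T_def power_mult_distrib by simp
    qed
    also have "(\<Sum>k\<in>{1..<p}. T k) = (\<Sum>k\<in>{1..<p}. real p * of_int (if even k then t k else 0) + real p * of_int (if even k then 0 else t k) * s)"
    proof (rule sum.cong[OF refl])
      fix k assume k: "k \<in> {1..<p}"
      have "T k = real p * of_int (t k) * (if even k then 1 else s)"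
        unfolding T_def c[OF k] power_mult_distrib sp[of k] by (simp add: t_def)
      then show "T k = real p * of_int (if even k then t k else 0) + real p * of_int (if even k then 0 else t k) * s" by simp
    qed
    also have "\<dots> = real p * of_int u + real p * of_int v * s"
      by (simp only: sum.distrib sum_distrib_left[symmetric] sum_distrib_right[symmetric] u_def v_def of_int_sum)
    finally show "(of_int e + of_int f * s) ^ p = of_int (e ^ p + int p * u) + of_int (f ^ p * \<theta> ^ m + int p * v) * s"
      by (simp add: algebra_simps)
  qed
qed

text \<open>Coefficients of (e + f s)^k with respect to 1 and s, where s is a square root of
  \<theta>.\<close>

primrec quadratic_power :: "int \<Rightarrow> int \<Rightarrow> int \<Rightarrow> nat \<Rightarrow> int \<times> int" where
  "quadratic_power e f \<theta> 0 = (1, 0)"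
| "quadratic_power e f \<theta> (Suc k) = (case quadratic_power e f \<theta> k of (a, b) \<Rightarrow> (e * a + f * \<theta> * b, f * a + e * b))"

lemma quadratic_power_real:
  fixes s :: real
  assumes "s * s = of_int \<theta>"
  shows "(of_int e + of_int f * s) ^ k = of_int (fst (quadratic_power e f \<theta> k)) + of_int (snd (quadratic_power e f \<theta> k)) * s"
proof (induction k)
  case (Suc k)
  obtain a b where ab: "quadratic_power e f \<theta> k = (a, b)" by fastforce
  have "(of_int e + of_int f * s) ^ Suc k = (of_int e + of_int f * s) * (of_int a + of_int b * s)" using Suc ab by simp
  also have "\<dots> = of_int e * of_int a + of_int f * of_int b * (s * s) + (of_int f * of_int a + of_int e * of_int b) * s"
    by (simp add: algebra_simps)
  finally show ?case unfolding assms by (simp add: ab algebra_simps)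
qed simp

lemma fermat_int:
  assumes "Factorial_Ring.prime p" "a \<ge> 0"
  shows "[a ^ p = a] (mod int p)"
proof -
  define n where "n = nat a"
  have an: "a = int n" using assms(2) by (simp add: n_def)
  have "[n ^ p = n] (mod p)"
  proof (cases "p dvd n")
    case True
    then have "p dvd n ^ p" using assms(1) prime_gt_0_nat by (simp add: prime_dvd_power_iff)
    then show ?thesis using True by (simp add: cong_def dvd_eq_mod_eq_0)
  next
    case False
    then have "[n ^ (p - 1) * n = 1 * n] (mod p)" using fermat_theorem[OF assms(1)] cong_scalar_right by blast
    moreover have "n ^ (p - 1) * n = n ^ p" using prime_gt_0_nat[OF assms(1)] by (metis power_minus_mult)
    ultimately show ?thesis by simp
  qed
  then show ?thesis unfolding an by (metis cong_int_iff of_nat_power)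
qed

text \<open>Euler's criterion for a primitive root: the half power is a square root of 1 modulo p,
  and it is not 1 because the order of \<theta> is p - 1.\<close>

lemma primroot_half_power:
  assumes p: "Factorial_Ring.prime p" "p = 2 * m + 1" and \<theta>: "residue_primroot p \<theta>"
  shows "[int \<theta> ^ m = -1] (mod int p)"
proof -
  have ip: "Factorial_Ring.prime (int p)" using p(1) by simp
  have m0: "m > 0" using p prime_gt_1_nat[OF p(1)] by simp
  have o: "ord p \<theta> = 2 * m" using \<theta> p totient_prime[OF p(1)] by (simp add: residue_primroot_def)
  have "[\<theta> ^ (2 * m) = 1] (mod p)" using o by (metis ord_divides dvd_refl)
  then have "[int \<theta> ^ (2 * m) = 1] (mod int p)" by (metis cong_int_iff of_nat_1 of_nat_power)
  moreover have "int \<theta> ^ (2 * m) - 1 = (int \<theta> ^ m - 1) * (int \<theta> ^ m + 1)"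
    unfolding mult_2 power_add by (simp add: algebra_simps)
  ultimately have "int p dvd (int \<theta> ^ m - 1) * (int \<theta> ^ m + 1)" by (simp add: cong_iff_dvd_diff)
  then have "int p dvd int \<theta> ^ m - 1 \<or> int p dvd int \<theta> ^ m + 1" using ip prime_dvd_mult_iff by blast
  moreover have "\<not> int p dvd int \<theta> ^ m - 1"
  proof
    assume "int p dvd int \<theta> ^ m - 1"
    then have "[int \<theta> ^ m = 1] (mod int p)" by (simp add: cong_iff_dvd_diff)
    then have "[\<theta> ^ m = 1] (mod p)" by (metis cong_int_iff of_nat_1 of_nat_power)
    then have "2 * m dvd m" using o ord_divides by metis
    then show False using m0 by (auto dest: dvd_imp_le)
  qed
  ultimately show ?thesis by (simp add: cong_iff_dvd_diff)
qed

text \<open>Since \<theta> is a nonresidue, the p-th power conjugates e + f s to e - f s modulo p.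
  One more factor gives the norm e^2 - f^2 \<theta>, which is 1.\<close>

lemma quadratic_power_norm_one:
  fixes e f :: int
  assumes p: "Factorial_Ring.prime p" "odd p" and \<theta>: "residue_primroot p \<theta>"
    and ef: "e \<ge> 0" "f \<ge> 0" "[e\<^sup>2 - f\<^sup>2 * int \<theta> = 1] (mod int p)"
  shows "[fst (quadratic_power e f (int \<theta>) (p + 1)) = 1] (mod int p)" "[snd (quadratic_power e f (int \<theta>) (p + 1)) = 0] (mod int p)"
proof -
  obtain m where m: "p = 2 * m + 1" using p(2) by (rule oddE)
  obtain a b where ab: "quadratic_power e f (int \<theta>) p = (a, b)" by fastforce
  obtain u v where uv: "\<And>s :: real. s * s = of_int (int \<theta>) \<Longrightarrow>
    (of_int e + of_int f * s) ^ p = of_int (e ^ p + int p * u) + of_int (f ^ p * int \<theta> ^ m + int p * v) * s"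
    using real_quadratic_freshman[OF p(1) m] by blast
  have \<theta>0: "\<theta> > 0"
  proof (rule ccontr)
    assume "\<not> \<theta> > 0"
    moreover have "coprime p \<theta>" using \<theta> by (simp add: residue_primroot_def)
    ultimately have "p = 1" by simp
    then show False using p(1) by simp
  qed
  define s where "s = sqrt (real \<theta>)"
  have s: "s * s = of_int (int \<theta>)" "s > 0" using \<theta>0 by (simp_all add: s_def)
  have s': "(-s) * (-s) = of_int (int \<theta>)" using s by simp
  define A B where "A = e ^ p + int p * u" and "B = f ^ p * int \<theta> ^ m + int p * v"
  \<comment> \<open>Evaluating at both square roots of \<theta> separates the two coefficients by
    linear algebra, without appeal to irrationality.\<close>
  have e1: "of_int a + of_int b * s = of_int A + of_int B * s"
    using quadratic_power_real[OF s(1), of e f p] uv[OF s(1)] ab by (simp add: A_def B_def)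
  have e2: "of_int a + of_int b * (-s) = of_int A + of_int B * (-s)"
    using quadratic_power_real[OF s', of e f p] uv[OF s'] ab by (simp add: A_def B_def)
  have "real_of_int a = of_int A" using e1 e2 by linarith
  then have aA: "a = A" by simp
  then have "of_int b * s = of_int B * s" using e1 by simp
  then have bB: "b = B" using s(2) by simp
  have "[A = e ^ p] (mod int p)" by (simp add: A_def cong_iff_dvd_diff)
  then have a: "[a = e] (mod int p)" unfolding aA using fermat_int[OF p(1) ef(1)] cong_trans by blast
  have "[B = f ^ p * int \<theta> ^ m] (mod int p)" by (simp add: B_def cong_iff_dvd_diff)
  moreover have "[f ^ p * int \<theta> ^ m = f * (-1)] (mod int p)"
    by (rule cong_mult[OF fermat_int[OF p(1) ef(2)] primroot_half_power[OF p(1) m \<theta>]])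
  ultimately have b: "[b = f * (-1)] (mod int p)" unfolding bB by (rule cong_trans)
  have n: "quadratic_power e f (int \<theta>) (p + 1) = (e * a + f * int \<theta> * b, f * a + e * b)" by (simp add: ab)
  have "[e * a + f * int \<theta> * b = e * e + f * int \<theta> * (f * (-1))] (mod int p)"
    by (intro cong_add cong_mult cong_refl a b)
  also have "e * e + f * int \<theta> * (f * (-1)) = e\<^sup>2 - f\<^sup>2 * int \<theta>" by (simp add: power2_eq_square)
  also note ef(3)
  finally show "[fst (quadratic_power e f (int \<theta>) (p + 1)) = 1] (mod int p)" by (simp only: n fst_conv)
  have "[f * a + e * b = f * e + e * (f * (-1))] (mod int p)"
    by (intro cong_add cong_mult cong_refl a b)
  then show "[snd (quadratic_power e f (int \<theta>) (p + 1)) = 0] (mod int p)" by (simp only: n snd_conv) (simp add: algebra_simps)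
qed

section \<open>Orders of torus elements and conjugation to normal form\<close>

context affine_setting
begin

text \<open>The matrix ||e,f\<theta>;f,e|| represents multiplication by e + f s, so its powers have
  the coefficients of the powers of that number as entries.\<close>

lemma norm_pow:
  assumes "k \<in> carrier G" "acts k e (f * \<theta>) f e"
  shows "acts (k [^] m) (fst (quadratic_power e f \<theta> m)) (snd (quadratic_power e f \<theta> m) * \<theta>)
    (snd (quadratic_power e f \<theta> m)) (fst (quadratic_power e f \<theta> m))"
proof (induction m)
  case 0 then show ?case using acts_one by simp
next
  case (Suc m)
  obtain a b where ab: "quadratic_power e f \<theta> m = (a, b)" by fastforce
  have ih: "acts (k [^] m) a (b * \<theta>) b a" using Suc ab by simp
  have "acts (k [^] m \<otimes> k) (e * a + f * \<theta> * b) (e * (b * \<theta>) + f * \<theta> * a) (f * a + e * b) (f * (b * \<theta>) + e * a)"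
    by (rule acts_mult[OF _ assms(1) ih assms(2)]) (use assms(1) in simp)
  then show ?case by (simp add: ab algebra_simps)
qed

lemma norm_ord_dvd:
  assumes oddp: "odd p" and \<theta>: "residue_primroot p \<theta>" and k: "k \<in> H" "acts k e (f * int \<theta>) f e"
    and ef: "e \<ge> 0" "f \<ge> 0" "[e\<^sup>2 - f\<^sup>2 * int \<theta> = 1] (mod int p)"
  shows "ord k dvd p + 1"
proof -
  have kG: "k \<in> carrier G" using H_carrier[OF k(1)] .
  note q = quadratic_power_norm_one[OF prime_p oddp \<theta> ef]
  have "[snd (quadratic_power e f (int \<theta>) (p + 1)) * int \<theta> = 0 * int \<theta>] (mod int p)" by (rule cong_scalar_right[OF q(2)])
  then have "k [^] (p + 1) = \<one>"
    using acts_identity_iff[OF pow_sub[OF H(1) k(1)] norm_pow[OF kG k(2), of "p + 1"]] q by simp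
  then show ?thesis using pow_eq_id[OF kG] by blast
qed

text \<open>As s is inverse to t modulo p, both diagonal entries become 1 at the same
  exponents.\<close>

lemma diagonal_ord:
  assumes k: "k \<in> H" "acts k t 0 0 s" and ts: "t \<ge> 0" "[t * s = 1] (mod int p)"
  shows "ord k = Pocklington.ord p (nat t)"
proof -
  have kG: "k \<in> carrier G" using H_carrier[OF k(1)] .
  have t: "int (nat t) = t" using ts(1) by simp
  have "(k [^] m = \<one>) = (Pocklington.ord p (nat t) dvd m)" for m
  proof -
    have "(k [^] m = \<one>) = ([t ^ m = 1] (mod int p) \<and> [s ^ m = 1] (mod int p))"
      using acts_identity_iff[OF pow_sub[OF H(1) k(1)] diagonal_pow[OF kG k(2), of m]] by simp
    moreover have "[s ^ m = 1] (mod int p)" if h: "[t ^ m = 1] (mod int p)"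
    proof -
      have "[t ^ m * s ^ m = 1 * s ^ m] (mod int p)" by (rule cong_scalar_right[OF h])
      moreover have "[t ^ m * s ^ m = 1] (mod int p)" using cong_pow[OF ts(2), of m] by (simp add: power_mult_distrib)
      ultimately show ?thesis by (metis cong_sym cong_trans mult_1)
    qed
    moreover have "[t ^ m = 1] (mod int p) \<longleftrightarrow> [nat t ^ m = 1] (mod p)"
      using cong_int_iff[of "nat t ^ m" 1 p] t by simp
    ultimately show ?thesis using ord_divides[of "nat t" m p] by blast
  qed
  then show ?thesis using ord_unique[OF kG] by blast
qed

text \<open>With P the base change, M the old and N the new matrix, the four congruences are the
  entries of PM = NP. No inverse of P has to be computed.\<close>

lemma change_acts:
  assumes det: "\<not> int p dvd a * d - b * c" and k: "k \<in> carrier G" "acts k m11 m12 m21 m22"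
    and e: "[a * m11 + b * m21 = n11 * a + n12 * c] (mod int p)" "[a * m12 + b * m22 = n11 * b + n12 * d] (mod int p)"
      "[c * m11 + d * m21 = n21 * a + n22 * c] (mod int p)" "[c * m12 + d * m22 = n21 * b + n22 * d] (mod int p)"
  shows "affine_setting.acts G (vec (a, b)) (vec (c, d)) k n11 n12 n21 n22"
proof -
  interpret S: affine_setting G p "vec (a, b)" "vec (c, d)" H by (rule change_setting[OF det])
  have v: "S.vec (i, j) = vec (i * a + j * c, i * b + j * d)" for i j
    by (simp add: S.vec_def vec_int_pow vec_add)
  show ?thesis unfolding S.acts_def v acts_vec[OF k] vec_eq_iff using e by (simp add: cong_def)
qed

end

lemma primroot_residue:
  assumes p: "Factorial_Ring.prime p" and \<theta>: "residue_primroot p \<theta>" and r: "\<not> int p dvd r"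
  obtains i where "[r = int \<theta> ^ i] (mod int p)"
proof -
  have p0: "int p > 0" using prime_gt_0_nat[OF p] by simp
  define q where "q = nat (r mod int p)"
  have q: "int q = r mod int p" using p0 by (simp add: q_def)
  have "q \<noteq> 0" using r q by (metis dvd_eq_mod_eq_0 of_nat_0)
  moreover have "q < p" using q p0 by (metis of_nat_less_iff pos_mod_bound)
  ultimately have "q \<in> totatives p" using p by (simp add: totatives_prime)
  then have "q \<in> (\<lambda>i. \<theta> ^ i mod p) ` {..<totient p}"
    using residue_primroot_is_generator[OF prime_gt_1_nat[OF p] \<theta>] by (simp add: bij_betw_def)
  then obtain i where "q = \<theta> ^ i mod p" by blast
  then have "r mod int p = int \<theta> ^ i mod int p" using q by (metis of_nat_mod of_nat_power)
  then show ?thesis using that by (simp add: cong_def)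
qed

lemma square_one_mod_prime:
  fixes a :: int
  assumes p: "Factorial_Ring.prime p" and "int p dvd a * a - 1"
  obtains s where "s = 1 \<or> s = -1" "[a = s] (mod int p)"
proof -
  have ip: "Factorial_Ring.prime (int p)" using p by simp
  have "a * a - 1 = (a - 1) * (a - (-1))" by (simp add: algebra_simps)
  then have "int p dvd a - 1 \<or> int p dvd a - (-1)" using assms(2) ip by (metis prime_dvd_mult_iff)
  then show ?thesis using that[of 1] that[of "-1"] by (auto simp: cong_iff_dvd_diff)
qed

section \<open>Matrices inverted by the reflection diag(1,-1)\<close>

context affine_setting
begin

text \<open>The product yx is an involution with matrix ||a,-b;c,-d||. The entries of its square
  give a^2 - bc = 1, d^2 - bc = 1 and b(d - a) = c(d - a) = 0. If b and c both vanished, the square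
  of x would be \<one>; so one of them can be cancelled and d = a.\<close>

lemma inverting_matrix:
  assumes x: "x \<in> H" "acts x a b c d" and y: "y \<in> H" "acts y 1 0 0 (-1)"
    and yy: "y \<otimes> y = \<one>" and yx: "y \<otimes> x \<otimes> inv y = inv x" and xx: "x \<otimes> x \<noteq> \<one>"
  shows "[d = a] (mod int p)" "int p dvd a * a - b * c - 1" "\<not> (int p dvd b \<and> int p dvd c)"
proof -
  have xG: "x \<in> carrier G" and yG: "y \<in> carrier G" using x y H_carrier by auto
  have ip: "Factorial_Ring.prime (int p)" using prime_p by simp
  have "y \<otimes> x = y \<otimes> x \<otimes> inv y \<otimes> y" using xG yG by (simp add: m_assoc)
  then have "y \<otimes> x = inv x \<otimes> y" using yx by simp
  then have "y \<otimes> x \<otimes> (y \<otimes> x) = inv x \<otimes> (y \<otimes> y) \<otimes> x" using xG yG by (simp add: m_assoc)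
  then have one: "y \<otimes> x \<otimes> (y \<otimes> x) = \<one>" using yy xG by simp
  have "acts (y \<otimes> x) a (- b) c (- d)" using acts_mult[OF yG xG y(2) x(2)] by simp
  from acts_mult[OF _ _ this this]
  have "acts (y \<otimes> x \<otimes> (y \<otimes> x)) (a * a + (- b) * c) (a * (- b) + (- b) * (- d)) (c * a + (- d) * c) (c * (- b) + (- d) * (- d))"
    using xG yG by simp
  then have E: "int p dvd a * a + (- b) * c - 1" "int p dvd a * (- b) + (- b) * (- d) - 0"
    "int p dvd c * a + (- d) * c - 0" "int p dvd c * (- b) + (- d) * (- d) - 1"
    using acts_unique[OF _ acts_one] one unfolding cong_iff_dvd_diff by auto
  then show e1: "int p dvd a * a - b * c - 1" by simp
  show nbc: "\<not> (int p dvd b \<and> int p dvd c)"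
  proof
    assume bc: "int p dvd b \<and> int p dvd c"
    have X: "acts (x \<otimes> x) (a * a + b * c) (a * b + b * d) (c * a + d * c) (c * b + d * d)"
      by (rule acts_mult[OF xG xG x(2) x(2)])
    have "int p dvd a * a - b * c - 1 + 2 * c * b" "int p dvd c * (- b) + (- d) * (- d) - 1 + 2 * c * b"
      using dvd_add[OF e1, of "2 * c * b"] dvd_add[OF E(4), of "2 * c * b"] bc by auto
    then have "int p dvd a * a + b * c - 1" "int p dvd c * b + d * d - 1" by (simp_all add: algebra_simps)
    moreover have "int p dvd a * b + b * d - 0" "int p dvd c * a + d * c - 0" using bc by auto
    ultimately have "x \<otimes> x = \<one>"
      using acts_identity_iff[OF sub_mult[OF H(1) x(1) x(1)] X] unfolding cong_iff_dvd_diff by blast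
    then show False using xx by simp
  qed
  have "int p dvd b * (d - a)" "int p dvd c * (d - a)"
  proof -
    have "a * (- b) + (- b) * (- d) - 0 = b * (d - a)" "c * a + (- d) * c - 0 = - (c * (d - a))" by (simp_all add: algebra_simps)
    then show "int p dvd b * (d - a)" "int p dvd c * (d - a)" using E(2,3) by simp_all
  qed
  then have "int p dvd d - a" using nbc ip by (metis prime_dvd_mult_iff)
  then show "[d = a] (mod int p)" by (simp add: cong_iff_dvd_diff)
qed

text \<open>Write b/c as a power \<theta>^i. For even i let s^2 = b/c: the vectors (1,s), (1,-s) are
  eigenvectors of x for a + sc and a - sc, and y exchanges them. For odd i, b/c = \<theta> s^2, and
  multiplying the second basis vector by s produces the norm form with e = a, f = sc; y stays
  diagonal.\<close>

lemma semisimple_case: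
  assumes oddp: "odd p" and \<theta>: "residue_primroot p \<theta>"
    and xH: "x \<in> H" and yH: "y \<in> H" and H_gen: "H = generate G {x, y}"
    and x: "acts x a b c a" and y: "acts y 1 0 0 (-1)"
    and det: "int p dvd a * a - b * c - 1" and bc: "\<not> int p dvd b" "\<not> int p dvd c"
  shows "(ord x dvd p + 1 \<and> (\<exists>e f. e \<in> {0..<int p} \<and> f \<in> {0..<int p} \<and> [e\<^sup>2 - f\<^sup>2 * int \<theta> = 1] (mod int p) \<and>
        mat_ord p (e, f * int \<theta>, f, e) = ord x \<and> G \<cong> affine_group p {(e, f * int \<theta>, f, e), (1,0,0,-1)})) \<or>
    (ord x dvd p - 1 \<and> (\<exists>t s. t \<in> {1..<int p} \<and> s \<in> {1..<int p} \<and> [t * s = 1] (mod int p) \<and>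
        Pocklington.ord p (nat t) = ord x \<and> G \<cong> affine_group p {(t, 0, 0, s), (0,1,1,0)}))"
proof -
  have ip: "Factorial_Ring.prime (int p)" using prime_p by simp
  have p0: "int p > 0" using prime_gt_0_nat[OF prime_p] by simp
  have xG: "x \<in> carrier G" and yG: "y \<in> carrier G" using xH yH H_carrier by auto
  have "coprime c (int p)" using prime_imp_coprime[OF ip bc(2)] by (simp add: coprime_commute)
  then obtain c' where c': "[c * c' = 1] (mod int p)" using cong_solve_coprime_int by blast
  have bcc: "[b = c * (b * c')] (mod int p)"
    using cong_scalar_left[OF c', of b] by (simp add: cong_sym_eq mult.commute mult.left_commute)
  have "\<not> int p dvd b * c'"
  proof
    assume "int p dvd b * c'"
    then have "[c * (b * c') = 0] (mod int p)" by (simp add: cong_0_iff)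
    then show False using bcc bc(1) cong_trans cong_0_iff by blast
  qed
  then obtain i where "[b * c' = int \<theta> ^ i] (mod int p)" using primroot_residue[OF prime_p \<theta>] by blast
  then have bi: "[b = c * int \<theta> ^ i] (mod int p)" using bcc cong_scalar_left cong_trans by blast
  have co\<theta>: "\<not> int p dvd int \<theta>"
  proof -
    have "coprime p \<theta>" using \<theta> by (simp add: residue_primroot_def)
    then have "\<not> p dvd \<theta>" using prime_p by (metis coprime_common_divisor_nat dvd_refl not_prime_1)
    then show ?thesis by simp
  qed
  define m s where "m = i div 2" and "s = int \<theta> ^ m"
  have s: "\<not> int p dvd s" unfolding s_def using co\<theta> ip prime_dvd_power by blast
  have detc: "[a * a - b * c = 1] (mod int p)" using det by (simp add: cong_iff_dvd_diff)
  show ?thesis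
  proof (cases "even i")
    case True
    then obtain j where "i = 2 * j" by (rule evenE)
    then have "int \<theta> ^ i = s * s" by (simp add: s_def m_def mult_2 power_add)
    then have b: "[b = c * (s * s)] (mod int p)" using bi by simp
    have D: "\<not> int p dvd 1 * (- s) - s * 1"
    proof
      assume "int p dvd 1 * (- s) - s * 1"
      moreover have "1 * (- s) - s * 1 = - (2 * s)" by simp
      ultimately have "int p dvd 2 * s" by (metis dvd_minus_iff)
      then show False using s p_not_dvd_two[OF oddp] ip prime_dvd_mult_iff by blast
    qed
    \<comment> \<open>The two eigenvalues, reduced to standard residues; their product is the
      determinant a^2 - bc = 1.\<close>
    define t u where "t = (a + s * c) mod int p" and "u = (a - s * c) mod int p"
    have tm: "[a + s * c = t] (mod int p)" "[a - s * c = u] (mod int p)" by (simp_all add: t_def u_def cong_def)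
    have tu: "[t * u = 1] (mod int p)"
    proof -
      have "[t * u = (a + s * c) * (a - s * c)] (mod int p)" by (intro cong_mult cong_sym[OF tm(1)] cong_sym[OF tm(2)])
      also have "(a + s * c) * (a - s * c) = a * a - c * (s * s) * c" by (simp add: algebra_simps)
      also have "[a * a - c * (s * s) * c = a * a - b * c] (mod int p)"
        by (intro cong_diff cong_mult cong_refl cong_sym[OF b])
      also note detc
      finally show ?thesis .
    qed
    have "t \<noteq> 0" "u \<noteq> 0" using tu prime_gt_1_nat[OF prime_p] by (auto simp: cong_def)
    then have tr: "t \<in> {1..<int p}" "u \<in> {1..<int p}"
      using pos_mod_sign[OF p0, of "a + s * c"] pos_mod_sign[OF p0, of "a - s * c"] p0 by (auto simp: t_def u_def)
    interpret S: affine_setting G p "vec (1, s)" "vec (1, - s)" H by (rule change_setting[OF D])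
    have sx: "S.acts x (a + s * c) 0 0 (a - s * c)"
    proof (rule change_acts[OF D xG x])
      show "[1 * b + s * a = (a + s * c) * s + 0 * (- s)] (mod int p)" "[1 * b + (- s) * a = 0 * s + (a - s * c) * (- s)] (mod int p)"
        using b by (simp_all add: cong_iff_dvd_diff algebra_simps)
    qed simp_all
    then have Sx: "S.acts x t 0 0 u" using S.acts_cong tm cong_refl by blast
    have Sy: "S.acts y 0 1 1 0" by (rule change_acts[OF D yG y]) simp_all
    have o: "ord x = Pocklington.ord p (nat t)" by (rule S.diagonal_ord[OF xH Sx _ tu]) (use tr in simp)
    have "coprime p (nat t)"
    proof (rule prime_imp_coprime[OF prime_p])
      show "\<not> p dvd nat t"
      proof
        assume "p dvd nat t"
        then have "p \<le> nat t" by (rule dvd_imp_le) (use tr in simp)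
        then show False using tr(1) unfolding atLeastLessThan_iff by linarith
      qed
    qed
    then have "Pocklington.ord p (nat t) dvd p - 1"
      using order_divides_totient[of p "nat t"] totient_prime[OF prime_p] by simp
    then show ?thesis using S.recognize2(1)[OF xH Sx yH Sy H_gen] o tr tu by auto
  next
    case False
    then have "int \<theta> ^ i = int \<theta> ^ (2 * m + 1)" by (simp add: m_def)
    then have "int \<theta> ^ i = int \<theta> * (s * s)" by (simp add: s_def mult_2 power_add)
    then have b: "[b = c * (int \<theta> * (s * s))] (mod int p)" using bi by simp
    have D: "\<not> int p dvd 1 * s - 0 * 0" using s by simp
    \<comment> \<open>Reduced to standard residues, as the statement requires; the norm condition is
      again the determinant condition.\<close>
    define e f where "e = a mod int p" and "f = (s * c) mod int p"
    have ef: "[a = e] (mod int p)" "[s * c = f] (mod int p)" by (simp_all add: e_def f_def cong_def)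
    have efr: "e \<in> {0..<int p}" "f \<in> {0..<int p}" using p0 by (simp_all add: e_def f_def)
    have norm: "[e\<^sup>2 - f\<^sup>2 * int \<theta> = 1] (mod int p)"
    proof -
      have "[e\<^sup>2 - f\<^sup>2 * int \<theta> = a\<^sup>2 - (s * c)\<^sup>2 * int \<theta>] (mod int p)"
        by (intro cong_diff cong_mult cong_pow cong_refl cong_sym[OF ef(1)] cong_sym[OF ef(2)])
      also have "a\<^sup>2 - (s * c)\<^sup>2 * int \<theta> = a * a - c * (int \<theta> * (s * s)) * c" by (simp add: power2_eq_square algebra_simps)
      also have "[a * a - c * (int \<theta> * (s * s)) * c = a * a - b * c] (mod int p)"
        by (intro cong_diff cong_mult cong_refl cong_sym[OF b])
      also note detc
      finally show ?thesis .
    qed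
    interpret S: affine_setting G p "vec (1, 0)" "vec (0, s)" H by (rule change_setting[OF D])
    have sx: "S.acts x a (s * c * int \<theta>) (s * c) a"
    proof (rule change_acts[OF D xG x])
      show "[1 * b + 0 * a = a * 0 + s * c * int \<theta> * s] (mod int p)"
        using b by (simp add: ac_simps)
    qed (simp_all add: ac_simps)
    have Sx: "S.acts x e (f * int \<theta>) f e"
      by (rule S.acts_cong[OF sx]) (intro cong_mult cong_refl ef)+
    have Sy: "S.acts y 1 0 0 (-1)" by (rule change_acts[OF D yG y]) simp_all
    have "ord x dvd p + 1" by (rule S.norm_ord_dvd[OF oddp \<theta> xH Sx _ _ norm]) (use efr in simp_all)
    then show ?thesis using S.recognize2[OF xH Sx yH Sy H_gen] efr norm by blast
  qed
qed

lemma dihedral_case: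
  assumes oddp: "odd p" and \<theta>: "residue_primroot p \<theta>"
    and xH: "x \<in> H" and yH: "y \<in> H" and H_gen: "H = generate G {x, y}"
    and yy: "y \<otimes> y = \<one>" and yx: "y \<otimes> x \<otimes> inv y = inv x" and xx: "x \<otimes> x \<noteq> \<one>"
    and y: "acts y 1 0 0 (-1)"
  shows "(ord x dvd p + 1 \<and> (\<exists>e f. e \<in> {0..<int p} \<and> f \<in> {0..<int p} \<and> [e\<^sup>2 - f\<^sup>2 * int \<theta> = 1] (mod int p) \<and>
        mat_ord p (e, f * int \<theta>, f, e) = ord x \<and> G \<cong> affine_group p {(e, f * int \<theta>, f, e), (1,0,0,-1)})) \<or>
    (ord x dvd p - 1 \<and> (\<exists>t s. t \<in> {1..<int p} \<and> s \<in> {1..<int p} \<and> [t * s = 1] (mod int p) \<and>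
        Pocklington.ord p (nat t) = ord x \<and> G \<cong> affine_group p {(t, 0, 0, s), (0,1,1,0)})) \<or>
    (ord x = p \<and> G \<cong> affine_group p {(1,1,0,1), (-1,0,0,1)}) \<or>
    (ord x = 2 * p \<and> G \<cong> affine_group p {(1,1,0,1), (-1,0,0,-1), (1,0,0,-1)}) \<or>
    (ord x = p \<and> G \<cong> affine_group p {(1,1,0,1), (-1,0,0,-1)})"
proof -
  have ip: "Factorial_Ring.prime (int p)" using prime_p by simp
  have xG: "x \<in> carrier G" and yG: "y \<in> carrier G" using xH yH H_carrier by auto
  obtain a b c d where x0: "acts x a b c d" using acts_exists[OF xG] by blast
  note I = inverting_matrix[OF xH x0 yH y yy yx xx]
  have x: "acts x a b c a" using acts_cong[OF x0 cong_refl cong_refl cong_refl I(1)] .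
  have sgn: "\<exists>s. (s = 1 \<or> s = -1) \<and> [a = s] (mod int p)" if "int p dvd b \<or> int p dvd c"
  proof -
    have "int p dvd b * c" using that by auto
    then have "int p dvd a * a - b * c - 1 + b * c" using I(2) dvd_add by blast
    then have "int p dvd a * a - 1" by simp
    then show ?thesis using square_one_mod_prime[OF prime_p] by metis
  qed
  consider "\<not> int p dvd b" "\<not> int p dvd c" | "\<not> int p dvd b" "int p dvd c" | "int p dvd b" "\<not> int p dvd c"
    using I(3) by blast
  then show ?thesis
  proof cases
    case 1
    then show ?thesis using semisimple_case[OF oddp \<theta> xH yH H_gen x y I(2) 1] by blast
  next
    case 2
    then obtain s where s: "s = 1 \<or> s = -1" "[a = s] (mod int p)" using sgn by blast
    have x': "acts x s b 0 s" by (rule acts_cong[OF x s(2) cong_refl _ s(2)]) (use 2 in \<open>simp add: cong_0_iff\<close>)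
    \<comment> \<open>Replacing the second basis vector by s b times itself makes the off-diagonal
      entry equal to the diagonal entry s, since s^2 = 1.\<close>
    have D: "\<not> int p dvd 1 * (s * b) - 0 * 0" using 2(1) s(1) by auto
    interpret S: affine_setting G p "vec (1, 0)" "vec (0, s * b)" H by (rule change_setting[OF D])
    have "S.acts x s s 0 s" by (rule change_acts[OF D xG x']) (use s(1) in auto)
    moreover have "S.acts y 1 0 0 (-1)" by (rule change_acts[OF D yG y]) simp_all
    ultimately show ?thesis using S.unipotent_case_plus[OF oddp xH yH H_gen yy yx _ s(1)] by blast
  next
    case 3
    then obtain s where s: "s = 1 \<or> s = -1" "[a = s] (mod int p)" using sgn by blast
    have x': "acts x s 0 c s" by (rule acts_cong[OF x s(2) _ cong_refl s(2)]) (use 3 in \<open>simp add: cong_0_iff\<close>)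
    \<comment> \<open>The basis vectors are exchanged so that x becomes upper triangular; this turns
      y into diag(-1,1).\<close>
    have D: "\<not> int p dvd 0 * 0 - 1 * (s * c)" using 3(2) s(1) by auto
    interpret S: affine_setting G p "vec (0, 1)" "vec (s * c, 0)" H by (rule change_setting[OF D])
    have "S.acts x s s 0 s" by (rule change_acts[OF D xG x']) (use s(1) in auto)
    moreover have "S.acts y (-1) 0 0 1" by (rule change_acts[OF D yG y]) simp_all
    ultimately show ?thesis using S.unipotent_case_minus[OF oddp xH yH H_gen yy yx _ s(1)] by blast
  qed
qed

text \<open>u commutes with v = diag(1,-1), so it is diagonal with entries 1 or -1. As u is neither
  \<one> nor v, its first entry is -1, and u or uv is the scalar -1.\<close>

lemma klein_case:
  assumes oddp: "odd p" and uH: "u \<in> H" and vH: "v \<in> H" and H_gen: "H = generate G {u, v}"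
    and uu: "u \<otimes> u = \<one>" and vv: "v \<otimes> v = \<one>" and uv: "v \<otimes> u \<otimes> inv v = inv u" and ne: "u \<noteq> \<one>" "u \<noteq> v"
    and v: "acts v 1 0 0 (-1)"
  shows "G \<cong> affine_group p {(-1,0,0,-1), (1,0,0,-1)}"
proof -
  have ip: "Factorial_Ring.prime (int p)" using prime_p by simp
  have uG: "u \<in> carrier G" and vG: "v \<in> carrier G" using uH vH H_carrier by auto
  have two: "\<not> int p dvd 2" using p_not_dvd_two[OF oddp] .
  have iu: "inv u = u" using uu uG by (simp add: inv_equality)
  have "v \<otimes> u = v \<otimes> u \<otimes> inv v \<otimes> v" using uG vG by (simp add: m_assoc)
  then have c: "v \<otimes> u = u \<otimes> v" using uv iu by simp
  obtain a b c d where u0: "acts u a b c d" using acts_exists[OF uG] by blast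
  have "[- b = b] (mod int p)" "[c = - c] (mod int p)"
    using acts_mult[OF vG uG v u0] acts_mult[OF uG vG u0 v] c acts_unique by fastforce+
  then have "int p dvd 2 * b" "int p dvd 2 * c" by (simp_all add: cong_iff_dvd_diff)
  then have bc: "int p dvd b" "int p dvd c" using two ip prime_dvd_mult_iff by blast+
  then have u1: "acts u a 0 0 d" by (intro acts_cong[OF u0]) (simp_all add: cong_0_iff)
  have "acts (u \<otimes> u) (a * a) 0 0 (d * d)" using acts_mult[OF uG uG u1 u1] by simp
  then have "int p dvd a * a - 1" "int p dvd d * d - 1"
    using acts_unique[OF _ acts_one] uu unfolding cong_iff_dvd_diff by auto
  then obtain s t where s: "s = 1 \<or> s = -1" "[a = s] (mod int p)" and t: "t = 1 \<or> t = -1" "[d = t] (mod int p)"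
    using square_one_mod_prime[OF prime_p] by metis
  have u2: "acts u s 0 0 t" using acts_cong[OF u1 s(2) cong_refl cong_refl t(2)] .
  have "\<not> (s = 1 \<and> t = 1)" using acts_identity_iff[OF uH u2] ne(1) by auto
  moreover have "\<not> (s = 1 \<and> t = -1)" using acts_eq[OF uH vH] u2 v ne(2) by auto
  ultimately have s1: "s = -1" using s(1) t(1) by blast
  show ?thesis
  proof (cases "t = -1")
    case True
    then show ?thesis using recognize2(1)[OF uH _ vH v H_gen] u2 s1 by simp
  next
    case False
    then have "acts u (-1) 0 0 1" using u2 s1 t(1) by simp
    then have z: "acts (u \<otimes> v) (-1) 0 0 (-1)" using acts_mult[OF uG vG _ v] by fastforce
    have zH: "u \<otimes> v \<in> H" by (rule sub_mult[OF H(1) uH vH])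
    have "H = generate G {u \<otimes> v, v}"
    proof (rule generate_eqI[OF H_gen _ subgroup.subset[OF H(1)]])
      have S: "{u \<otimes> v, v} \<subseteq> carrier G" using uG vG by simp
      have "(u \<otimes> v) \<otimes> v \<in> generate G {u \<otimes> v, v}"
        by (rule sub_mult[OF generate_is_subgroup[OF S]]) (auto intro: generate.incl)
      moreover have "(u \<otimes> v) \<otimes> v = u" using vv uG vG by (simp add: m_assoc)
      ultimately show "u \<in> generate G {u \<otimes> v, v}" by simp
    qed (use zH vH in \<open>auto intro: generate.incl\<close>)
    then show ?thesis using recognize2(1)[OF zH z vH v] by simp
  qed
qed

end

section \<open>From a core-free dihedral-like subgroup to the list of matrix groups\<close>

context fin_group
begin

text \<open>With v^y denoting y v y^-1, the elements w' w'^y and w (w^y)^-1 are a fixed and an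
  inverted vector. They are nontrivial because y neither inverts w' nor fixes w. Applying y to a
  relation between them and using that p is odd gives independence.\<close>

lemma involution_eigenbasis:
  assumes p: "Factorial_Ring.prime p" "odd p" and W: "W \<lhd> G" "card W = p\<^sup>2"
    and ex: "\<And>w. w \<in> W \<Longrightarrow> w [^] p = \<one>" and y: "y \<in> carrier G" "y \<otimes> y = \<one>"
    and nc: "w \<in> W" "y \<otimes> w \<otimes> inv y \<noteq> w" and ni: "w' \<in> W" "y \<otimes> w' \<otimes> inv y \<noteq> inv w'"
  obtains w1 w2 where "plane_basis G p w1 w2" "plane_basis.plane G w1 w2 = W"
    "y \<otimes> w1 \<otimes> inv y = w1" "y \<otimes> w2 \<otimes> inv y = inv w2"
proof -
  have Ws: "subgroup W G" using normal_imp_subgroup[OF W(1)] .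
  have WG: "w \<in> carrier G" if "w \<in> W" for w using sub_mem[OF Ws that] .
  have WC: "v \<otimes> w = w \<otimes> v" if "v \<in> W" "w \<in> W" for v w by (rule comm_prime_square_card[OF p(1) Ws W(2) that])
  have Wy: "y \<otimes> v \<otimes> inv y \<in> W" if "v \<in> W" for v using normal_conj[OF W(1) y(1) that] .
  have iy: "inv y = y" using y by (simp add: inv_equality)
  have yy: "y \<otimes> (y \<otimes> v \<otimes> inv y) \<otimes> inv y = v" if "v \<in> carrier G" for v
  proof -
    have "y \<otimes> (y \<otimes> v \<otimes> inv y) \<otimes> inv y = (y \<otimes> y) \<otimes> v \<otimes> inv (y \<otimes> y)" using that y(1) by (simp add: word_simps)
    then show ?thesis using y(2) that by simp
  qed
  define w1 w2 where "w1 = w' \<otimes> (y \<otimes> w' \<otimes> inv y)" and "w2 = w \<otimes> inv (y \<otimes> w \<otimes> inv y)"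
  have inW: "w1 \<in> W" "w2 \<in> W" unfolding w1_def w2_def
    using nc(1) ni(1) Wy sub_mult[OF Ws] sub_inv[OF Ws] by auto
  have wG: "w \<in> carrier G" "w' \<in> carrier G" "w1 \<in> carrier G" "w2 \<in> carrier G" using WG nc(1) ni(1) inW by auto
  have distr: "y \<otimes> (a \<otimes> b) \<otimes> inv y = (y \<otimes> a \<otimes> inv y) \<otimes> (y \<otimes> b \<otimes> inv y)" if "a \<in> carrier G" "b \<in> carrier G" for a b
    using that y(1) by (simp add: word_simps)
  have inv_conj: "y \<otimes> inv a \<otimes> inv y = inv (y \<otimes> a \<otimes> inv y)" if "a \<in> carrier G" for a
    using that y(1) by (simp add: word_simps)
  have y1: "y \<otimes> w1 \<otimes> inv y = w1"
  proof -
    have "y \<otimes> w1 \<otimes> inv y = (y \<otimes> w' \<otimes> inv y) \<otimes> w'"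
      unfolding w1_def using distr[of w' "y \<otimes> w' \<otimes> inv y"] yy[of w'] wG y(1) by simp
    then show ?thesis unfolding w1_def using WC[OF ni(1) Wy[OF ni(1)]] by simp
  qed
  have y2: "y \<otimes> w2 \<otimes> inv y = inv w2"
  proof -
    have "y \<otimes> w2 \<otimes> inv y = (y \<otimes> w \<otimes> inv y) \<otimes> inv w"
      unfolding w2_def using distr[of w "inv (y \<otimes> w \<otimes> inv y)"] inv_conj[of "y \<otimes> w \<otimes> inv y"] yy[of w] wG y(1) by simp
    moreover have "inv w2 = (y \<otimes> w \<otimes> inv y) \<otimes> inv w"
      unfolding w2_def using wG y(1) by (simp add: inv_mult_group)
    ultimately show ?thesis by simp
  qed
  have n1: "w1 \<noteq> \<one>"
  proof
    assume "w1 = \<one>"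
    then have "(y \<otimes> w' \<otimes> inv y) \<otimes> w' = \<one>" using WC[OF ni(1) Wy[OF ni(1)]] unfolding w1_def by simp
    then have "inv w' = y \<otimes> w' \<otimes> inv y" using wG y(1) by (intro inv_equality) auto
    then show False using ni(2) by simp
  qed
  have n2: "w2 \<noteq> \<one>"
  proof
    assume "w2 = \<one>"
    then have "w \<otimes> inv (y \<otimes> w \<otimes> inv y) \<otimes> (y \<otimes> w \<otimes> inv y) = y \<otimes> w \<otimes> inv y" unfolding w2_def using wG y(1) by simp
    then have "w = y \<otimes> w \<otimes> inv y" using wG y(1) by (simp only: m_assoc[of w] inv_closed m_closed l_inv r_one)
    then show False using nc(2) by simp
  qed
  have o: "ord v = p" if "v \<in> W" "v \<noteq> \<one>" for v
  proof -
    have "ord v dvd p" using ex[OF that(1)] pow_eq_id[OF WG[OF that(1)]] by blast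
    then have "ord v = 1 \<or> ord v = p" using p(1) prime_nat_iff by blast
    then show ?thesis using that ord_eq_1[OF WG[OF that(1)]] by blast
  qed
  have ip: "Factorial_Ring.prime (int p)" using p(1) by simp
  have B: "plane_basis G p w1 w2"
  proof
    fix i j :: int assume e: "w1 [^] i \<otimes> w2 [^] j = \<one>"
    interpret h: group_hom G G "\<lambda>z. y \<otimes> z \<otimes> inv y"
      using y(1) by unfold_locales (auto simp: hom_def word_simps)
    have "w1 [^] i \<otimes> inv (w2 [^] j) = y \<otimes> (w1 [^] i \<otimes> w2 [^] j) \<otimes> inv y"
      using h.hom_int_pow[OF wG(3), of i] h.hom_int_pow[OF wG(4), of j] h.hom_mult[of "w1 [^] i" "w2 [^] j"] wG y1 y2
      by (simp add: int_pow_inv)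
    then have "w1 [^] i \<otimes> inv (w2 [^] j) = \<one>" using e y(1) by simp
    then have a: "w1 [^] i = w2 [^] j" using wG inv_solve_right'[of \<one> "w1 [^] i" "w2 [^] j"] by simp
    have "w2 [^] (j + j) = w2 [^] j \<otimes> w2 [^] j" using int_pow_mult[OF wG(4)] by blast
    then have "w2 [^] (j + j) = \<one>" using e a by simp
    then have "int p dvd j + j" using int_pow_eq_id[OF wG(4)] o[OF inW(2) n2] by simp
    then have "int p dvd 2 * j" by simp
    moreover have "\<not> int p dvd 2"
    proof
      assume "int p dvd 2"
      then have "p dvd 2" by (metis of_nat_dvd_iff of_nat_numeral)
      then have "p = 2" using primes_dvd_imp_eq[OF p(1) two_is_prime_nat] by blast
      then show False using p(2) by simp
    qed
    ultimately have j: "int p dvd j" using ip prime_dvd_mult_iff by blast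
    then have "w2 [^] j = \<one>" using int_pow_eq_id[OF wG(4)] o[OF inW(2) n2] by simp
    then have "int p dvd i" using a int_pow_eq_id[OF wG(3)] o[OF inW(1) n1] by simp
    then show "int p dvd i \<and> int p dvd j" using j by simp
  qed (use p(1) wG WC inW ex in auto)
  interpret B: plane_basis G p w1 w2 by (rule B)
  have "B.plane \<subseteq> W"
  proof
    fix a assume "a \<in> B.plane"
    then obtain v where "a = B.vec v" unfolding B.plane_def by blast
    then have "a = w1 [^] fst v \<otimes> w2 [^] snd v" by (simp add: B.vec_def)
    moreover have "u [^] (i::int) \<in> W" if "u \<in> W" for u i by (rule subgroup_int_pow_closed[OF Ws that])
    ultimately show "a \<in> W" using sub_mult[OF Ws] inW by blast
  qed
  then have "B.plane = W" using card_subset_eq[OF fin_sub[OF Ws]] B.card_plane W(2) by simp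
  then show ?thesis using that[OF B _ y1 y2] by blast
qed

text \<open>An involution of H is diagonalizable on W with eigenvalues 1 and -1 unless it inverts
  all of W, in which case it is central in H. For n \<ge> 3 the reflection y is not central. For n =
  2 at most one of x, y inverts W, and x and y may exchange roles.\<close>

lemma odd_classification:
  assumes p: "Factorial_Ring.prime p" "odd p" and \<theta>: "residue_primroot p \<theta>"
    and dl: "dihedral_like G H C" and H_gen: "H = generate G {x, y}" and x: "x \<in> C" "ord x = n" "n \<ge> 2"
    and y: "y \<in> H" "y \<notin> C"
    and core: "\<And>h. \<lbrakk>h \<in> H; \<And>g. g \<in> carrier G \<Longrightarrow> g \<otimes> h \<otimes> inv g \<in> H\<rbrakk> \<Longrightarrow> h = \<one>"
    and cG: "card (carrier G) = p\<^sup>2 * card H"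
  shows "(n \<ge> 3 \<and> n dvd p + 1 \<and> (\<exists>e f. e \<in> {0..<int p} \<and> f \<in> {0..<int p} \<and> [e\<^sup>2 - f\<^sup>2 * int \<theta> = 1] (mod int p) \<and>
        mat_ord p (e, f * int \<theta>, f, e) = n \<and> G \<cong> affine_group p {(e, f * int \<theta>, f, e), (1,0,0,-1)})) \<or>
    (n \<ge> 3 \<and> n dvd p - 1 \<and> (\<exists>t s. t \<in> {1..<int p} \<and> s \<in> {1..<int p} \<and> [t * s = 1] (mod int p) \<and>
        Pocklington.ord p (nat t) = n \<and> G \<cong> affine_group p {(t, 0, 0, s), (0,1,1,0)})) \<or>
    (n = 2 \<and> G \<cong> affine_group p {(-1,0,0,-1), (1,0,0,-1)}) \<or>
    (n = p \<and> G \<cong> affine_group p {(1,1,0,1), (-1,0,0,1)}) \<or>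
    (n = 2 * p \<and> G \<cong> affine_group p {(1,1,0,1), (-1,0,0,-1), (1,0,0,-1)}) \<or>
    (n = p \<and> G \<cong> affine_group p {(1,1,0,1), (-1,0,0,-1)})"
proof -
  note Hs = dl_sub[OF dl]
  have xH: "x \<in> H" using x(1) Hs(3) by blast
  have xG: "x \<in> carrier G" and yG: "y \<in> carrier G" using sub_mem[OF Hs(1)] xH y(1) by auto
  have yy: "y \<otimes> y = \<one>" using dl_sq[OF dl y] .
  have yx: "y \<otimes> x \<otimes> inv y = inv x" using dl_inverts[OF dl y x(1)] by simp
  have yx': "x \<otimes> y \<otimes> inv x = inv y" if "x \<otimes> x = \<one>"
  proof -
    have iv: "inv x = x" "inv y = y" using that yy xG yG by (simp_all add: inv_equality)
    have "y \<otimes> x = x \<otimes> y" 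
    proof -
      have "y \<otimes> x \<otimes> inv y \<otimes> y = x \<otimes> y" using yx iv by simp
      then show ?thesis using xG yG by (simp add: m_assoc)
    qed
    then have "x \<otimes> y \<otimes> x = y \<otimes> (x \<otimes> x)" using xG yG by (simp flip: m_assoc)
    then show ?thesis using that iv yG by simp
  qed
  have x1: "x \<noteq> \<one>" using x(2,3) ord_eq_1[OF xG] by auto
  obtain W where W: "W \<lhd> G" "card W = p\<^sup>2" "W \<inter> H = {\<one>}"
    using normal_complement_exists[OF p dl y _ cG] core by blast
  have Ws: "subgroup W G" using normal_imp_subgroup[OF W(1)] .
  have WG: "w \<in> carrier G" if "w \<in> W" for w using sub_mem[OF Ws that] .
  note fct = complement_factorization[OF W(1,2) Hs(1) W(3) cG]
  have fth: "h = \<one>" if "h \<in> H" "\<And>w. w \<in> W \<Longrightarrow> h \<otimes> w = w \<otimes> h" for h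
    by (rule complement_faithful[OF W(1,2) Hs(1) W(3) cG _ that(1)]) (use core that(2) in blast)+
  have exw: "w [^] p = \<one>" if "w \<in> W" for w
    by (rule complement_exponent[OF W(1,2) Hs(1) W(3) cG p _ dl y x(1) x1 that]) (rule core)
  have commI: "h \<otimes> w = w \<otimes> h" if "h \<otimes> w \<otimes> inv h = w" "h \<in> carrier G" "w \<in> carrier G" for h w
  proof -
    have "h \<otimes> w \<otimes> inv h \<otimes> h = w \<otimes> h" using that(1) by simp
    then show ?thesis using that(2,3) by (simp add: m_assoc)
  qed
  have setting: "\<exists>w1 w2. affine_setting G p w1 w2 H \<and> affine_setting.acts G w1 w2 r 1 0 0 (-1)"
    if r: "r \<in> H" "r \<otimes> r = \<one>" "r \<noteq> \<one>" and ni: "w' \<in> W" "r \<otimes> w' \<otimes> inv r \<noteq> inv w'" for r w'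
  proof -
    have rG: "r \<in> carrier G" using sub_mem[OF Hs(1) r(1)] .
    have "\<exists>w\<in>W. r \<otimes> w \<otimes> inv r \<noteq> w"
    proof (rule ccontr)
      assume "\<not> (\<exists>w\<in>W. r \<otimes> w \<otimes> inv r \<noteq> w)"
      then have "r = \<one>" using fth[OF r(1)] commI rG WG by blast
      then show False using r(3) by simp
    qed
    then obtain w where w: "w \<in> W" "r \<otimes> w \<otimes> inv r \<noteq> w" by blast
    obtain w1 w2 where b: "plane_basis G p w1 w2" "plane_basis.plane G w1 w2 = W"
      "r \<otimes> w1 \<otimes> inv r = w1" "r \<otimes> w2 \<otimes> inv r = inv w2"
      by (rule involution_eigenbasis[OF p W(1,2) exw rG r(2) w ni])
    have S: "affine_setting G p w1 w2 H"
      by (rule affine_setting.intro[OF b(1)], unfold affine_setting_axioms_def b(2), use W(1,3) Hs(1) fct fth in blast)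
    interpret S: affine_setting G p w1 w2 H by (rule S)
    have "S.acts r 1 0 0 (-1)" using b(3,4) S.basis_carrier by (simp add: S.acts_def S.vec_def int_pow_neg)
    then show ?thesis using S by blast
  qed
  show ?thesis
  proof (cases "n = 2")
    case False
    then have n3: "n \<ge> 3" using x(3) by simp
    have xx: "x \<otimes> x \<noteq> \<one>"
    proof
      assume "x \<otimes> x = \<one>"
      then have "x [^] (2::nat) = \<one>" using xG by (simp add: numeral_2_eq_2)
      then have "n dvd 2" using pow_eq_id[OF xG] x(2) by blast
      then show False using n3 by (auto dest: dvd_imp_le)
    qed
    have "\<exists>w\<in>W. y \<otimes> w \<otimes> inv y \<noteq> inv w"
    proof (rule ccontr)
      assume "\<not> (\<exists>w\<in>W. y \<otimes> w \<otimes> inv y \<noteq> inv w)"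
      then have I: "y \<otimes> w \<otimes> inv y = inv w" if "w \<in> W" for w using that by blast
      \<comment> \<open>If y acted as -1 on W, it would commute with the action of x. But y turns x
        into x^-1, so x and x^-1 act alike and x^2 centralizes W.\<close>
      have "x \<otimes> x = \<one>"
      proof (rule fth)
        show "x \<otimes> x \<in> H" using sub_mult[OF Hs(1) xH xH] .
        fix w assume w: "w \<in> W"
        define v where "v = inv x \<otimes> w \<otimes> x"
        have v: "v \<in> W" "v \<in> carrier G" using normal_conj[OF W(1) inv_closed[OF xG] w] WG xG by (auto simp: v_def)
        have wv: "w = x \<otimes> v \<otimes> inv x" using xG WG[OF w] by (simp add: v_def word_simps)
        have "inv w = y \<otimes> (x \<otimes> v \<otimes> inv x) \<otimes> inv y" using I[OF w] wv by simp
        also have "\<dots> = (y \<otimes> x \<otimes> inv y) \<otimes> (y \<otimes> v \<otimes> inv y) \<otimes> inv (y \<otimes> x \<otimes> inv y)"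
          using xG yG v by (simp add: word_simps)
        also have "\<dots> = inv x \<otimes> inv v \<otimes> inv (inv x)" unfolding yx I[OF v(1)] ..
        also have "\<dots> = inv (inv x \<otimes> v \<otimes> x)" using xG v by (simp add: word_simps)
        finally have "w = inv x \<otimes> v \<otimes> x" using xG v WG[OF w] inv_inj by (metis inv_closed inv_inv m_closed)
        then have "x \<otimes> x \<otimes> w = x \<otimes> v \<otimes> x" using xG v by (simp add: word_simps)
        also have "\<dots> = w \<otimes> (x \<otimes> x)" unfolding wv using xG v by (simp add: word_simps)
        finally show "x \<otimes> x \<otimes> w = w \<otimes> (x \<otimes> x)" .
      qed
      then show False using xx by simp
    qed
    then obtain w1 w2 where w: "affine_setting G p w1 w2 H" "affine_setting.acts G w1 w2 y 1 0 0 (-1)"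
      using setting[OF y(1) yy] y(2) sub_one[OF Hs(2)] by metis
    have "ord x = p \<longrightarrow> n = p" using x(2) by simp
    then show ?thesis using affine_setting.dihedral_case[OF w(1) p(2) \<theta> xH y(1) H_gen yy yx xx w(2)] n3 unfolding x(2) by blast
  next
    case True
    have "x [^] (2::nat) = \<one>" using pow_ord_eq_1[OF xG] x(2) True by simp
    then have xx: "x \<otimes> x = \<one>" using xG by (simp add: numeral_2_eq_2)
    have ne: "y \<noteq> \<one>" "x \<noteq> y" "y \<noteq> x" using y(2) x(1) sub_one[OF Hs(2)] by auto
    have H_gen': "H = generate G {y, x}" using H_gen by (simp add: insert_commute)
    show ?thesis
    proof (cases "\<exists>w'\<in>W. y \<otimes> w' \<otimes> inv y \<noteq> inv w'")
      case True
      then obtain w1 w2 where w: "affine_setting G p w1 w2 H" "affine_setting.acts G w1 w2 y 1 0 0 (-1)"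
        using setting[OF y(1) yy ne(1)] by blast
      show ?thesis using affine_setting.klein_case[OF w(1) p(2) xH y(1) H_gen xx yy yx x1 ne(2) w(2)] \<open>n = 2\<close> by blast
    next
      case False
      \<comment> \<open>If x also inverted W, then xy would act trivially, and faithfulness would
        give x = y.\<close>
      have "\<exists>w'\<in>W. x \<otimes> w' \<otimes> inv x \<noteq> inv w'"
      proof (rule ccontr)
        assume "\<not> (\<exists>w'\<in>W. x \<otimes> w' \<otimes> inv x \<noteq> inv w')"
        then have I: "x \<otimes> w \<otimes> inv x = inv w" "y \<otimes> w \<otimes> inv y = inv w" if "w \<in> W" for w using that False by blast+
        have iy: "inv y = y" using yy yG by (simp add: inv_equality)
        have "x \<otimes> y = \<one>"
        proof (rule fth)
          show "x \<otimes> y \<in> H" using sub_mult[OF Hs(1) xH y(1)] .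
          fix w assume w: "w \<in> W"
          have "x \<otimes> y \<otimes> w \<otimes> inv (x \<otimes> y) = x \<otimes> (y \<otimes> w \<otimes> inv y) \<otimes> inv x" using xG yG WG[OF w] by (simp add: word_simps)
          also have "\<dots> = w" using I w sub_inv[OF Ws w] WG[OF w] by simp
          finally show "x \<otimes> y \<otimes> w = w \<otimes> (x \<otimes> y)" by (rule commI) (use xG yG WG[OF w] in auto)
        qed
        then have "inv y = x" using xG yG by (simp add: inv_equality)
        then show False using iy ne(2) by simp
      qed
      then obtain w1 w2 where w: "affine_setting G p w1 w2 H" "affine_setting.acts G w1 w2 x 1 0 0 (-1)"
        using setting[OF xH xx x1] by blast
      show ?thesis using affine_setting.klein_case[OF w(1) p(2) y(1) xH H_gen' yy xx yx'[OF xx] ne(1,3) w(2)] \<open>n = 2\<close> by blast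
    qed
  qed
qed

end

section \<open>Permutation groups, and the case p = 2\<close>

lemma Bij_eq_inj:
  assumes S: "finite S"
  shows "Bij S = {f \<in> S \<rightarrow>\<^sub>E S. inj_on f S}"
proof (intro equalityI subsetI)
  fix f
  show "f \<in> {f \<in> S \<rightarrow>\<^sub>E S. inj_on f S}" if "f \<in> Bij S"
    using that by (auto simp: Bij_def bij_betw_def PiE_def)
  assume "f \<in> {f \<in> S \<rightarrow>\<^sub>E S. inj_on f S}"
  then have f: "f ` S \<subseteq> S" "inj_on f S" "f \<in> extensional S" by (auto simp: PiE_def)
  then show "f \<in> Bij S" using endo_inj_surj[OF S f(1,2)] by (simp add: Bij_def bij_betw_def)
qed

text \<open>4! = 24, from the count of extensional injections.\<close>

lemma card_Bij_four:
  assumes "finite S" "card S = 4"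
  shows "card (Bij S) = 24"
proof -
  have "{0..<4::nat} = {0, 1, 2, 3}" by auto
  then show ?thesis unfolding Bij_eq_inj[OF assms(1)]
    using card_inj_on_subset_funcset[OF assms(1) assms(1) order.refl] assms(2) by simp
qed

lemma fin_group_BijGroup: "finite S \<Longrightarrow> fin_group (BijGroup S)"
  unfolding fin_group_def fin_group_axioms_def
  by (simp add: group_BijGroup) (simp add: BijGroup_def Bij_eq_inj finite_PiE)

lemma permutation_action:
  assumes "finite S" "subgroup A (BijGroup S)"
  shows "fin_action ((BijGroup S)\<lparr>carrier := A\<rparr>) S (\<lambda>g. g)"
proof -
  interpret B: fin_group "BijGroup S" by (rule fin_group_BijGroup[OF assms(1)])
  interpret A: fin_group "(BijGroup S)\<lparr>carrier := A\<rparr>" by (rule B.fin_group_sub[OF assms(2)])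
  have Bij: "g \<in> Bij S" if "g \<in> A" for g using B.sub_mem[OF assms(2) that] by (simp add: BijGroup_def)
  show ?thesis
  proof
    show "g x \<in> S" if "g \<in> carrier ((BijGroup S)\<lparr>carrier := A\<rparr>)" "x \<in> S" for g x
      using Bij_imp_funcset[OF Bij] that by auto
    show "(g \<otimes>\<^bsub>(BijGroup S)\<lparr>carrier := A\<rparr>\<^esub> h) x = g (h x)"
      if "g \<in> carrier ((BijGroup S)\<lparr>carrier := A\<rparr>)" "h \<in> carrier ((BijGroup S)\<lparr>carrier := A\<rparr>)" "x \<in> S" for g h x
      using that Bij by (simp add: BijGroup_def compose_def)
  qed (simp_all add: assms(1) BijGroup_def)
qed

lemma permutation_eqI:
  assumes "subgroup A (BijGroup S)" "f \<in> A" "g \<in> A" "\<And>v. v \<in> S \<Longrightarrow> f v = g v"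
  shows "f = g"
proof -
  have "A \<subseteq> Bij S" using subgroup.subset[OF assms(1)] by (simp add: BijGroup_def)
  then have "f \<in> Bij S" "g \<in> Bij S" using assms(2,3) by auto
  then show ?thesis using assms(4) by (intro extensionalityI[of f S g] Bij_imp_extensional) auto
qed

text \<open>If every conjugate of h fixes x, then h fixes every point of the orbit of x, which is
  everything; faithfulness gives h = \<one>.\<close>

lemma (in fin_action) transitive_core:
  assumes "x \<in> E" "orbit x = E"
    and faithful: "\<And>g. \<lbrakk>g \<in> carrier G; \<And>v. v \<in> E \<Longrightarrow> act g v = v\<rbrakk> \<Longrightarrow> g = \<one>"
    and h: "h \<in> stab x" "\<And>g. g \<in> carrier G \<Longrightarrow> g \<otimes> h \<otimes> inv g \<in> stab x"
  shows "h = \<one>"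
proof (rule faithful)
  show hG: "h \<in> carrier G" using h(1) by (simp add: stab_def)
  fix v assume "v \<in> E"
  then obtain g where g: "g \<in> carrier G" "v = act g x" using assms(2) by (auto simp: orbit_def)
  have "g \<otimes> (inv g \<otimes> h \<otimes> inv (inv g)) \<otimes> inv g \<in> stab (act g x)"
    by (rule stab_conj_mem[OF assms(1) g(1) h(2)]) (use g(1) in simp)
  moreover have "g \<otimes> (inv g \<otimes> h \<otimes> inv (inv g)) \<otimes> inv g = h" using g(1) hG by (simp add: word_simps)
  ultimately show "act h v = v" using g(2) by (simp add: stab_def)
qed

lemma (in fin_group) prime_order_dvd_card:
  assumes "Factorial_Ring.prime q" "subgroup A G" "x \<in> A" "x [^] q = \<one>" "x \<noteq> \<one>"
  shows "q dvd card A"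
proof -
  have xG: "x \<in> carrier G" using sub_mem[OF assms(2,3)] .
  have "ord x dvd q" using pow_eq_id[OF xG] assms(4) by blast
  then have "ord x = q" using assms(1,5) ord_eq_1[OF xG] prime_nat_iff by blast
  then show ?thesis using ord_dvd_sub[OF assms(2,3)] by simp
qed

lemma (in group) small_pow:
  assumes "x \<in> carrier G"
  shows "x [^] (2::nat) = x \<otimes> x" "x [^] (3::nat) = x \<otimes> x \<otimes> x"
  using assms by (simp_all add: numeral_2_eq_2 numeral_3_eq_3)

lemma dihedral_mult: "(a, b) \<otimes>\<^bsub>dihedral n\<^esub> (c, d) = ((a + (if b then - c else c)) mod int n, b \<noteq> d)"
  by (simp add: dihedral_def)

text \<open>The cyclic part consists of the elements mapped to pairs (k, False); x and y are the
  preimages of the rotation (1, False) and the reflection (0, True).\<close>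

lemma (in fin_group) dihedral_structure:
  assumes n: "n \<ge> 2" and H: "subgroup H G" and iso: "\<phi> \<in> iso (G\<lparr>carrier := H\<rparr>) (dihedral n)"
  obtains C x y where "dihedral_like G H C" "H = generate G {x, y}" "x \<in> C" "ord x = n"
    "y \<in> H" "y \<notin> C" "card H = 2 * n"
proof -
  have HG: "h \<in> carrier G" if "h \<in> H" for h using sub_mem[OF H that] .
  have bij: "bij_betw \<phi> H ({0..<int n} \<times> UNIV)" using iso by (simp add: iso_def dihedral_def)
  have mult: "\<phi> (a \<otimes> b) = \<phi> a \<otimes>\<^bsub>dihedral n\<^esub> \<phi> b" if "a \<in> H" "b \<in> H" for a b
    using iso that by (simp add: iso_def hom_def)
  have inj: "a = b" if "\<phi> a = \<phi> b" "a \<in> H" "b \<in> H" for a b using bij that by (auto simp: bij_betw_def dest: inj_onD)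
  have surj: "\<exists>h\<in>H. \<phi> h = v" if "v \<in> {0..<int n} \<times> UNIV" for v using bij that unfolding bij_betw_def by (metis imageE)
  have rng: "fst (\<phi> h) \<in> {0..<int n}" if "h \<in> H" for h using bij_betwE[OF bij] that by (metis mem_Times_iff)
  \<comment> \<open>The neutral element is located as an idempotent. This uses only that \<phi> is
    multiplicative and injective, and no group structure on \<open>dihedral n\<close>.\<close>
  obtain e where e: "e \<in> H" "\<phi> e = (0, False)" using surj[of "(0, False)"] n by auto
  have "\<phi> (e \<otimes> e) = \<phi> e" by (simp add: mult[OF e(1) e(1)] e(2) dihedral_mult)
  then have "e \<otimes> e = e" using inj sub_mult[OF H e(1) e(1)] e(1) by blast
  then have "e = \<one>" using HG[OF e(1)] by simp
  then have \<phi>1: "\<phi> \<one> = (0, False)" using e(2) by simp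
  obtain x where x: "x \<in> H" "\<phi> x = (1, False)" using surj[of "(1, False)"] n by auto
  obtain y where y: "y \<in> H" "\<phi> y = (0, True)" using surj[of "(0, True)"] n by auto
  have xG: "x \<in> carrier G" and yG: "y \<in> carrier G" using HG x(1) y(1) by auto
  have xk: "x [^] k \<in> H" "\<phi> (x [^] k) = (int k mod int n, False)" for k :: nat
  proof -
    show "x [^] k \<in> H" for k :: nat by (rule pow_sub[OF H x(1)])
    then show "\<phi> (x [^] k) = (int k mod int n, False)"
    proof (induction k)
      case 0 then show ?case using \<phi>1 by simp
    next
      case (Suc k)
      then show ?case using mult[OF _ x(1)] by (simp add: x(2) dihedral_mult mod_add_left_eq mod_add_right_eq add.commute)
    qed
  qed
  define C where "C = {h \<in> H. \<not> snd (\<phi> h)}"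
  have Cx: "h = x [^] nat (fst (\<phi> h))" if "h \<in> C" for h
  proof (rule inj)
    show "\<phi> h = \<phi> (x [^] nat (fst (\<phi> h)))"
      unfolding xk(2) using that rng[of h] by (simp add: C_def prod_eq_iff)
  qed (use that xk(1) in \<open>auto simp: C_def\<close>)
  have snd_mult: "snd (\<phi> (a \<otimes> b)) = (snd (\<phi> a) \<noteq> snd (\<phi> b))" if "a \<in> H" "b \<in> H" for a b
    using mult[OF that] by (cases "\<phi> a"; cases "\<phi> b") (simp add: dihedral_mult)
  have Cs: "subgroup C G"
    by (rule subgroup_finI) (use HG sub_mult[OF H] sub_one[OF H] \<phi>1 snd_mult in \<open>auto simp: C_def\<close>)
  have xC: "x \<in> C" using x by (simp add: C_def)
  have yC: "y \<notin> C" using y by (simp add: C_def)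
  have dl: "dihedral_like G H C"
    unfolding dihedral_like_def
  proof (intro conjI ballI)
    show "\<exists>c\<in>C. \<forall>z\<in>C. \<exists>k::nat. z = c [^] k" using Cx xC by blast
    show "h \<otimes> h = \<one>" if "h \<in> H - C" for h
    proof (rule inj)
      have "\<phi> h = (fst (\<phi> h), True)" using that by (simp add: C_def prod_eq_iff)
      then obtain k where "\<phi> h = (k, True)" by blast
      then show "\<phi> (h \<otimes> h) = \<phi> \<one>" using that mult[of h h] \<phi>1 by (simp add: dihedral_mult)
    qed (use that sub_mult[OF H] sub_one[OF H] in auto)
    show "h \<otimes> k \<in> C" if "h \<in> H - C" "k \<in> H - C" for h k
      using that snd_mult[of h k] sub_mult[OF H, of h k] by (auto simp: C_def)
  qed (use H Cs in \<open>auto simp: C_def\<close>)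
  have ox: "ord x = n"
  proof -
    have "(x [^] k = \<one>) = (n dvd k)" for k :: nat
    proof -
      have "(x [^] k = \<one>) = (\<phi> (x [^] k) = \<phi> \<one>)" using inj[OF _ xk(1) sub_one[OF H]] by auto
      also have "\<dots> = (int n dvd int k)" unfolding xk(2) \<phi>1 by (simp add: dvd_eq_mod_eq_0 zmod_int[symmetric])
      finally show ?thesis by simp
    qed
    then show ?thesis using ord_unique[OF xG] by blast
  qed
  have gen: "H = generate G {x, y}"
  proof
    have S: "{x, y} \<subseteq> carrier G" using xG yG by simp
    note gs = generate_is_subgroup[OF S]
    have xy: "x \<in> generate G {x, y}" "y \<in> generate G {x, y}" by (auto intro: generate.incl)
    have CS: "C \<subseteq> generate G {x, y}"
    proof
      fix h assume "h \<in> C"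
      then have "h = x [^] nat (fst (\<phi> h))" by (rule Cx)
      also have "\<dots> \<in> generate G {x, y}" by (rule pow_sub[OF gs xy(1)])
      finally show "h \<in> generate G {x, y}" .
    qed
    show "H \<subseteq> generate G {x, y}"
    proof
      fix h assume h: "h \<in> H"
      show "h \<in> generate G {x, y}"
      proof (cases "h \<in> C")
        case False
        have "h \<otimes> y \<in> C" using snd_mult[OF h y(1)] False h y sub_mult[OF H h y(1)] by (simp add: C_def)
        then have "h \<otimes> y \<otimes> inv y \<in> generate G {x, y}" using CS sub_mult[OF gs] sub_inv[OF gs] xy(2) by blast
        then show ?thesis using HG[OF h] yG by (simp add: m_assoc)
      qed (use CS in blast)
    qed
    show "generate G {x, y} \<subseteq> H" by (rule generate_subgroup_incl[OF _ H]) (use x y in auto)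
  qed
  have "card H = 2 * n" using bij_betw_same_card[OF bij] by (simp add: card_cartesian_product)
  then show ?thesis using that[OF dl gen xC ox y(1) yC] by blast
qed

text \<open>Conjugation by the bijection h, restricted to T in order to stay extensional.\<close>

lemma BijGroup_iso:
  assumes h: "bij_betw h S T"
  shows "BijGroup S \<cong> BijGroup T"
proof -
  define k where "k = inv_into S h"
  have k: "bij_betw k T S" unfolding k_def by (rule bij_betw_inv_into[OF h])
  have kh: "k (h x) = x" if "x \<in> S" for x unfolding k_def using bij_betw_inv_into_left[OF h that] .
  have hk: "h (k y) = y" if "y \<in> T" for y unfolding k_def using bij_betw_inv_into_right[OF h that] .
  have hS: "h x \<in> T" if "x \<in> S" for x using bij_betwE[OF h] that by blast
  have kT: "k y \<in> S" if "y \<in> T" for y using bij_betwE[OF k] that by blast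
  have mem: "(\<lambda>y\<in>B. u (f (v y))) \<in> Bij B" if "bij_betw u A B" "bij_betw v B A" "f \<in> Bij A"
    for A B u f v
  proof -
    have "bij_betw (u \<circ> (f \<circ> v)) B B"
      using that by (intro bij_betw_trans[of _ B A] bij_betw_trans[of v B A]) (auto simp: Bij_def)
    then show ?thesis by (auto simp: Bij_def cong: bij_betw_cong)
  qed
  have val: "f x \<in> A" if "f \<in> Bij A" "x \<in> A" for f x A using Bij_imp_funcset[OF that(1)] that(2) by auto
  define \<Phi> where "\<Phi> f = (\<lambda>y\<in>T. h (f (k y)))" for f
  define \<Psi> where "\<Psi> f = (\<lambda>x\<in>S. k (f (h x)))" for f
  have \<Phi>: "\<Phi> f \<in> Bij T" if "f \<in> Bij S" for f unfolding \<Phi>_def by (rule mem[OF h k that])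
  have \<Psi>: "\<Psi> f \<in> Bij S" if "f \<in> Bij T" for f unfolding \<Psi>_def by (rule mem[OF k h that])
  have "\<Phi> \<in> iso (BijGroup S) (BijGroup T)"
  proof (rule isoI)
    show "\<Phi> \<in> hom (BijGroup S) (BijGroup T)"
    proof (rule homI)
      show "\<Phi> f \<in> carrier (BijGroup T)" if "f \<in> carrier (BijGroup S)" for f
        using that \<Phi> by (simp add: BijGroup_def)
      show "\<Phi> (f \<otimes>\<^bsub>BijGroup S\<^esub> g) = \<Phi> f \<otimes>\<^bsub>BijGroup T\<^esub> \<Phi> g"
        if "f \<in> carrier (BijGroup S)" "g \<in> carrier (BijGroup S)" for f g
      proof -
        have fg: "f \<in> Bij S" "g \<in> Bij S" using that by (simp_all add: BijGroup_def)
        have v: "g (k y) \<in> S" if "y \<in> T" for y using val[OF fg(2) kT[OF that]] .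
        have "\<Phi> (compose S f g) = compose T (\<Phi> f) (\<Phi> g)"
          by (rule extensionalityI[of _ T]) (simp_all add: \<Phi>_def compose_def kT hS[OF v] kh[OF v])
        then show ?thesis using fg \<Phi> by (simp add: BijGroup_def)
      qed
    qed
    have 1: "\<Psi> (\<Phi> f) = f" if "f \<in> Bij S" for f
      by (rule extensionalityI[of _ S]) (use that Bij_imp_extensional[OF that] kh hS val[OF that] in \<open>auto simp: \<Phi>_def \<Psi>_def\<close>)
    have 2: "\<Phi> (\<Psi> f) = f" if "f \<in> Bij T" for f
      by (rule extensionalityI[of _ T]) (use that Bij_imp_extensional[OF that] hk kT val[OF that] in \<open>auto simp: \<Phi>_def \<Psi>_def\<close>)
    show "bij_betw \<Phi> (carrier (BijGroup S)) (carrier (BijGroup T))"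
      by (rule bij_betwI[where g = \<Psi>]) (use \<Phi> \<Psi> 1 2 in \<open>auto simp: BijGroup_def\<close>)
  qed
  then show ?thesis by (auto simp: is_iso_def)
qed

text \<open>The translations are transitive on the four points, and the stabilizer of the origin
  contains the two matrices, of orders 3 and 2. So the group has order at least 24 and is the full
  symmetric group.\<close>

lemma affine_group_two: "affine_group 2 {(1,1,1,0), (0,1,1,0)} = BijGroup (Vp 2)"
proof -
  have I2: "{0..<2::int} = {0, 1}" by auto
  have V: "Vp 2 = {(0,0), (0,1), (1,0), (1,1)}" by (auto simp: Vp_def I2)
  have finV: "finite (Vp 2)" and cV: "card (Vp 2) = 4" by (simp_all add: V)
  have Bij: "permV 2 f \<in> carrier (BijGroup (Vp 2))" if "f \<in> Vp 2 \<rightarrow> Vp 2" "inj_on f (Vp 2)" for f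
    using that by (auto simp: BijGroup_def Bij_eq_inj[OF finV] permV_def)
  define D where "D = (\<lambda>a. permV 2 (transl 2 a)) ` Vp 2 \<union> (\<lambda>M. permV 2 (mat_act 2 M)) ` {(1,1,1,0), (0,1,1,0)}"
  have DB: "D \<subseteq> carrier (BijGroup (Vp 2))"
  proof -
    have "permV 2 (transl 2 a) \<in> carrier (BijGroup (Vp 2))" if "a \<in> Vp 2" for a
      by (rule Bij) (use that in \<open>auto simp: V transl_def inj_on_def\<close>)
    moreover have "permV 2 (mat_act 2 (1,1,1,0)) \<in> carrier (BijGroup (Vp 2))"
      "permV 2 (mat_act 2 (0,1,1,0)) \<in> carrier (BijGroup (Vp 2))"
      by (rule Bij; auto simp: V mat_act_def inj_on_def)+
    ultimately show ?thesis by (auto simp: D_def)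
  qed
  interpret B: fin_group "BijGroup (Vp 2)" by (rule fin_group_BijGroup[OF finV])
  define A where "A = generate (BijGroup (Vp 2)) D"
  have A: "subgroup A (BijGroup (Vp 2))" unfolding A_def by (rule B.generate_is_subgroup[OF DB])
  have DA: "f \<in> A" if "f \<in> D" for f unfolding A_def by (rule generate.incl[OF that])
  interpret A: fin_action "(BijGroup (Vp 2))\<lparr>carrier := A\<rparr>" "Vp 2" "\<lambda>g. g" by (rule permutation_action[OF finV A])
  have z: "(0, 0) \<in> Vp 2" by (simp add: V)
  have orb: "A.orbit (0, 0) = Vp 2"
  proof
    show "A.orbit (0, 0) \<subseteq> Vp 2" unfolding A.orbit_def using A.act_closed z by blast
    show "Vp 2 \<subseteq> A.orbit (0, 0)"
    proof
      fix a assume a: "a \<in> Vp 2"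
      have "permV 2 (transl 2 a) \<in> A" by (rule DA) (use a in \<open>simp add: D_def\<close>)
      moreover have "a = permV 2 (transl 2 a) (0, 0)" using a z by (auto simp: permV_def transl_def V)
      ultimately show "a \<in> A.orbit (0, 0)" unfolding A.orbit_def by auto
    qed
  qed
  define f g where "f = permV 2 (mat_act 2 (1,1,1,0))" and "g = permV 2 (mat_act 2 (0,1,1,0))"
  have fA: "f \<in> A" and gA: "g \<in> A" unfolding f_def g_def by (rule DA; simp add: D_def)+
  have fv: "f v = mat_act 2 (1,1,1,0) v" and gv: "g v = mat_act 2 (0,1,1,0) v" if "v \<in> Vp 2" for v
    using that by (simp_all add: f_def g_def permV_def)
  have fV: "f v \<in> Vp 2" and gV: "g v \<in> Vp 2" if "v \<in> Vp 2" for v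
    using A.act_closed[of f v] A.act_closed[of g v] fA gA that by simp_all
  have cf: "f \<in> carrier ((BijGroup (Vp 2))\<lparr>carrier := A\<rparr>)" and cg: "g \<in> carrier ((BijGroup (Vp 2))\<lparr>carrier := A\<rparr>)"
    using fA gA by simp_all
  have mem: "h \<in> A" if "h \<in> carrier ((BijGroup (Vp 2))\<lparr>carrier := A\<rparr>)" for h using that by simp
  have f3: "f [^]\<^bsub>(BijGroup (Vp 2))\<lparr>carrier := A\<rparr>\<^esub> (3::nat) = \<one>\<^bsub>(BijGroup (Vp 2))\<lparr>carrier := A\<rparr>\<^esub>"
    unfolding A.small_pow(2)[OF cf]
  proof (rule permutation_eqI[OF A mem mem])
    fix v assume v: "v \<in> Vp 2"
    have "(f \<otimes>\<^bsub>(BijGroup (Vp 2))\<lparr>carrier := A\<rparr>\<^esub> f \<otimes>\<^bsub>(BijGroup (Vp 2))\<lparr>carrier := A\<rparr>\<^esub> f) v = f (f (f v))"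
      unfolding A.act_mult[OF A.m_closed[OF cf cf] cf v] A.act_mult[OF cf cf fV[OF v]] ..
    also have "\<dots> = mat_act 2 (1,1,1,0) (mat_act 2 (1,1,1,0) (mat_act 2 (1,1,1,0) v))"
      using fv[OF fV[OF fV[OF v]]] fv[OF fV[OF v]] fv[OF v] by simp
    also have "\<dots> = v" using v by (auto simp: V mat_act_def)
    finally show "(f \<otimes>\<^bsub>(BijGroup (Vp 2))\<lparr>carrier := A\<rparr>\<^esub> f \<otimes>\<^bsub>(BijGroup (Vp 2))\<lparr>carrier := A\<rparr>\<^esub> f) v = \<one>\<^bsub>(BijGroup (Vp 2))\<lparr>carrier := A\<rparr>\<^esub> v"
      unfolding A.act_one[OF v] .
  qed (intro A.m_closed A.one_closed cf)+
  have g2: "g [^]\<^bsub>(BijGroup (Vp 2))\<lparr>carrier := A\<rparr>\<^esub> (2::nat) = \<one>\<^bsub>(BijGroup (Vp 2))\<lparr>carrier := A\<rparr>\<^esub>"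
    unfolding A.small_pow(1)[OF cg]
  proof (rule permutation_eqI[OF A mem mem])
    fix v assume v: "v \<in> Vp 2"
    have "(g \<otimes>\<^bsub>(BijGroup (Vp 2))\<lparr>carrier := A\<rparr>\<^esub> g) v = g (g v)"
      unfolding A.act_mult[OF cg cg v] ..
    also have "\<dots> = mat_act 2 (0,1,1,0) (mat_act 2 (0,1,1,0) v)"
      using gv[OF gV[OF v]] gv[OF v] by simp
    also have "\<dots> = v" using v by (auto simp: V mat_act_def)
    finally show "(g \<otimes>\<^bsub>(BijGroup (Vp 2))\<lparr>carrier := A\<rparr>\<^esub> g) v = \<one>\<^bsub>(BijGroup (Vp 2))\<lparr>carrier := A\<rparr>\<^esub> v"
      unfolding A.act_one[OF v] .
  qed (intro A.m_closed A.one_closed cg)+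
  have v1: "(1, 0) \<in> Vp 2" by (simp add: V)
  have ne: "f \<noteq> \<one>\<^bsub>(BijGroup (Vp 2))\<lparr>carrier := A\<rparr>\<^esub>" "g \<noteq> \<one>\<^bsub>(BijGroup (Vp 2))\<lparr>carrier := A\<rparr>\<^esub>"
  proof -
    have "f (1, 0) \<noteq> (1, 0)" "g (1, 0) \<noteq> (1, 0)" unfolding fv[OF v1] gv[OF v1] by (simp_all add: mat_act_def)
    then show "f \<noteq> \<one>\<^bsub>(BijGroup (Vp 2))\<lparr>carrier := A\<rparr>\<^esub>" "g \<noteq> \<one>\<^bsub>(BijGroup (Vp 2))\<lparr>carrier := A\<rparr>\<^esub>"
      using A.act_one[OF v1] by metis+
  qed
  have fg: "f \<in> A.stab (0, 0)" "g \<in> A.stab (0, 0)"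
    using fA gA fv[OF z] gv[OF z] by (simp_all add: A.stab_def mat_act_def)
  have "3 dvd card (A.stab (0, 0))" "2 dvd card (A.stab (0, 0))"
    by (rule A.prime_order_dvd_card[OF _ A.stab_sub[OF z] fg(1) f3 ne(1)], simp)
      (rule A.prime_order_dvd_card[OF _ A.stab_sub[OF z] fg(2) g2 ne(2)], simp)
  moreover have "6 dvd k" if "3 dvd k" "2 dvd k" for k :: nat using that by presburger
  ultimately have "6 dvd card (A.stab (0, 0))" by blast
  moreover have "card (A.stab (0, 0)) > 0" using A.card_sub_pos[OF A.stab_sub[OF z]] .
  ultimately have "6 \<le> card (A.stab (0, 0))" by (simp add: dvd_imp_le)
  then have c: "24 \<le> card A" using A.orbit_stab[OF z] by (simp add: orb cV)
  have "A = Bij (Vp 2)"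
  proof (rule card_seteq)
    show "finite (Bij (Vp 2))" using B.fin by (simp add: BijGroup_def)
    show "A \<subseteq> Bij (Vp 2)" using subgroup.subset[OF A] by (simp add: BijGroup_def)
    show "card (Bij (Vp 2)) \<le> card A" using c card_Bij_four[OF finV cV] by simp
  qed
  then show ?thesis unfolding affine_group_def D_def[symmetric] A_def[symmetric] by (simp add: BijGroup_def)
qed

theorem mainTheorem7:
  fixes p n \<theta> :: nat and \<Omega> :: "'a set" and G :: "('a \<Rightarrow> 'a) set"
  assumes "Factorial_Ring.prime p"
    and "residue_primroot p \<theta>"
    and "finite \<Omega>" and "card \<Omega> = p ^ 2"
    and "subgroup G (BijGroup \<Omega>)"
    and "transitive_on \<Omega> G"
    and "n \<ge> 2"
    and "\<forall>\<omega>\<in>\<Omega>. stabilizer \<Omega> G \<omega> \<cong> dihedral n"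
  shows
    "(p = 2 \<and> n = 3 \<and>
        (BijGroup \<Omega>)\<lparr>carrier := G\<rparr> \<cong> affine_group p {(1,1,1,0), (0,1,1,0)})
   \<or> (p \<ge> 3 \<and> n dvd (p + 1) \<and> n \<ge> 3 \<and>
        (\<exists>e f. e \<in> {0..<int p} \<and> f \<in> {0..<int p} \<and>
           [e^2 - f^2 * int \<theta> = 1] (mod int p) \<and>
           mat_ord p (e, f * int \<theta>, f, e) = n \<and>
           (BijGroup \<Omega>)\<lparr>carrier := G\<rparr> \<cong> affine_group p {(e, f * int \<theta>, f, e), (1,0,0,-1)}))
   \<or> (p \<ge> 3 \<and> n dvd (p - 1) \<and> n \<ge> 3 \<and>
        (\<exists>t s. t \<in> {1..<int p} \<and> s \<in> {1..<int p} \<and> [t * s = 1] (mod int p) \<and>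
           ord p (nat t) = n \<and>
           (BijGroup \<Omega>)\<lparr>carrier := G\<rparr> \<cong> affine_group p {(t, 0, 0, s), (0,1,1,0)}))
   \<or> (p \<ge> 3 \<and> n = 2 \<and>
        (BijGroup \<Omega>)\<lparr>carrier := G\<rparr> \<cong> affine_group p {(-1,0,0,-1), (1,0,0,-1)})
   \<or> (p \<ge> 3 \<and> n = p \<and>
        (BijGroup \<Omega>)\<lparr>carrier := G\<rparr> \<cong> affine_group p {(1,1,0,1), (-1,0,0,1)})
   \<or> (p \<ge> 3 \<and> n = 2 * p \<and>
        (BijGroup \<Omega>)\<lparr>carrier := G\<rparr> \<cong> affine_group p {(1,1,0,1), (-1,0,0,-1), (1,0,0,-1)})
   \<or> (p \<ge> 3 \<and> n = p \<and>
        (BijGroup \<Omega>)\<lparr>carrier := G\<rparr> \<cong> affine_group p {(1,1,0,1), (-1,0,0,-1)})"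
proof -
  let ?G = "(BijGroup \<Omega>)\<lparr>carrier := G\<rparr>"
  have p0: "p > 0" using prime_gt_0_nat[OF assms(1)] .
  then have "\<Omega> \<noteq> {}" using assms(4) by auto
  then obtain \<omega> where \<omega>: "\<omega> \<in> \<Omega>" by blast
  interpret A: fin_action ?G \<Omega> "\<lambda>g. g" by (rule permutation_action[OF assms(3,5)])
  define H where "H = A.stab \<omega>"
  have H: "subgroup H ?G" unfolding H_def by (rule A.stab_sub[OF \<omega>])
  have "stabilizer \<Omega> G \<omega> = ?G\<lparr>carrier := H\<rparr>" by (simp add: stabilizer_def H_def A.stab_def)
  then obtain \<phi> where \<phi>: "\<phi> \<in> iso (?G\<lparr>carrier := H\<rparr>) (dihedral n)"
    using bspec[OF assms(8) \<omega>] by (auto simp: is_iso_def)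
  obtain C x y where D: "dihedral_like ?G H C" "H = generate ?G {x, y}" "x \<in> C" "A.ord x = n"
    "y \<in> H" "y \<notin> C" "card H = 2 * n"
    by (rule A.dihedral_structure[OF assms(7) H \<phi>])
  have orb: "A.orbit \<omega> = \<Omega>"
  proof
    show "A.orbit \<omega> \<subseteq> \<Omega>" unfolding A.orbit_def using A.act_closed \<omega> by blast
    show "\<Omega> \<subseteq> A.orbit \<omega>"
    proof
      fix v assume "v \<in> \<Omega>"
      then obtain g where "g \<in> G" "g \<omega> = v" using assms(6) \<omega> by (auto simp: transitive_on_def)
      then show "v \<in> A.orbit \<omega>" unfolding A.orbit_def by auto
    qed
  qed
  have cG: "card (carrier ?G) = p\<^sup>2 * card H" using A.orbit_stab[OF \<omega>] orb assms(4) by (simp add: H_def)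
  have faithful: "g = \<one>\<^bsub>?G\<^esub>" if "g \<in> carrier ?G" "\<And>v. v \<in> \<Omega> \<Longrightarrow> g v = v" for g
    by (rule permutation_eqI[OF assms(5)]) (use that A.one_closed A.act_one in auto)
  have core: "h = \<one>\<^bsub>?G\<^esub>"
    if "h \<in> H" "\<And>g. g \<in> carrier ?G \<Longrightarrow> g \<otimes>\<^bsub>?G\<^esub> h \<otimes>\<^bsub>?G\<^esub> inv\<^bsub>?G\<^esub> g \<in> H" for h
    by (rule A.transitive_core[OF \<omega> orb faithful]) (use that in \<open>auto simp: H_def\<close>)
  show ?thesis
  proof (cases "p = 2")
    case True
    interpret B: fin_group "BijGroup \<Omega>" by (rule fin_group_BijGroup[OF assms(3)])
    have c4: "card \<Omega> = 4" using assms(4) True by simp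
    have c24: "card (Bij \<Omega>) = 24" by (rule card_Bij_four[OF assms(3) c4])
    have cGn: "card G = 8 * n" using cG D(7) True by simp
    have "card G dvd 24" using B.card_dvd_carrier[OF assms(5)] c24 by (simp add: BijGroup_def)
    \<comment> \<open>By Lagrange 4 * 2n divides 24, so n divides 3; with n \<ge> 2 only n = 3
      remains, and G is the whole symmetric group.\<close>
    then have "8 * n dvd 8 * 3" using cGn by simp
    then have "8 = (0::nat) \<or> n dvd 3" by (simp only: nat_mult_dvd_cancel_disj)
    then have "n dvd 3" by simp
    moreover from this have "n \<le> 3" by (simp add: dvd_imp_le)
    moreover have "n \<noteq> 2"
    proof
      assume "n = 2"
      then show False using \<open>n dvd 3\<close> by simp
    qed
    ultimately have n3: "n = 3" using assms(7) by simp
    have "G = Bij \<Omega>"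
    proof (rule card_subset_eq)
      show "finite (Bij \<Omega>)" using B.fin by (simp add: BijGroup_def)
      show "G \<subseteq> Bij \<Omega>" using subgroup.subset[OF assms(5)] by (simp add: BijGroup_def)
    qed (simp add: cGn n3 c24)
    then have "?G = BijGroup \<Omega>" by (simp add: BijGroup_def)
    moreover have "card (Vp 2) = card \<Omega>" by (simp add: Vp_def c4)
    then obtain h where "bij_betw h \<Omega> (Vp 2)"
      using finite_same_card_bij[OF assms(3), of "Vp 2"] by (auto simp: Vp_def)
    ultimately show ?thesis using BijGroup_iso affine_group_two True n3 by metis
  next
    case False
    then have p3: "p \<ge> 3" using prime_ge_2_nat[OF assms(1)] by simp
    then have "odd p" using prime_odd_nat[OF assms(1)] by simp
    from A.odd_classification[OF assms(1) this assms(2) D(1,2,3,4) assms(7) D(5,6) core cG]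
    show ?thesis using p3 by blast
  qed
qed

end
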